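(* For all integers $\Delta,m\ge 1$, $$\mathfrak{c}(\Delta,m)\le\begin{cases}\frac12(m^2+m)+m(\Delta-1), & \text{if } \Delta\le 2,\\[2pt] \frac12(m^2+m)\Delta^2, & \text{if } \Delta\ge 3.\end{cases}$$
   Context: A matrix is treated as the multiset of its columns. Two vectors $\mathbf{a},\overline{\mathbf{a}}\in\mathbb{R}^d$ differ if $\mathbf{a}\neq\pm\overline{\mathbf{a}}$. A multiset $X\subseteq\mathbb{R}^d$ has differing columns if every pair of vectors in $X$ differs and $\mathbf{0}\notin X$. The number of differing columns of a matrix $A$, i.e. the largest cardinality of a subset of the columns of $A$ that has differing columns, is denoted $|A|$. For an integer matrix $A$ with $m$ rows and $\operatorname{rank} A=m$, let $\Delta(A):=\max\{|\det B| : B \text{ is an } m\times m \text{ submatrix of } A\}$; $A$ is $\Delta$-modular if $\Delta(A)\le\Delta$. For integers $\Delta,m\ge 1$, $$\mathfrak{c}(\Delta,m):=\max\{|A| : A \text{ is an integer matrix with } m \text{ rows},\ \operatorname{rank}A=m,\ \Delta(A)\le\Delta\}.$$ *)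

theory Defs
  imports
    "HOL-Library.Multiset"
    "Jordan_Normal_Form.DL_Rank"
    "Jordan_Normal_Form.DL_Submatrix"
begin

definition differ :: "'a::ring_1 vec \<Rightarrow> 'a vec \<Rightarrow> bool" where
  "differ a b \<longleftrightarrow> a \<noteq> b \<and> a \<noteq> - b"

text \<open>A pair of vectors in a multiset is a two-element sub-multiset. A vector occurring twice
  thus forms a pair with itself, which does not differ.\<close>

definition has_differing_columns :: "'a::ring_1 vec multiset \<Rightarrow> bool" where
  "has_differing_columns X \<longleftrightarrow>
     (\<forall>a b. {#a, b#} \<subseteq># X \<longrightarrow> differ a b) \<and> (\<forall>a \<in># X. a \<noteq> 0\<^sub>v (dim_vec a))"

definition num_differing_columns :: "'a::ring_1 mat \<Rightarrow> nat" where
  "num_differing_columns A = Max {size X | X. X \<subseteq># mset (cols A) \<and> has_differing_columns X}"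

definition full_row_rank :: "int mat \<Rightarrow> bool" where
  "full_row_rank A \<longleftrightarrow> vec_space.rank (dim_row A) (map_mat real_of_int A) = dim_row A"

text \<open>The maximum below ranges over a nonempty set when \<open>full_row_rank A\<close> holds, and it is only
  used for such matrices.\<close>

definition max_minor :: "int mat \<Rightarrow> int" where
  "max_minor A = Max {\<bar>det B\<bar> | B. (\<exists>I J. B = submatrix A I J) \<and>
                                  B \<in> carrier_mat (dim_row A) (dim_row A)}"

definition delta_modular :: "nat \<Rightarrow> int mat \<Rightarrow> bool" where
  "delta_modular \<Delta> A \<longleftrightarrow> full_row_rank A \<and> max_minor A \<le> int \<Delta>"

definition differing_column_counts :: "nat \<Rightarrow> nat \<Rightarrow> nat set" where
  "differing_column_counts \<Delta> m =
     {num_differing_columns A | A :: int mat. dim_row A = m \<and> delta_modular \<Delta> A}"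

text \<open>\<open>Max\<close> is unspecified on infinite sets, so a bound on \<open>max_differing_columns \<Delta> m\<close> is
  meaningful only together with \<open>finite (differing_column_counts \<Delta> m)\<close>; nonemptiness is
  shown below.\<close>

definition max_differing_columns :: "nat \<Rightarrow> nat \<Rightarrow> nat" where
  "max_differing_columns \<Delta> m = Max (differing_column_counts \<Delta> m)"

lemma submatrix_full:
  assumes "submatrix A I J \<in> carrier_mat (dim_row A) (dim_col A)"
  shows "submatrix A I J = A"
proof -
  have full: "{i. i < n \<and> i \<in> K} = {..<n}" if "card {i. i < n \<and> i \<in> K} = n" for n :: nat and K
    by (rule card_subset_eq) (use that in auto)
  have r: "card {i. i < dim_row A \<and> i \<in> I} = dim_row A"
    using carrier_matD(1)[OF assms] by (simp only: dim_submatrix)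
  have c: "card {j. j < dim_col A \<and> j \<in> J} = dim_col A"
    using carrier_matD(2)[OF assms] by (simp only: dim_submatrix)
  have pk: "pick K i = i" if K: "{i. i < n \<and> i \<in> K} = {..<n}" and "i < n" for n i :: nat and K
  proof -
    have in_K: "a \<in> K" if "a < n" for a
    proof -
      have "a \<in> {i. i < n \<and> i \<in> K}" unfolding K using that by simp
      then show ?thesis by simp
    qed
    have "{a \<in> K. a < i} = {..<i}"
      using in_K \<open>i < n\<close> less_trans by blast
    then show ?thesis using pick_card_in_set[OF in_K[OF \<open>i < n\<close>]] by simp
  qed
  show ?thesis
  proof (rule eq_matI)
    fix i j assume ij: "i < dim_row A" "j < dim_col A"
    then show "submatrix A I J $$ (i, j) = A $$ (i, j)"
      by (simp add: submatrix_index r c pk[OF full[OF r]] pk[OF full[OF c]])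
  qed (simp_all only: dim_submatrix r c)
qed

lemma delta_modular_one_mat:
  assumes "\<Delta> \<ge> 1"
  shows "delta_modular \<Delta> (1\<^sub>m m)"
proof -
  interpret idom_vec m "TYPE(real)" .
  interpret vec_space "TYPE(real)" m .
  have "rank (1\<^sub>m m :: real mat) = m"
    using det_rank_iff[of "1\<^sub>m m :: real mat"] by simp
  moreover have "map_mat real_of_int (1\<^sub>m m) = 1\<^sub>m m" by (rule eq_matI) auto
  ultimately have "full_row_rank (1\<^sub>m m)" by (simp add: full_row_rank_def)
  moreover have "submatrix (1\<^sub>m m :: int mat) UNIV UNIV = 1\<^sub>m m"
    by (rule submatrix_full) (auto simp: dim_submatrix intro!: carrier_matI)
  then have "{\<bar>det B\<bar> | B. (\<exists>I J. B = submatrix (1\<^sub>m m :: int mat) I J) \<and> B \<in> carrier_mat m m} = {1}"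
    using submatrix_full[of "1\<^sub>m m :: int mat"]
    by (auto) (metis abs_one det_one one_carrier_mat)+
  then have "max_minor (1\<^sub>m m) = 1" by (simp add: max_minor_def)
  ultimately show ?thesis using assms by (simp add: delta_modular_def)
qed

lemma differing_column_counts_nonempty:
  assumes "\<Delta> \<ge> 1"
  shows "differing_column_counts \<Delta> m \<noteq> {}"
proof -
  have "num_differing_columns (1\<^sub>m m :: int mat) \<in> differing_column_counts \<Delta> m"
    unfolding differing_column_counts_def using delta_modular_one_mat[OF assms, of m]
    by (intro CollectI exI[of _ "1\<^sub>m m"]) simp
  then show ?thesis by blast
qed

end

theory Submission
  imports Defs "HOL-Library.Function_Algebras"
begin


definition shatters :: "'a set set \<Rightarrow> 'a set \<Rightarrow> bool" where
  "shatters F K \<longleftrightarrow> (\<lambda>S. S \<inter> K) ` F = Pow K"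

lemma shatters_subset:
  assumes "shatters F K" "L \<subseteq> K"
  shows "shatters F L"
proof -
  have "\<exists>S\<in>F. S \<inter> L = T" if "T \<subseteq> L" for T
  proof -
    have "T \<in> (\<lambda>S. S \<inter> K) ` F" using assms that by (auto simp: shatters_def)
    then obtain S where "S \<in> F" "S \<inter> K = T" by auto
    then show ?thesis using assms(2) that by blast
  qed
  then show ?thesis by (auto simp: shatters_def image_iff)
qed

lemma card_le_card_shattered:
  assumes "finite X" "F \<subseteq> Pow X"
  shows "card F \<le> card {K. K \<subseteq> X \<and> shatters F K}"
  using assms
proof (induction X arbitrary: F rule: finite_induct)
  case empty
  show ?case
  proof (cases "F = {}")
    case False
    then have "F = {{}}" using empty by auto
    then have "{K. K \<subseteq> {} \<and> shatters F K} = {{}}" by (auto simp: shatters_def)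
    with \<open>F = {{}}\<close> show ?thesis by simp
  qed simp
next
  case (insert a X)
  define F0 where "F0 = {S \<in> F. a \<notin> S}"
  define F1 where "F1 = (\<lambda>S. S - {a}) ` {S \<in> F. a \<in> S}"
  have fin: "finite F" using insert by (meson finite_Pow_iff finite_insert finite_subset)
  have F: "F = F0 \<union> {S \<in> F. a \<in> S}" by (auto simp: F0_def)
  have inj: "inj_on (\<lambda>S. S - {a}) {S \<in> F. a \<in> S}" by (auto simp: inj_on_def)
  have "card F = card F0 + card {S \<in> F. a \<in> S}"
    by (subst F, rule card_Un_disjoint) (use fin in \<open>auto simp: F0_def\<close>)
  also have "card {S \<in> F. a \<in> S} = card F1" using inj by (simp add: F1_def card_image)
  also have "card F0 + card F1 = card (F0 \<union> F1) + card (F0 \<inter> F1)"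
    by (rule card_Un_Int) (use fin in \<open>auto simp: F0_def F1_def\<close>)
  also have "card (F0 \<union> F1) \<le> card {K. K \<subseteq> X \<and> shatters (F0 \<union> F1) K}"
    by (rule insert.IH) (use insert.prems in \<open>auto simp: F0_def F1_def\<close>)
  also have "card (F0 \<inter> F1) \<le> card {K. K \<subseteq> X \<and> shatters (F0 \<inter> F1) K}"
    by (rule insert.IH) (use insert.prems in \<open>auto simp: F0_def F1_def\<close>)
  finally have 1: "card F \<le> card {K. K \<subseteq> X \<and> shatters (F0 \<union> F1) K}
      + card {K. K \<subseteq> X \<and> shatters (F0 \<inter> F1) K}" by simp
  let ?U = "{K. K \<subseteq> X \<and> shatters (F0 \<union> F1) K}" and ?N = "{K. K \<subseteq> X \<and> shatters (F0 \<inter> F1) K}"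
  have finX: "finite ?U" "finite ?N" using insert.hyps by auto
  have aX: "a \<notin> X" by fact
  have "card ?N = card (insert a ` ?N)"
    by (rule card_image[symmetric]) (use aX in \<open>auto simp: inj_on_def\<close>)
  then have "card ?U + card ?N = card (?U \<union> insert a ` ?N)"
    using finX aX by (subst card_Un_disjoint) auto
  also have "\<dots> \<le> card {K. K \<subseteq> insert a X \<and> shatters F K}"
  proof (rule card_mono)
    show "finite {K. K \<subseteq> insert a X \<and> shatters F K}" using insert.hyps by simp
    have "shatters F K" if K: "K \<subseteq> X" "shatters (F0 \<union> F1) K" for K
    proof -
      have aK: "a \<notin> K" using K aX by auto
      have "\<exists>S\<in>F. S \<inter> K = T" if "T \<subseteq> K" for T
      proof -
        have "T \<in> (\<lambda>S. S \<inter> K) ` (F0 \<union> F1)" using K(2) that by (simp add: shatters_def)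
        then obtain S where "S \<in> F0 \<union> F1" "S \<inter> K = T" by auto
        then obtain S' where "S' \<in> F" "S' = S \<or> S = S' - {a}" by (auto simp: F0_def F1_def)
        then show ?thesis using aK \<open>S \<inter> K = T\<close> by (intro bexI[of _ S']) auto
      qed
      then show ?thesis by (auto simp: shatters_def image_iff)
    qed
    moreover have "shatters F (insert a K)" if K: "K \<subseteq> X" "shatters (F0 \<inter> F1) K" for K
    proof -
      have aK: "a \<notin> K" using K aX by auto
      have "\<exists>S\<in>F. S \<inter> insert a K = T" if T: "T \<subseteq> insert a K" for T
      proof -
        have "T - {a} \<in> (\<lambda>S. S \<inter> K) ` (F0 \<inter> F1)" using K(2) T by (auto simp: shatters_def)
        then obtain S where S: "S \<in> F0" "S \<in> F1" "S \<inter> K = T - {a}" by auto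
        obtain S' where S': "S' \<in> F" "a \<in> S'" "S = S' - {a}" using S by (auto simp: F1_def)
        show ?thesis
        proof (cases "a \<in> T")
          case True
          then have "S' \<inter> insert a K = T" using S' S(3) aK T by auto
          then show ?thesis using S' by blast
        next
          case False
          then have "S \<inter> insert a K = T" using S by (auto simp: F0_def)
          then show ?thesis using S by (auto simp: F0_def)
        qed
      qed
      then show ?thesis by (auto simp: shatters_def image_iff)
    qed
    ultimately show "?U \<union> insert a ` ?N \<subseteq> {K. K \<subseteq> insert a X \<and> shatters F K}" by auto
  qed
  finally show ?case using 1 by simp
qed

lemma shattersD: "shatters F K \<Longrightarrow> T \<subseteq> K \<Longrightarrow> \<exists>S\<in>F. S \<inter> K = T"
  unfolding shatters_def by (metis PowI imageE)

lemma card_le_if_no_shattered_pair: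
  assumes X: "finite X" "F \<subseteq> Pow X"
    and no: "\<And>a b S T U. a \<in> X \<Longrightarrow> b \<in> X \<Longrightarrow> a \<noteq> b \<Longrightarrow> S \<in> F \<Longrightarrow> T \<in> F \<Longrightarrow> U \<in> F \<Longrightarrow>
      a \<in> S \<Longrightarrow> b \<notin> S \<Longrightarrow> a \<notin> T \<Longrightarrow> b \<in> T \<Longrightarrow> a \<in> U \<Longrightarrow> b \<in> U \<Longrightarrow> False"
  shows "card F \<le> 1 + card X"
proof -
  have small: "K = {} \<or> (\<exists>a\<in>X. K = {a})" if K: "K \<subseteq> X" "shatters F K" for K
  proof (rule ccontr)
    assume "\<not> ?thesis"
    then obtain a where a: "a \<in> K" "K \<noteq> {a}" using K(1) by auto
    then obtain b where ab: "a \<in> K" "b \<in> K" "a \<noteq> b" by auto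
    have sh: "shatters F {a, b}" by (rule shatters_subset[OF K(2)]) (use ab in auto)
    obtain S where S: "S \<in> F" "S \<inter> {a, b} = {a}" using shattersD[OF sh, of "{a}"] by auto
    obtain T where T: "T \<in> F" "T \<inter> {a, b} = {b}" using shattersD[OF sh, of "{b}"] by auto
    obtain U where U: "U \<in> F" "U \<inter> {a, b} = {a, b}" using shattersD[OF sh, of "{a, b}"] by auto
    have "a \<in> S" "b \<notin> S" "a \<notin> T" "b \<in> T" "a \<in> U" "b \<in> U" using ab S T U by auto
    moreover have "a \<in> X" "b \<in> X" using ab K by auto
    ultimately show False using no ab(3) S(1) T(1) U(1) by metis
  qed
  have "card F \<le> card {K. K \<subseteq> X \<and> shatters F K}" by (rule card_le_card_shattered[OF X])
  also have "\<dots> \<le> card (insert {} ((\<lambda>a. {a}) ` X))"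
    by (rule card_mono) (use X small in auto)
  also have "\<dots> \<le> 1 + card ((\<lambda>a. {a}) ` X)" using card_insert_le_m1 X by (simp add: card_insert_if)
  also have "\<dots> \<le> 1 + card X" using card_image_le[OF X(1)] by simp
  finally show ?thesis .
qed

lemma card_le_if_no_shattered_triple:
  assumes X: "finite X" "F \<subseteq> Pow X"
    and no: "\<And>a b c S T U V. a \<in> X \<Longrightarrow> b \<in> X \<Longrightarrow> c \<in> X \<Longrightarrow> a \<noteq> b \<Longrightarrow> a \<noteq> c \<Longrightarrow> b \<noteq> c \<Longrightarrow>
      S \<in> F \<Longrightarrow> T \<in> F \<Longrightarrow> U \<in> F \<Longrightarrow> V \<in> F \<Longrightarrow> S \<inter> {a, b, c} = {a, b} \<Longrightarrow> T \<inter> {a, b, c} = {a, c} \<Longrightarrow>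
      U \<inter> {a, b, c} = {b, c} \<Longrightarrow> V \<inter> {a, b, c} = {a, b, c} \<Longrightarrow> False"
  shows "2 * card F \<le> 2 + card X ^ 2 + card X"
proof -
  have small: "card K \<le> 2" if K: "K \<subseteq> X" "shatters F K" for K
  proof (rule ccontr)
    assume "\<not> ?thesis"
    then have "3 \<le> card K" by simp
    then obtain L where L: "L \<subseteq> K" "card L = 3" using obtain_subset_with_card_n by metis
    then obtain a b c where abc: "L = {a, b, c}" "a \<noteq> b" "a \<noteq> c" "b \<noteq> c"
      by (auto simp: card_3_iff)
    have sh: "shatters F {a, b, c}" using shatters_subset[OF K(2) L(1)] abc by simp
    obtain S where S: "S \<in> F" "S \<inter> {a, b, c} = {a, b}" using shattersD[OF sh, of "{a, b}"] by auto
    obtain T where T: "T \<in> F" "T \<inter> {a, b, c} = {a, c}" using shattersD[OF sh, of "{a, c}"] by auto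
    obtain U where U: "U \<in> F" "U \<inter> {a, b, c} = {b, c}" using shattersD[OF sh, of "{b, c}"] by auto
    obtain V where V: "V \<in> F" "V \<inter> {a, b, c} = {a, b, c}" using shattersD[OF sh, of "{a, b, c}"] by auto
    have "a \<in> X" "b \<in> X" "c \<in> X" using abc L K by auto
    then show False using no[OF _ _ _ abc(2-4) S(1) T(1) U(1) V(1) S(2) T(2) U(2) V(2)] by simp
  qed
  let ?S = "\<lambda>k. {K. K \<subseteq> X \<and> card K = k}"
  have "card F \<le> card {K. K \<subseteq> X \<and> shatters F K}" by (rule card_le_card_shattered[OF X])
  also have "\<dots> \<le> card (?S 0 \<union> ?S 1 \<union> ?S 2)"
  proof (rule card_mono)
    show "finite (?S 0 \<union> ?S 1 \<union> ?S 2)" using X by simp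
    show "{K. K \<subseteq> X \<and> shatters F K} \<subseteq> ?S 0 \<union> ?S 1 \<union> ?S 2"
    proof
      fix K assume "K \<in> {K. K \<subseteq> X \<and> shatters F K}"
      then have "K \<subseteq> X" "card K \<le> 2" using small by auto
      then show "K \<in> ?S 0 \<union> ?S 1 \<union> ?S 2" by (cases "card K = 0"; cases "card K = 1") auto
    qed
  qed
  also have "\<dots> \<le> card (?S 0) + card (?S 1) + card (?S 2)"
    by (meson add_le_mono card_Un_le le_refl order_trans)
  also have "\<dots> = (card X choose 0) + (card X choose 1) + (card X choose 2)"
    using n_subsets[OF X(1)] by metis
  finally have "card F \<le> 1 + card X + (card X choose 2)" by simp
  moreover have "2 * (card X choose 2) = card X * (card X - 1)"
    unfolding choose_two by (rule dvd_mult_div_cancel) (cases "card X"; simp)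
  ultimately have "2 * card F \<le> 2 + 2 * card X + card X * (card X - 1)" by linarith
  also have "\<dots> = 2 + card X ^ 2 + card X"
    by (cases "card X") (auto simp: power2_eq_square algebra_simps)
  finally show ?thesis .
qed


locale alternating_form =
  fixes I :: "nat set" and \<omega> :: "(nat \<Rightarrow> 'v::real_vector) \<Rightarrow> real"
  assumes fin_I: "finite I"
    and form_cong: "\<And>x y. (\<And>i. i \<in> I \<Longrightarrow> x i = y i) \<Longrightarrow> \<omega> x = \<omega> y"
    and form_linear: "\<And>x i. i \<in> I \<Longrightarrow> linear (\<lambda>v. \<omega> (x(i := v)))"
    and form_eq: "\<And>x i j. i \<in> I \<Longrightarrow> j \<in> I \<Longrightarrow> i \<noteq> j \<Longrightarrow> x i = x j \<Longrightarrow> \<omega> x = 0"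
begin

lemma form_add: "i \<in> I \<Longrightarrow> \<omega> (x(i := u + v)) = \<omega> (x(i := u)) + \<omega> (x(i := v))"
  using linear_add[OF form_linear] by blast

lemma form_diff: "i \<in> I \<Longrightarrow> \<omega> (x(i := u - v)) = \<omega> (x(i := u)) - \<omega> (x(i := v))"
  using linear_diff[OF form_linear] by blast

lemma form_minus: "i \<in> I \<Longrightarrow> \<omega> (x(i := - v)) = - \<omega> (x(i := v))"
  using linear_neg[OF form_linear] by blast

lemma form_scale: "i \<in> I \<Longrightarrow> \<omega> (x(i := c *\<^sub>R v)) = c * \<omega> (x(i := v))"
  using linear_scale[OF form_linear] by (metis real_scaleR_def)

lemma form_sum: "i \<in> I \<Longrightarrow> \<omega> (x(i := (\<Sum>k\<in>A. f k))) = (\<Sum>k\<in>A. \<omega> (x(i := f k)))"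
  using linear_sum[OF form_linear] by blast

lemma form_zero: "i \<in> I \<Longrightarrow> \<omega> (x(i := 0)) = 0"
  using linear_0[OF form_linear] by blast

lemma form_span_0:
  assumes "i \<in> I" "v \<in> span (x ` (I - {i}))"
  shows "\<omega> (x(i := v)) = 0"
  using assms(2)
proof (induction rule: span_induct_alt)
  case base
  show ?case using assms(1) by (rule form_zero)
next
  case (step c y z)
  then obtain j where "j \<in> I" "j \<noteq> i" "y = x j" by auto
  then have "\<omega> (x(i := y)) = 0" using assms(1) by (intro form_eq[of i j]) auto
  moreover have "\<omega> (x(i := z)) = 0" using step by blast
  ultimately have "\<omega> (x(i := c *\<^sub>R y + z)) = 0" unfolding form_add[OF assms(1)] form_scale[OF assms(1)] by simp
  then show ?case .
qed

lemma form_span_cong: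
  assumes "i \<in> I" "u - v \<in> span (x ` (I - {i}))"
  shows "\<omega> (x(i := u)) = \<omega> (x(i := v))"
  using form_span_0[OF assms] form_diff[OF assms(1), of x u v] by simp

lemma form_swap:
  assumes "i \<in> I" "j \<in> I" "i \<noteq> j"
  shows "\<omega> (x(i := u, j := v)) = - \<omega> (x(i := v, j := u))"
proof -
  have e: "\<omega> (x(i := a, j := a)) = 0" for a using assms by (intro form_eq[of i j]) auto
  have "0 = \<omega> (x(i := u + v, j := u + v))" using e by simp
  also have "\<dots> = \<omega> (x(i := u + v, j := u)) + \<omega> (x(i := u + v, j := v))"
    using assms by (simp add: form_add)
  also have "\<dots> = \<omega> (x(j := u, i := u + v)) + \<omega> (x(j := v, i := u + v))"
    using assms by (simp add: fun_upd_twist)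
  also have "\<dots> = \<omega> (x(j := u, i := u)) + \<omega> (x(j := u, i := v)) + \<omega> (x(j := v, i := u)) + \<omega> (x(j := v, i := v))"
    using assms by (simp add: form_add)
  also have "\<dots> = \<omega> (x(i := v, j := u)) + \<omega> (x(i := u, j := v))"
    using assms e by (simp add: fun_upd_twist)
  finally show ?thesis by simp
qed

lemma form_dependent:
  assumes T: "finite T" "card T < card I" "\<And>i. i \<in> I \<Longrightarrow> x i \<in> span T"
  shows "\<omega> x = 0"
proof (cases "inj_on x I")
  case False
  then obtain i j where "i \<in> I" "j \<in> I" "i \<noteq> j" "x i = x j" by (auto simp: inj_on_def)
  then show ?thesis by (rule form_eq)
next
  case True
  have "dependent (x ` I)"
  proof (rule ccontr)
    assume "\<not> dependent (x ` I)"
    then have "card (x ` I) \<le> card T"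
      using independent_span_bound[OF T(1), of "x ` I"] T(3) by auto
    then show False using T(2) True by (simp add: card_image)
  qed
  then obtain a where a: "a \<in> x ` I" "a \<in> span (x ` I - {a})" by (auto simp: dependent_def)
  then obtain i where i: "i \<in> I" "a = x i" by auto
  have "x ` I - {a} = x ` (I - {i})" using True i by (auto simp: inj_on_def)
  then have "\<omega> (x(i := x i)) = 0" using a i by (intro form_span_0) auto
  then show ?thesis by simp
qed

lemma alternating_form_contract:
  assumes i: "i \<in> I"
  shows "alternating_form (I - {i}) (\<lambda>x. \<omega> (x(i := e)))"
proof (rule alternating_form.intro, goal_cases)
  case 1
  show ?case using fin_I by simp
next
  case (2 x y)
  then show ?case by (intro form_cong) auto
next
  case (3 x j)
  then have "x(j := v, i := e) = x(i := e, j := v)" for v by (auto simp: fun_upd_twist)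
  then show ?case using form_linear[of j "x(i := e)"] 3 by simp
next
  case (4 x j k)
  then show ?case by (intro form_eq[of j k]) auto
qed

lemma alternating_form_scale: "alternating_form I (\<lambda>x. c * \<omega> x)"
proof (rule alternating_form.intro, goal_cases)
  case (2 x y)
  then have "\<omega> x = \<omega> y" by (rule form_cong)
  then show ?case by simp
next
  case (3 x i)
  then show ?case using linear_compose_scale_right[OF form_linear[OF 3], of c] by simp
next
  case (4 x i j)
  then have "\<omega> x = 0" by (intro form_eq[of i j])
  then show ?case by simp
qed (rule fin_I)

end

text \<open>Configurations.\<close>

locale based_form = alternating_form I \<omega>
  for I :: "nat set" and \<omega> :: "(nat \<Rightarrow> 'v::real_vector) \<Rightarrow> real" +
  fixes B :: "nat \<Rightarrow> 'v"
  assumes form_B: "\<omega> B = 1"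
begin

definition crd :: "nat \<Rightarrow> 'v \<Rightarrow> real" where "crd i v = \<omega> (B(i := v))"

abbreviation V :: "'v set" where "V \<equiv> span (B ` I)"

lemma B_in_V: "i \<in> I \<Longrightarrow> B i \<in> V" by (simp add: span_base)

lemma crd_linear: "i \<in> I \<Longrightarrow> linear (crd i)"
  unfolding crd_def by (rule form_linear)

lemma crd_add [simp]: "i \<in> I \<Longrightarrow> crd i (u + v) = crd i u + crd i v"
  by (simp add: crd_def form_add)
lemma crd_diff [simp]: "i \<in> I \<Longrightarrow> crd i (u - v) = crd i u - crd i v"
  by (simp add: crd_def form_diff)
lemma crd_minus [simp]: "i \<in> I \<Longrightarrow> crd i (- v) = - crd i v"
  by (simp add: crd_def form_minus)
lemma crd_scale [simp]: "i \<in> I \<Longrightarrow> crd i (c *\<^sub>R v) = c * crd i v"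
  by (simp add: crd_def form_scale)
lemma crd_zero [simp]: "i \<in> I \<Longrightarrow> crd i 0 = 0"
  by (simp add: crd_def form_zero)
lemma crd_sum [simp]: "i \<in> I \<Longrightarrow> crd i (sum f A) = (\<Sum>a\<in>A. crd i (f a))"
  by (simp add: crd_def form_sum)

lemma crd_B [simp]: "i \<in> I \<Longrightarrow> j \<in> I \<Longrightarrow> crd i (B j) = (if i = j then 1 else 0)"
  using form_B form_eq[of i j "B(i := B j)"] by (auto simp: crd_def)

lemma expand: "v \<in> V \<Longrightarrow> v = (\<Sum>i\<in>I. crd i v *\<^sub>R B i)"
proof (induction rule: span_induct_alt)
  case base
  show ?case by simp
next
  case (step c y z)
  then obtain j where j: "j \<in> I" "y = B j" by auto
  have "(\<Sum>i\<in>I. crd i (c *\<^sub>R y + z) *\<^sub>R B i) =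
      (\<Sum>i\<in>I. (if i = j then c *\<^sub>R B j else 0)) + (\<Sum>i\<in>I. crd i z *\<^sub>R B i)"
    using j by (simp add: sum.distrib[symmetric]) (intro sum.cong, auto simp: algebra_simps)
  also have "\<dots> = c *\<^sub>R y + z" using j fin_I step by simp
  finally show ?case by simp
qed

lemma eqI: "u \<in> V \<Longrightarrow> v \<in> V \<Longrightarrow> (\<And>i. i \<in> I \<Longrightarrow> crd i u = crd i v) \<Longrightarrow> u = v"
  using expand[of u] expand[of v] by (simp cong: sum.cong)

lemma B_inj: "inj_on B I"
proof
  fix i j assume "i \<in> I" "j \<in> I" "B i = B j"
  then show "i = j" using crd_B[of i i] crd_B[of i j] by (metis zero_neq_one)
qed

lemma independent_B: "independent (B ` I)"
proof
  assume "dependent (B ` I)"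
  then obtain a where "a \<in> B ` I" "a \<in> span (B ` I - {a})" by (auto simp: dependent_def)
  then obtain i where i: "i \<in> I" "B i \<in> span (B ` I - {B i})" by auto
  have "B ` I - {B i} = B ` (I - {i})" using B_inj i by (auto simp: inj_on_def)
  then have "\<omega> (B(i := B i)) = 0" using i by (intro form_span_0) auto
  then show False using form_B by simp
qed

lemma card_B: "card (B ` I) = card I" using B_inj by (simp add: card_image)

text \<open>In a slot the coordinates along basis vectors occupying other slots may be dropped.\<close>

lemma form_restrict:
  assumes "i \<in> I" "v \<in> V" "J \<subseteq> I" "\<And>k. k \<in> I - J \<Longrightarrow> k \<noteq> i \<and> x k = B k"
  shows "\<omega> (x(i := v)) = (\<Sum>k\<in>J. crd k v * \<omega> (x(i := B k)))"
proof -
  have fJ: "finite J" using assms(3) fin_I finite_subset by blast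
  have eq: "v - (\<Sum>k\<in>J. crd k v *\<^sub>R B k) = (\<Sum>k\<in>I - J. crd k v *\<^sub>R B k)"
    by (subst (1) expand[OF assms(2)]) (simp add: sum_diff[OF fin_I assms(3)])
  have "\<omega> (x(i := v)) = \<omega> (x(i := (\<Sum>k\<in>J. crd k v *\<^sub>R B k)))"
  proof (rule form_span_cong[OF assms(1)])
    show "v - (\<Sum>k\<in>J. crd k v *\<^sub>R B k) \<in> span (x ` (I - {i}))"
      unfolding eq
    proof (intro span_sum span_scale span_base)
      fix k assume "k \<in> I - J"
      then have "k \<noteq> i" "x k = B k" using assms(4) by auto
      then show "B k \<in> x ` (I - {i})" using \<open>k \<in> I - J\<close> by force
    qed
  qed
  also have "\<dots> = (\<Sum>k\<in>J. crd k v * \<omega> (x(i := B k)))"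
    using assms(1) by (simp add: form_sum form_scale)
  finally show ?thesis .
qed

lemma form2:
  assumes "i \<in> I" "j \<in> I" "i \<noteq> j" "u \<in> V" "v \<in> V"
  shows "\<omega> (B(i := u, j := v)) = crd i u * crd j v - crd j u * crd i v"
proof -
  have "\<omega> (B(i := u, j := v)) = \<omega> ((B(j := v))(i := u))" using assms by (simp add: fun_upd_twist)
  also have "\<dots> = (\<Sum>k\<in>{i, j}. crd k u * \<omega> ((B(j := v))(i := B k)))"
    using assms by (intro form_restrict) auto
  also have "\<dots> = crd i u * \<omega> (B(j := v)) + crd j u * \<omega> (B(i := B j, j := v))"
  proof -
    have "B(j := v, i := B i) = B(j := v)" using assms by (auto simp: fun_eq_iff)
    moreover have "B(j := v, i := B j) = B(i := B j, j := v)" using assms by (auto simp: fun_eq_iff)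
    ultimately show ?thesis using assms by simp
  qed
  also have "\<omega> (B(i := B j, j := v)) = - \<omega> (B(i := v, j := B j))" using assms by (intro form_swap)
  also have "B(i := v, j := B j) = B(i := v)" using assms by (auto simp: fun_eq_iff)
  finally have "\<omega> (B(i := u, j := v)) = crd i u * \<omega> (B(j := v)) + crd j u * - \<omega> (B(i := v))" .
  then show ?thesis unfolding crd_def by simp
qed

lemma form3:
  assumes "i \<in> I" "j \<in> I" "l \<in> I" "i \<noteq> j" "i \<noteq> l" "j \<noteq> l" "u \<in> V" "v \<in> V" "w \<in> V"
  shows "\<omega> (B(i := u, j := v, l := w)) =
     crd i u * (crd j v * crd l w - crd l v * crd j w)
   - crd j u * (crd i v * crd l w - crd l v * crd i w)
   + crd l u * (crd i v * crd j w - crd j v * crd i w)"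
proof -
  have "\<omega> (B(i := u, j := v, l := w)) = \<omega> ((B(j := v, l := w))(i := u))"
    using assms by (simp add: fun_upd_twist)
  also have "\<dots> = (\<Sum>k\<in>{i, j, l}. crd k u * \<omega> ((B(j := v, l := w))(i := B k)))"
    using assms by (intro form_restrict) auto
  also have "\<dots> = crd i u * \<omega> (B(j := v, l := w)) + crd j u * \<omega> (B(l := w, i := B j, j := v))
     + crd l u * \<omega> (B(j := v, i := B l, l := w))"
  proof -
    have "(B(j := v, l := w))(i := B i) = B(j := v, l := w)" using assms by (auto simp: fun_eq_iff)
    moreover have "(B(j := v, l := w))(i := B j) = B(l := w, i := B j, j := v)"
      using assms by (auto simp: fun_eq_iff)
    moreover have "(B(j := v, l := w))(i := B l) = B(j := v, i := B l, l := w)"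
      using assms by (auto simp: fun_eq_iff)
    ultimately show ?thesis using assms by simp
  qed
  also have "\<omega> (B(l := w, i := B j, j := v)) = - \<omega> (B(l := w, i := v, j := B j))"
    using assms by (intro form_swap)
  also have "B(l := w, i := v, j := B j) = B(i := v, l := w)" using assms by (auto simp: fun_eq_iff)
  also have "\<omega> (B(j := v, i := B l, l := w)) = - \<omega> (B(j := v, i := w, l := B l))"
    using assms by (intro form_swap)
  also have "B(j := v, i := w, l := B l) = B(i := w, j := v)" using assms by (auto simp: fun_eq_iff)
  finally have E: "\<omega> (B(i := u, j := v, l := w)) = crd i u * \<omega> (B(j := v, l := w))
     + crd j u * - \<omega> (B(i := v, l := w)) + crd l u * - \<omega> (B(i := w, j := v))" .
  have F: "\<omega> (B(j := v, l := w)) = crd j v * crd l w - crd l v * crd j w"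
     "\<omega> (B(i := v, l := w)) = crd i v * crd l w - crd l v * crd i w"
     "\<omega> (B(i := w, j := v)) = crd i w * crd j v - crd j w * crd i v"
    using assms by (auto intro!: form2)
  show ?thesis unfolding E F by (simp add: algebra_simps)
qed

text \<open>Two slots holding combinations of two basis vectors.\<close>

lemma form_pair_slots:
  assumes "i \<in> I" "j \<in> I" "i \<noteq> j"
  shows "\<omega> (x(i := a *\<^sub>R u + b *\<^sub>R v, j := c *\<^sub>R u + d *\<^sub>R v)) = (a * d - b * c) * \<omega> (x(i := u, j := v))"
proof -
  have z: "\<omega> (x(i := y, j := y)) = 0" for y using assms by (intro form_eq[of i j]) auto
  have 1: "\<omega> (x(i := a *\<^sub>R u + b *\<^sub>R v, j := y)) = a * \<omega> (x(i := u, j := y)) + b * \<omega> (x(i := v, j := y))" for y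
    using assms by (simp add: fun_upd_twist form_add form_scale)
  have "\<omega> (x(i := v, j := u)) = - \<omega> (x(i := u, j := v))" using assms by (intro form_swap)
  then show ?thesis using assms z by (simp add: form_add form_scale 1 algebra_simps)
qed

end


context alternating_form begin

lemma form_mod_slots:
  assumes J: "J \<subseteq> I" "\<And>j. j \<in> J \<Longrightarrow> x j = y j"
    and d: "\<And>i. i \<in> I - J \<Longrightarrow> x i - y i \<in> span (y ` J)"
  shows "\<omega> x = \<omega> y"
proof -
  have "\<omega> (override_on y x K) = \<omega> y" if "finite K" "K \<subseteq> I - J" for K
    using that
  proof (induction K rule: finite_induct)
    case empty
    then show ?case by simp
  next
    case (insert k K)
    let ?z = "override_on y x K"
    have e: "override_on y x (insert k K) = ?z(k := x k)" by (rule override_on_insert)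
    have "span (y ` J) \<subseteq> span (?z ` (I - {k}))"
    proof (rule span_mono, rule)
      fix w assume "w \<in> y ` J"
      then obtain j where j: "j \<in> J" "w = y j" by auto
      then have "j \<notin> K" "j \<in> I - {k}" using insert.prems J(1) by auto
      then have "w = ?z j" "j \<in> I - {k}" using j by auto
      then show "w \<in> ?z ` (I - {k})" by blast
    qed
    then have "x k - y k \<in> span (?z ` (I - {k}))" using d[of k] insert.prems by auto
    then have "\<omega> (?z(k := x k)) = \<omega> (?z(k := y k))" using insert.prems by (intro form_span_cong) auto
    moreover have "?z(k := y k) = ?z" using insert.hyps by (simp add: fun_upd_idem_iff)
    ultimately have "\<omega> (override_on y x (insert k K)) = \<omega> y" unfolding e using insert by simp
    then show ?case .
  qed
  from this[of "I - J"] have "\<omega> (override_on y x (I - J)) = \<omega> y" using fin_I by simp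
  moreover have "\<omega> (override_on y x (I - J)) = \<omega> x"
    by (rule form_cong) (use J in \<open>auto simp: override_on_def\<close>)
  ultimately show ?thesis by simp
qed

lemma rebase:
  assumes "\<omega> C \<noteq> 0"
  shows "based_form I (\<lambda>x. \<omega> x / \<omega> C) C"
proof -
  have "alternating_form I (\<lambda>x. \<omega> x / \<omega> C)"
    using alternating_form_scale[of "1 / \<omega> C"] by simp
  then show ?thesis using assms by (simp add: based_form_def based_form_axioms_def)
qed

end

context based_form begin

lemma rebase_span:
  assumes "\<omega> C \<noteq> 0" "\<And>i. i \<in> I \<Longrightarrow> C i \<in> V"
  shows "span (C ` I) = V"
proof -
  interpret C: based_form I "\<lambda>x. \<omega> x / \<omega> C" C using assms(1) by (rule rebase)
  have sub: "C ` I \<subseteq> V" using assms(2) by auto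
  have c1: "card (C ` I) = card I" by (rule C.card_B)
  have c2: "card (B ` I) = card I" by (rule card_B)
  have "b \<in> span (C ` I)" if "b \<in> B ` I" for b
  proof (rule ccontr)
    assume n: "b \<notin> span (C ` I)"
    then have "independent (insert b (C ` I))" using C.independent_B independent_insertI by blast
    moreover have "insert b (C ` I) \<subseteq> V" using sub that by (auto simp: span_base)
    ultimately have "card (insert b (C ` I)) \<le> card (B ` I)"
      using independent_span_bound[of "B ` I" "insert b (C ` I)"] fin_I by simp
    moreover have "b \<notin> C ` I" using n span_base by blast
    ultimately show False using c1 c2 fin_I by simp
  qed
  then have "V \<subseteq> span (C ` I)" by (intro span_minimal) auto
  moreover have "span (C ` I) \<subseteq> V" using span_minimal[OF sub] by simp
  ultimately show ?thesis by auto
qed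

text \<open>Contraction.\<close>

definition proj :: "nat set \<Rightarrow> 'v \<Rightarrow> 'v" where
  "proj J v = (\<Sum>j\<in>J. crd j v *\<^sub>R B j)"

definition restr :: "nat set \<Rightarrow> (nat \<Rightarrow> 'v) \<Rightarrow> real" where
  "restr J x = \<omega> (override_on B x J)"

lemma based_form_restr:
  assumes J: "J \<subseteq> I"
  shows "based_form J (restr J) B"
proof -
  have "alternating_form J (restr J)"
  proof (rule alternating_form.intro, goal_cases)
    case 1
    show ?case using J fin_I by (rule finite_subset)
  next
    case (2 x y)
    then have "override_on B x J = override_on B y J" by (auto simp: override_on_def fun_eq_iff)
    then show ?case by (simp add: restr_def)
  next
    case (3 x j)
    have "override_on B (x(j := v)) J = (override_on B x J)(j := v)" for v
      using 3 by (auto simp: override_on_def fun_eq_iff)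
    then show ?case using form_linear[of j "override_on B x J"] 3 J by (auto simp: restr_def)
  next
    case (4 x j k)
    then show ?case using J by (auto simp: restr_def intro!: form_eq[of j k])
  qed
  moreover have "override_on B B J = B" by (auto simp: override_on_def)
  ultimately show ?thesis using form_B by (simp add: based_form_def based_form_axioms_def restr_def)
qed

lemma crd_restr: 
  assumes "J \<subseteq> I" "j \<in> J" shows "based_form.crd (restr J) B j v = crd j v"
proof -
  interpret R: based_form J "restr J" B using assms(1) by (rule based_form_restr)
  have "override_on B (B(j := v)) J = B(j := v)" using assms by (auto simp: override_on_def fun_eq_iff)
  then show ?thesis by (simp add: R.crd_def crd_def restr_def)
qed

lemma crd_proj [simp]:
  assumes "J \<subseteq> I" "i \<in> I" shows "crd i (proj J v) = (if i \<in> J then crd i v else 0)"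
proof -
  have fJ: "finite J" using assms fin_I finite_subset by blast
  have "crd i (proj J v) = (\<Sum>j\<in>J. if i = j then crd j v else 0)"
    unfolding proj_def using assms by (simp) (intro sum.cong, auto)
  then show ?thesis using fJ by simp
qed

lemma proj_in_span: "proj J v \<in> span (B ` J)"
  unfolding proj_def by (intro span_sum span_scale span_base) auto

lemma proj_minus: "J \<subseteq> I \<Longrightarrow> proj J (- v) = - proj J v"
  by (auto simp: proj_def sum_negf[symmetric] intro!: sum.cong)

lemma span_sub_V: "J \<subseteq> I \<Longrightarrow> span (B ` J) \<subseteq> V"
  by (intro span_mono) auto

lemma proj_in_V: "J \<subseteq> I \<Longrightarrow> proj J v \<in> V"
  using proj_in_span span_sub_V by blast

lemma diff_proj:
  assumes "J \<subseteq> I" "v \<in> V"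
  shows "v - proj J v \<in> span (B ` (I - J))"
proof -
  have "v - proj J v = (\<Sum>k\<in>I - J. crd k v *\<^sub>R B k)"
    unfolding proj_def by (subst (1) expand[OF assms(2)]) (simp add: sum_diff[OF fin_I assms(1)])
  moreover have "(\<Sum>k\<in>I - J. crd k v *\<^sub>R B k) \<in> span (B ` (I - J))"
    by (intro span_sum span_scale span_base) auto
  ultimately show ?thesis by simp
qed

lemma restr_lift:
  assumes J: "J \<subseteq> I" and x: "\<And>j. j \<in> J \<Longrightarrow> y j \<in> V \<and> x j = proj J (y j)"
  shows "restr J x = restr J y"
  unfolding restr_def
proof (rule form_mod_slots[of "I - J"])
  fix i assume "i \<in> I - (I - J)"
  then have i: "i \<in> J" by auto
  have "y i - proj J (y i) \<in> span (B ` (I - J))" using x[OF i] J by (intro diff_proj) auto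
  then have "- (y i - proj J (y i)) \<in> span (B ` (I - J))" by (rule span_neg)
  moreover have "override_on B y J ` (I - J) = B ` (I - J)" by (auto simp: override_on_def)
  ultimately show "override_on B x J i - override_on B y J i \<in> span (override_on B y J ` (I - J))"
    using x[OF i] i by simp
qed auto

text \<open>Lattices.\<close>

definition lat :: "'v set" where "lat = {v \<in> V. \<forall>i\<in>I. crd i v \<in> \<int>}"

lemma lat_in_V: "v \<in> lat \<Longrightarrow> v \<in> V" by (simp add: lat_def)
lemma lat_crd: "v \<in> lat \<Longrightarrow> i \<in> I \<Longrightarrow> crd i v \<in> \<int>" by (simp add: lat_def)
lemma lat_add: "u \<in> lat \<Longrightarrow> v \<in> lat \<Longrightarrow> u + v \<in> lat" by (simp add: lat_def span_add)
lemma lat_diff: "u \<in> lat \<Longrightarrow> v \<in> lat \<Longrightarrow> u - v \<in> lat" by (simp add: lat_def span_diff)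
lemma lat_minus: "u \<in> lat \<Longrightarrow> - u \<in> lat" by (simp add: lat_def span_neg)
lemma lat_zero: "0 \<in> lat" by (simp add: lat_def span_zero)
lemma lat_B: "i \<in> I \<Longrightarrow> B i \<in> lat" by (simp add: lat_def B_in_V)

lemma form_perm:
  assumes "\<And>i. i \<in> I \<Longrightarrow> x i \<in> B ` I"
  shows "\<omega> x \<in> {-1, 0, 1}"
  using assms
proof (induction "card {i \<in> I. x i \<noteq> B i}" arbitrary: x rule: less_induct)
  case less
  show ?case
  proof (cases "\<exists>i\<in>I. x i \<noteq> B i")
    case False
    then have "\<omega> x = \<omega> B" by (intro form_cong) auto
    then show ?thesis by (simp add: form_B)
  next
    case True
    then obtain i where i: "i \<in> I" "x i \<noteq> B i" by auto
    then obtain j where j: "j \<in> I" "x i = B j" using less.prems by auto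
    then have ij: "i \<noteq> j" using i by auto
    show ?thesis
    proof (cases "x j = B j")
      case True
      then have "\<omega> x = 0" using i j ij by (intro form_eq[of i j]) auto
      then show ?thesis by simp
    next
      case xj: False
      let ?y = "x(i := x j, j := x i)"
      have "\<omega> x = \<omega> (x(i := x i, j := x j))" by simp
      also have "\<dots> = - \<omega> ?y" using i j ij by (intro form_swap)
      finally have "\<omega> x = - \<omega> ?y" .
      moreover have "\<omega> ?y \<in> {-1, 0, 1}"
      proof (rule less.hyps)
        have "{k \<in> I. ?y k \<noteq> B k} \<subseteq> {k \<in> I. x k \<noteq> B k} - {j}"
          using i j ij by auto
        moreover have "j \<in> {k \<in> I. x k \<noteq> B k}" using j xj by simp
        ultimately have "{k \<in> I. ?y k \<noteq> B k} \<subset> {k \<in> I. x k \<noteq> B k}" by blast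
        then show "card {k \<in> I. ?y k \<noteq> B k} < card {k \<in> I. x k \<noteq> B k}"
          using fin_I by (intro psubset_card_mono) auto
        show "?y k \<in> B ` I" if "k \<in> I" for k using less.prems i j that by auto
      qed
      ultimately show ?thesis by auto
    qed
  qed
qed

lemma form_lat:
  assumes "\<And>i. i \<in> I \<Longrightarrow> x i \<in> lat"
  shows "\<omega> x \<in> \<int>"
proof -
  have "\<omega> x \<in> \<int>" if "finite K" "K \<subseteq> I" "\<And>i. i \<in> K \<Longrightarrow> x i \<in> lat" "\<And>i. i \<in> I - K \<Longrightarrow> x i \<in> B ` I" for K x
    using that
  proof (induction K arbitrary: x rule: finite_induct)
    case empty
    then have "\<omega> x \<in> {-1, 0, 1}" by (intro form_perm) auto
    then show ?case by auto
  next
    case (insert k K)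
    have k: "k \<in> I" "x k \<in> lat" using insert by auto
    have "x k = (\<Sum>i\<in>I. crd i (x k) *\<^sub>R B i)" using k by (intro expand lat_in_V)
    then have "\<omega> x = \<omega> (x(k := \<Sum>i\<in>I. crd i (x k) *\<^sub>R B i))" by (metis fun_upd_triv)
    also have "\<dots> = (\<Sum>i\<in>I. crd i (x k) * \<omega> (x(k := B i)))" using k by (simp add: form_sum form_scale)
    also have "\<dots> \<in> \<int>"
    proof (intro Ints_sum Ints_mult)
      fix i assume i: "i \<in> I"
      show "crd i (x k) \<in> \<int>" using k i by (simp add: lat_def)
      show "\<omega> (x(k := B i)) \<in> \<int>"
        by (rule insert.IH) (use insert i in auto)
    qed
    finally show ?case .
  qed
  from this[of I] show ?thesis using assms fin_I by auto
qed

lemma form_half_lat: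
  assumes f: "f \<in> V" "\<And>i. i \<in> I \<Longrightarrow> 2 * crd i f \<in> \<int>"
    and x: "\<And>i. i \<in> I \<Longrightarrow> x i \<in> lat \<or> x i - f \<in> lat"
  shows "2 * \<omega> x \<in> \<int>"
proof (cases "\<forall>i\<in>I. x i \<in> lat")
  case True
  then show ?thesis by (intro Ints_mult form_lat) auto
next
  case False
  then obtain i where i: "i \<in> I" "x i - f \<in> lat" using x by blast
  define y where "y = (\<lambda>j. if j = i \<or> x j \<in> lat then x j else x j - x i)"
  have "\<omega> x = \<omega> y"
  proof (rule form_mod_slots[of "{i}"])
    show "x j - y j \<in> span (y ` {i})" if "j \<in> I - {i}" for j
      by (auto simp: y_def span_base span_zero)
  qed (use i in \<open>auto simp: y_def\<close>)
  moreover have "2 * \<omega> y = \<omega> (y(i := 2 *\<^sub>R x i))"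
    using i form_scale[of i y 2 "x i"] fun_upd_triv[of y i] by (simp add: y_def)
  moreover have "\<omega> (y(i := 2 *\<^sub>R x i)) \<in> \<int>"
  proof (rule form_lat)
    fix j assume j: "j \<in> I"
    show "(y(i := 2 *\<^sub>R x i)) j \<in> lat"
    proof (cases "j = i")
      case True
      have "x i = (x i - f) + f" by simp
      then have "x i \<in> V" using i(2) f(1) lat_in_V span_add by metis
      moreover have "2 * crd k (x i) \<in> \<int>" if "k \<in> I" for k
      proof -
        have "2 * crd k (x i) = 2 * crd k (x i - f) + 2 * crd k f" using that by simp
        moreover have "crd k (x i - f) \<in> \<int>" using i(2) that by (rule lat_crd)
        ultimately show ?thesis using f(2)[OF that] by (simp del: crd_diff)
      qed
      ultimately have "2 *\<^sub>R x i \<in> lat" by (simp add: lat_def span_scale)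
      then show ?thesis using True by simp
    next
      case False
      show ?thesis
      proof (cases "x j \<in> lat")
        case True
        then show ?thesis using False by (simp add: y_def)
      next
        case False
        then have "x j - f \<in> lat" using x j by blast
        then have "(x j - f) - (x i - f) \<in> lat" using i(2) lat_diff by blast
        then show ?thesis using False \<open>j \<noteq> i\<close> by (simp add: y_def)
      qed
    qed
  qed
  ultimately show ?thesis by simp
qed

end

locale conf = based_form I \<omega> B
  for I :: "nat set" and \<omega> :: "(nat \<Rightarrow> 'v::real_vector) \<Rightarrow> real" and B :: "nat \<Rightarrow> 'v" +
  fixes q :: nat and W :: "'v set"
  assumes q_pos: "q \<ge> 1"
    and fin_W: "finite W"
    and W_minus: "\<And>v. v \<in> W \<Longrightarrow> - v \<in> W"
    and zero_W: "0 \<notin> W"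
    and B_W: "\<And>i. i \<in> I \<Longrightarrow> B i \<in> W"
    and W_V: "\<And>v. v \<in> W \<Longrightarrow> v \<in> V"
    and W_bound: "\<And>x. (\<And>i. i \<in> I \<Longrightarrow> x i \<in> W) \<Longrightarrow> \<bar>\<omega> x\<bar> \<le> 1"
    and W_int: "\<And>x. (\<And>i. i \<in> I \<Longrightarrow> x i \<in> W) \<Longrightarrow> real q * \<omega> x \<in> \<int>"
begin

lemma crd_bound: "v \<in> W \<Longrightarrow> i \<in> I \<Longrightarrow> \<bar>crd i v\<bar> \<le> 1"
  unfolding crd_def by (rule W_bound) (auto simp: B_W)

lemma crd_int: "v \<in> W \<Longrightarrow> i \<in> I \<Longrightarrow> real q * crd i v \<in> \<int>"
  unfolding crd_def by (rule W_int) (auto simp: B_W)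

lemma conf_rebase:
  assumes "\<And>i. i \<in> I \<Longrightarrow> C i \<in> W" "\<bar>\<omega> C\<bar> = 1"
  shows "conf I (\<lambda>x. \<omega> x / \<omega> C) C q W"
proof -
  have C0: "\<omega> C \<noteq> 0" using assms(2) by auto
  have sp: "span (C ` I) = V" by (rule rebase_span[OF C0]) (use assms W_V in auto)
  have "\<omega> C = 1 \<or> \<omega> C = -1" using assms(2) by auto
  then have "real q * (\<omega> x / \<omega> C) \<in> \<int>" if "\<And>i. i \<in> I \<Longrightarrow> x i \<in> W" for x
    using W_int[OF that] by auto
  moreover have "\<bar>\<omega> x / \<omega> C\<bar> \<le> 1" if "\<And>i. i \<in> I \<Longrightarrow> x i \<in> W" for x
    using W_bound[OF that] assms(2) by simp
  ultimately show ?thesis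
    using rebase[OF C0] q_pos fin_W W_minus zero_W assms(1) W_V sp
    by (simp add: conf_def conf_axioms_def)
qed

lemma conf_restr:
  assumes J: "J \<subseteq> I"
  shows "conf J (restr J) B q (proj J ` W - {0})"
proof -
  have lift: "\<exists>y. restr J x = \<omega> y \<and> (\<forall>i\<in>I. y i \<in> W)"
    if x: "\<And>j. j \<in> J \<Longrightarrow> x j \<in> proj J ` W - {0}" for x
  proof -
    have "\<forall>j\<in>J. \<exists>w. w \<in> W \<and> x j = proj J w" using x by blast
    then obtain y where y: "\<forall>j\<in>J. y j \<in> W \<and> x j = proj J (y j)" by metis
    have "restr J x = \<omega> (override_on B y J)"
      using restr_lift[OF J, of y x] y W_V by (auto simp: restr_def)
    moreover have "override_on B y J i \<in> W" if "i \<in> I" for i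
      using y B_W that by (auto simp: override_on_def)
    ultimately show ?thesis by blast
  qed
  have "conf_axioms J (restr J) B q (proj J ` W - {0})"
  proof (rule conf_axioms.intro, goal_cases)
    case 1
    show ?case by (rule q_pos)
  next
    case 2
    show ?case using fin_W by simp
  next
    case (3 v)
    then obtain w where "w \<in> W" "v = proj J w" "v \<noteq> 0" by auto
    then have "- v = proj J (- w)" "- w \<in> W" "- v \<noteq> 0" using proj_minus[OF J] W_minus by auto
    then show ?case by blast
  next
    case 4
    show ?case by simp
  next
    case (5 i)
    then have iI: "i \<in> I" using J by auto
    have "proj J (B i) = B i"
      by (rule eqI) (use J iI 5 in \<open>auto simp: B_in_V proj_in_V\<close>)
    moreover have "B i \<noteq> 0" using B_W[OF iI] zero_W by metis
    ultimately show ?case using B_W[OF iI] by (metis DiffI imageI singletonD)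
  next
    case (6 v)
    then show ?case using proj_in_span by auto
  next
    case (7 x)
    then obtain y where "restr J x = \<omega> y" "\<forall>i\<in>I. y i \<in> W" using lift by blast
    then show ?case using W_bound by simp
  next
    case (8 x)
    then obtain y where "restr J x = \<omega> y" "\<forall>i\<in>I. y i \<in> W" using lift by blast
    then show ?case using W_int by simp
  qed
  then show ?thesis using based_form_restr[OF J] by (simp add: conf_def)
qed

lemma minor2:
  assumes "i \<in> I" "j \<in> I" "i \<noteq> j" "u \<in> W" "v \<in> W"
  shows "\<bar>crd i u * crd j v - crd j u * crd i v\<bar> \<le> 1"
    and "real q * (crd i u * crd j v - crd j u * crd i v) \<in> \<int>"
proof -
  have W: "\<And>k. k \<in> I \<Longrightarrow> (B(i := u, j := v)) k \<in> W" using assms B_W by auto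
  have "\<omega> (B(i := u, j := v)) = crd i u * crd j v - crd j u * crd i v"
    using assms W_V by (intro form2) auto
  then show "\<bar>crd i u * crd j v - crd j u * crd i v\<bar> \<le> 1"
    "real q * (crd i u * crd j v - crd j u * crd i v) \<in> \<int>"
    using W_bound[of "B(i := u, j := v)"] W_int[of "B(i := u, j := v)"] W by auto
qed

lemma minor3:
  assumes "i \<in> I" "j \<in> I" "l \<in> I" "i \<noteq> j" "i \<noteq> l" "j \<noteq> l" "u \<in> W" "v \<in> W" "w \<in> W"
  shows "\<bar>crd i u * (crd j v * crd l w - crd l v * crd j w)
   - crd j u * (crd i v * crd l w - crd l v * crd i w)
   + crd l u * (crd i v * crd j w - crd j v * crd i w)\<bar> \<le> 1"
proof -
  have W: "\<And>k. k \<in> I \<Longrightarrow> (B(i := u, j := v, l := w)) k \<in> W" using assms B_W by auto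
  have "\<omega> (B(i := u, j := v, l := w)) = crd i u * (crd j v * crd l w - crd l v * crd j w)
   - crd j u * (crd i v * crd l w - crd l v * crd i w)
   + crd l u * (crd i v * crd j w - crd j v * crd i w)"
    using assms W_V by (intro form3) auto
  then show ?thesis using W_bound[of "B(i := u, j := v, l := w)"] W by simp
qed

end


lemma card_le_fibres:
  assumes "finite A" "\<And>y. y \<in> f ` A \<Longrightarrow> card {x \<in> A. f x = y} \<le> n"
  shows "card A \<le> n * card (f ` A)"
proof -
  have "card A = (\<Sum>y\<in>f ` A. card {x \<in> A. f x = y})"
    using sum.image_gen[OF assms(1), of "\<lambda>_. 1::nat" f] by simp
  also have "\<dots> \<le> (\<Sum>y\<in>f ` A. n)" by (intro sum_mono assms(2))
  finally show ?thesis by (simp add: mult.commute)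
qed

lemma unit_cases: 
  fixes x :: real assumes "\<bar>x\<bar> \<le> 1" "x \<in> \<int>" shows "x \<in> {-1, 0, 1}"
proof -
  obtain k :: int where k: "x = of_int k" using assms(2) by (auto elim: Ints_cases)
  then have "\<bar>k\<bar> \<le> 1" using assms(1) by simp
  then have "k = -1 \<or> k = 0 \<or> k = 1" by auto
  then show ?thesis using k by auto
qed

lemma unit_minor:
  fixes a b c d :: real
  assumes "a \<in> {1, -1}" "b \<in> {1, -1}" "c \<in> {1, -1}" "d \<in> {1, -1}" "\<bar>a * d - b * c\<bar> \<le> 1"
  shows "b = a * c * d"
  using assms by auto

context conf begin

definition supp :: "'v \<Rightarrow> nat set" where "supp v = {i \<in> I. crd i v \<noteq> 0}"

lemma supp_nonempty: "v \<in> W \<Longrightarrow> supp v \<noteq> {}"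
proof
  assume v: "v \<in> W" "supp v = {}"
  have "v = 0" by (rule eqI) (use v W_V in \<open>auto simp: supp_def span_zero\<close>)
  then show False using v zero_W by simp
qed

lemma supp_minus: "supp (- v) = supp v" by (auto simp: supp_def)

lemma unit_W: assumes "q = 1" "v \<in> W" "i \<in> I" shows "crd i v \<in> {-1, 0, 1}"
  using crd_bound[OF assms(2,3)] crd_int[OF assms(2,3)] assms(1) by (intro unit_cases) auto

lemma supp_unit: assumes "q = 1" "v \<in> W" "i \<in> supp v" shows "crd i v = 1 \<or> crd i v = -1"
  using unit_W[OF assms(1,2), of i] assms(3) by (auto simp: supp_def)

lemma supp_determines:
  assumes q: "q = 1" and uv: "u \<in> W" "v \<in> W" "supp u = supp v"
  shows "u = v \<or> u = - v"
proof -
  obtain i where i: "i \<in> supp u" using supp_nonempty[OF uv(1)] by auto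
  then have iI: "i \<in> I" by (simp add: supp_def)
  have main: "u = w" if w: "w \<in> W" "supp u = supp w" "crd i u = crd i w" for w
  proof (rule eqI)
    show "u \<in> V" "w \<in> V" using W_V[OF uv(1)] W_V[OF w(1)] .
    fix j assume j: "j \<in> I"
    show "crd j u = crd j w"
    proof (cases "j = i \<or> j \<notin> supp u")
      case True
      then have "j = i \<or> j \<notin> supp u \<and> j \<notin> supp w" by (simp add: w(2))
      then show ?thesis using w(3) j by (auto simp: supp_def)
    next
      case False
      then have js: "j \<in> supp u" "j \<in> supp w" by (simp_all flip: w(2))
      have "\<bar>crd i u * crd j w - crd j u * crd i w\<bar> \<le> 1"
        by (rule minor2(1)) (use iI j False uv(1) w(1) in auto)
      then show ?thesis
        using supp_unit[OF q uv(1) js(1)] supp_unit[OF q w(1) js(2)] supp_unit[OF q uv(1) i] w(3)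
        by (elim disjE) simp_all
    qed
  qed
  have "i \<in> supp v" using i by (simp only: uv(3))
  from supp_unit[OF q uv(2) this] have "crd i u = crd i v \<or> crd i u = crd i (- v)"
    using supp_unit[OF q uv(1) i] iI by auto
  then show ?thesis
  proof
    assume "crd i u = crd i v"
    then have "u = v" by (intro main uv)
    then show ?thesis ..
  next
    assume "crd i u = crd i (- v)"
    then have "u = - v" using uv(3) by (intro main W_minus uv(2)) (simp_all only: supp_minus)
    then show ?thesis ..
  qed
qed

theorem card_unimodular:
  assumes q: "q = 1"
  shows "card W \<le> card I ^ 2 + card I"
proof -
  let ?F = "insert {} (supp ` W)"
  have "card W \<le> 2 * card (supp ` W)"
  proof (rule card_le_fibres[OF fin_W])
    fix y assume "y \<in> supp ` W"
    then obtain u where u: "u \<in> W" "y = supp u" by auto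
    have "{x \<in> W. supp x = y} \<subseteq> {u, - u}"
    proof
      fix x assume "x \<in> {x \<in> W. supp x = y}"
      then have "x \<in> W" "supp x = supp u" using u(2) by simp_all
      from supp_determines[OF q this(1) u(1) this(2)] show "x \<in> {u, - u}" by simp
    qed
    then have "card {x \<in> W. supp x = y} \<le> card {u, - u}" by (intro card_mono) auto
    also have "\<dots> \<le> 2" by (simp add: card_insert_if)
    finally show "card {x \<in> W. supp x = y} \<le> 2" .
  qed
  also have "card ?F = 1 + card (supp ` W)"
  proof (subst card_insert_disjoint)
    show "{} \<notin> supp ` W" using supp_nonempty by (metis imageE)
  qed (use fin_W in auto)
  then have "2 * card (supp ` W) = 2 * card ?F - 2" by simp
  also have "2 * card ?F \<le> 2 + card I ^ 2 + card I"
  proof (rule card_le_if_no_shattered_triple[OF fin_I])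
    show "?F \<subseteq> Pow I" by (auto simp: supp_def)
    fix a b c S T U Y
    assume abc: "a \<in> I" "b \<in> I" "c \<in> I" "a \<noteq> b" "a \<noteq> c" "b \<noteq> c"
      and F: "S \<in> ?F" "T \<in> ?F" "U \<in> ?F" "Y \<in> ?F"
      and e: "S \<inter> {a, b, c} = {a, b}" "T \<inter> {a, b, c} = {a, c}"
        "U \<inter> {a, b, c} = {b, c}" "Y \<inter> {a, b, c} = {a, b, c}"
    have ie: "x \<in> X \<longleftrightarrow> x \<in> L" if "X \<inter> K = L" "x \<in> K" for x X and K L :: "nat set"
      using that(2) unfolding that(1)[symmetric] by simp
    have ne: "X \<noteq> {}" if "X \<inter> K = insert x L" for x X and K L :: "nat set"
      using that by (metis Int_empty_left insert_not_empty)
    have "S \<noteq> {}" "T \<noteq> {}" "U \<noteq> {}" "Y \<noteq> {}"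
      using ne[OF e(1)] ne[OF e(2)] ne[OF e(3)] ne[OF e(4)] .
    then obtain s t u y where W: "s \<in> W" "t \<in> W" "u \<in> W" "y \<in> W"
      and S: "S = supp s" "T = supp t" "U = supp u" "Y = supp y" using F by auto
    have "a \<in> S" "b \<in> S" "c \<notin> S" "a \<in> T" "b \<notin> T" "c \<in> T" "a \<notin> U" "b \<in> U" "c \<in> U" "a \<in> Y" "b \<in> Y" "c \<in> Y"
      using ie[OF e(1)] ie[OF e(2)] ie[OF e(3)] ie[OF e(4)] abc by simp_all
    then have i: "c \<notin> supp s" "b \<notin> supp t" "a \<notin> supp u" and j: "a \<in> supp s" "b \<in> supp s"
        "a \<in> supp t" "c \<in> supp t" "b \<in> supp u" "c \<in> supp u" "a \<in> supp y" "b \<in> supp y" "c \<in> supp y"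
      unfolding S by blast+
    have z: "crd c s = 0" "crd b t = 0" "crd a u = 0" using i abc by (simp_all add: supp_def)
    have su: "crd e w \<in> {1, -1}" if "w \<in> W" "e \<in> supp w" for e w
      using supp_unit[OF q that] by simp
    note n = su[OF W(1) j(1)] su[OF W(1) j(2)] su[OF W(2) j(3)] su[OF W(2) j(4)] su[OF W(3) j(5)]
      su[OF W(3) j(6)] su[OF W(4) j(7)] su[OF W(4) j(8)] su[OF W(4) j(9)]
    have m: "\<bar>crd a s * crd b y - crd b s * crd a y\<bar> \<le> 1"
      "\<bar>crd a t * crd c y - crd c t * crd a y\<bar> \<le> 1" "\<bar>crd b u * crd c y - crd c u * crd b y\<bar> \<le> 1"
      using abc W by (auto intro: minor2(1))
    have d: "crd b s = crd a s * crd a y * crd b y" "crd c t = crd a t * crd a y * crd c y"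
      "crd c u = crd b u * crd b y * crd c y" using unit_minor[OF n(1,2,7,8) m(1)] unit_minor[OF n(3,4,7,9) m(2)] unit_minor[OF n(5,6,8,9) m(3)] by this
    have y2: "crd b y * crd b y = 1" using n(8) by auto
    have abs1: "\<bar>x\<bar> = 1" if "x \<in> {1, -1}" for x :: real using that by auto
    note one = abs1[OF n(1)] abs1[OF n(3)] abs1[OF n(5)] abs1[OF n(7)] abs1[OF n(9)]
    have "\<bar>crd a s * (crd b t * crd c u - crd c t * crd b u)
       - crd b s * (crd a t * crd c u - crd c t * crd a u)
       + crd c s * (crd a t * crd b u - crd b t * crd a u)\<bar> \<le> 1"
      using abc W by (intro minor3)
    moreover have "crd a s * (crd b t * crd c u - crd c t * crd b u)
       - crd b s * (crd a t * crd c u - crd c t * crd a u)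
       + crd c s * (crd a t * crd b u - crd b t * crd a u)
       = - (crd a s * crd a t * crd b u * crd a y * crd c y) * (1 + crd b y * crd b y)"
      unfolding z d by (simp add: algebra_simps)
    ultimately have "\<bar>- (crd a s * crd a t * crd b u * crd a y * crd c y) * (1 + 1)\<bar> \<le> 1"
      unfolding y2 by simp
    then show False using one by (simp add: abs_mult)
  qed
  finally show ?thesis by simp
qed

end


lemma half_int_cases:
  fixes x :: real
  assumes "2 * x \<in> \<int>" "\<bar>x\<bar> \<le> 1"
  shows "x = -1 \<or> x = -1/2 \<or> x = 0 \<or> x = 1/2 \<or> x = 1"
proof -
  obtain k :: int where k: "2 * x = of_int k" using assms(1) by (auto elim: Ints_cases)
  then have "\<bar>k\<bar> \<le> 2" using assms(2) by linarith
  then have "k = -2 \<or> k = -1 \<or> k = 0 \<or> k = 1 \<or> k = 2" by auto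
  then show ?thesis using k by auto
qed

lemma half_not_int [simp]: "(1/2::real) \<notin> \<int>" "(-1/2::real) \<notin> \<int>"
proof -
  show "(1/2::real) \<notin> \<int>"
  proof
    assume "(1/2::real) \<in> \<int>"
    then obtain k :: int where "(1/2::real) = of_int k" by (auto elim: Ints_cases)
    then have "real_of_int (2 * k) = real_of_int 1" by simp
    then have "2 * k = 1" by (simp only: of_int_eq_iff)
    then show False by presburger
  qed
  then show "(-1/2::real) \<notin> \<int>" using minus_in_Ints_iff[of "1/2::real"] by simp
qed

lemma half_diff_int:
  fixes x y :: real
  assumes "2 * x \<in> \<int>" "2 * y \<in> \<int>" "x \<in> \<int> \<longleftrightarrow> y \<in> \<int>"
  shows "x - y \<in> \<int>" "x + y \<in> \<int>"
proof -
  obtain a b :: int where ab: "2 * x = of_int a" "2 * y = of_int b"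
    using assms(1,2) by (auto elim!: Ints_cases)
  have ev: "z \<in> \<int> \<longleftrightarrow> even c" if "2 * z = of_int c" for z :: real and c
  proof
    assume "z \<in> \<int>"
    then obtain d :: int where "z = of_int d" by (auto elim: Ints_cases)
    then have "real_of_int (2 * d) = of_int c" using that by simp
    then have "2 * d = c" by (simp only: of_int_eq_iff)
    then show "even c" by auto
  next
    assume "even c"
    then obtain d where "c = 2 * d" by auto
    then have "z = of_int d" using that by simp
    then show "z \<in> \<int>" by simp
  qed
  have e: "even a \<longleftrightarrow> even b" using assms(3) ev[OF ab(1)] ev[OF ab(2)] by simp
  have "2 * (x - y) = of_int (a - b)" "2 * (x + y) = of_int (a + b)" using ab by (simp_all add: algebra_simps)
  from ev[OF this(1)] ev[OF this(2)] show "x - y \<in> \<int>" "x + y \<in> \<int>" using e by simp_all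
qed

lemma three_elements:
  assumes "\<not> card A \<le> 2"
  obtains a b c where "a \<in> A" "b \<in> A" "c \<in> A" "a \<noteq> b" "a \<noteq> c" "b \<noteq> c"
proof -
  have "3 \<le> card A" using assms by simp
  then obtain L where L: "L \<subseteq> A" "card L = 3" using obtain_subset_with_card_n by metis
  then obtain a b c where "L = {a, b, c}" "a \<noteq> b" "a \<noteq> c" "b \<noteq> c"
    by (auto simp: card_3_iff)
  then show ?thesis using L(1) that[of a b c] by simp
qed

lemma half_prod:
  fixes a b :: real
  assumes "a = 1/2 \<or> a = -1/2" "b = 1/2 \<or> b = -1/2"
  shows "2 * (a * b) = 1/2 \<or> 2 * (a * b) = -1/2"
  using assms by (elim disjE; hypsubst; simp)

lemma int_abs_less_2:
  fixes x :: real
  assumes "x \<in> \<int>" "x \<noteq> 0" "\<bar>x\<bar> < 2"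
  shows "x = 1 \<or> x = -1"
proof -
  obtain k :: int where k: "x = of_int k" using assms(1) by (auto elim: Ints_cases)
  then have "\<bar>k\<bar> < 2" "k \<noteq> 0" using assms by auto
  then have "k = 1 \<or> k = -1" by auto
  then show ?thesis using k by auto
qed

context based_form begin

lemma extend_independent:
  assumes "finite T" "independent T" "T \<subseteq> V"
  shows "\<exists>x. \<omega> x \<noteq> 0 \<and> (\<forall>j\<in>I. x j \<in> T \<or> x j = B j) \<and> T \<subseteq> x ` I"
  using assms
proof (induction T rule: finite_induct)
  case empty
  have "\<omega> B \<noteq> 0 \<and> (\<forall>j\<in>I. B j \<in> {} \<or> B j = B j) \<and> {} \<subseteq> B ` I" by (simp add: form_B)
  then show ?case by blast
next
  case (insert t T)
  have ind: "independent T" using insert.prems(1) independent_mono by blast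
  have tV: "t \<in> V" and TV: "T \<subseteq> V" using insert.prems(2) by auto
  obtain x where x: "\<omega> x \<noteq> 0" "\<forall>j\<in>I. x j \<in> T \<or> x j = B j" "T \<subseteq> x ` I"
    using insert.IH[OF ind TV] by blast
  interpret X: based_form I "\<lambda>y. \<omega> y / \<omega> x" x using x(1) by (rule rebase)
  have xV: "x j \<in> V" if "j \<in> I" for j using x(2) that TV B_in_V[OF that] by auto
  have sp: "span (x ` I) = V" using x(1) xV by (rule rebase_span)
  then have tX: "t \<in> span (x ` I)" using tV by simp
  have nt: "t \<notin> span T" using insert.prems(1) insert.hyps independent_insert by metis
  have "\<exists>j\<in>I. x j \<notin> T \<and> X.crd j t \<noteq> 0"
  proof (rule ccontr)
    assume "\<not> ?thesis"
    then have c: "x j \<in> T \<or> X.crd j t = 0" if "j \<in> I" for j using that by blast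
    have "(\<Sum>j\<in>I. X.crd j t *\<^sub>R x j) \<in> span T"
    proof (rule span_sum)
      fix j assume "j \<in> I"
      then show "X.crd j t *\<^sub>R x j \<in> span T"
        using c[of j] by (cases "x j \<in> T") (auto intro: span_scale span_base span_zero)
    qed
    then show False using nt X.expand[OF tX] by simp
  qed
  then obtain j where j: "j \<in> I" "x j \<notin> T" "X.crd j t \<noteq> 0" by blast
  have "\<omega> (x(j := t)) \<noteq> 0" using j(3) by (auto simp: X.crd_def)
  moreover have "\<forall>l\<in>I. (x(j := t)) l \<in> insert t T \<or> (x(j := t)) l = B l" using x(2) by auto
  moreover have "insert t T \<subseteq> (x(j := t)) ` I"
  proof
    fix v assume v: "v \<in> insert t T"
    show "v \<in> (x(j := t)) ` I"
    proof (cases "v = t")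
      case True
      then show ?thesis using j(1) by (intro image_eqI[of _ _ j]) auto
    next
      case False
      then have "v \<in> T" using v by simp
      then obtain l where "l \<in> I" "v = x l" using x(3) by auto
      then show ?thesis using \<open>v \<in> T\<close> j(2) by (intro image_eqI[of _ _ l]) auto
    qed
  qed
  ultimately show ?case by blast
qed

text \<open>Replacing basis vectors in slots where a vector has no component does not change its coordinates.\<close>

lemma crd_rebase_off:
  assumes C: "\<omega> C \<noteq> 0" "\<And>i. i \<in> I - A \<Longrightarrow> C i = B i"
    and v: "v \<in> V" "\<And>a. a \<in> A \<Longrightarrow> a \<in> I \<Longrightarrow> crd a v = 0" and i: "i \<in> I - A"
  shows "\<omega> (C(i := v)) = crd i v * \<omega> C"
proof -
  interpret X: based_form I "\<lambda>y. \<omega> y / \<omega> C" C using C(1) by (rule rebase)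
  have "v = (\<Sum>p\<in>I. crd p v *\<^sub>R B p)" using v(1) by (rule expand)
  also have "\<dots> = (\<Sum>p\<in>I. crd p v *\<^sub>R C p)"
    using C(2) v(2) by (intro sum.cong) (metis Diff_iff scaleR_zero_left)+
  finally have e: "v = (\<Sum>p\<in>I. crd p v *\<^sub>R C p)" .
  have "X.crd i v = X.crd i (\<Sum>p\<in>I. crd p v *\<^sub>R C p)" using e by simp
  also have "\<dots> = (\<Sum>p\<in>I. crd p v * X.crd i (C p))" using i by simp
  also have "\<dots> = (\<Sum>p\<in>I. if p = i then crd p v else 0)"
    using i by (intro sum.cong) auto
  also have "\<dots> = crd i v" using i fin_I by simp
  finally show ?thesis using C(1) by (simp add: X.crd_def divide_simps)
qed

lemma proj_eq_iff:
  assumes "J \<subseteq> I" shows "proj J u = proj J v \<longleftrightarrow> (\<forall>j\<in>J. crd j u = crd j v)"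
proof
  assume e: "proj J u = proj J v"
  show "\<forall>j\<in>J. crd j u = crd j v"
  proof
    fix j assume "j \<in> J"
    then show "crd j u = crd j v" using crd_proj[OF assms, of j u] crd_proj[OF assms, of j v] assms e by auto
  qed
next
  assume "\<forall>j\<in>J. crd j u = crd j v"
  then show "proj J u = proj J v" by (simp add: proj_def)
qed

lemma proj_zero [simp]: "J \<subseteq> I \<Longrightarrow> proj J 0 = 0" 
  by (auto simp: proj_def intro!: sum.neutral)

lemma proj_eq_0_iff:
  assumes "J \<subseteq> I" shows "proj J v = 0 \<longleftrightarrow> (\<forall>j\<in>J. crd j v = 0)"
  using proj_eq_iff[OF assms, of v 0] assms by auto

end

locale bimod = conf I \<omega> B 2 W
  for I :: "nat set" and \<omega> :: "(nat \<Rightarrow> 'v::real_vector) \<Rightarrow> real" and B :: "nat \<Rightarrow> 'v" and W :: "'v set"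
begin

lemma crd_half: "v \<in> W \<Longrightarrow> i \<in> I \<Longrightarrow> 2 * crd i v \<in> \<int>"
  using crd_int[of v i] by simp

lemma crd_cases:
  "v \<in> W \<Longrightarrow> i \<in> I \<Longrightarrow> crd i v = -1 \<or> crd i v = -1/2 \<or> crd i v = 0 \<or> crd i v = 1/2 \<or> crd i v = 1"
  by (intro half_int_cases crd_half crd_bound)

lemma crd_nonint: "v \<in> W \<Longrightarrow> i \<in> I \<Longrightarrow> crd i v \<notin> \<int> \<Longrightarrow> crd i v = 1/2 \<or> crd i v = -1/2"
  using crd_cases[of v i] by auto

lemma crd_integral: "v \<in> W \<Longrightarrow> i \<in> I \<Longrightarrow> crd i v \<in> \<int> \<Longrightarrow> crd i v = -1 \<or> crd i v = 0 \<or> crd i v = 1"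
  using crd_cases[of v i] half_not_int by metis

definition Kset :: "(nat \<Rightarrow> 'v) \<Rightarrow> nat set" where
  "Kset C = {i \<in> I. \<exists>v\<in>W. \<omega> (C(i := v)) \<notin> \<int>}"

abbreviation "K \<equiv> Kset B"
abbreviation "Q \<equiv> I - Kset B"

lemma K_I: "K \<subseteq> I" by (auto simp: Kset_def)
lemma finite_K: "finite K" using K_I fin_I finite_subset by blast
lemma crd_Q: "v \<in> W \<Longrightarrow> i \<in> Q \<Longrightarrow> crd i v \<in> \<int>" by (auto simp: Kset_def crd_def)
lemma K_ex: "i \<in> K \<Longrightarrow> \<exists>v\<in>W. crd i v \<notin> \<int>" by (auto simp: Kset_def crd_def)
lemma K_mem: "v \<in> W \<Longrightarrow> i \<in> I \<Longrightarrow> crd i v \<notin> \<int> \<Longrightarrow> i \<in> K" by (auto simp: Kset_def crd_def)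
lemma crd_Q_cases: "v \<in> W \<Longrightarrow> i \<in> Q \<Longrightarrow> crd i v = -1 \<or> crd i v = 0 \<or> crd i v = 1"
  using crd_integral[of v i] crd_Q[of v i] by blast

lemma nonint_K:
  assumes v: "v \<in> W" "i \<in> I" "crd i v \<notin> \<int>" and j: "j \<in> K"
  shows "crd j v \<notin> \<int>"
proof
  assume vj: "crd j v \<in> \<int>"
  then have ij: "i \<noteq> j" using v by auto
  obtain u where u: "u \<in> W" "crd j u \<notin> \<int>" using K_ex[OF j] by blast
  have jI: "j \<in> I" using j K_I by auto
  have "real 2 * (crd i v * crd j u - crd j v * crd i u) \<in> \<int>"
    using v(1,2) u(1) ij jI by (intro minor2(2))
  then have m: "2 * (crd i v * crd j u) - crd j v * (2 * crd i u) \<in> \<int>" by (simp add: algebra_simps)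
  have "crd j v * (2 * crd i u) \<in> \<int>" using vj crd_half[OF u(1) v(2)] by (rule Ints_mult)
  from Ints_add[OF m this] have "2 * (crd i v * crd j u) \<in> \<int>" by simp
  moreover have "2 * (crd i v * crd j u) = 1/2 \<or> 2 * (crd i v * crd j u) = -1/2"
    using crd_nonint[OF v] crd_nonint[OF u(1) jI u(2)] by (rule half_prod)
  ultimately show False using half_not_int by metis
qed

lemma int_K_iff: "v \<in> W \<Longrightarrow> i \<in> K \<Longrightarrow> j \<in> K \<Longrightarrow> crd i v \<in> \<int> \<longleftrightarrow> crd j v \<in> \<int>"
  using nonint_K K_I by blast

lemma diff_int:
  assumes "u \<in> W" "v \<in> W" "i \<in> K" "crd i u \<in> \<int> \<longleftrightarrow> crd i v \<in> \<int>" "j \<in> I"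
  shows "crd j u - crd j v \<in> \<int>"
proof (rule half_diff_int(1))
  show "2 * crd j u \<in> \<int>" "2 * crd j v \<in> \<int>" using crd_half assms by blast+
  show "crd j u \<in> \<int> \<longleftrightarrow> crd j v \<in> \<int>"
  proof (cases "j \<in> K")
    case True
    then show ?thesis using int_K_iff[OF assms(1,3), of j] int_K_iff[OF assms(2,3), of j] assms(4) by simp
  next
    case False
    then show ?thesis using K_mem[OF assms(1,5)] K_mem[OF assms(2,5)] by blast
  qed
qed

text \<open>The kernel and the fibres of the contraction of a slot.\<close>

abbreviation pr :: "nat \<Rightarrow> 'v \<Rightarrow> 'v" where "pr i \<equiv> proj (I - {i})"

definition D :: "nat \<Rightarrow> 'v set" where
  "D i = {d. d \<noteq> 0 \<and> (\<exists>u\<in>W. \<exists>v\<in>W. u \<noteq> v \<and> pr i u = d \<and> pr i v = d)}"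

lemma pr_eq_iff: "pr i u = pr i v \<longleftrightarrow> (\<forall>j\<in>I - {i}. crd j u = crd j v)"
  by (rule proj_eq_iff) auto

lemma fibre_diff:
  assumes two: "i \<in> K" "l \<in> K" "l \<noteq> i" and uv: "u \<in> W" "v \<in> W" "u \<noteq> v" "pr i u = pr i v" "pr i u \<noteq> 0"
  shows "\<bar>crd i u - crd i v\<bar> = 1"
proof -
  have e: "crd j u = crd j v" if "j \<in> I" "j \<noteq> i" for j using uv(4) that by (simp add: pr_eq_iff)
  have lI: "l \<in> I" and iI: "i \<in> I" using two K_I by auto
  have "crd l u = crd l v" using e[OF lI] two by simp
  then have d: "crd i u - crd i v \<in> \<int>" using diff_int[OF uv(1,2) two(2) _ iI] by simp
  have ne: "crd i u - crd i v \<noteq> 0"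
  proof
    assume "crd i u - crd i v = 0"
    then have "crd j u = crd j v" if "j \<in> I" for j using e[OF that] by (cases "j = i") auto
    then have "u = v" using uv W_V by (intro eqI) auto
    then show False using uv by simp
  qed
  have "\<not> (\<forall>j\<in>I - {i}. crd j u = 0)" using uv(5) proj_eq_0_iff[of "I - {i}" u] by auto
  then obtain j where j: "j \<in> I" "j \<noteq> i" "crd j u \<noteq> 0" by auto
  have "\<bar>crd i u - crd i v\<bar> < 2"
  proof (cases "crd l u \<in> \<int>")
    case True
    then have "crd j u \<in> \<int>" using nonint_K[OF uv(1) j(1) _ two(2)] by blast
    then have "\<bar>crd j u\<bar> = 1" using crd_integral[OF uv(1) j(1)] j(3) by auto
    moreover have "\<bar>crd i u * crd j v - crd j u * crd i v\<bar> \<le> 1"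
      using iI j uv by (intro minor2(1)) auto
    then have "\<bar>(crd i u - crd i v) * crd j u\<bar> \<le> 1" using e[OF j(1,2)] by (simp add: algebra_simps)
    ultimately show ?thesis by (simp add: abs_mult)
  next
    case False
    then have "crd l v \<notin> \<int>" using e[OF lI two(3)] by simp
    then have "crd i v = 1/2 \<or> crd i v = -1/2" "crd i u = 1/2 \<or> crd i u = -1/2"
      using crd_nonint[OF uv(2) iI nonint_K[OF uv(2) lI _ two(1)]]
        crd_nonint[OF uv(1) iI nonint_K[OF uv(1) lI False two(1)]] by auto
    then show ?thesis by (elim disjE) simp_all
  qed
  then show ?thesis using int_abs_less_2[OF d ne] by auto
qed

lemma fibre_le_2:
  assumes two: "i \<in> K" "l \<in> K" "l \<noteq> i" and d: "d \<noteq> 0"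
  shows "card {v \<in> W. pr i v = d} \<le> 2"
proof (rule ccontr)
  assume "\<not> ?thesis"
  from three_elements[OF this] obtain a b c where
    "a \<in> {v \<in> W. pr i v = d}" "b \<in> {v \<in> W. pr i v = d}" "c \<in> {v \<in> W. pr i v = d}"
    and abc: "a \<noteq> b" "a \<noteq> c" "b \<noteq> c" .
  then have m: "a \<in> W" "b \<in> W" "c \<in> W" "pr i a = d" "pr i b = d" "pr i c = d"
    by simp_all
  have "\<bar>crd i a - crd i b\<bar> = 1" "\<bar>crd i a - crd i c\<bar> = 1" "\<bar>crd i b - crd i c\<bar> = 1"
    using fibre_diff[OF two m(1,2) abc(1)] fibre_diff[OF two m(1,3) abc(2)] fibre_diff[OF two m(2,3) abc(3)]
    unfolding m(4) m(5) m(6) using d by blast+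
  then show False by linarith
qed

lemma kernel_subset:
  assumes two: "i \<in> I" "l \<in> K" "l \<noteq> i"
  shows "{v \<in> W. pr i v = 0} \<subseteq> {B i, - B i}"
proof
  fix v assume "v \<in> {v \<in> W. pr i v = 0}"
  then have v: "v \<in> W" "\<forall>j\<in>I - {i}. crd j v = 0" using proj_eq_0_iff[of "I - {i}" v] by auto
  have lI: "l \<in> I" using two K_I by auto
  then have l0: "crd l v = 0" using v two by auto
  have int: "crd i v \<in> \<int>" using nonint_K[OF v(1) two(1) _ two(2)] l0 by auto
  have "crd i v \<noteq> 0"
  proof
    assume "crd i v = 0"
    then have "v = 0" using v W_V by (intro eqI) (auto simp: span_zero)
    then show False using v zero_W by simp
  qed
  then have "crd i v = 1 \<or> crd i v = -1" using crd_integral[OF v(1) two(1) int] by auto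
  moreover have "v = crd i v *\<^sub>R B i"
    by (rule eqI) (use v W_V two(1) in \<open>auto intro: span_scale B_in_V\<close>)
  ultimately show "v \<in> {B i, - B i}" by auto
qed

lemma D_subset: "D i \<subseteq> pr i ` W - {0}" by (auto simp: D_def)
lemma finite_D: "finite (D i)" using D_subset fin_W finite_subset by blast

text \<open>The number of vectors lost in a contraction.\<close>

lemma card_contract:
  assumes two: "i \<in> K" "l \<in> K" "l \<noteq> i"
  shows "card W \<le> card (pr i ` W - {0}) + 2 + card (D i)"
proof -
  let ?W' = "pr i ` W - {0}"
  have iI: "i \<in> I" using two K_I by auto
  have "W = {v \<in> W. pr i v = 0} \<union> {v \<in> W. pr i v \<in> ?W'}" by auto
  then have "card W \<le> card {v \<in> W. pr i v = 0} + card {v \<in> W. pr i v \<in> ?W'}"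
    by (metis (lifting) card_Un_le)
  moreover have "card {v \<in> W. pr i v = 0} \<le> card {B i, - B i}"
    using kernel_subset[OF iI two(2,3)] by (intro card_mono) auto
  moreover have "card {B i, - B i} \<le> 2" by (simp add: card_insert_if)
  moreover have "card {v \<in> W. pr i v \<in> ?W'} \<le> card ?W' + card (D i)"
  proof -
    have fin: "finite ?W'" using fin_W by simp
    have "{v \<in> W. pr i v \<in> ?W'} = (\<Union>d\<in>?W'. {v \<in> W. pr i v = d})" by auto
    then have "card {v \<in> W. pr i v \<in> ?W'} = card (\<Union>d\<in>?W'. {v \<in> W. pr i v = d})" by simp
    also have "\<dots> \<le> (\<Sum>d\<in>?W'. card {v \<in> W. pr i v = d})" by (rule card_UN_le[OF fin])
    also have "\<dots> \<le> (\<Sum>d\<in>?W'. 1 + (if d \<in> D i then 1 else 0))"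
    proof (rule sum_mono)
      fix d assume d: "d \<in> ?W'"
      show "card {v \<in> W. pr i v = d} \<le> 1 + (if d \<in> D i then 1 else 0)"
      proof (cases "d \<in> D i")
        case True
        then show ?thesis using fibre_le_2[OF two, of d] d by simp
      next
        case False
        then have "u = v" if "u \<in> W" "v \<in> W" "pr i u = d" "pr i v = d" for u v
          using that d unfolding D_def mem_Collect_eq by (metis DiffE insertI1)
        then have "card {v \<in> W. pr i v = d} \<le> Suc 0"
          using fin_W by (subst card_le_Suc0_iff_eq) auto
        then show ?thesis using False by simp
      qed
    qed
    also have "\<dots> = card ?W' + (\<Sum>d\<in>?W'. if d \<in> D i then 1 else 0)" by (simp only: sum.distrib) simp
    also have "(\<Sum>d\<in>?W'. if d \<in> D i then 1 else 0) = card {d \<in> ?W'. d \<in> D i}"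
      using fin by (simp add: sum.If_cases Int_def)
    also have "{d \<in> ?W'. d \<in> D i} = D i" using D_subset by blast
    finally show ?thesis .
  qed
  ultimately show ?thesis by linarith
qed

end


lemma half_int_pos:
  fixes x :: real
  assumes "2 * x \<in> \<int>" "x \<noteq> 0"
  shows "1/2 \<le> \<bar>x\<bar>" "\<bar>x\<bar> < 1 \<Longrightarrow> \<bar>x\<bar> = 1/2"
proof -
  obtain k :: int where k: "2 * x = of_int k" using assms(1) by (auto elim: Ints_cases)
  have "k \<noteq> 0" using k assms(2) by auto
  then have "1 \<le> \<bar>k\<bar>" by linarith
  then have "1 \<le> real_of_int \<bar>k\<bar>" by linarith
  then show "1/2 \<le> \<bar>x\<bar>" using k by linarith
  assume "\<bar>x\<bar> < 1"
  then have "\<bar>k\<bar> < 2" using k by linarith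
  then have "k = 1 \<or> k = -1" using \<open>k \<noteq> 0\<close> by linarith
  then show "\<bar>x\<bar> = 1/2" using k by auto
qed

lemma half_int_abs:
  fixes x :: real
  assumes "2 * x \<in> \<int>" "\<bar>x\<bar> \<le> 1" "\<bar>x\<bar> \<noteq> 1"
  shows "\<bar>x\<bar> \<le> 1/2"
  using half_int_cases[OF assms(1,2)] assms(3) by (elim disjE) simp_all

lemma abs_half_not_int: "\<bar>x\<bar> = 1/2 \<Longrightarrow> (x::real) \<notin> \<int>"
proof -
  assume "\<bar>x\<bar> = 1/2"
  then have "x = 1/2 \<or> x = -1/2" by linarith
  then show ?thesis using half_not_int by metis
qed

context bimod begin

lemma bimod_rebase:
  assumes "\<And>i. i \<in> I \<Longrightarrow> C i \<in> W" "\<bar>\<omega> C\<bar> = 1"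
  shows "bimod I (\<lambda>x. \<omega> x / \<omega> C) C W"
  unfolding bimod_def by (rule conf_rebase[OF assms])

lemma Kset_rebase:
  assumes "\<And>i. i \<in> I \<Longrightarrow> C i \<in> W" "\<bar>\<omega> C\<bar> = 1"
  shows "bimod.Kset I (\<lambda>x. \<omega> x / \<omega> C) W C' = Kset C'"
proof -
  interpret C: bimod I "\<lambda>x. \<omega> x / \<omega> C" C W using assms by (rule bimod_rebase)
  have "\<omega> C = 1 \<or> \<omega> C = -1" using assms(2) by linarith
  then have e: "z / \<omega> C \<in> \<int> \<longleftrightarrow> z \<in> \<int>" for z by (elim disjE) simp_all
  show ?thesis unfolding Kset_def C.Kset_def e by (rule refl)
qed

lemma bimod_restr: "J \<subseteq> I \<Longrightarrow> bimod J (restr J) B (proj J ` W - {0})"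
  unfolding bimod_def by (rule conf_restr)

lemma D_lifts:
  assumes two: "i \<in> K" "l \<in> K" "l \<noteq> i" and d: "d \<in> D i"
  obtains u v where "u \<in> W" "v \<in> W" "pr i u = d" "pr i v = d" "crd i v = crd i u + 1"
proof -
  obtain u v where uv: "u \<in> W" "v \<in> W" "u \<noteq> v" "pr i u = d" "pr i v = d" "d \<noteq> 0"
    using d unfolding D_def by blast
  have "\<bar>crd i u - crd i v\<bar> = 1" by (rule fibre_diff[OF two uv(1-3)]) (simp_all add: uv)
  then have "crd i v = crd i u + 1 \<or> crd i u = crd i v + 1" by linarith
  then show ?thesis using that[OF uv(1,2,4,5)] that[OF uv(2,1,5,4)] by blast
qed

lemma pr_B: "i \<in> I \<Longrightarrow> j \<in> I \<Longrightarrow> j \<noteq> i \<Longrightarrow> pr i (B j) = B j"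
  by (rule eqI) (auto simp: B_in_V proj_in_V)

lemma B_in_contract: "i \<in> I \<Longrightarrow> j \<in> I \<Longrightarrow> j \<noteq> i \<Longrightarrow> B j \<in> pr i ` W - {0}"
proof -
  assume a: "i \<in> I" "j \<in> I" "j \<noteq> i"
  have "B j \<noteq> 0" using B_W[OF a(2)] zero_W by metis
  moreover have "B j \<in> pr i ` W" using pr_B[OF a] B_W[OF a(2)] by (metis imageI)
  ultimately show ?thesis by simp
qed

text \<open>A circuit of the doubly covered vectors of a contraction gives a base of few half coordinates.\<close>

lemma circuit_base:
  assumes two: "i \<in> K" "l \<in> K" "l \<noteq> i"
    and S: "S \<subseteq> I - {i}" "\<And>j. j \<in> S \<Longrightarrow> x j \<in> D i" "\<And>j. j \<in> I - {i} - S \<Longrightarrow> x j = B j"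
    and N: "restr (I - {i}) x \<noteq> 0"
    and c: "c \<in> D i" "c = (\<Sum>j\<in>S. \<mu> j *\<^sub>R x j)" "\<And>j. j \<in> S \<Longrightarrow> \<mu> j \<noteq> 0"
    and nt: "\<And>j. S = {j} \<Longrightarrow> \<bar>\<mu> j\<bar> \<noteq> 1"
  shows "\<exists>C. (\<forall>i\<in>I. C i \<in> W) \<and> \<bar>\<omega> C\<bar> = 1 \<and> card (Kset C) \<le> 4"
proof -
  define J where "J = I - {i}"
  have iI: "i \<in> I" using two K_I by auto
  have JI: "J \<subseteq> I" by (auto simp: J_def)
  have fS: "finite S" using S(1) fin_I finite_subset by blast
  interpret R: bimod J "restr J" B "pr i ` W - {0}" unfolding J_def by (rule bimod_restr) auto
  define n where "n = restr J x"
  have n0: "n \<noteq> 0" using N by (simp add: n_def J_def)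
  have xW: "x j \<in> pr i ` W - {0}" if "j \<in> J" for j
  proof (cases "j \<in> S")
    case True
    then show ?thesis using S(2) D_subset by blast
  next
    case False
    then show ?thesis using S(3)[of j] B_in_contract[OF iI, of j] that by (simp add: J_def)
  qed
  have n2: "2 * n \<in> \<int>" using R.W_int[of x] xW by (simp add: n_def)
  have cx: "restr J (x(j := c)) = \<mu> j * n" if j: "j \<in> S" for j
  proof -
    have jJ: "j \<in> J" using j S(1) by (auto simp: J_def)
    have "restr J (x(j := c)) = (\<Sum>p\<in>S. \<mu> p * restr J (x(j := x p)))"
      unfolding c(2) using jJ by (simp add: R.form_sum R.form_scale)
    also have "\<dots> = (\<Sum>p\<in>S. if p = j then \<mu> p * n else 0)"
    proof (rule sum.cong)
      fix p assume p: "p \<in> S"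
      have "restr J (x(j := x p)) = 0" if "p \<noteq> j"
        using that jJ p S(1) by (intro R.form_eq[of j p]) (auto simp: J_def)
      then show "\<mu> p * restr J (x(j := x p)) = (if p = j then \<mu> p * n else 0)" by (simp add: n_def)
    qed simp
    also have "\<dots> = \<mu> j * n" using fS j by simp
    finally show ?thesis .
  qed
  have m2: "2 * (\<mu> j * n) \<in> \<int>" if j: "j \<in> S" for j
  proof -
    have "real 2 * restr J (x(j := c)) \<in> \<int>"
      by (rule R.W_int) (use xW c(1) D_subset in auto)
    then show ?thesis by (simp only: cx[OF j] of_nat_numeral)
  qed
  text \<open>All choices of lifts.\<close>
  define P where "P = (\<lambda>d p. fst p \<in> W \<and> snd p \<in> W \<and> pr i (fst p) = d \<and> pr i (snd p) = d \<and>
    crd i (snd p) = crd i (fst p) + 1)"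
  have "\<forall>d\<in>D i. \<exists>p. P d p"
  proof
    fix d assume "d \<in> D i"
    then obtain u v where "u \<in> W" "v \<in> W" "pr i u = d" "pr i v = d" "crd i v = crd i u + 1"
      by (rule D_lifts[OF two])
    then have "P d (u, v)" by (simp add: P_def)
    then show "\<exists>p. P d p" ..
  qed
  then obtain f where f: "\<forall>d\<in>D i. P d (f d)" using bchoice by metis
  define lo where "lo d = fst (f d)" for d
  define hi where "hi d = snd (f d)" for d
  have lh: "lo d \<in> W \<and> hi d \<in> W \<and> pr i (lo d) = d \<and> pr i (hi d) = d \<and> crd i (hi d) = crd i (lo d) + 1"
    if "d \<in> D i" for d using bspec[OF f that] by (simp add: P_def lo_def hi_def)
  define y where "y = (\<lambda>pos j. if j = i then (if pos = (n > 0) then hi c else lo c)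
     else if j \<in> S then (if pos = (\<mu> j * n < 0) then hi (x j) else lo (x j)) else B j)"
  have iS: "i \<notin> S" using S(1) by auto
  have yW: "y pos j \<in> W" if "j \<in> I" for pos j
    using that lh[OF c(1)] lh[OF S(2)] B_W by (auto simp: y_def)
  have yx: "pr i (y pos j) = x j" if "j \<in> J" for pos j
    using that lh[OF S(2)] S(3)[of j] pr_B[OF iI, of j] by (auto simp: y_def J_def)
  have yc: "pr i (y pos i) = c" for pos using lh[OF c(1)] by (auto simp: y_def)
  define s where "s = (\<lambda>pos. crd i (y pos i) - (\<Sum>j\<in>S. \<mu> j * crd i (y pos j)))"
  have dep: "y pos i - (\<Sum>j\<in>S. \<mu> j *\<^sub>R y pos j) = s pos *\<^sub>R B i" for pos
  proof (rule eqI)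
    show "y pos i - (\<Sum>j\<in>S. \<mu> j *\<^sub>R y pos j) \<in> V" "s pos *\<^sub>R B i \<in> V"
      using yW iI S(1) W_V B_in_V by (auto intro!: span_diff span_sum span_scale)
    fix k assume k: "k \<in> I"
    show "crd k (y pos i - (\<Sum>j\<in>S. \<mu> j *\<^sub>R y pos j)) = crd k (s pos *\<^sub>R B i)"
    proof (cases "k = i")
      case True
      then show ?thesis using iI by (simp add: s_def)
    next
      case False
      then have kJ: "k \<in> J" using k by (simp add: J_def)
      have e: "crd k (y pos j) = crd k (x j)" if "j \<in> J" for j
        using yx[OF that, of pos] crd_proj[OF JI k, of "y pos j"] kJ by (simp add: J_def)
      have "crd k (y pos i) = crd k c"
        using yc[of pos] crd_proj[OF JI k, of "y pos i"] kJ by (simp add: J_def)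
      also have "\<dots> = (\<Sum>j\<in>S. \<mu> j * crd k (x j))" unfolding c(2) using k by simp
      also have "\<dots> = (\<Sum>j\<in>S. \<mu> j * crd k (y pos j))"
      proof (rule sum.cong)
        fix j assume "j \<in> S"
        then have "j \<in> J" using S(1) by (auto simp: J_def)
        then show "\<mu> j * crd k (x j) = \<mu> j * crd k (y pos j)" by (simp only: e)
      qed (rule refl)
      finally show ?thesis using k iI False by simp
    qed
  qed
  have slot: "\<omega> ((y pos)(k := s pos *\<^sub>R B i)) = \<omega> ((y pos)(k := y pos i)) - (\<Sum>j\<in>S. \<mu> j * \<omega> ((y pos)(k := y pos j)))"
    if "k \<in> I" for k pos
    unfolding dep[symmetric] using that by (simp add: form_diff form_sum form_scale)
  have yBi: "\<omega> ((y pos)(i := B i)) = n" for pos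
  proof -
    have "\<omega> ((y pos)(i := B i)) = restr J (y pos)"
      unfolding restr_def by (rule form_cong) (auto simp: override_on_def J_def)
    also have "\<dots> = restr J x"
      using yx[of _ pos] yW[of _ pos] W_V JI by (intro restr_lift[symmetric]) (auto simp: J_def)
    finally show ?thesis by (simp add: n_def)
  qed
  have wy: "\<omega> (y pos) = s pos * n" for pos
  proof -
    have "\<omega> ((y pos)(i := y pos j)) = 0" if "j \<in> S" for j
      using that iS S(1) iI by (intro form_eq[of i j]) auto
    then have "\<omega> ((y pos)(i := s pos *\<^sub>R B i)) = \<omega> (y pos)" using slot[OF iI, of pos] by simp
    moreover have "\<omega> ((y pos)(i := s pos *\<^sub>R B i)) = s pos * n" using iI yBi by (simp add: form_scale)
    ultimately show ?thesis by simp
  qed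
  define t where "t = \<bar>n\<bar> + (\<Sum>j\<in>S. \<bar>\<mu> j * n\<bar>)"
  have "\<omega> (y True) - \<omega> (y False) = t"
  proof -
    have "crd i (y True i) * n - crd i (y False i) * n = \<bar>n\<bar>"
      using lh[OF c(1)] n0 by (cases "n > 0") (auto simp: y_def algebra_simps)
    moreover have "\<mu> j * crd i (y True j) * n - \<mu> j * crd i (y False j) * n = - \<bar>\<mu> j * n\<bar>" if "j \<in> S" for j
    proof -
      have "j \<noteq> i" using that iS by auto
      then show ?thesis using lh[OF S(2)[OF that]] that
        by (cases "\<mu> j * n < 0") (simp_all add: y_def algebra_simps)
    qed
    then have "(\<Sum>j\<in>S. \<mu> j * crd i (y True j) * n - \<mu> j * crd i (y False j) * n) = (\<Sum>j\<in>S. - \<bar>\<mu> j * n\<bar>)"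
      by (intro sum.cong) auto
    ultimately show ?thesis
      by (simp add: wy s_def t_def left_diff_distrib sum_distrib_right sum_subtractf sum_negf)
  qed
  moreover have b: "\<bar>\<omega> (y pos)\<bar> \<le> 1" and h: "2 * \<omega> (y pos) \<in> \<int>" for pos
    using W_bound[of "y pos"] W_int[of "y pos"] yW by auto
  ultimately have t2: "t \<le> 2" using b[of True] b[of False] by linarith
  have a: "1/2 \<le> \<bar>\<mu> j * n\<bar>" if "j \<in> S" for j
    using half_int_pos(1)[OF m2[OF that]] c(3)[OF that] n0 by simp
  have an: "1/2 \<le> \<bar>n\<bar>" using half_int_pos(1)[OF n2 n0] .
  have sumS: "card S * (1/2) \<le> (\<Sum>j\<in>S. \<bar>\<mu> j * n\<bar>)"
    using sum_bounded_below[of S "1/2" "\<lambda>j. \<bar>\<mu> j * n\<bar>"] a by simp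
  have "real (card S) \<le> 3" using sumS an t2 by (simp add: t_def)
  then have cS: "card S \<le> 3" by simp
  have S0: "S \<noteq> {}" using c(1,2) by (auto simp: D_def)
  have ne: "\<bar>n\<bar> \<noteq> \<bar>\<mu> j * n\<bar>" if "S = {j}" for j using nt[OF that] n0 by (simp add: abs_mult)
  have t32: "3/2 \<le> t"
  proof (cases "card S = 1")
    case True
    then obtain j where j: "S = {j}" by (auto simp: card_1_singleton_iff)
    then have "t = \<bar>n\<bar> + \<bar>\<mu> j * n\<bar>" by (simp add: t_def)
    moreover have "\<not> (\<bar>n\<bar> < 1 \<and> \<bar>\<mu> j * n\<bar> < 1)"
      using half_int_pos(2)[OF n2 n0] half_int_pos(2)[OF m2, of j] c(3)[of j] n0 ne[OF j] j by auto
    ultimately show ?thesis using an a[of j] j by (auto simp: not_less)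
  next
    case False
    moreover have "card S \<noteq> 0" using S0 fS by simp
    ultimately have "2 \<le> card S" by linarith
    then have "2 \<le> real (card S)" by linarith
    then show ?thesis using sumS an by (simp add: t_def)
  qed
  have "\<exists>pos. \<bar>\<omega> (y pos)\<bar> = 1"
  proof (rule ccontr)
    assume "\<nexists>pos. \<bar>\<omega> (y pos)\<bar> = 1"
    then have "\<bar>\<omega> (y pos)\<bar> \<le> 1/2" for pos
      using half_int_abs[OF h[of pos] b[of pos]] by blast
    from this[of True] this[of False] show False using \<open>\<omega> (y True) - \<omega> (y False) = t\<close> t32 by linarith
  qed
  then obtain pos where pos: "\<bar>\<omega> (y pos)\<bar> = 1" by blast
  have sn: "\<bar>s pos * n\<bar> = 1" using pos wy by simp
  have s0: "s pos \<noteq> 0" using sn by auto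
  interpret Y: bimod I "\<lambda>z. \<omega> z / \<omega> (y pos)" "y pos" W using yW pos by (rule bimod_rebase)
  have KY: "Y.K = Kset (y pos)" using yW pos by (rule Kset_rebase)
  have yj: "\<bar>\<omega> ((y pos)(j := B i))\<bar> = \<bar>\<mu> j * n\<bar>" if j: "j \<in> S" for j
  proof -
    have jI: "j \<in> I" and ji: "j \<noteq> i" using j S(1) by auto
    have "\<omega> ((y pos)(j := y pos i)) = 0" using jI ji iI by (intro form_eq[of i j]) auto
    moreover have "(\<Sum>p\<in>S. \<mu> p * \<omega> ((y pos)(j := y pos p))) = (\<Sum>p\<in>S. if p = j then \<mu> p * \<omega> (y pos) else 0)"
    proof (rule sum.cong)
      fix p assume p: "p \<in> S"
      have "\<omega> ((y pos)(j := y pos p)) = 0" if "p \<noteq> j"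
        using that jI p S(1) by (intro form_eq[of j p]) auto
      then show "\<mu> p * \<omega> ((y pos)(j := y pos p)) = (if p = j then \<mu> p * \<omega> (y pos) else 0)" by simp
    qed simp
    ultimately have "s pos * \<omega> ((y pos)(j := B i)) = - (\<mu> j * \<omega> (y pos))"
      using slot[OF jI, of pos] jI fS j by (simp add: form_scale)
    then have "s pos * \<omega> ((y pos)(j := B i)) = s pos * - (\<mu> j * n)" using wy[of pos] by simp
    then have "\<omega> ((y pos)(j := B i)) = - (\<mu> j * n)" using s0 by (simp only: mult_cancel_left) simp
    then show ?thesis by simp
  qed
  have yo: "\<omega> ((y pos)(k := B i)) = 0" if k: "k \<in> I" "k \<noteq> i" "k \<notin> S" for k
  proof -
    have "\<omega> ((y pos)(k := y pos i)) = 0" using k iI by (intro form_eq[of i k]) auto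
    moreover have "\<omega> ((y pos)(k := y pos p)) = 0" if "p \<in> S" for p
      using that k S(1) by (intro form_eq[of k p]) auto
    ultimately have "s pos * \<omega> ((y pos)(k := B i)) = 0" using slot[OF k(1), of pos] k(1) by (simp add: form_scale)
    then show ?thesis using s0 by simp
  qed
  have "\<exists>k\<in>I. \<bar>\<omega> ((y pos)(k := B i))\<bar> = 1/2"
  proof (rule ccontr)
    assume no: "\<not> ?thesis"
    have "\<bar>n\<bar> \<noteq> 1/2" using no yBi iI by auto
    then have n1: "1 \<le> \<bar>n\<bar>" using half_int_pos(2)[OF n2 n0] by linarith
    have m1: "1 \<le> \<bar>\<mu> j * n\<bar>" if "j \<in> S" for j
    proof -
      have "j \<in> I" using that S(1) by blast
      then have "\<bar>\<omega> ((y pos)(j := B i))\<bar> \<noteq> 1/2" using no by blast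
      then have "\<bar>\<mu> j * n\<bar> \<noteq> 1/2" by (simp only: yj[OF that] not_False_eq_True)
      then show ?thesis using half_int_pos(2)[OF m2[OF that]] c(3)[OF that] n0 by (meson linorder_not_less mult_eq_0_iff)
    qed
    have "real (card S) \<le> (\<Sum>j\<in>S. \<bar>\<mu> j * n\<bar>)"
      using sum_bounded_below[of S 1 "\<lambda>j. \<bar>\<mu> j * n\<bar>"] m1 by simp
    then have "real (card S) \<le> 1" using n1 t2 by (simp add: t_def)
    moreover have "card S \<noteq> 0" using S0 fS by simp
    ultimately have "card S = 1" by linarith
    then obtain j where j: "S = {j}" by (auto simp: card_1_singleton_iff)
    then have "\<bar>n\<bar> = 1" "\<bar>\<mu> j * n\<bar> = 1" using n1 m1[of j] t2 by (auto simp: t_def)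
    then show False using ne[OF j] by simp
  qed
  then obtain k where k: "k \<in> I" "\<bar>\<omega> ((y pos)(k := B i))\<bar> = 1/2" by blast
  have "\<bar>Y.crd k (B i)\<bar> = 1/2" using k(2) pos by (simp add: Y.crd_def)
  then have kn: "Y.crd k (B i) \<notin> \<int>" by (rule abs_half_not_int)
  have "Y.K \<subseteq> insert i S"
  proof
    fix j assume j: "j \<in> Y.K"
    have jI: "j \<in> I" using j Y.K_I by auto
    have "Y.crd j (B i) \<notin> \<int>" using Y.nonint_K[OF B_W[OF iI] k(1) kn j] .
    then have "\<omega> ((y pos)(j := B i)) \<noteq> 0" by (auto simp: Y.crd_def)
    then show "j \<in> insert i S" using yo[OF jI] by auto
  qed
  then have "card Y.K \<le> card (insert i S)" using fS by (intro card_mono) auto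
  also have "\<dots> \<le> 4" using cS fS by (simp add: card_insert_if)
  finally have "card (Kset (y pos)) \<le> 4" using KY by simp
  then show ?thesis using yW pos by blast
qed

lemma card_D_large:
  assumes min: "\<And>C. (\<And>i. i \<in> I \<Longrightarrow> C i \<in> W) \<Longrightarrow> \<bar>\<omega> C\<bar> = 1 \<Longrightarrow> card K \<le> card (Kset C)"
    and k5: "5 \<le> card K" and i: "i \<in> K"
  shows "card (D i) \<le> 2 * (card I - 1)"
proof -
  have "K \<noteq> {i}" using k5 by auto
  then obtain l where l: "l \<in> K" "l \<noteq> i" using i by auto
  have iI: "i \<in> I" using i K_I by auto
  interpret R: bimod "I - {i}" "restr (I - {i})" B "pr i ` W - {0}" by (rule bimod_restr) auto
  obtain E where E: "E \<subseteq> D i" "independent E" "D i \<subseteq> span E"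
    by (rule maximal_independent_subset)
  have DV: "D i \<subseteq> R.V" using D_subset R.W_V by blast
  have fE: "finite E" using E(1) finite_D finite_subset by blast
  have "D i \<subseteq> E \<union> uminus ` E"
  proof (rule ccontr)
    assume "\<not> ?thesis"
    then obtain c where c: "c \<in> D i" "c \<notin> E" "c \<notin> uminus ` E" by blast
    then have cm: "- c \<notin> E" by (metis add.inverse_inverse imageI)
    have cE: "c \<in> span E" using c(1) E(3) by blast
    define \<rho> where "\<rho> = representation E c"
    define T where "T = {b. \<rho> b \<noteq> 0}"
    have TE: "T \<subseteq> E" unfolding T_def \<rho>_def using representation_ne_zero by blast
    have fT: "finite T" using TE fE finite_subset by blast
    have cT: "c = (\<Sum>b\<in>T. \<rho> b *\<^sub>R b)"
      using sum_nonzero_representation_eq[OF E(2) cE] by (simp add: T_def \<rho>_def)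
    have iT: "independent T" using E(2) TE independent_mono by blast
    have "T \<subseteq> R.V" using TE E(1) DV by blast
    from R.extend_independent[OF fT iT this] obtain x where
      x: "restr (I - {i}) x \<noteq> 0" "\<forall>j\<in>I - {i}. x j \<in> T \<or> x j = B j" "T \<subseteq> x ` (I - {i})" by blast
    interpret X: based_form "I - {i}" "\<lambda>y. restr (I - {i}) y / restr (I - {i}) x" x
      using x(1) by (rule R.rebase)
    define S where "S = {j \<in> I - {i}. x j \<in> T}"
    have bij: "bij_betw x S T"
      unfolding bij_betw_def
    proof
      show "inj_on x S" using X.B_inj by (rule inj_on_subset) (auto simp: S_def)
      show "x ` S = T" using x(3) by (auto simp: S_def)
    qed
    have cS: "c = (\<Sum>j\<in>S. \<rho> (x j) *\<^sub>R x j)"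
      using cT sum.reindex_bij_betw[OF bij, of "\<lambda>b. \<rho> b *\<^sub>R b"] by simp
    have "\<exists>C. (\<forall>i\<in>I. C i \<in> W) \<and> \<bar>\<omega> C\<bar> = 1 \<and> card (Kset C) \<le> 4"
    proof (rule circuit_base[OF i l, of S x c "\<lambda>j. \<rho> (x j)"])
      show "S \<subseteq> I - {i}" by (auto simp: S_def)
      show "x j \<in> D i" if "j \<in> S" for j using that TE E(1) by (auto simp: S_def)
      show "x j = B j" if "j \<in> I - {i} - S" for j using that x(2) by (auto simp: S_def)
      show "\<rho> (x j) \<noteq> 0" if "j \<in> S" for j using that by (auto simp: S_def T_def)
      show "\<bar>\<rho> (x j)\<bar> \<noteq> 1" if "S = {j}" for j
      proof
        assume "\<bar>\<rho> (x j)\<bar> = 1"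
        then have "\<rho> (x j) = 1 \<or> \<rho> (x j) = -1" by linarith
        moreover have "c = \<rho> (x j) *\<^sub>R x j" using cS that by simp
        ultimately have "c = x j \<or> - c = x j" by auto
        moreover have "x j \<in> E" using that TE by (auto simp: S_def)
        ultimately show False using c(2) cm by auto
      qed
    qed (use x(1) c(1) cS in auto)
    then obtain C where C: "\<forall>i\<in>I. C i \<in> W" "\<bar>\<omega> C\<bar> = 1" "card (Kset C) \<le> 4" by blast
    then show False using min[of C] k5 by auto
  qed
  then have "card (D i) \<le> card (E \<union> uminus ` E)" using fE by (intro card_mono) auto
  also have "\<dots> \<le> card E + card (uminus ` E)" by (rule card_Un_le)
  also have "\<dots> \<le> 2 * card E" using card_image_le[OF fE, of uminus] by simp
  also have "card E \<le> card (I - {i})"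
  proof -
    have "card E \<le> card (B ` (I - {i}))"
      using independent_span_bound[of "B ` (I - {i})" E] E(1,2) DV fin_I by blast
    then show ?thesis using R.card_B by simp
  qed
  finally show ?thesis using iI fin_I by simp
qed

end


lemma unit_interval:
  fixes p x y :: real
  assumes "p = 1 \<or> p = -1" "y = x + 1"
  obtains s t where "s = x \<or> s = y" "t = x \<or> t = y" "p * s = p * t + 1"
  using assms(1)
proof
  assume "p = 1"
  then show ?thesis using assms(2) that[of y x] by simp
next
  assume "p = -1"
  then show ?thesis using assms(2) that[of x y] by simp
qed

lemma three_unit_intervals:
  fixes p q r :: real
  assumes p: "p = 1 \<or> p = -1" "q = 1 \<or> q = -1" "r = 1 \<or> r = -1"
    and x: "x2 = x1 + 1" "y2 = y1 + 1" "z2 = z1 + 1"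
    and b: "\<And>x y z. x = x1 \<or> x = x2 \<Longrightarrow> y = y1 \<or> y = y2 \<Longrightarrow> z = z1 \<or> z = z2 \<Longrightarrow>
      \<bar>p * x + q * y + r * z\<bar> \<le> 1"
  shows False
proof -
  obtain s t where s: "s = x1 \<or> s = x2" "t = x1 \<or> t = x2" "p * s = p * t + 1"
    by (rule unit_interval[OF p(1) x(1)])
  obtain s' t' where s': "s' = y1 \<or> s' = y2" "t' = y1 \<or> t' = y2" "q * s' = q * t' + 1"
    by (rule unit_interval[OF p(2) x(2)])
  obtain s'' t'' where s'': "s'' = z1 \<or> s'' = z2" "t'' = z1 \<or> t'' = z2" "r * s'' = r * t'' + 1"
    by (rule unit_interval[OF p(3) x(3)])
  show False using b[OF s(1) s'(1) s''(1)] b[OF s(2) s'(2) s''(2)] s(3) s'(3) s''(3) by linarith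
qed

context based_form begin

lemma form2_off:
  assumes C: "\<omega> C \<noteq> 0" "\<And>i. i \<in> I - A \<Longrightarrow> C i = B i" "\<And>i. i \<in> I \<Longrightarrow> C i \<in> V"
    and i: "i \<in> I - A" "j \<in> I - A" "i \<noteq> j"
    and uv: "u \<in> V" "v \<in> V" "\<And>a. a \<in> A \<Longrightarrow> a \<in> I \<Longrightarrow> crd a u = 0 \<and> crd a v = 0"
  shows "\<omega> (C(i := u, j := v)) = \<omega> C * (crd i u * crd j v - crd j u * crd i v)"
proof -
  interpret X: based_form I "\<lambda>y. \<omega> y / \<omega> C" C using C(1) by (rule rebase)
  have sp: "span (C ` I) = V" by (rule rebase_span[OF C(1,3)])
  have c: "X.crd k w = crd k w" if "k \<in> I - A" "w \<in> V" "\<And>a. a \<in> A \<Longrightarrow> a \<in> I \<Longrightarrow> crd a w = 0" for k w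
    using crd_rebase_off[OF C(1,2) that(2,3,1)] C(1) by (simp add: X.crd_def)
  have "\<omega> (C(i := u, j := v)) / \<omega> C = X.crd i u * X.crd j v - X.crd j u * X.crd i v"
    by (rule X.form2) (use i uv sp in auto)
  also have "\<dots> = crd i u * crd j v - crd j u * crd i v"
    using i uv by (simp add: c)
  finally show ?thesis using C(1) by (simp add: field_simps)
qed

lemma form3_off:
  assumes C: "\<omega> C \<noteq> 0" "\<And>i. i \<in> I - A \<Longrightarrow> C i = B i" "\<And>i. i \<in> I \<Longrightarrow> C i \<in> V"
    and i: "i \<in> I - A" "j \<in> I - A" "l \<in> I - A" "i \<noteq> j" "i \<noteq> l" "j \<noteq> l"
    and uv: "u \<in> V" "v \<in> V" "w \<in> V" "\<And>a. a \<in> A \<Longrightarrow> a \<in> I \<Longrightarrow> crd a u = 0 \<and> crd a v = 0 \<and> crd a w = 0"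
  shows "\<omega> (C(i := u, j := v, l := w)) = \<omega> C *
     (crd i u * (crd j v * crd l w - crd l v * crd j w)
   - crd j u * (crd i v * crd l w - crd l v * crd i w)
   + crd l u * (crd i v * crd j w - crd j v * crd i w))"
proof -
  interpret X: based_form I "\<lambda>y. \<omega> y / \<omega> C" C using C(1) by (rule rebase)
  have sp: "span (C ` I) = V" by (rule rebase_span[OF C(1,3)])
  have c: "X.crd k z = crd k z" if "k \<in> I - A" "z \<in> V" "\<And>a. a \<in> A \<Longrightarrow> a \<in> I \<Longrightarrow> crd a z = 0" for k z
    using crd_rebase_off[OF C(1,2) that(2,3,1)] C(1) by (simp add: X.crd_def)
  have "\<omega> (C(i := u, j := v, l := w)) / \<omega> C = X.crd i u * (X.crd j v * X.crd l w - X.crd l v * X.crd j w)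
   - X.crd j u * (X.crd i v * X.crd l w - X.crd l v * X.crd i w)
   + X.crd l u * (X.crd i v * X.crd j w - X.crd j v * X.crd i w)"
    by (rule X.form3) (use i uv sp in auto)
  also have "\<dots> = crd i u * (crd j v * crd l w - crd l v * crd j w)
   - crd j u * (crd i v * crd l w - crd l v * crd i w)
   + crd l u * (crd i v * crd j w - crd j v * crd i w)"
    using i uv by (simp add: c)
  finally show ?thesis using C(1) by (simp add: field_simps)
qed

end

context bimod begin

lemma finite_Q: "finite Q" using fin_I by simp

lemma minor_Q:
  assumes "u \<in> W" "v \<in> W" "a \<in> Q" "b \<in> Q"
  shows "crd a u * crd b v - crd b u * crd a v \<in> {-1, 0, 1}"
proof (cases "a = b")
  case False
  have "\<bar>crd a u * crd b v - crd b u * crd a v\<bar> \<le> 1"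
    by (rule minor2(1)) (use assms False in auto)
  moreover have "crd a u * crd b v - crd b u * crd a v \<in> \<int>"
    using assms by (intro Ints_diff Ints_mult crd_Q)
  ultimately show ?thesis by (rule unit_cases)
qed simp

lemma indep_rows:
  assumes A: "A \<subseteq> Q" and W: "u \<in> W" "v \<in> W"
    and p: "proj A u \<noteq> 0" "proj A v \<noteq> 0" "proj A u \<noteq> proj A v" "proj A u \<noteq> - proj A v"
  shows "\<exists>a\<in>A. \<exists>b\<in>A. a \<noteq> b \<and> \<bar>crd a u * crd b v - crd b u * crd a v\<bar> = 1"
proof (rule ccontr)
  assume no: "\<not> ?thesis"
  have AI: "A \<subseteq> I" using A by auto
  have z: "crd a u * crd b v = crd b u * crd a v" if "a \<in> A" "b \<in> A" for a b
  proof (cases "a = b")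
    case False
    then have "\<bar>crd a u * crd b v - crd b u * crd a v\<bar> \<noteq> 1" using no that by blast
    moreover have "crd a u * crd b v - crd b u * crd a v \<in> {-1, 0, 1}"
      using minor_Q[OF W] that A by blast
    ultimately show ?thesis by auto
  qed simp
  obtain a where a: "a \<in> A" "crd a u \<noteq> 0" using p(1) proj_eq_0_iff[OF AI] by blast
  obtain a' where a': "a' \<in> A" "crd a' v \<noteq> 0" using p(2) proj_eq_0_iff[OF AI] by blast
  have aQ: "a \<in> Q" using a(1) A by blast
  have "crd a v \<noteq> 0" using z[OF a(1) a'(1)] a(2) a'(2) by auto
  then have "crd a v = crd a u \<or> crd a v = - crd a u"
    using crd_Q_cases[OF W(1) aQ] crd_Q_cases[OF W(2) aQ] a(2) by auto
  then show False
  proof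
    assume e: "crd a v = crd a u"
    have "crd b u = crd b v" if "b \<in> A" for b
    proof -
      have "crd a u * crd b v = crd a u * crd b u" using z[OF a(1) that] e by simp
      then show ?thesis using a(2) by simp
    qed
    then show False using p(3) proj_eq_iff[OF AI] by blast
  next
    assume e: "crd a v = - crd a u"
    have "crd b u = crd b (- v)" if "b \<in> A" for b
    proof -
      have bI: "b \<in> I" using that AI by blast
      have "crd a u * crd b v = crd a u * - crd b u" using z[OF a(1) that] e by simp
      then have "crd b v = - crd b u" using a(2) mult_cancel_left by blast
      then show ?thesis using bI by simp
    qed
    then have "proj A u = proj A (- v)" using proj_eq_iff[OF AI] by blast
    then show False using p(4) proj_minus[OF AI] by simp
  qed
qed

abbreviation \<gamma> :: "'v \<Rightarrow> 'v" where "\<gamma> \<equiv> proj Q"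

lemma gamma_eq_iff: "\<gamma> u = \<gamma> v \<longleftrightarrow> (\<forall>q\<in>Q. crd q u = crd q v)" by (rule proj_eq_iff) auto
lemma gamma_eq_0_iff: "\<gamma> u = 0 \<longleftrightarrow> (\<forall>q\<in>Q. crd q u = 0)" by (rule proj_eq_0_iff) auto

lemma crd_pr: "i \<in> I \<Longrightarrow> j \<in> I \<Longrightarrow> j \<noteq> i \<Longrightarrow> crd j (pr i u) = crd j u" by simp

lemma gamma_pr: "i \<in> K \<Longrightarrow> \<gamma> (pr i u) = \<gamma> u"
proof -
  assume i: "i \<in> K"
  then have iI: "i \<in> I" using K_I by auto
  have "crd q (pr i u) = crd q u" if "q \<in> Q" for q
  proof -
    have "q \<in> I" "q \<noteq> i" using that i by auto
    then show ?thesis using iI by simp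
  qed
  then show ?thesis unfolding gamma_eq_iff by blast
qed

lemma gamma_minus: "\<gamma> (- u) = - \<gamma> u" by (rule proj_minus) auto

lemma card_lifted_parts:
  assumes A: "A \<subseteq> Q" and iI: "i \<in> I" and iA: "i \<notin> A" and fG: "finite G"
    and lift: "\<And>g. g \<in> G \<Longrightarrow> g \<noteq> 0 \<and> (\<exists>u v. u \<in> W \<and> v \<in> W \<and> proj A u = g \<and> proj A v = g \<and> crd i v = crd i u + 1)"
  shows "card G \<le> 2 * card A"
proof -
  define sp where "sp = (\<lambda>g. {q \<in> A. crd q g \<noteq> 0})"
  have AI: "A \<subseteq> I" using A by blast
  have fA: "finite A" using AI fin_I finite_subset by blast
  have AQ: "q \<in> Q" if "q \<in> A" for q using that A by blast
  have crdg: "crd q (proj A u) = crd q u" if q: "q \<in> A" for q u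
    using q AI by (subst crd_proj) auto
  have pA: "proj A u = proj A v \<longleftrightarrow> (\<forall>q\<in>A. crd q u = crd q v)" for u v by (rule proj_eq_iff[OF AI])
  have pA0: "proj A u = 0 \<longleftrightarrow> (\<forall>q\<in>A. crd q u = 0)" for u by (rule proj_eq_0_iff[OF AI])
  have spW: "sp (proj A u) = {q \<in> A. crd q u \<noteq> 0}" for u
    unfolding sp_def using crdg by (intro Collect_cong) auto
  have det: "g' = g \<or> g' = - g" if g: "g \<in> G" "g' \<in> G" "sp g = sp g'" for g g'
  proof (rule ccontr)
    assume no: "\<not> ?thesis"
    obtain u where u: "u \<in> W" "proj A u = g" using lift[OF g(1)] by blast
    obtain v where v: "v \<in> W" "proj A v = g'" using lift[OF g(2)] by blast
    have "\<exists>a\<in>A. \<exists>b\<in>A. a \<noteq> b \<and> \<bar>crd a u * crd b v - crd b u * crd a v\<bar> = 1"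
    proof (rule indep_rows[OF A u(1) v(1)])
      show "proj A u \<noteq> 0" "proj A v \<noteq> 0" using lift[OF g(1)] lift[OF g(2)] u v by auto
      show "proj A u \<noteq> proj A v" using no u v by auto
      show "proj A u \<noteq> - proj A v" using no u v by auto
    qed
    then obtain a b where ab0: "a \<in> A" "b \<in> A" and ab: "a \<in> Q" "b \<in> Q" "\<bar>crd a u * crd b v - crd b u * crd a v\<bar> = 1" using AQ by blast
    have same: "crd q u = 0 \<longleftrightarrow> crd q v = 0" if "q \<in> A" for q
    proof -
      have "q \<in> sp g \<longleftrightarrow> q \<in> sp g'" by (simp only: g(3))
      then show ?thesis using spW[of u] spW[of v] u(2) v(2) that by simp
    qed
    show False
      using ab(3) same[OF ab0(1)] same[OF ab0(2)] crd_Q_cases[OF u(1) ab(1)] crd_Q_cases[OF u(1) ab(2)]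
        crd_Q_cases[OF v(1) ab(1)] crd_Q_cases[OF v(1) ab(2)]
      by (elim disjE) simp_all
  qed
  have "card G \<le> 2 * card (sp ` G)"
  proof (rule card_le_fibres[OF fG])
    fix y assume "y \<in> sp ` G"
    then obtain g where g: "g \<in> G" "y = sp g" by blast
    have "{x \<in> G. sp x = y} \<subseteq> {g, - g}"
    proof
      fix x assume "x \<in> {x \<in> G. sp x = y}"
      then have "x \<in> G" "sp g = sp x" using g(2) by simp_all
      from det[OF g(1) this] show "x \<in> {g, - g}" by simp
    qed
    then have "card {x \<in> G. sp x = y} \<le> card {g, - g}" by (intro card_mono) auto
    also have "\<dots> \<le> 2" by (simp add: card_insert_if)
    finally show "card {x \<in> G. sp x = y} \<le> 2" .
  qed
  moreover have "card (insert {} (sp ` G)) = 1 + card (sp ` G)"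
  proof -
    have "sp g \<noteq> {}" if gG: "g \<in> G" for g
    proof -
      obtain u where u: "proj A u = g" using lift[OF gG] by blast
      then have "proj A u \<noteq> 0" using lift[OF gG] by simp
      then obtain q where "q \<in> A" "crd q u \<noteq> 0" using pA0 by blast
      then have "q \<in> sp g" using spW[of u] u by simp
      then show ?thesis by blast
    qed
    then have "{} \<notin> sp ` G" by (metis imageE)
    then show ?thesis using fG by simp
  qed
  moreover have "card (insert {} (sp ` G)) \<le> 1 + card A"
  proof (rule card_le_if_no_shattered_pair[OF fA])
    show "insert {} (sp ` G) \<subseteq> Pow A" by (auto simp: sp_def)
    fix a b S T U
    assume ab0: "a \<in> A" "b \<in> A" "a \<noteq> b"
      and F: "S \<in> insert {} (sp ` G)" "T \<in> insert {} (sp ` G)" "U \<in> insert {} (sp ` G)"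
      and e: "a \<in> S" "b \<notin> S" "a \<notin> T" "b \<in> T" "a \<in> U" "b \<in> U"
    have ab: "a \<in> Q" "b \<in> Q" "a \<noteq> b" using ab0 AQ by auto
    have "S \<noteq> {}" "T \<noteq> {}" "U \<noteq> {}" using e by auto
    then obtain g h k where g: "g \<in> G" "S = sp g" and h: "h \<in> G" "T = sp h" and k: "k \<in> G" "U = sp k"
      using F by blast
    obtain u1 u2 where u: "u1 \<in> W" "u2 \<in> W" "proj A u1 = g" "proj A u2 = g" "crd i u2 = crd i u1 + 1"
      using lift[OF g(1)] by blast
    obtain v1 v2 where v: "v1 \<in> W" "v2 \<in> W" "proj A v1 = h" "proj A v2 = h" "crd i v2 = crd i v1 + 1"
      using lift[OF h(1)] by blast
    obtain w1 w2 where w: "w1 \<in> W" "w2 \<in> W" "proj A w1 = k" "proj A w2 = k" "crd i w2 = crd i w1 + 1"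
      using lift[OF k(1)] by blast
    have S: "S = {q \<in> A. crd q u1 \<noteq> 0}" "T = {q \<in> A. crd q v1 \<noteq> 0}" "U = {q \<in> A. crd q w1 \<noteq> 0}"
      using spW[of u1] spW[of v1] spW[of w1] u(3) v(3) w(3) g(2) h(2) k(2) by simp_all
    have c: "crd a u1 \<noteq> 0" "crd b u1 = 0" "crd a v1 = 0" "crd b v1 \<noteq> 0" "crd a w1 \<noteq> 0" "crd b w1 \<noteq> 0"
      using e ab0(1,2) unfolding S by simp_all
    have e2: "crd q u2 = crd q u1" "crd q v2 = crd q v1" "crd q w2 = crd q w1" if "q \<in> A" for q
      using that pA[of u2 u1] pA[of v2 v1] pA[of w2 w1] u(3,4) v(3,4) w(3,4) by simp_all
    have ne: "i \<noteq> a" "i \<noteq> b" "a \<in> I" "b \<in> I" using ab0 iA AI by auto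
    have m: "\<bar>- (crd b v1 * crd a w1) * crd i x + - (crd a u1 * crd b w1) * crd i y + crd a u1 * crd b v1 * crd i z\<bar> \<le> 1"
      if x: "x = u1 \<or> x = u2" and y: "y = v1 \<or> y = v2" and z: "z = w1 \<or> z = w2" for x y z
    proof -
      have W: "x \<in> W" "y \<in> W" "z \<in> W" using x y z u(1,2) v(1,2) w(1,2) by metis+
      have qx: "crd a x = crd a u1" "crd b x = 0" using x e2(1)[OF ab0(1)] e2(1)[OF ab0(2)] c(2) by metis+
      have qy: "crd a y = 0" "crd b y = crd b v1" using y e2(2)[OF ab0(1)] e2(2)[OF ab0(2)] c(3) by metis+
      have qz: "crd a z = crd a w1" "crd b z = crd b w1" using z e2(3)[OF ab0(1)] e2(3)[OF ab0(2)] by metis+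
      have "\<bar>crd i x * (crd a y * crd b z - crd b y * crd a z)
        - crd a x * (crd i y * crd b z - crd b y * crd i z)
        + crd b x * (crd i y * crd a z - crd a y * crd i z)\<bar> \<le> 1"
        using iI ne ab(3) W by (intro minor3)
      then show ?thesis unfolding qx qy qz by (simp add: algebra_simps)
    qed
    have ua: "crd a u1 = 1 \<or> crd a u1 = -1" using crd_Q_cases[OF u(1) ab(1)] c(1) by blast
    have vb: "crd b v1 = 1 \<or> crd b v1 = -1" using crd_Q_cases[OF v(1) ab(2)] c(4) by blast
    have wa: "crd a w1 = 1 \<or> crd a w1 = -1" using crd_Q_cases[OF w(1) ab(1)] c(5) by blast
    have wb: "crd b w1 = 1 \<or> crd b w1 = -1" using crd_Q_cases[OF w(1) ab(2)] c(6) by blast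
    show False
    proof (rule three_unit_intervals)
      show "- (crd b v1 * crd a w1) = 1 \<or> - (crd b v1 * crd a w1) = -1" using vb wa by auto
      show "- (crd a u1 * crd b w1) = 1 \<or> - (crd a u1 * crd b w1) = -1" using ua wb by auto
      show "crd a u1 * crd b v1 = 1 \<or> crd a u1 * crd b v1 = -1" using ua vb by auto
      show "crd i u2 = crd i u1 + 1" "crd i v2 = crd i v1 + 1" "crd i w2 = crd i w1 + 1"
        using u(5) v(5) w(5) .
      fix x y z
      assume x: "x = crd i u1 \<or> x = crd i u2" "y = crd i v1 \<or> y = crd i v2" "z = crd i w1 \<or> z = crd i w2"
      obtain x' where x': "x' = u1 \<or> x' = u2" "x = crd i x'" using x(1) by blast
      obtain y' where y': "y' = v1 \<or> y' = v2" "y = crd i y'" using x(2) by blast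
      obtain z' where z': "z' = w1 \<or> z' = w2" "z = crd i z'" using x(3) by blast
      show "\<bar>- (crd b v1 * crd a w1) * x + - (crd a u1 * crd b w1) * y + crd a u1 * crd b v1 * z\<bar> \<le> 1"
        unfolding x'(2) y'(2) z'(2) using x'(1) y'(1) z'(1) by (rule m)
    qed
  qed
  ultimately show ?thesis by linarith
qed

lemma card_gamma_D:
  assumes two: "i \<in> K" "l \<in> K" "l \<noteq> i"
  shows "card (\<gamma> ` D i - {0}) \<le> 2 * card Q"
proof (rule card_lifted_parts)
  show "i \<in> I" "i \<notin> Q" using two K_I by auto
  show "finite (\<gamma> ` D i - {0})" using finite_D by simp
  fix g assume g: "g \<in> \<gamma> ` D i - {0}"
  then obtain d where d: "d \<in> D i" "g = \<gamma> d" by blast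
  obtain u v where uv: "u \<in> W" "v \<in> W" "pr i u = d" "pr i v = d" "crd i v = crd i u + 1"
    by (rule D_lifts[OF two d(1)])
  have "\<gamma> u = g" "\<gamma> v = g" using gamma_pr[OF two(1), of u] gamma_pr[OF two(1), of v] uv d(2) by auto
  then show "g \<noteq> 0 \<and> (\<exists>u v. u \<in> W \<and> v \<in> W \<and> \<gamma> u = g \<and> \<gamma> v = g \<and> crd i v = crd i u + 1)"
    using uv g by blast
qed simp

end


lemma unit_comb_int:
  fixes s t x y :: real
  assumes "s = 1 \<or> s = -1" "t = 1 \<or> t = -1" "x - y \<in> \<int>" "x + y \<in> \<int>"
  shows "s * x - t * y \<in> \<int>"
proof -
  have "- (x - y) \<in> \<int>" "- (x + y) \<in> \<int>" using assms(3,4) by (simp_all only: minus_in_Ints_iff)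
  then have "y - x \<in> \<int>" "- x - y \<in> \<int>" by simp_all
  then show ?thesis using assms by (elim disjE) simp_all
qed

context bimod begin

definition square :: "nat \<Rightarrow> nat \<Rightarrow> 'v \<Rightarrow> bool" where
  "square i j u \<longleftrightarrow> u \<in> W \<and> u + B i \<in> W \<and> u + B j \<in> W \<and> u + B i + B j \<in> W"

lemma square_commute: "square i j u \<longleftrightarrow> square j i u"
  by (auto simp: square_def add.commute add.left_commute)

lemma K_Q: "i \<in> K \<Longrightarrow> q \<in> Q \<Longrightarrow> q \<noteq> i" by blast

lemma crd_Q_B [simp]: "i \<in> K \<Longrightarrow> q \<in> Q \<Longrightarrow> crd q (B i) = 0"
  using K_I K_Q by auto

lemma gamma_add_B: "i \<in> K \<Longrightarrow> \<gamma> (u + B i) = \<gamma> u"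
  unfolding gamma_eq_iff by simp

text \<open>Two squares over different outer parts.\<close>

lemma diff_minor:
  assumes A: "A \<subseteq> Q" and ij: "i \<in> I - A" "j \<in> I - A" "i \<noteq> j"
    and W: "x1 \<in> W" "x2 \<in> W" "y1 \<in> W" "y2 \<in> W"
    and p: "x2 = x1 + p" "p \<in> V" and r: "y2 = y1 + r" "r \<in> V"
    and z: "\<And>a. a \<in> A \<Longrightarrow> crd a p = 0 \<and> crd a r = 0"
    and g: "proj A x1 \<noteq> 0" "proj A y1 \<noteq> 0" "proj A x1 \<noteq> proj A y1" "proj A x1 \<noteq> - proj A y1"
  shows "\<bar>crd i p * crd j r - crd j p * crd i r\<bar> \<le> 1"
proof -
  obtain a b where ab: "a \<in> A" "b \<in> A" "a \<noteq> b" "\<bar>crd a x1 * crd b y1 - crd b x1 * crd a y1\<bar> = 1"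
    using indep_rows[OF A W(1,3) g] by blast
  define C where "C = B(a := x1, b := y1)"
  have I: "i \<in> I" "j \<in> I" "a \<in> I" "b \<in> I" "i \<noteq> a" "i \<noteq> b" "j \<noteq> a" "j \<noteq> b"
    using ij ab A by auto
  have wC: "\<omega> C = crd a x1 * crd b y1 - crd b x1 * crd a y1"
    unfolding C_def using I(3,4) ab(3) W_V[OF W(1)] W_V[OF W(3)] by (rule form2)
  have C0: "\<omega> C \<noteq> 0" using wC ab(4) by auto
  have "\<omega> (C(i := x2, j := y2)) = \<omega> (C(i := p, j := r))"
  proof (rule form_mod_slots[of "{a, b}"])
    fix k assume k: "k \<in> I - {a, b}"
    have "x1 \<in> (C(i := p, j := r)) ` {a, b}" "y1 \<in> (C(i := p, j := r)) ` {a, b}"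
      using I ab(3) by (auto simp: C_def)
    then show "(C(i := x2, j := y2)) k - (C(i := p, j := r)) k \<in> span ((C(i := p, j := r)) ` {a, b})"
      using ij(3) by (auto intro: span_base span_zero simp: p(1) r(1))
  qed (use I in auto)
  also have "\<dots> = \<omega> C * (crd i p * crd j r - crd j p * crd i r)"
  proof (rule form2_off[of C "{a, b}"])
    show "\<omega> C \<noteq> 0" by (rule C0)
    show "C k = B k" if "k \<in> I - {a, b}" for k using that by (auto simp: C_def)
    show "C k \<in> V" if "k \<in> I" for k using that W_V[OF W(1)] W_V[OF W(3)] B_in_V[OF that] by (auto simp: C_def)
    show "p \<in> V" "r \<in> V" by fact+
    show "crd c p = 0 \<and> crd c r = 0" if "c \<in> {a, b}" for c
      using that z ab(1,2) by auto
  qed (use I ij in auto)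
  finally have "\<bar>\<omega> (C(i := x2, j := y2))\<bar> = \<bar>crd i p * crd j r - crd j p * crd i r\<bar>"
    using wC ab(4) by (simp add: abs_mult)
  moreover have "\<bar>\<omega> (C(i := x2, j := y2))\<bar> \<le> 1"
    by (rule W_bound) (use W B_W in \<open>auto simp: C_def\<close>)
  ultimately show ?thesis by simp
qed

lemma squares_same_pair:
  assumes ij: "i \<in> K" "j \<in> K" "i \<noteq> j" and sq: "square i j u" "square i j v"
    and g: "\<gamma> u \<noteq> 0" "\<gamma> v \<noteq> 0"
  shows "\<gamma> v = \<gamma> u \<or> \<gamma> v = - \<gamma> u"
proof (rule ccontr)
  assume no: "\<not> ?thesis"
  have W: "u \<in> W" "u + B i + B j \<in> W" "v + B j \<in> W" "v + B i \<in> W"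
    using sq unfolding square_def by blast+
  have I: "i \<in> I" "j \<in> I" using ij K_I by auto
  have gv: "\<gamma> (v + B j) = \<gamma> v" by (rule gamma_add_B[OF ij(2)])
  have "\<bar>crd i (B i + B j) * crd j (B i - B j) - crd j (B i + B j) * crd i (B i - B j)\<bar> \<le> 1"
  proof (rule diff_minor[OF _ _ _ ij(3) W(1,2,3,4)])
    show "B i + B j \<in> V" "B i - B j \<in> V" using I B_in_V by (auto intro: span_add span_diff)
    show "\<gamma> u \<noteq> 0" "\<gamma> (v + B j) \<noteq> 0" "\<gamma> u \<noteq> \<gamma> (v + B j)" "\<gamma> u \<noteq> - \<gamma> (v + B j)"
      unfolding gv using g no by auto
    show "crd a (B i + B j) = 0 \<and> crd a (B i - B j) = 0" if "a \<in> Q" for a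
      using that ij by simp
  qed (use I ij in \<open>auto simp: algebra_simps\<close>)
  then show False using I ij(3) by simp
qed

lemma half_signs:
  fixes x y z :: real
  assumes "x = 1/2 \<or> x = -1/2" "y = 1/2 \<or> y = -1/2" "z = 1/2 \<or> z = -1/2"
  shows "\<exists>s\<in>{1,-1}. \<exists>t\<in>{1,-1}. \<bar>1 * (0 * z - t * y) - s * (1 * z - t * x) + 0 * (1 * y - 0 * x)\<bar> = 3/2"
  using assms by (elim disjE; hypsubst) simp_all

lemma squares_adjacent:
  assumes ij: "i \<in> K" "j \<in> K" "l \<in> K" "i \<noteq> j" "i \<noteq> l" "j \<noteq> l" and sq: "square i j u" "square i l v"
    and g: "\<gamma> u \<noteq> 0" "\<gamma> v \<noteq> 0" and k: "\<kappa> \<in> W" "\<gamma> \<kappa> = 0" "crd i \<kappa> \<notin> \<int>"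
  shows "\<gamma> v = \<gamma> u \<or> \<gamma> v = - \<gamma> u"
proof (rule ccontr)
  assume no: "\<not> ?thesis"
  have IK: "i \<in> I" "j \<in> I" "l \<in> I" using ij K_I by auto
  have "crd j \<kappa> \<notin> \<int>" "crd l \<kappa> \<notin> \<int>" using nonint_K[OF k(1) IK(1) k(3)] ij by auto
  then have half: "crd i \<kappa> = 1/2 \<or> crd i \<kappa> = -1/2" "crd j \<kappa> = 1/2 \<or> crd j \<kappa> = -1/2"
    "crd l \<kappa> = 1/2 \<or> crd l \<kappa> = -1/2" using crd_nonint[OF k(1)] IK k(3) by blast+
  obtain s t :: real where st: "s \<in> {1, -1}" "t \<in> {1, -1}"
    "\<bar>1 * (0 * crd l \<kappa> - t * crd j \<kappa>) - s * (1 * crd l \<kappa> - t * crd i \<kappa>) + 0 * (1 * crd j \<kappa> - 0 * crd i \<kappa>)\<bar> = 3/2"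
    using half_signs[OF half] by blast
  have diag: "\<exists>x y. x \<in> W \<and> y \<in> W \<and> y = x + (B i + r *\<^sub>R B p) \<and> \<gamma> x = \<gamma> w"
    if "square i p w" "p \<in> K" "r \<in> {1, -1}" for p w and r :: real
  proof (cases "r = 1")
    case True
    then have "w \<in> W \<and> w + B i + B p \<in> W \<and> w + B i + B p = w + (B i + r *\<^sub>R B p) \<and> \<gamma> w = \<gamma> w"
      using that(1) unfolding square_def by simp
    then show ?thesis by blast
  next
    case False
    then have "w + B p \<in> W \<and> w + B i \<in> W \<and> w + B i = (w + B p) + (B i + r *\<^sub>R B p) \<and> \<gamma> (w + B p) = \<gamma> w"
      using that(1,3) gamma_add_B[OF that(2)] unfolding square_def by simp
    then show ?thesis by blast
  qed
  obtain u1 u2 where u: "u1 \<in> W" "u2 \<in> W" "u2 = u1 + (B i + s *\<^sub>R B j)" "\<gamma> u1 = \<gamma> u"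
    using diag[OF sq(1) ij(2) st(1)] by blast
  obtain v1 v2 where v: "v1 \<in> W" "v2 \<in> W" "v2 = v1 + (B i + t *\<^sub>R B l)" "\<gamma> v1 = \<gamma> v"
    using diag[OF sq(2) ij(3) st(2)] by blast
  have "\<exists>a\<in>Q. \<exists>b\<in>Q. a \<noteq> b \<and> \<bar>crd a u1 * crd b v1 - crd b u1 * crd a v1\<bar> = 1"
  proof (rule indep_rows[OF _ u(1) v(1)])
    show "\<gamma> u1 \<noteq> 0" "\<gamma> v1 \<noteq> 0" "\<gamma> u1 \<noteq> \<gamma> v1" "\<gamma> u1 \<noteq> - \<gamma> v1"
      unfolding u(4) v(4) using g no by auto
  qed simp
  then obtain a b where ab: "a \<in> Q" "b \<in> Q" "a \<noteq> b" "\<bar>crd a u1 * crd b v1 - crd b u1 * crd a v1\<bar> = 1" by blast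
  define C where "C = B(a := u1, b := v1)"
  have I: "a \<in> I" "b \<in> I" "i \<noteq> a" "i \<noteq> b" "j \<noteq> a" "j \<noteq> b" "l \<noteq> a" "l \<noteq> b"
    using ij ab by auto
  have wC: "\<omega> C = crd a u1 * crd b v1 - crd b u1 * crd a v1"
    unfolding C_def using I(1,2) ab(3) W_V[OF u(1)] W_V[OF v(1)] by (rule form2)
  have C0: "\<omega> C \<noteq> 0" using wC ab(4) by auto
  let ?p = "B i + s *\<^sub>R B j" and ?r = "B i + t *\<^sub>R B l"
  have "\<omega> (C(i := u2, j := v2, l := \<kappa>)) = \<omega> (C(i := ?p, j := ?r, l := \<kappa>))"
  proof (rule form_mod_slots[of "{a, b}"])
    fix k assume "k \<in> I - {a, b}"
    have "u1 \<in> (C(i := ?p, j := ?r, l := \<kappa>)) ` {a, b}" "v1 \<in> (C(i := ?p, j := ?r, l := \<kappa>)) ` {a, b}"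
      using I ab(3) by (auto simp: C_def)
    then show "(C(i := u2, j := v2, l := \<kappa>)) k - (C(i := ?p, j := ?r, l := \<kappa>)) k
       \<in> span ((C(i := ?p, j := ?r, l := \<kappa>)) ` {a, b})"
      using ij(4-6) by (auto intro: span_base span_zero simp: u(3) v(3))
  qed (use I in auto)
  also have "\<dots> = \<omega> C *
     (crd i ?p * (crd j ?r * crd l \<kappa> - crd l ?r * crd j \<kappa>)
   - crd j ?p * (crd i ?r * crd l \<kappa> - crd l ?r * crd i \<kappa>)
   + crd l ?p * (crd i ?r * crd j \<kappa> - crd j ?r * crd i \<kappa>))"
  proof (rule form3_off[of C "{a, b}"])
    show "\<omega> C \<noteq> 0" by (rule C0)
    show "C k = B k" if "k \<in> I - {a, b}" for k using that by (auto simp: C_def)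
    show "C k \<in> V" if "k \<in> I" for k using W_V[OF u(1)] W_V[OF v(1)] B_in_V[OF that] by (auto simp: C_def)
    show "?p \<in> V" "?r \<in> V" using IK B_in_V by (auto intro: span_add span_scale)
    show "\<kappa> \<in> V" by (rule W_V[OF k(1)])
    have "crd a \<kappa> = 0" "crd b \<kappa> = 0" using k(2) ab(1,2) unfolding gamma_eq_0_iff by blast+
    then show "crd c ?p = 0 \<and> crd c ?r = 0 \<and> crd c \<kappa> = 0" if "c \<in> {a, b}" for c
      using that I IK by auto
  qed (use I IK ij in auto)
  also have "\<dots> = \<omega> C * (1 * (0 * crd l \<kappa> - t * crd j \<kappa>) - s * (1 * crd l \<kappa> - t * crd i \<kappa>) + 0 * (1 * crd j \<kappa> - 0 * crd i \<kappa>))"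
    using IK ij(4-6) by simp
  finally have "\<bar>\<omega> (C(i := u2, j := v2, l := \<kappa>))\<bar> = 3/2" using st(3) wC ab(4) by (simp only: abs_mult)
  moreover have "\<bar>\<omega> (C(i := u2, j := v2, l := \<kappa>))\<bar> \<le> 1"
    by (rule W_bound) (use u v k B_W in \<open>auto simp: C_def\<close>)
  ultimately show False by simp
qed

lemma no_tetrahedron:
  assumes ij: "i \<in> K" "j \<in> K" "l \<in> K" "i \<noteq> j" "i \<noteq> l" "j \<noteq> l"
    and W: "u \<in> W" "u + r *\<^sub>R B i + B j \<in> W" "u + B j + s *\<^sub>R B l \<in> W" "u + r *\<^sub>R B i + s *\<^sub>R B l \<in> W"
    and rs: "\<bar>r\<bar> = 1" "\<bar>s\<bar> = 1"
  shows "\<gamma> u = 0"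
proof (rule ccontr)
  assume "\<gamma> u \<noteq> 0"
  then obtain a where a: "a \<in> Q" "crd a u \<noteq> 0" using gamma_eq_0_iff by blast
  have IK: "i \<in> I" "j \<in> I" "l \<in> I" using ij K_I by auto
  have I: "a \<in> I" "i \<noteq> a" "j \<noteq> a" "l \<noteq> a" using ij a by auto
  define C where "C = B(a := u)"
  have wC: "\<omega> C = crd a u" by (simp add: C_def crd_def)
  have C1: "\<bar>\<omega> C\<bar> = 1" using wC crd_Q_cases[OF W(1) a(1)] a(2) by auto
  then have C0: "\<omega> C \<noteq> 0" by auto
  let ?x = "u + r *\<^sub>R B i + B j" and ?y = "u + B j + s *\<^sub>R B l" and ?z = "u + r *\<^sub>R B i + s *\<^sub>R B l"
  let ?p = "r *\<^sub>R B i + B j" and ?q = "B j + s *\<^sub>R B l" and ?w = "r *\<^sub>R B i + s *\<^sub>R B l"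
  have "\<omega> (C(i := ?x, j := ?y, l := ?z)) = \<omega> (C(i := ?p, j := ?q, l := ?w))"
  proof (rule form_mod_slots[of "{a}"])
    fix k assume "k \<in> I - {a}"
    have "u \<in> (C(i := ?p, j := ?q, l := ?w)) ` {a}"
      using I by (auto simp: C_def)
    then show "(C(i := ?x, j := ?y, l := ?z)) k - (C(i := ?p, j := ?q, l := ?w)) k
       \<in> span ((C(i := ?p, j := ?q, l := ?w)) ` {a})"
      using ij(4-6) by (auto intro: span_base span_zero)
  qed (use I in auto)
  also have "\<dots> = \<omega> C *
     (crd i ?p * (crd j ?q * crd l ?w - crd l ?q * crd j ?w)
   - crd j ?p * (crd i ?q * crd l ?w - crd l ?q * crd i ?w)
   + crd l ?p * (crd i ?q * crd j ?w - crd j ?q * crd i ?w))"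
  proof (rule form3_off[of C "{a}"])
    show "\<omega> C \<noteq> 0" by (rule C0)
    show "C k = B k" if "k \<in> I - {a}" for k using that by (auto simp: C_def)
    show "C k \<in> V" if "k \<in> I" for k using W_V[OF W(1)] B_in_V[OF that] by (auto simp: C_def)
    show "?p \<in> V" "?q \<in> V" "?w \<in> V" using IK B_in_V by (auto intro: span_add span_scale)
    show "crd c ?p = 0 \<and> crd c ?q = 0 \<and> crd c ?w = 0" if "c \<in> {a}" for c
      using that I IK by auto
  qed (use I IK ij in auto)
  also have "\<dots> = \<omega> C * (2 * (r * s))"
    using IK ij(4-6) by simp
  finally have "\<bar>\<omega> (C(i := ?x, j := ?y, l := ?z))\<bar> = 2" using C1 rs by (simp add: abs_mult)
  moreover have "\<bar>\<omega> (C(i := ?x, j := ?y, l := ?z))\<bar> \<le> 1"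
    by (rule W_bound) (use W B_W in \<open>auto simp: C_def\<close>)
  ultimately show False by simp
qed

lemma lifts_aligned:
  assumes i: "i \<in> I" and o: "q \<in> Q" "q \<noteq> i" "crd q u \<noteq> 0" "crd q u2 = crd q u" "crd q v = crd q u" "crd q v2 = crd q u"
    and W: "u \<in> W" "u2 \<in> W" "v \<in> W" "v2 \<in> W" and d: "crd i u2 = crd i u + 1" "crd i v2 = crd i v + 1"
  shows "crd i u = crd i v"
proof -
  have g: "\<bar>crd q u\<bar> = 1" using crd_Q_cases[OF W(1) o(1)] o(3) by auto
  have m: "\<bar>crd i x - crd i y\<bar> \<le> 1" if "x \<in> W" "y \<in> W" "crd q x = crd q u" "crd q y = crd q u" for x y
  proof -
    have "\<bar>crd i x * crd q y - crd q x * crd i y\<bar> \<le> 1"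
      using that(1,2) i o by (intro minor2(1)) auto
    then have "\<bar>(crd i x - crd i y) * crd q u\<bar> \<le> 1" unfolding that(3,4) by (simp add: algebra_simps)
    then show ?thesis using g by (simp add: abs_mult)
  qed
  show ?thesis using m[OF W(2,3) o(4,5)] m[OF W(4,1) o(6)] d by linarith
qed

end

locale minbimod = bimod I \<omega> B W
  for I :: "nat set" and \<omega> :: "(nat \<Rightarrow> 'v::real_vector) \<Rightarrow> real" and B :: "nat \<Rightarrow> 'v" and W :: "'v set" +
  assumes min: "\<And>C. (\<And>i. i \<in> I \<Longrightarrow> C i \<in> W) \<Longrightarrow> \<bar>\<omega> C\<bar> = 1 \<Longrightarrow> card K \<le> card (Kset C)"
begin

text \<open>Integral vectors supported on K.\<close>

lemma integral_on_K:
  assumes v: "v \<in> W" "\<gamma> v = 0" and ab: "a \<in> K" "b \<in> K" "a \<noteq> b" "crd a v \<noteq> 0" "crd b v \<noteq> 0"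
  shows "crd a v \<notin> \<int>"
proof
  assume int: "crd a v \<in> \<int>"
  have I: "a \<in> I" "b \<in> I" using ab K_I by auto
  have vint: "crd k v \<in> \<int>" if "k \<in> I" for k
    using nonint_K[OF v(1) that _ ab(1)] int by blast
  have va: "crd a v = 1 \<or> crd a v = -1" using crd_integral[OF v(1) I(1) int] ab(4) by blast
  have vb: "crd b v = 1 \<or> crd b v = -1" using crd_integral[OF v(1) I(2) vint[OF I(2)]] ab(5) by blast
  define C where "C = B(a := v)"
  have wC: "\<omega> C = crd a v" by (simp add: C_def crd_def)
  have "card K \<le> card (Kset C)"
    by (rule min) (use v B_W va wC in \<open>auto simp: C_def\<close>)
  moreover have "Kset C \<subseteq> K - {b}"
  proof
    fix k assume "k \<in> Kset C"
    then obtain w where k: "k \<in> I" "w \<in> W" "\<omega> (C(k := w)) \<notin> \<int>" unfolding Kset_def by blast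
    have val: "\<omega> (C(k := w)) = crd a v * crd k w - crd k v * crd a w" if "k \<noteq> a"
      unfolding C_def using I(1) k(1) that W_V[OF v(1)] W_V[OF k(2)] by (intro form2) auto
    have "k \<in> K"
    proof (rule ccontr)
      assume "k \<notin> K"
      then have q: "k \<in> Q" using k(1) by blast
      then have "k \<noteq> a" using ab(1) by blast
      moreover have "crd k v = 0" using v(2) q unfolding gamma_eq_0_iff by blast
      ultimately have "\<omega> (C(k := w)) = crd a v * crd k w" using val by simp
      then show False using k(3) crd_Q[OF k(2) q] int Ints_mult by metis
    qed
    moreover have "k \<noteq> b"
    proof
      assume kb: "k = b"
      have iff: "crd b w \<in> \<int> \<longleftrightarrow> crd a w \<in> \<int>" by (rule int_K_iff[OF k(2) ab(2,1)])
      have d: "crd b w - crd a w \<in> \<int>" "crd b w + crd a w \<in> \<int>"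
        using half_diff_int[OF crd_half[OF k(2) I(2)] crd_half[OF k(2) I(1)] iff] .
      have "\<omega> (C(k := w)) = crd a v * crd b w - crd b v * crd a w" using val kb ab(3) by simp
      moreover have "crd a v * crd b w - crd b v * crd a w \<in> \<int>"
        using va vb d by (rule unit_comb_int)
      ultimately show False using k(3) by simp
    qed
    ultimately show "k \<in> K - {b}" by blast
  qed
  then have "card (Kset C) \<le> card (K - {b})" using finite_K by (intro card_mono) auto
  moreover have "card (K - {b}) < card K" using ab(2) finite_K by (intro card_Diff1_less)
  ultimately show False by linarith
qed

lemma close_in_fibre:
  assumes uv: "u \<in> W" "v \<in> W" "\<gamma> u = \<gamma> v" "\<gamma> u \<noteq> 0" and p: "p \<in> K" "crd p u \<in> \<int> \<longleftrightarrow> crd p v \<in> \<int>"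
  shows "card {k \<in> K. crd k u \<noteq> crd k v} \<le> 2"
    and "k \<in> I \<Longrightarrow> crd k v - crd k u \<in> {-1, 0, 1}"
proof -
  obtain q where q: "q \<in> Q" "crd q u \<noteq> 0" using uv(4) gamma_eq_0_iff by blast
  have eQ: "crd r u = crd r v" if "r \<in> Q" for r using uv(3) that unfolding gamma_eq_iff by blast
  have qI: "q \<in> I" using q by blast
  have uq: "\<bar>crd q u\<bar> = 1" using crd_Q_cases[OF uv(1) q(1)] q(2) by auto
  define \<delta> where "\<delta> k = crd k v - crd k u" for k
  have \<delta>: "\<delta> k = -1 \<or> \<delta> k = 0 \<or> \<delta> k = 1" if k: "k \<in> I" for k
  proof (cases "k = q")
    case True
    then show ?thesis using eQ[OF q(1)] by (simp add: \<delta>_def)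
  next
    case False
    have "\<bar>crd k v * crd q u - crd q v * crd k u\<bar> \<le> 1"
      using uv k qI False by (intro minor2(1)) auto
    then have "\<bar>\<delta> k * crd q u\<bar> \<le> 1" using eQ[OF q(1)] by (simp add: \<delta>_def algebra_simps)
    then have "\<bar>\<delta> k\<bar> \<le> 1" using uq by (simp add: abs_mult)
    moreover have "\<delta> k \<in> \<int>" unfolding \<delta>_def using diff_int[OF uv(2,1) p(1) _ k] p(2) by blast
    ultimately have "\<delta> k \<in> {-1, 0, 1}" by (rule unit_cases)
    then show ?thesis by blast
  qed
  then show "k \<in> I \<Longrightarrow> crd k v - crd k u \<in> {-1, 0, 1}" by (auto simp: \<delta>_def)
  show "card {k \<in> K. crd k u \<noteq> crd k v} \<le> 2"
  proof (cases "\<exists>j\<in>K. \<delta> j \<noteq> 0")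
    case False
    then have empty: "{k \<in> K. crd k u \<noteq> crd k v} = {}" by (auto simp: \<delta>_def)
    show ?thesis unfolding empty by simp
  next
    case True
    then obtain j where j: "j \<in> K" "\<delta> j \<noteq> 0" by blast
    have jI: "j \<in> I" and jq: "q \<noteq> j" using j(1) K_I q by auto
    have dj: "\<delta> j = 1 \<or> \<delta> j = -1" using \<delta>[OF jI] j(2) by blast
    define C where "C = B(q := u, j := v)"
    have "\<omega> C = crd q u * crd j v - crd j u * crd q v"
      unfolding C_def using qI jI jq W_V[OF uv(1)] W_V[OF uv(2)] by (rule form2)
    then have "\<omega> C = crd q u * \<delta> j" using eQ[OF q(1)] by (simp add: \<delta>_def algebra_simps)
    then have "\<bar>\<omega> C\<bar> = 1" using uq dj by (auto simp: abs_mult)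
    then have kC: "card K \<le> card (Kset C)"
      by (intro min) (use uv B_W in \<open>auto simp: C_def\<close>)
    let ?Z = "{k \<in> K. \<delta> k = 0}"
    have "Kset C \<subseteq> insert q (insert j ?Z)"
    proof
      fix l assume "l \<in> Kset C"
      then obtain w where l: "l \<in> I" "w \<in> W" "\<omega> (C(l := w)) \<notin> \<int>" unfolding Kset_def by blast
      show "l \<in> insert q (insert j ?Z)"
      proof (rule ccontr)
        assume no: "l \<notin> insert q (insert j ?Z)"
        then have ne: "q \<noteq> l" "j \<noteq> l" and lz: "l \<in> K \<Longrightarrow> \<delta> l \<noteq> 0" by auto
        have vd: "crd k v = crd k u + \<delta> k" for k by (simp add: \<delta>_def)
        have "\<omega> (C(l := w)) =
          crd q u * (crd j v * crd l w - crd l v * crd j w)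
          - crd j u * (crd q v * crd l w - crd l v * crd q w)
          + crd l u * (crd q v * crd j w - crd j v * crd q w)"
          unfolding C_def using qI jI l(1) jq ne W_V[OF uv(1)] W_V[OF uv(2)] W_V[OF l(2)] by (rule form3)
        also have "\<dots> = crd q u * (\<delta> j * crd l w - \<delta> l * crd j w) + crd q w * (crd j u * \<delta> l - crd l u * \<delta> j)"
          unfolding eQ[OF q(1), symmetric] vd[of j] vd[of l] by (simp add: algebra_simps)
        finally have val: "\<omega> (C(l := w)) = crd q u * (\<delta> j * crd l w - \<delta> l * crd j w)
          + crd q w * (crd j u * \<delta> l - crd l u * \<delta> j)" .
        have cross: "\<delta> j * crd l x - \<delta> l * crd j x \<in> \<int>" if x: "x \<in> W" for x
        proof (cases "l \<in> K")
          case True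
          have dl: "\<delta> l = 1 \<or> \<delta> l = -1" using \<delta>[OF l(1)] lz[OF True] by blast
          have "crd l x - crd j x \<in> \<int>" "crd l x + crd j x \<in> \<int>"
            using half_diff_int[OF crd_half[OF x l(1)] crd_half[OF x jI] int_K_iff[OF x True j(1)]] .
          then show ?thesis
            using dj dl by (intro unit_comb_int)
        next
          case False
          then have lQ: "l \<in> Q" using l(1) by blast
          then have "\<delta> l = 0" using eQ by (simp add: \<delta>_def)
          then show ?thesis using dj crd_Q[OF x lQ] by (elim disjE) simp_all
        qed
        have "crd j u * \<delta> l - crd l u * \<delta> j = - (\<delta> j * crd l u - \<delta> l * crd j u)" by (simp add: algebra_simps)
        then have "crd j u * \<delta> l - crd l u * \<delta> j \<in> \<int>" using cross[OF uv(1)] minus_in_Ints_iff by metis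
        then have "\<omega> (C(l := w)) \<in> \<int>" unfolding val
          by (intro Ints_add Ints_mult cross[OF l(2)] crd_Q[OF uv(1) q(1)] crd_Q[OF l(2) q(1)])
        then show False using l(3) by simp
      qed
    qed
    then have "card (Kset C) \<le> card (insert q (insert j ?Z))" using finite_K by (intro card_mono) auto
    also have "\<dots> \<le> 2 + card ?Z" using finite_K by (simp add: card_insert_if)
    finally have "card K \<le> 2 + card ?Z" using kC by simp
    moreover have "card K = card ?Z + card {k \<in> K. crd k u \<noteq> crd k v}"
    proof -
      have "K = ?Z \<union> {k \<in> K. crd k u \<noteq> crd k v}" by (auto simp: \<delta>_def)
      moreover have "card (?Z \<union> {k \<in> K. crd k u \<noteq> crd k v}) = card ?Z + card {k \<in> K. crd k u \<noteq> crd k v}"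
        by (rule card_Un_disjoint) (use finite_K in \<open>auto simp: \<delta>_def\<close>)
      ultimately show ?thesis by simp
    qed
    ultimately show ?thesis by linarith
  qed
qed

end


lemma card_pm_le_2:
  fixes S :: "'a::group_add set"
  assumes "\<And>g h. g \<in> S \<Longrightarrow> h \<in> S \<Longrightarrow> h = g \<or> h = - g"
  shows "finite S" "card S \<le> 2"
proof -
  have "finite S \<and> card S \<le> 2"
  proof (cases "S = {}")
    case False
    then obtain g where "g \<in> S" by blast
    then have sub: "S \<subseteq> {g, - g}" using assms by blast
    have "card S \<le> card {g, - g}" by (rule card_mono[OF _ sub]) simp
    also have "\<dots> \<le> 2" by (simp add: card_insert_if)
    finally show ?thesis using sub finite_subset by blast
  qed simp
  then show "finite S" "card S \<le> 2" by blast+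
qed

context based_form begin

lemma proj_restr:
  assumes "J \<subseteq> I" "A \<subseteq> J"
  shows "based_form.proj (restr J) B A v = proj A v"
proof -
  interpret R: based_form J "restr J" B using assms(1) by (rule based_form_restr)
  show ?thesis unfolding R.proj_def proj_def
    using assms by (intro sum.cong) (auto simp: crd_restr)
qed

lemma proj_proj: "A \<subseteq> J \<Longrightarrow> J \<subseteq> I \<Longrightarrow> proj A (proj J v) = proj A v"
proof (subst proj_eq_iff)
  assume a: "A \<subseteq> J" "J \<subseteq> I"
  then show "A \<subseteq> I" by blast
  show "\<forall>j\<in>A. crd j (proj J v) = crd j v"
  proof
    fix j assume "j \<in> A"
    then have "j \<in> J" "j \<in> I" using a by auto
    then show "crd j (proj J v) = crd j v" using crd_proj[OF a(2), of j v] by simp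
  qed
qed

end

context bimod begin

definition sq_parts :: "nat \<Rightarrow> 'v set" where
  "sq_parts i = {g. g \<noteq> 0 \<and> (\<exists>j\<in>K - {i}. \<exists>u. square i j u \<and> \<gamma> u = g)}"

lemma card_sq_parts:
  assumes i: "i \<in> K"
  shows "finite (sq_parts i)" "card (sq_parts i) \<le> 2 * (card K - 1)"
    and "\<kappa> \<in> W \<Longrightarrow> \<gamma> \<kappa> = 0 \<Longrightarrow> crd i \<kappa> \<notin> \<int> \<Longrightarrow> card (sq_parts i) \<le> 2"
proof -
  define P where "P j = {g. g \<noteq> 0 \<and> (\<exists>u. square i j u \<and> \<gamma> u = g)}" for j
  have eq: "sq_parts i = (\<Union>j\<in>K - {i}. P j)" unfolding sq_parts_def P_def by auto
  have P: "h = g \<or> h = - g" if j: "j \<in> K - {i}" and g: "g \<in> P j" "h \<in> P j" for g h j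
  proof -
    obtain u where u: "square i j u" "\<gamma> u = g" "g \<noteq> 0" using g(1) unfolding P_def by blast
    obtain v where v: "square i j v" "\<gamma> v = h" "h \<noteq> 0" using g(2) unfolding P_def by blast
    have "\<gamma> v = \<gamma> u \<or> \<gamma> v = - \<gamma> u"
      by (rule squares_same_pair[OF i _ _ u(1) v(1)]) (use j u v in auto)
    then show ?thesis by (simp only: u v)
  qed
  have fP: "finite (P j) \<and> card (P j) \<le> 2" if "j \<in> K - {i}" for j
    using card_pm_le_2[OF P[OF that]] by blast
  show "finite (sq_parts i)" unfolding eq using fP finite_K by blast
  have "card (sq_parts i) \<le> (\<Sum>j\<in>K - {i}. card (P j))"
    unfolding eq by (rule card_UN_le) (use finite_K in simp)
  also have "\<dots> \<le> (\<Sum>j\<in>K - {i}. 2)" using fP by (intro sum_mono) blast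
  also have "\<dots> = 2 * (card K - 1)" using i finite_K by simp
  finally show "card (sq_parts i) \<le> 2 * (card K - 1)" .
  assume k: "\<kappa> \<in> W" "\<gamma> \<kappa> = 0" "crd i \<kappa> \<notin> \<int>"
  show "card (sq_parts i) \<le> 2"
  proof (rule card_pm_le_2(2))
    fix g h assume g: "g \<in> sq_parts i" "h \<in> sq_parts i"
    obtain j u where u: "j \<in> K - {i}" "square i j u" "\<gamma> u = g" "g \<noteq> 0" using g(1) unfolding sq_parts_def by blast
    obtain l v where v: "l \<in> K - {i}" "square i l v" "\<gamma> v = h" "h \<noteq> 0" using g(2) unfolding sq_parts_def by blast
    show "h = g \<or> h = - g"
    proof (cases "j = l")
      case True
      then show ?thesis using P[of j g h] u v unfolding P_def by blast
    next
      case False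
      have "\<gamma> v = \<gamma> u \<or> \<gamma> v = - \<gamma> u"
        by (rule squares_adjacent[OF i _ _ _ _ False u(2) v(2) _ _ k]) (use u v in auto)
      then show ?thesis by (simp only: u v)
    qed
  qed
qed

lemma D_null:
  assumes two: "i \<in> K" "l \<in> K" "l \<noteq> i"
    and H: "\<And>v a b. v \<in> W \<Longrightarrow> \<gamma> v = 0 \<Longrightarrow> a \<in> K \<Longrightarrow> b \<in> K \<Longrightarrow> a \<noteq> b \<Longrightarrow> crd a v \<noteq> 0 \<Longrightarrow> crd b v \<noteq> 0 \<Longrightarrow> crd a v \<notin> \<int>"
  shows "card {d \<in> D i. \<gamma> d = 0} \<le> 2 ^ (card K - 1)"
    and "d \<in> D i \<Longrightarrow> \<gamma> d = 0 \<Longrightarrow> \<exists>\<kappa>\<in>W. \<gamma> \<kappa> = 0 \<and> crd i \<kappa> \<notin> \<int>"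
proof -
  have iI: "i \<in> I" using two K_I by auto
  have lift: "\<exists>u\<in>W. \<gamma> u = 0 \<and> crd i u \<notin> \<int> \<and> pr i u = d" if d: "d \<in> D i" "\<gamma> d = 0" for d
  proof -
    obtain u v where uv: "u \<in> W" "v \<in> W" "pr i u = d" "pr i v = d" "crd i v = crd i u + 1"
      by (rule D_lifts[OF two d(1)])
    have g: "\<gamma> u = 0" "\<gamma> v = 0" using gamma_pr[OF two(1), of u] gamma_pr[OF two(1), of v] uv d(2) by auto
    have "d \<noteq> 0" using d(1) unfolding D_def by blast
    then have "\<not> (\<forall>j\<in>I - {i}. crd j u = 0)" using uv(3) proj_eq_0_iff[of "I - {i}" u] by auto
    then obtain j where j: "j \<in> I" "j \<noteq> i" "crd j u \<noteq> 0" by blast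
    have jK: "j \<in> K" using j(1,3) g(1) unfolding gamma_eq_0_iff by blast
    have "crd j v = crd j u" using pr_eq_iff[of i u v] uv(3,4) j by auto
    then have jv: "crd j v \<noteq> 0" using j(3) by simp
    show ?thesis
    proof (cases "crd i u = 0")
      case True
      then have "crd i v \<noteq> 0" using uv(5) by simp
      then have "crd i v \<notin> \<int>" using H[OF uv(2) g(2) two(1) jK _ _ jv] j(2) by blast
      then show ?thesis using uv(2,4) g(2) by blast
    next
      case False
      then have "crd i u \<notin> \<int>" using H[OF uv(1) g(1) two(1) jK _ _ j(3)] j(2) by blast
      then show ?thesis using uv(1,3) g(1) by blast
    qed
  qed
  then show "d \<in> D i \<Longrightarrow> \<gamma> d = 0 \<Longrightarrow> \<exists>\<kappa>\<in>W. \<gamma> \<kappa> = 0 \<and> crd i \<kappa> \<notin> \<int>" by blast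
  define \<phi> where "\<phi> d = {k \<in> K - {i}. crd k d = 1/2}" for d
  have half: "crd k d = 1/2 \<or> crd k d = -1/2" if d: "d \<in> D i" "\<gamma> d = 0" and k: "k \<in> K - {i}" for d k
  proof -
    obtain u where u: "u \<in> W" "crd i u \<notin> \<int>" "pr i u = d" using lift[OF d] by blast
    have kI: "k \<in> I" using k K_I by auto
    have "crd k d = crd k u" using u(3) crd_pr[OF iI kI, of u] k by auto
    then show ?thesis using crd_nonint[OF u(1) kI nonint_K[OF u(1) iI u(2)]] k by auto
  qed
  have "inj_on \<phi> {d \<in> D i. \<gamma> d = 0}"
  proof (rule inj_onI)
    fix d e assume de: "d \<in> {d \<in> D i. \<gamma> d = 0}" "e \<in> {d \<in> D i. \<gamma> d = 0}" "\<phi> d = \<phi> e"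
    obtain u where u: "pr i u = d" using lift[of d] de(1) by blast
    obtain v where v: "pr i v = e" using lift[of e] de(2) by blast
    show "d = e"
    proof (rule eqI)
      show "d \<in> V" "e \<in> V" unfolding u[symmetric] v[symmetric] by (rule proj_in_V; simp)+
      fix k assume k: "k \<in> I"
      consider "k = i" | "k \<in> Q" | "k \<in> K - {i}" using k by blast
      then show "crd k d = crd k e"
      proof cases
        case 1
        then show ?thesis unfolding u[symmetric] v[symmetric] using iI by simp
      next
        case 2
        then have "crd k d = 0" "crd k e = 0" using de(1,2) unfolding gamma_eq_0_iff mem_Collect_eq by blast+
        then show ?thesis by simp
      next
        case 3
        have "k \<in> \<phi> d \<longleftrightarrow> k \<in> \<phi> e" by (simp only: de(3))
        then have "crd k d = 1/2 \<longleftrightarrow> crd k e = 1/2" using 3 by (simp add: \<phi>_def)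
        then show ?thesis using half[of d k] half[of e k] de(1,2) 3 by auto
      qed
    qed
  qed
  moreover have "\<phi> ` {d \<in> D i. \<gamma> d = 0} \<subseteq> Pow (K - {i})" unfolding \<phi>_def by blast
  ultimately have "card {d \<in> D i. \<gamma> d = 0} \<le> card (Pow (K - {i}))"
    using finite_K by (intro card_inj_on_le) auto
  also have "\<dots> = 2 ^ (card K - 1)" using two(1) finite_K by (simp add: card_Pow)
  finally show "card {d \<in> D i. \<gamma> d = 0} \<le> 2 ^ (card K - 1)" .
qed

lemma card_D_split:
  assumes e: "\<And>g. g \<noteq> 0 \<Longrightarrow> card {d \<in> D i. \<gamma> d = g} \<le> (if g \<in> S then 2 else 1)" and S: "finite S"
  shows "card (D i) \<le> card {d \<in> D i. \<gamma> d = 0} + card (\<gamma> ` D i - {0}) + card S"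
proof -
  let ?G = "\<gamma> ` D i - {0}"
  have fG: "finite ?G" using finite_D by simp
  have "D i = {d \<in> D i. \<gamma> d = 0} \<union> (\<Union>g\<in>?G. {d \<in> D i. \<gamma> d = g})" by blast
  then have "card (D i) \<le> card {d \<in> D i. \<gamma> d = 0} + card (\<Union>g\<in>?G. {d \<in> D i. \<gamma> d = g})"
    by (metis (lifting) card_Un_le)
  also have "card (\<Union>g\<in>?G. {d \<in> D i. \<gamma> d = g}) \<le> (\<Sum>g\<in>?G. card {d \<in> D i. \<gamma> d = g})"
    by (rule card_UN_le[OF fG])
  also have "\<dots> \<le> (\<Sum>g\<in>?G. 1 + (if g \<in> S then 1 else 0))"
  proof (rule sum_mono)
    fix g assume "g \<in> ?G"
    then have "card {d \<in> D i. \<gamma> d = g} \<le> (if g \<in> S then 2 else 1)" by (intro e) blast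
    then show "card {d \<in> D i. \<gamma> d = g} \<le> 1 + (if g \<in> S then 1 else 0)" by (auto split: if_splits)
  qed
  also have "\<dots> = card ?G + (\<Sum>g\<in>?G. if g \<in> S then 1 else 0)" by (simp only: sum.distrib) simp
  also have "(\<Sum>g\<in>?G. if g \<in> S then 1 else 0) = card {g \<in> ?G. g \<in> S}"
    using fG by (simp add: sum.If_cases Int_def)
  also have "\<dots> \<le> card S" using S by (intro card_mono) auto
  finally show ?thesis by linarith
qed

lemma eq_add_B:
  assumes "u \<in> V" "v \<in> V" "j \<in> I" "crd j v = crd j u + c" "\<And>k. k \<in> I \<Longrightarrow> k \<noteq> j \<Longrightarrow> crd k v = crd k u"
  shows "v = u + c *\<^sub>R B j"
proof (rule eqI)
  show "v \<in> V" by fact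
  show "u + c *\<^sub>R B j \<in> V" using assms by (intro span_add span_scale B_in_V)
  fix k assume "k \<in> I"
  then show "crd k v = crd k (u + c *\<^sub>R B j)" using assms(3-5) by (cases "k = j") auto
qed

end

context minbimod begin

lemma square_over:
  assumes two: "i \<in> K" "l \<in> K" "l \<noteq> i" and d: "d \<in> D i" "e \<in> D i" "d \<noteq> e" "\<gamma> d = \<gamma> e" "\<gamma> d \<noteq> 0"
  shows "\<exists>j\<in>K - {i}. (\<exists>u. square i j u \<and> \<gamma> u = \<gamma> d) \<and> (\<forall>k\<in>I. crd k d \<noteq> crd k e \<longleftrightarrow> k = j)
    \<and> \<bar>crd j e - crd j d\<bar> = 1"
proof -
  have iI: "i \<in> I" using two K_I by auto
  obtain u u2 where u: "u \<in> W" "u2 \<in> W" "pr i u = d" "pr i u2 = d" "crd i u2 = crd i u + 1"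
    by (rule D_lifts[OF two d(1)])
  obtain v v2 where v: "v \<in> W" "v2 \<in> W" "pr i v = e" "pr i v2 = e" "crd i v2 = crd i v + 1"
    by (rule D_lifts[OF two d(2)])
  have gu: "\<gamma> u = \<gamma> d" "\<gamma> u2 = \<gamma> d" "\<gamma> v = \<gamma> d" "\<gamma> v2 = \<gamma> d"
    using gamma_pr[OF two(1), of u] gamma_pr[OF two(1), of u2] gamma_pr[OF two(1), of v]
      gamma_pr[OF two(1), of v2] u v d(4) by auto
  have cd: "crd k d = crd k u" "crd k u2 = crd k u" "crd k e = crd k v" "crd k v2 = crd k v"
    if "k \<in> I" "k \<noteq> i" for k
    using crd_pr[OF iI that(1), of u] crd_pr[OF iI that(1), of u2] crd_pr[OF iI that(1), of v]
      crd_pr[OF iI that(1), of v2] u(3,4) v(3,4) that(2) by auto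
  have cdi: "crd i d = 0" "crd i e = 0" using iI unfolding u(3)[symmetric] v(3)[symmetric] by simp_all
  have "\<gamma> u \<noteq> 0" using gu d(5) by simp
  then obtain q where q: "q \<in> Q" "crd q u \<noteq> 0" unfolding gamma_eq_0_iff by blast
  have eQ: "crd r u2 = crd r u" "crd r v = crd r u" "crd r v2 = crd r u" if "r \<in> Q" for r
    using that gu gamma_eq_iff[of u2 u] gamma_eq_iff[of v u] gamma_eq_iff[of v2 u] by simp_all
  have "q \<noteq> i" using q two by auto
  then have ii: "crd i u = crd i v"
    using lifts_aligned[OF iI q(1) _ q(2) eQ[OF q(1)] u(1,2) v(1,2) u(5) v(5)] by blast
  have cls: "crd i u \<in> \<int> \<longleftrightarrow> crd i v2 \<in> \<int>" unfolding v(5) ii[symmetric]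
    by (metis Ints_1 Ints_add Ints_diff add_diff_cancel_right')
  have guv: "\<gamma> u = \<gamma> v2" using gu by simp
  note cl = close_in_fibre[OF u(1) v(2) guv \<open>\<gamma> u \<noteq> 0\<close> two(1) cls]
  have "\<not> (\<forall>j\<in>I - {i}. crd j u = crd j v)" using d(3) u(3) v(3) pr_eq_iff[of i u v] by auto
  then obtain j where j: "j \<in> I" "j \<noteq> i" "crd j u \<noteq> crd j v" by blast
  have jK: "j \<in> K" using eQ(2)[of j] j(1,3) by fastforce
  let ?S = "{k \<in> K. crd k u \<noteq> crd k v2}"
  have "{i, j} \<subseteq> ?S" using two(1) jK j cd(4)[OF j(1,2)] ii v(5) by simp
  moreover have "finite ?S" using finite_K by simp
  moreover have "card ?S \<le> card {i, j}" using cl(1) j(2) by simp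
  ultimately have S: "{i, j} = ?S" by (intro card_seteq)
  have oth: "crd k u = crd k v" if k: "k \<in> I" "k \<noteq> j" for k
  proof (cases "k \<in> Q \<or> k = i")
    case True
    then show ?thesis using eQ(2)[of k] ii by auto
  next
    case False
    then have kK: "k \<in> K" "k \<noteq> i" using k(1) by auto
    have "k \<notin> ?S" unfolding S[symmetric] using kK k(2) by simp
    then show ?thesis using kK(1) cd(4)[OF k(1) kK(2)] by simp
  qed
  have "crd j v - crd j u \<in> {-1, 0, 1}" using cl(2)[OF j(1)] cd(4)[OF j(1,2)] by simp
  then have dj: "crd j v = crd j u + 1 \<or> crd j u = crd j v + 1" using j(3) by auto
  have uV: "u \<in> V" "u2 \<in> V" "v \<in> V" "v2 \<in> V" using u v W_V by auto
  have u2: "u2 = u + B i" using eq_add_B[OF uV(1,2) iI u(5)] cd(2) by simp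
  have v2: "v2 = v + B i" using eq_add_B[OF uV(3,4) iI v(5)] cd(4) by simp
  have sq: "\<exists>w. square i j w \<and> \<gamma> w = \<gamma> d"
    using dj
  proof
    assume "crd j v = crd j u + 1"
    then have "v = u + B j" using eq_add_B[OF uV(1,3) j(1), of 1] oth by simp
    then have "square i j u" unfolding square_def using u v u2 v2 by (simp add: algebra_simps)
    then show ?thesis using gu by blast
  next
    assume "crd j u = crd j v + 1"
    then have "u = v + B j" using eq_add_B[OF uV(3,1) j(1), of 1] oth by simp
    then have "square i j v" unfolding square_def using u v u2 v2 by (simp add: algebra_simps)
    then show ?thesis using gu by blast
  qed
  have "crd k d \<noteq> crd k e \<longleftrightarrow> k = j" if k: "k \<in> I" for k
  proof (cases "k = i")
    case True
    then show ?thesis using cdi j(2) by simp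
  next
    case False
    then show ?thesis using cd(1,3)[OF k False] oth[OF k] j(3) by auto
  qed
  moreover have "\<bar>crd j e - crd j d\<bar> = 1" using cd(1,3)[OF j(1,2)] dj by auto
  ultimately show ?thesis using sq jK j(2) by blast
qed

lemma card_D_over:
  assumes two: "i \<in> K" "l \<in> K" "l \<noteq> i" and g: "g \<noteq> 0"
  shows "card {d \<in> D i. \<gamma> d = g} \<le> (if g \<in> sq_parts i then 2 else 1)"
proof (cases "g \<in> sq_parts i")
  case False
  have "d = e" if "d \<in> {d \<in> D i. \<gamma> d = g}" "e \<in> {d \<in> D i. \<gamma> d = g}" for d e
  proof (rule ccontr)
    assume ne: "d \<noteq> e"
    have de: "d \<in> D i" "e \<in> D i" "\<gamma> d = \<gamma> e" "\<gamma> d \<noteq> 0" using that g by auto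
    obtain j u where "j \<in> K - {i}" "square i j u" "\<gamma> u = \<gamma> d"
      using square_over[OF two de(1,2) ne de(3,4)] by blast
    then have "g \<in> sq_parts i" using that(1) g unfolding sq_parts_def by blast
    then show False using False by blast
  qed
  then have "card {d \<in> D i. \<gamma> d = g} \<le> Suc 0"
    using finite_D by (subst card_le_Suc0_iff_eq) auto
  then show ?thesis using False by simp
next
  case True
  have "card {d \<in> D i. \<gamma> d = g} \<le> 2"
  proof (rule ccontr)
    assume "\<not> ?thesis"
    from three_elements[OF this] obtain a b c where
      m: "a \<in> {d \<in> D i. \<gamma> d = g}" "b \<in> {d \<in> D i. \<gamma> d = g}" "c \<in> {d \<in> D i. \<gamma> d = g}"
      and abc: "a \<noteq> b" "a \<noteq> c" "b \<noteq> c" .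
    have m': "a \<in> D i" "b \<in> D i" "c \<in> D i" "\<gamma> a = \<gamma> b" "\<gamma> a = \<gamma> c" "\<gamma> b = \<gamma> c" "\<gamma> a \<noteq> 0" "\<gamma> b \<noteq> 0"
      using m g by auto
    obtain j where j: "j \<in> K" "\<forall>k\<in>I. crd k a \<noteq> crd k b \<longleftrightarrow> k = j" "\<bar>crd j b - crd j a\<bar> = 1"
      using square_over[OF two m'(1,2) abc(1) m'(4,7)] by blast
    obtain p where p: "p \<in> K" "\<forall>k\<in>I. crd k a \<noteq> crd k c \<longleftrightarrow> k = p" "\<bar>crd p c - crd p a\<bar> = 1"
      using square_over[OF two m'(1,3) abc(2) m'(5,7)] by blast
    obtain r where r: "r \<in> K" "\<forall>k\<in>I. crd k b \<noteq> crd k c \<longleftrightarrow> k = r" "\<bar>crd r c - crd r b\<bar> = 1"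
      using square_over[OF two m'(2,3) abc(3) m'(6,8)] by blast
    have I: "j \<in> I" "p \<in> I" "r \<in> I" using j(1) p(1) r(1) K_I by auto
    show False
    proof (cases "j = p")
      case True
      have "r = j" using bspec[OF j(2) I(3)] bspec[OF p(2) I(3)] bspec[OF r(2) I(3)] True by auto
      then have "\<bar>crd j c - crd j a\<bar> = 1" "\<bar>crd j c - crd j b\<bar> = 1" using p(3) r(3) True by simp_all
      then show False using j(3) by linarith
    next
      case False
      then show False
        using bspec[OF j(2) I(1)] bspec[OF p(2) I(1)] bspec[OF r(2) I(1)]
          bspec[OF j(2) I(2)] bspec[OF p(2) I(2)] bspec[OF r(2) I(2)] by metis
    qed
  qed
  then show ?thesis using True by simp
qed

lemma card_D_small:
  assumes two: "i \<in> K" "l \<in> K" "l \<noteq> i" and k4: "card K \<le> 4"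
  shows "card (D i) \<le> 2 * card I \<or>
    card K = 4 \<and> card (D i) \<le> 10 + 2 * card Q \<and> sq_parts i \<noteq> {} \<and> (\<exists>\<kappa>\<in>W. \<gamma> \<kappa> = 0 \<and> crd i \<kappa> \<notin> \<int>)"
proof -
  have split: "card (D i) \<le> card {d \<in> D i. \<gamma> d = 0} + card (\<gamma> ` D i - {0}) + card (sq_parts i)"
    by (rule card_D_split[OF card_D_over[OF two] card_sq_parts(1)[OF two(1)]])
  have G: "card (\<gamma> ` D i - {0}) \<le> 2 * card Q" by (rule card_gamma_D[OF two])
  have I: "card I = card K + card Q" using card_Un_disjoint[OF finite_K finite_Q] K_I
    by (simp add: Diff_disjoint Un_absorb1)
  have k2: "2 \<le> card K"
  proof -
    have "card {i, l} \<le> card K" using two finite_K by (intro card_mono) auto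
    then show ?thesis using two(3) by simp
  qed
  have null: "card {d \<in> D i. \<gamma> d = 0} \<le> 2 ^ (card K - 1)" by (rule D_null(1)[OF two]) (rule integral_on_K)
  show ?thesis
  proof (cases "\<exists>\<kappa>\<in>W. \<gamma> \<kappa> = 0 \<and> crd i \<kappa> \<notin> \<int>")
    case False
    moreover have "\<exists>\<kappa>\<in>W. \<gamma> \<kappa> = 0 \<and> crd i \<kappa> \<notin> \<int>" if "d \<in> D i" "\<gamma> d = 0" for d
      by (rule D_null(2)[OF two _ that]) (rule integral_on_K)
    ultimately have "{d \<in> D i. \<gamma> d = 0} = {}" by blast
    then have "card {d \<in> D i. \<gamma> d = 0} = 0" by (simp only: card.empty)
    then show ?thesis using split G I card_sq_parts(2)[OF two(1)] k2 by linarith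
  next
    case True
    then have s2: "card (sq_parts i) \<le> 2" using card_sq_parts(3)[OF two(1)] by blast
    consider "card K = 2" | "card K = 3" | "card K = 4" using k2 k4 by linarith
    then show ?thesis
    proof cases
      case 1
      then show ?thesis using null split G I s2 by simp
    next
      case 2
      then show ?thesis using null split G I s2 by simp
    next
      case 3
      then have n8: "card {d \<in> D i. \<gamma> d = 0} \<le> 8" using null by simp
      show ?thesis
      proof (cases "sq_parts i = {}")
        case True
        then have "card (sq_parts i) = 0" by (simp only: card.empty)
        then show ?thesis using n8 split G I 3 by linarith
      next
        case False
        then show ?thesis using n8 split G s2 3 True by (intro disjI2) auto
      qed
    qed
  qed
qed

lemma card_W_two_contractions:
  assumes ij: "i \<in> K" "j \<in> K" "i \<noteq> j" and k4: "card K = 4"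
    and sq: "square i j u0" "\<gamma> u0 \<noteq> 0" and k: "\<kappa> \<in> W" "\<gamma> \<kappa> = 0" "crd i \<kappa> \<notin> \<int>"
    and D: "card (D i) \<le> 10 + 2 * card Q"
  shows "card W \<le> card (proj (I - {i} - {j}) ` W - {0}) + 18 + 4 * card Q"
proof -
  define J where "J = I - {i}"
  let ?W = "pr i ` W - {0}"
  have iI: "i \<in> I" and jI: "j \<in> I" and JI: "J \<subseteq> I" using ij K_I by (auto simp: J_def)
  interpret R: bimod J "restr J" B ?W unfolding J_def by (rule bimod_restr) auto
  have Rc: "R.crd k v = crd k v" if "k \<in> J" for k v by (rule crd_restr[OF JI that])
  have cpr: "crd k (pr i v) = crd k v" if "k \<in> J" for k v using crd_pr[OF iI, of k v] that by (auto simp: J_def)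
  have RK: "R.K = K - {i}"
  proof
    show "R.K \<subseteq> K - {i}"
    proof
      fix k assume k: "k \<in> R.K"
      then have kJ: "k \<in> J" using R.K_I by blast
      obtain v where v: "v \<in> ?W" "R.crd k v \<notin> \<int>" using R.K_ex[OF k] by blast
      then obtain w where w: "w \<in> W" "v = pr i w" by blast
      have "crd k w \<notin> \<int>" using v(2) unfolding Rc[OF kJ] w(2) cpr[OF kJ] .
      then show "k \<in> K - {i}" using K_mem[OF w(1)] kJ by (auto simp: J_def)
    qed
    show "K - {i} \<subseteq> R.K"
    proof
      fix k assume k: "k \<in> K - {i}"
      then have kJ: "k \<in> J" using K_I by (auto simp: J_def)
      obtain w where w: "w \<in> W" "crd k w \<notin> \<int>" using K_ex k by blast
      have n: "R.crd k (pr i w) \<notin> \<int>" using w(2) unfolding Rc[OF kJ] cpr[OF kJ] .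
      have "pr i w \<noteq> 0" using n kJ by auto
      then have "pr i w \<in> ?W" using w(1) by blast
      from R.K_mem[OF this kJ n] show "k \<in> R.K" .
    qed
  qed
  have RQ: "J - R.K = Q" unfolding RK using ij by (auto simp: J_def)
  have Rg: "R.\<gamma> v = \<gamma> v" for v unfolding RQ by (rule proj_restr[OF JI]) (use ij in \<open>auto simp: J_def\<close>)
  have gpr: "\<gamma> (pr i v) = \<gamma> v" for v by (rule gamma_pr[OF ij(1)])
  have jRK: "j \<in> R.K" unfolding RK using ij by blast
  have "card (K - {i} - {j}) = 2" using k4 ij finite_K by simp
  then obtain l where l: "l \<in> K - {i} - {j}" by (metis card.empty ex_in_conv zero_neq_numeral)
  then have lRK: "l \<in> R.K" "l \<noteq> j" unfolding RK by auto
  have Rpr: "R.pr j v = proj (I - {i} - {j}) v" for v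
    unfolding J_def[symmetric] by (rule proj_restr[OF JI]) auto
  have c1: "card W \<le> card ?W + 2 + card (D i)" by (rule card_contract[OF ij(1,2)]) (use ij in auto)
  have c2: "card ?W \<le> card (R.pr j ` ?W - {0}) + 2 + card (R.D j)" by (rule R.card_contract[OF jRK lRK])
  have "R.pr j ` ?W - {0} = proj (I - {i} - {j}) ` W - {0}"
  proof -
    have pp: "R.pr j (pr i w) = proj (I - {i} - {j}) w" for w
      unfolding Rpr by (rule proj_proj) auto
    show ?thesis
    proof
      show "R.pr j ` ?W - {0} \<subseteq> proj (I - {i} - {j}) ` W - {0}" using pp by auto
      show "proj (I - {i} - {j}) ` W - {0} \<subseteq> R.pr j ` ?W - {0}"
      proof
        fix v assume "v \<in> proj (I - {i} - {j}) ` W - {0}"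
        then obtain w where w: "w \<in> W" "v = R.pr j (pr i w)" "v \<noteq> 0" using pp by auto
        then have "pr i w \<noteq> 0" by auto
        then show "v \<in> R.pr j ` ?W - {0}" using w by blast
      qed
    qed
  qed
  then have c2': "card ?W \<le> card (proj (I - {i} - {j}) ` W - {0}) + 2 + card (R.D j)" using c2 by simp
  have two: "j \<in> K" "i \<in> K" "i \<noteq> j" using ij by auto
  have jJ: "j \<in> J" using jI ij by (auto simp: J_def)
  have over: "d = e" if d: "d \<in> R.D j" "\<gamma> d \<noteq> 0" and e: "e \<in> R.D j" "\<gamma> e = \<gamma> d" for d e
  proof (rule ccontr)
    assume ne: "d \<noteq> e"
    obtain u' u2' where u': "u' \<in> ?W" "u2' \<in> ?W" "R.pr j u' = d" "R.pr j u2' = d" "R.crd j u2' = R.crd j u' + 1"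
      by (rule R.D_lifts[OF jRK lRK d(1)])
    obtain v' v2' where v': "v' \<in> ?W" "v2' \<in> ?W" "R.pr j v' = e" "R.pr j v2' = e" "R.crd j v2' = R.crd j v' + 1"
      by (rule R.D_lifts[OF jRK lRK e(1)])
    obtain u where u: "u \<in> W" "u' = pr i u" using u'(1) by blast
    obtain u2 where u2: "u2 \<in> W" "u2' = pr i u2" using u'(2) by blast
    obtain v where v: "v \<in> W" "v' = pr i v" using v'(1) by blast
    obtain v2 where v2: "v2 \<in> W" "v2' = pr i v2" using v'(2) by blast
    have uj: "crd j u2 = crd j u + 1" "crd j v2 = crd j v + 1"
      using u'(5) v'(5) unfolding u(2) u2(2) v(2) v2(2) Rc[OF jJ] cpr[OF jJ] .
    have ck: "crd k u2 = crd k u" "crd k v2 = crd k v" "crd k d = crd k u" "crd k e = crd k v"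
      if k: "k \<in> I" "k \<noteq> i" "k \<noteq> j" for k
    proof -
      have kJ: "k \<in> J" using k by (simp add: J_def)
      have c: "crd k (R.pr j (pr i w)) = crd k w" for w
        unfolding Rpr using k kJ cpr[OF kJ, of w] by (subst crd_proj) auto
      show "crd k d = crd k u" "crd k e = crd k v" "crd k u2 = crd k u" "crd k v2 = crd k v"
        using c[of u] c[of u2] c[of v] c[of v2] u'(3,4) v'(3,4) unfolding u(2) u2(2) v(2) v2(2) by simp_all
    qed
    have gu: "\<gamma> u = \<gamma> d" "\<gamma> u2 = \<gamma> d" "\<gamma> v = \<gamma> d" "\<gamma> v2 = \<gamma> d"
    proof -
      have "\<gamma> (R.pr j (pr i w)) = \<gamma> w" for w
        unfolding gamma_eq_iff
      proof
        fix q assume "q \<in> Q"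
        then have "q \<in> J" "q \<noteq> j" "q \<noteq> i" "q \<in> I" using ij by (auto simp: J_def)
        then show "crd q (R.pr j (pr i w)) = crd q w"
          unfolding Rpr using cpr[of q w] by (subst crd_proj) auto
      qed
      then show "\<gamma> u = \<gamma> d" "\<gamma> u2 = \<gamma> d" "\<gamma> v = \<gamma> d" "\<gamma> v2 = \<gamma> d"
        using u'(3,4) v'(3,4) e(2) unfolding u(2) u2(2) v(2) v2(2) by metis+
    qed
    have g0: "\<gamma> u \<noteq> 0" using gu d(2) by simp
    then obtain q where q: "q \<in> Q" "crd q u \<noteq> 0" unfolding gamma_eq_0_iff by blast
    have eQ: "crd r u2 = crd r u" "crd r v = crd r u" "crd r v2 = crd r u" if "r \<in> Q" for r
      using that gu gamma_eq_iff[of u2 u] gamma_eq_iff[of v u] gamma_eq_iff[of v2 u] by simp_all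
    have "q \<noteq> j" using q ij by auto
    then have jj: "crd j u = crd j v"
      using lifts_aligned[OF jI q(1) _ q(2) eQ[OF q(1)] u(1) u2(1) v(1) v2(1) uj] by blast
    have int1: "x \<in> \<int> \<longleftrightarrow> x + 1 \<in> \<int>" for x :: real
      by (metis Ints_1 Ints_add Ints_diff add_diff_cancel_right')
    have "crd j u \<in> \<int> \<longleftrightarrow> crd j v2 \<in> \<int>" "crd j u2 \<in> \<int> \<longleftrightarrow> crd j v \<in> \<int>" "crd j u \<in> \<int> \<longleftrightarrow> crd j u2 \<in> \<int>"
      unfolding uj jj using int1[of "crd j v"] by blast+
    moreover have "\<gamma> u = \<gamma> v2" "\<gamma> u2 = \<gamma> v" "\<gamma> u2 \<noteq> 0" "\<gamma> u = \<gamma> u2" using gu g0 by simp_all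
    ultimately have cl1: "card {k \<in> K. crd k u \<noteq> crd k v2} \<le> 2" "\<And>k. k \<in> I \<Longrightarrow> crd k v2 - crd k u \<in> {-1, 0, 1}"
      and cl2: "card {k \<in> K. crd k u2 \<noteq> crd k v} \<le> 2"
      and cl3: "\<And>k. k \<in> I \<Longrightarrow> crd k u2 - crd k u \<in> {-1, 0, 1}"
      using close_in_fibre[OF u(1) v2(1) _ g0 ij(2)] close_in_fibre[OF u2(1) v(1) _ _ ij(2)]
        close_in_fibre[OF u(1) u2(1) _ g0 ij(2)] by blast+
    have "\<exists>l\<in>I. l \<noteq> i \<and> l \<noteq> j \<and> crd l u \<noteq> crd l v"
    proof (rule ccontr)
      assume no: "\<not> ?thesis"
      have "d = e" unfolding u'(3)[symmetric] v'(3)[symmetric] u(2) v(2) Rpr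
      proof (subst proj_eq_iff)
        show "\<forall>k\<in>I - {i} - {j}. crd k (pr i u) = crd k (pr i v)"
          using no cpr by (auto simp: J_def)
      qed auto
      then show False using ne by simp
    qed
    then obtain l where l: "l \<in> I" "l \<noteq> i" "l \<noteq> j" "crd l u \<noteq> crd l v" by blast
    have lK: "l \<in> K" using eQ(2)[of l] l(1,4) by fastforce
    have S1: "{j, l} = {k \<in> K. crd k u \<noteq> crd k v2}"
    proof (rule card_seteq)
      show "{j, l} \<subseteq> {k \<in> K. crd k u \<noteq> crd k v2}" using ij lK l ck(2)[OF l(1-3)] uj jj by simp
      show "card {k \<in> K. crd k u \<noteq> crd k v2} \<le> card {j, l}" using cl1(1) l(3) by simp
    qed (use finite_K in simp)
    have S2: "{j, l} = {k \<in> K. crd k u2 \<noteq> crd k v}"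
    proof (rule card_seteq)
      show "{j, l} \<subseteq> {k \<in> K. crd k u2 \<noteq> crd k v}" using ij lK l ck(1)[OF l(1-3)] uj jj by simp
      show "card {k \<in> K. crd k u2 \<noteq> crd k v} \<le> card {j, l}" using cl2 l(3) by simp
    qed (use finite_K in simp)
    have e1: "crd k u = crd k v2" if "k \<in> K" "k \<noteq> j" "k \<noteq> l" for k
    proof -
      have "k \<notin> {k \<in> K. crd k u \<noteq> crd k v2}" unfolding S1[symmetric] using that by simp
      then show ?thesis using that(1) by simp
    qed
    have "i \<notin> {k \<in> K. crd k u2 \<noteq> crd k v}" unfolding S2[symmetric] using l ij by simp
    then have e2: "crd i u2 = crd i v" using ij by simp
    define r where "r = crd i u2 - crd i u"
    define s where "s = crd l v - crd l u"
    have "crd l v2 - crd l u \<in> {-1, 0, 1}" by (rule cl1(2)[OF l(1)])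
    then have s1: "\<bar>s\<bar> = 1" using ck(2)[OF l(1-3)] l(4) unfolding s_def by auto
    have uV: "u \<in> V" "u2 \<in> V" "v \<in> V" "v2 \<in> V" using u u2 v v2 W_V by auto
    have comb: "u + a *\<^sub>R B i + b *\<^sub>R B j + c *\<^sub>R B l \<in> V" for a b c
      using uV(1) iI jI l(1) by (intro span_add span_scale B_in_V)
    have coords: "crd k u2 = crd k u + (if k = i then r else 0) + (if k = j then 1 else 0)"
       "crd k v = crd k u + (if k = i then r else 0) + (if k = l then s else 0)"
       "crd k v2 = crd k u + (if k = j then 1 else 0) + (if k = l then s else 0)" if kI: "k \<in> I" for k
    proof -
      consider "k = i" | "k = j" | "k = l" | "k \<noteq> i" "k \<noteq> j" "k \<noteq> l" by blast
      then have "crd k u2 = crd k u + (if k = i then r else 0) + (if k = j then 1 else 0) \<and>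
       crd k v = crd k u + (if k = i then r else 0) + (if k = l then s else 0) \<and>
       crd k v2 = crd k u + (if k = j then 1 else 0) + (if k = l then s else 0)"
      proof cases
        case 1
        then show ?thesis using e1[OF ij(1,3)] e2 l ij by (simp add: r_def)
      next
        case 2
        then show ?thesis using uj jj l ij by simp
      next
        case 3
        then show ?thesis using ck(1,2)[OF l(1-3)] l by (simp add: s_def)
      next
        case 4
        have "crd k u = crd k v2"
        proof (cases "k \<in> K")
          case True
          then show ?thesis using e1 4 by blast
        next
          case False
          then show ?thesis using eQ(3)[of k] kI by simp
        qed
        then show ?thesis using ck(1,2)[OF kI 4(1,2)] 4 by simp
      qed
      then show "crd k u2 = crd k u + (if k = i then r else 0) + (if k = j then 1 else 0)"
       "crd k v = crd k u + (if k = i then r else 0) + (if k = l then s else 0)"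
       "crd k v2 = crd k u + (if k = j then 1 else 0) + (if k = l then s else 0)" by blast+
    qed
    have "u2 = u + r *\<^sub>R B i + 1 *\<^sub>R B j + 0 *\<^sub>R B l"
      by (rule eqI[OF uV(2) comb]) (use coords(1) iI jI l in auto)
    then have u2e: "u2 = u + r *\<^sub>R B i + B j" by simp
    have "v = u + r *\<^sub>R B i + 0 *\<^sub>R B j + s *\<^sub>R B l"
      by (rule eqI[OF uV(3) comb]) (use coords(2) iI jI l in auto)
    then have ve: "v = u + r *\<^sub>R B i + s *\<^sub>R B l" by simp
    have "v2 = u + 0 *\<^sub>R B i + 1 *\<^sub>R B j + s *\<^sub>R B l"
      by (rule eqI[OF uV(4) comb]) (use coords(3) iI jI l in auto)
    then have v2e: "v2 = u + B j + s *\<^sub>R B l" by simp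
    have r3: "r = -1 \<or> r = 0 \<or> r = 1" using cl3[OF iI] unfolding r_def by auto
    show False
    proof (cases "r = 0")
      case False
      then have "\<bar>r\<bar> = 1" using r3 by auto
      then have "\<gamma> u = 0"
        using no_tetrahedron[OF ij(1,2) lK ij(3) _ _ u(1), of r s] l(2,3) u2(1) v(1) v2(1) s1
        unfolding u2e ve v2e by (metis)
      then show False using g0 by simp
    next
      case True
      have sq2: "\<exists>w. square j l w \<and> \<gamma> w = \<gamma> u"
      proof (cases "s = 1")
        case True
        then have "square j l u" unfolding square_def using u(1) u2(1) v(1) v2(1) \<open>r = 0\<close>
          unfolding u2e ve v2e by simp
        then show ?thesis by blast
      next
        case False
        then have sm: "s = -1" using s1 by linarith
        have "square j l v" unfolding square_def using u(1) u2(1) v(1) v2(1) \<open>r = 0\<close> sm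
          unfolding u2e ve v2e by (simp add: algebra_simps)
        then show ?thesis using gu by auto
      qed
      then obtain w where w: "square j l w" "\<gamma> w = \<gamma> u" by blast
      have kj: "crd j \<kappa> \<notin> \<int>" using nonint_K[OF k(1) iI k(3) ij(2)] .
      have sji: "square j i u0" using sq(1) square_commute by blast
      have lne: "i \<noteq> l" "j \<noteq> l" "j \<noteq> i" using l ij by auto
      have gw0: "\<gamma> w \<noteq> 0" using w(2) g0 by simp
      have "\<gamma> w = \<gamma> u0 \<or> \<gamma> w = - \<gamma> u0"
        by (rule squares_adjacent[OF ij(2,1) lK lne(3,2,1) sji w(1) sq(2) gw0 k(1,2) kj])
      then have "\<exists>x. square j i x \<and> \<gamma> x = \<gamma> w"
      proof
        assume "\<gamma> w = \<gamma> u0"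
        then show ?thesis using sji by metis
      next
        assume g: "\<gamma> w = - \<gamma> u0"
        have "- u0 \<in> W" "- (u0 + B j) \<in> W" "- (u0 + B i) \<in> W" "- (u0 + B j + B i) \<in> W"
          using sji unfolding square_def by (blast intro: W_minus)+
        then have "square j i (- (u0 + B j + B i))" unfolding square_def by (simp add: algebra_simps)
        moreover have "\<gamma> (- (u0 + B j + B i)) = \<gamma> w"
          unfolding gamma_minus g gamma_add_B[OF ij(1)] gamma_add_B[OF ij(2)] ..
        ultimately show ?thesis by blast
      qed
      then obtain x where x: "square j i x" "\<gamma> x = \<gamma> w" by blast
      have xW: "x \<in> W" "x + B j \<in> W" "x + B i \<in> W" using x(1) unfolding square_def by blast+
      have wW: "w \<in> W" "w + B j \<in> W" "w + B j + B l \<in> W" using w(1) unfolding square_def by blast+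
      obtain q' where q': "q' \<in> Q" "crd q' x \<noteq> 0" using gw0 x(2) gamma_eq_0_iff[of x] by auto
      have q'I: "q' \<noteq> j" "q' \<in> I" using q' ij by auto
      have "crd q' w = crd q' x" using x(2) q'(1) unfolding gamma_eq_iff by simp
      then have aj: "crd j x = crd j w"
        using q'I ij(2) q'(1) jI
        by (intro lifts_aligned[OF jI q'(1) q'I(1) q'(2) _ _ _ xW(1,2) wW(1,2)]) simp_all
      define a where "a = (if crd i x = crd i w then x + B i else x)"
      define b where "b = (if crd l a = crd l w then w + B j + B l else w + B j)"
      have aW: "a \<in> W" using xW by (simp add: a_def)
      have bW: "b \<in> W" using wW by (simp add: b_def)
      have ga: "\<gamma> a = \<gamma> w" unfolding a_def using x(2) gamma_add_B[OF ij(1), of x] by simp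
      have gb: "\<gamma> b = \<gamma> w" unfolding b_def
        using gamma_add_B[OF ij(2), of w] gamma_add_B[OF lK, of "w + B j"] by simp
      have ca: "crd i a \<noteq> crd i w" "crd j a = crd j w" using iI jI ij(3) aj by (auto simp: a_def)
      have cb: "crd i b = crd i w" "crd j b = crd j w + 1" "crd l b \<noteq> crd l a"
        using iI jI l lne by (auto simp: b_def)
      have "crd j a \<in> \<int> \<longleftrightarrow> crd j b \<in> \<int>" unfolding ca cb by (rule int1)
      then have "card {k \<in> K. crd k a \<noteq> crd k b} \<le> 2"
        by (intro close_in_fibre(1)[OF aW bW _ _ ij(2)]) (use ga gb gw0 in simp_all)
      moreover have "card {i, j, l} \<le> card {k \<in> K. crd k a \<noteq> crd k b}"
        by (rule card_mono) (use finite_K ij lK ca cb in auto)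
      ultimately show False using lne ij(3) by simp
    qed
  qed
  have "card (R.D j) \<le> card {d \<in> R.D j. R.\<gamma> d = 0} + card (R.\<gamma> ` R.D j - {0}) + card ({} :: 'v set)"
  proof (rule R.card_D_split)
    fix g :: 'v assume g: "g \<noteq> 0"
    have one: "d = e" if d: "d \<in> {d \<in> R.D j. R.\<gamma> d = g}" and e: "e \<in> {d \<in> R.D j. R.\<gamma> d = g}" for d e
    proof (rule over)
      show "d \<in> R.D j" "e \<in> R.D j" using d e by blast+
      show "\<gamma> d \<noteq> 0" "\<gamma> e = \<gamma> d" using d e g unfolding Rg mem_Collect_eq by metis+
    qed
    have fin: "finite {d \<in> R.D j. R.\<gamma> d = g}" using R.finite_D by (rule finite_subset[rotated]) blast
    have "card {d \<in> R.D j. R.\<gamma> d = g} \<le> Suc 0"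
      unfolding card_le_Suc0_iff_eq[OF fin] using one by blast
    then show "card {d \<in> R.D j. R.\<gamma> d = g} \<le> (if g \<in> {} then 2 else 1)" by simp
  qed simp
  moreover have "card {d \<in> R.D j. R.\<gamma> d = 0} \<le> 2 ^ (card R.K - 1)"
  proof (rule R.D_null(1)[OF jRK lRK])
    fix v a b assume v: "v \<in> ?W" "R.\<gamma> v = 0" and ab: "a \<in> R.K" "b \<in> R.K" "a \<noteq> b" "R.crd a v \<noteq> 0" "R.crd b v \<noteq> 0"
    obtain w where w: "w \<in> W" "v = pr i w" using v(1) by blast
    have abJ: "a \<in> J" "b \<in> J" using ab R.K_I by auto
    have "crd a w \<notin> \<int>"
    proof (rule integral_on_K[OF w(1)])
      show "\<gamma> w = 0" using v(2) unfolding Rg w(2) gpr .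
      show "a \<in> K" "b \<in> K" using ab(1,2) unfolding RK by auto
      show "a \<noteq> b" by fact
      show "crd a w \<noteq> 0" using ab(4) unfolding Rc[OF abJ(1)] w(2) cpr[OF abJ(1)] .
      show "crd b w \<noteq> 0" using ab(5) unfolding Rc[OF abJ(2)] w(2) cpr[OF abJ(2)] .
    qed
    then show "R.crd a v \<notin> \<int>" unfolding Rc[OF abJ(1)] w(2) cpr[OF abJ(1)] .
  qed
  moreover have "card R.K = 3" unfolding RK using k4 ij finite_K by simp
  moreover have "card (R.\<gamma> ` R.D j - {0}) \<le> 2 * card (J - R.K)" by (rule R.card_gamma_D[OF jRK lRK])
  ultimately have "card (R.D j) \<le> 4 + 2 * card Q" unfolding RQ by simp
  then show ?thesis using c1 c2' D by linarith
qed

end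


locale onerow = bimod I \<omega> B W
  for I :: "nat set" and \<omega> :: "(nat \<Rightarrow> 'v::real_vector) \<Rightarrow> real" and B :: "nat \<Rightarrow> 'v" and W :: "'v set" +
  fixes j :: nat
  assumes jI: "j \<in> I" and Kj: "K \<subseteq> {j}"
begin

lemma off_Q: "I - {j} \<subseteq> Q" using Kj by blast

lemma crd_off: "v \<in> W \<Longrightarrow> k \<in> I \<Longrightarrow> k \<noteq> j \<Longrightarrow> crd k v \<in> \<int>"
  using off_Q by (intro crd_Q) auto

lemma crd_off_cases: "v \<in> W \<Longrightarrow> k \<in> I \<Longrightarrow> k \<noteq> j \<Longrightarrow> crd k v = -1 \<or> crd k v = 0 \<or> crd k v = 1"
  using off_Q by (intro crd_Q_cases) auto

lemma card_off: "card (pr j ` W - {0}) \<le> card (I - {j}) ^ 2 + card (I - {j})"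
proof -
  define J where "J = I - {j}"
  have JI: "J \<subseteq> I" by (auto simp: J_def)
  interpret R: conf J "restr J" B 2 "pr j ` W - {0}" unfolding J_def by (rule conf_restr) auto
  have int: "restr J x \<in> \<int>" if x: "\<And>k. k \<in> J \<Longrightarrow> x k \<in> pr j ` W - {0}" for x
  proof (rule R.form_lat)
    fix k assume k: "k \<in> J"
    obtain w where w: "w \<in> W" "x k = pr j w" using x[OF k] by blast
    have "R.crd p (x k) \<in> \<int>" if p: "p \<in> J" for p
    proof -
      have pI: "p \<in> I" "p \<noteq> j" using p by (auto simp: J_def)
      have "R.crd p (x k) = crd p (x k)" by (rule crd_restr[OF JI p])
      also have "\<dots> = crd p w" unfolding w(2) by (rule crd_pr[OF jI pI])
      finally show ?thesis using crd_off[OF w(1) pI] by simp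
    qed
    then show "x k \<in> R.lat" using R.W_V[OF x[OF k]] by (simp add: R.lat_def)
  qed
  have "conf J (restr J) B 1 (pr j ` W - {0})"
    unfolding conf_def conf_axioms_def
    using R.based_form_axioms R.fin_W R.W_minus R.zero_W R.B_W R.W_V R.W_bound int by auto
  then interpret U: conf J "restr J" B 1 "pr j ` W - {0}" .
  show ?thesis using U.card_unimodular by (simp add: J_def)
qed

lemma kernel_off: "card {v \<in> W. pr j v = 0} \<le> 4"
proof -
  have "{v \<in> W. pr j v = 0} \<subseteq> {B j, - B j, (1/2) *\<^sub>R B j, (-1/2) *\<^sub>R B j}"
  proof
    fix v assume "v \<in> {v \<in> W. pr j v = 0}"
    then have v: "v \<in> W" "\<forall>k\<in>I - {j}. crd k v = 0" using proj_eq_0_iff[of "I - {j}" v] by auto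
    have e: "v = crd j v *\<^sub>R B j"
      by (rule eqI) (use v W_V jI in \<open>auto intro: span_scale B_in_V\<close>)
    have "crd j v \<noteq> 0" using e v(1) zero_W by auto
    then consider "crd j v = 1" | "crd j v = -1" | "crd j v = 1/2" | "crd j v = -1/2"
      using crd_cases[OF v(1) jI] by blast
    then show "v \<in> {B j, - B j, (1/2) *\<^sub>R B j, (-1/2) *\<^sub>R B j}"
    proof cases
      case 1 then show ?thesis using e by simp
    next
      case 2 then show ?thesis using e by simp
    next
      case 3 then show ?thesis using e by (metis insertCI)
    next
      case 4 then show ?thesis using e by (metis insertCI)
    qed
  qed
  then have "card {v \<in> W. pr j v = 0} \<le> card {B j, - B j, (1/2) *\<^sub>R B j, (-1/2) *\<^sub>R B j}" by (intro card_mono) auto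
  also have "\<dots> \<le> 4" by (simp add: card_insert_if)
  finally show ?thesis .
qed

lemma card_W_simple:
  assumes one: "\<And>u v. u \<in> W \<Longrightarrow> v \<in> W \<Longrightarrow> pr j u = pr j v \<Longrightarrow> pr j u \<noteq> 0 \<Longrightarrow> u = v"
  shows "card W \<le> card I ^ 2 + 3 * card I"
proof -
  let ?W = "{v \<in> W. pr j v \<noteq> 0}"
  have "W = {v \<in> W. pr j v = 0} \<union> ?W" by auto
  then have "card W \<le> card {v \<in> W. pr j v = 0} + card ?W" by (metis (lifting) card_Un_le)
  also have "card ?W = card (pr j ` ?W)"
    by (rule card_image[symmetric]) (use one in \<open>auto intro: inj_onI\<close>)
  also have "\<dots> \<le> card (pr j ` W - {0})" by (rule card_mono) (use fin_W in auto)
  finally have "card W \<le> 4 + (card (I - {j}) ^ 2 + card (I - {j}))"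
    using kernel_off card_off by linarith
  moreover obtain r where "card I = Suc r" "card (I - {j}) = r"
    using jI fin_I by (metis card_Suc_Diff1)
  ultimately show ?thesis by (simp add: power2_eq_square)
qed

text \<open>Contraction of a basis vector off the row j.\<close>

definition rest :: "nat \<Rightarrow> nat set" where "rest i = I - {i, j}"

abbreviation \<rho> :: "nat \<Rightarrow> 'v \<Rightarrow> 'v" where "\<rho> i \<equiv> proj (rest i)"

lemma rho_eq_iff: "\<rho> i u = \<rho> i v \<longleftrightarrow> (\<forall>k\<in>rest i. crd k u = crd k v)"
  by (rule proj_eq_iff) (auto simp: rest_def)
lemma rho_eq_0_iff: "\<rho> i v = 0 \<longleftrightarrow> (\<forall>k\<in>rest i. crd k v = 0)"
  by (rule proj_eq_0_iff) (auto simp: rest_def)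

definition over :: "nat \<Rightarrow> 'v set" where
  "over i = {v \<in> W. crd i v = 1 \<and> \<rho> i v = 0}"

definition bad :: "nat \<Rightarrow> 'v set" where
  "bad i = {h. h \<noteq> 0 \<and> (\<exists>d\<in>D i. \<exists>e\<in>D i. d \<noteq> e \<and> \<rho> i d = h \<and> \<rho> i e = h)}"

lemma crd_rho_pr: "i \<in> I \<Longrightarrow> \<rho> i (pr i v) = \<rho> i v"
  by (rule proj_proj) (auto simp: rest_def)

lemma fibre_off:
  assumes i: "i \<in> I" "i \<noteq> j" and uv: "u \<in> W" "v \<in> W" "u \<noteq> v" "pr i u = pr i v" "\<rho> i u \<noteq> 0"
  shows "\<bar>crd i u - crd i v\<bar> = 1"
proof -
  obtain a where a: "a \<in> rest i" "crd a u \<noteq> 0" using uv(5) rho_eq_0_iff by blast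
  have aI: "a \<in> I" "a \<noteq> i" "a \<noteq> j" using a by (auto simp: rest_def)
  have c: "crd a v = crd a u" using uv(4) pr_eq_iff[of i u v] aI by simp
  have "\<bar>crd a u\<bar> = 1" using crd_off_cases[OF uv(1) aI(1,3)] a(2) by auto
  moreover have "\<bar>crd i u * crd a v - crd a u * crd i v\<bar> \<le> 1"
    using i aI uv by (intro minor2(1)) auto
  then have "\<bar>(crd i u - crd i v) * crd a u\<bar> \<le> 1" unfolding c by (simp add: algebra_simps)
  ultimately have le: "\<bar>crd i u - crd i v\<bar> \<le> 1" by (simp add: abs_mult)
  have ne: "crd i u - crd i v \<noteq> 0"
  proof
    assume z: "crd i u - crd i v = 0"
    have "u = v"
    proof (rule eqI)
      show "u \<in> V" "v \<in> V" using uv W_V by auto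
      fix k assume k: "k \<in> I"
      show "crd k u = crd k v"
      proof (cases "k = i")
        case False
        then show ?thesis using uv(4) pr_eq_iff[of i u v] k by auto
      qed (use z in simp)
    qed
    then show False using uv by simp
  qed
  have "crd i u - crd i v \<in> \<int>" using crd_off uv i by (intro Ints_diff) auto
  then have "crd i u - crd i v = 1 \<or> crd i u - crd i v = -1" using le ne by (intro int_abs_less_2) auto
  then show ?thesis by auto
qed

lemma D_off_lifts:
  assumes i: "i \<in> I" "i \<noteq> j" and d: "d \<in> D i" "\<rho> i d \<noteq> 0"
  obtains u v where "u \<in> W" "v \<in> W" "pr i u = d" "pr i v = d" "crd i v = crd i u + 1"
proof -
  obtain u v where uv: "u \<in> W" "v \<in> W" "u \<noteq> v" "pr i u = d" "pr i v = d"
    using d(1) unfolding D_def by blast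
  have "pr i u = pr i v" using uv by simp
  moreover have "\<rho> i u \<noteq> 0" using d(2) unfolding uv(4)[symmetric] crd_rho_pr[OF i(1)] .
  ultimately have "\<bar>crd i u - crd i v\<bar> = 1" by (rule fibre_off[OF i uv(1-3)])
  then have "crd i v = crd i u + 1 \<or> crd i u = crd i v + 1" by linarith
  then show ?thesis using that[OF uv(1,2,4,5)] that[OF uv(2,1,5,4)] by blast
qed

lemma bad_lifts:
  assumes i: "i \<in> I" "i \<noteq> j" and de: "d \<in> D i" "e \<in> D i" "d \<noteq> e" "\<rho> i d = \<rho> i e" "\<rho> i d \<noteq> 0"
    and y: "y \<in> over i" "crd j y \<noteq> 0"
  shows "\<bar>crd j y\<bar> = 1/2" "\<bar>crd j d - crd j e\<bar> = 1/2"
    and "\<exists>u\<in>W. \<rho> i u = \<rho> i d \<and> u + (1/2) *\<^sub>R B j \<in> W \<and> u + B i \<in> W \<and> u + (1/2) *\<^sub>R B j + B i \<in> W"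
proof -
  obtain u1 v1 where u1: "u1 \<in> W" "v1 \<in> W" "pr i u1 = d" "pr i v1 = d" "crd i v1 = crd i u1 + 1"
    by (rule D_off_lifts[OF i de(1,5)])
  have "\<rho> i e \<noteq> 0" using de by simp
  from D_off_lifts[OF i de(2) this] obtain u2 v2 where
    u2: "u2 \<in> W" "v2 \<in> W" "pr i u2 = e" "pr i v2 = e" "crd i v2 = crd i u2 + 1" .
  have cd: "crd k d = crd k u1" "crd k v1 = crd k u1" "crd k e = crd k u2" "crd k v2 = crd k u2"
    if "k \<in> I" "k \<noteq> i" for k
    using crd_pr[OF i(1) that, of u1] crd_pr[OF i(1) that, of u2] crd_pr[OF i(1) that, of v1]
      crd_pr[OF i(1) that, of v2] u1(3,4) u2(3,4) by auto
  have cdi: "crd i d = 0" "crd i e = 0" using i unfolding u1(3)[symmetric] u2(3)[symmetric] by simp_all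
  have r: "crd k e = crd k d" if "k \<in> rest i" for k using de(4) that unfolding rho_eq_iff by simp
  obtain a where a: "a \<in> rest i" "crd a d \<noteq> 0" using de(5) rho_eq_0_iff by blast
  have aI: "a \<in> I" "a \<noteq> i" "a \<noteq> j" using a by (auto simp: rest_def)
  have aQ: "a \<in> Q" using off_Q aI by blast
  have ca: "crd a u1 = crd a d" "crd a v1 = crd a d" "crd a u2 = crd a d" "crd a v2 = crd a d"
    using cd[OF aI(1,2)] r[OF a(1)] by simp_all
  have ii: "crd i u1 = crd i u2"
    by (rule lifts_aligned[OF i(1) aQ aI(2) _ _ _ _ u1(1,2) u2(1,2) u1(5) u2(5)]) (use ca a in simp_all)
  have h: "\<bar>crd a d\<bar> = 1" using crd_off_cases[OF u1(1) aI(1,3)] ca(1) a(2) by auto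
  have yW: "y \<in> W" "crd i y = 1" "crd a y = 0" using y(1) a(1) unfolding over_def rho_eq_0_iff by auto
  have tri: "\<bar>crd j v - crd j u - crd j y\<bar> \<le> 1"
    if "u \<in> W" "v \<in> W" "crd a u = crd a d" "crd a v = crd a d" "crd i v = crd i u + 1" for u v
  proof -
    have "\<bar>crd j y * (crd i u * crd a v - crd a u * crd i v)
       - crd i y * (crd j u * crd a v - crd a u * crd j v)
       + crd a y * (crd j u * crd i v - crd i u * crd j v)\<bar> \<le> 1"
      using jI i aI that yW by (intro minor3) auto
    then have "\<bar>crd a d * (crd j v - crd j u - crd j y)\<bar> \<le> 1"
      unfolding yW that(3-5) by (simp add: algebra_simps)
    then show ?thesis using h by (simp add: abs_mult)
  qed
  have cj: "crd j u1 = crd j d" "crd j v1 = crd j d" "crd j u2 = crd j e" "crd j v2 = crd j e"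
    using cd[OF jI] i by auto
  have t1: "\<bar>crd j e - crd j d - crd j y\<bar> \<le> 1" using tri[OF u1(1) u2(2) ca(1,4)] u2(5) ii cj by simp
  have t2: "\<bar>crd j d - crd j e - crd j y\<bar> \<le> 1" using tri[OF u2(1) u1(2) ca(3,2)] u1(5) ii cj by simp
  have dne: "crd j d \<noteq> crd j e"
  proof
    assume j: "crd j d = crd j e"
    have "d = e"
    proof (rule eqI)
      show "d \<in> V" "e \<in> V" unfolding u1(3)[symmetric] u2(3)[symmetric] by (rule proj_in_V; simp)+
      fix k assume "k \<in> I"
      then consider "k = i" | "k = j" | "k \<in> rest i" by (auto simp: rest_def)
      then show "crd k d = crd k e" by cases (use cdi j r in simp_all)
    qed
    then show False using de by simp
  qed
  have "2 * (crd j d - crd j e) = 2 * crd j u1 - 2 * crd j u2" using cj by simp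
  then have "2 * (crd j d - crd j e) \<in> \<int>" using crd_half[OF u1(1) jI] crd_half[OF u2(1) jI] Ints_diff by metis
  then have h1: "1/2 \<le> \<bar>crd j d - crd j e\<bar>" using dne by (intro half_int_pos(1)) auto
  have h2: "1/2 \<le> \<bar>crd j y\<bar>" using half_int_pos(1)[OF crd_half[OF yW(1) jI] y(2)] .
  show y2: "\<bar>crd j y\<bar> = 1/2" and d2: "\<bar>crd j d - crd j e\<bar> = 1/2"
    using t1 t2 h1 h2 by linarith+
  have uV: "u1 \<in> V" "v1 \<in> V" "u2 \<in> V" "v2 \<in> V" using u1 u2 W_V by auto
  have v1: "v1 = u1 + B i" using eq_add_B[OF uV(1,2) i(1) u1(5)] cd(2) by simp
  have v2: "v2 = u2 + B i" using eq_add_B[OF uV(3,4) i(1) u2(5)] cd(4) by simp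
  have oth: "crd k u2 = crd k u1" if k: "k \<in> I" "k \<noteq> j" for k
  proof (cases "k = i")
    case False
    then have "k \<in> rest i" using k by (auto simp: rest_def)
    then show ?thesis using r cd[OF k(1) False] by simp
  qed (use ii in simp)
  have g: "\<rho> i u1 = \<rho> i d" "\<rho> i u2 = \<rho> i d"
    using crd_rho_pr[OF i(1), of u1] crd_rho_pr[OF i(1), of u2] u1(3) u2(3) de(4) by simp_all
  have "crd j u2 = crd j u1 + 1/2 \<or> crd j u1 = crd j u2 + 1/2" using d2 cj by linarith
  then show "\<exists>u\<in>W. \<rho> i u = \<rho> i d \<and> u + (1/2) *\<^sub>R B j \<in> W \<and> u + B i \<in> W \<and> u + (1/2) *\<^sub>R B j + B i \<in> W"
  proof
    assume "crd j u2 = crd j u1 + 1/2"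
    then have e: "u2 = u1 + (1/2) *\<^sub>R B j" using eq_add_B[OF uV(1,3) jI] oth by simp
    then have "u1 + (1/2) *\<^sub>R B j \<in> W" "u1 + B i \<in> W" "u1 + (1/2) *\<^sub>R B j + B i \<in> W"
      using u1(2) u2(1,2) unfolding v1 v2 by simp_all
    then show ?thesis using u1(1) g by blast
  next
    assume "crd j u1 = crd j u2 + 1/2"
    then have e: "u1 = u2 + (1/2) *\<^sub>R B j" using eq_add_B[OF uV(3,1) jI] oth by simp
    then have "u2 + (1/2) *\<^sub>R B j \<in> W" "u2 + B i \<in> W" "u2 + (1/2) *\<^sub>R B j + B i \<in> W"
      using u2(2) u1(1,2) unfolding v1 v2 by simp_all
    then show ?thesis using u2(1) g by blast
  qed
qed

lemma card_D_off:
  assumes i: "i \<in> I" "i \<noteq> j" and y: "y \<in> over i" "crd j y \<noteq> 0"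
  shows "card {d \<in> D i. \<rho> i d \<noteq> 0} \<le> 2 * card (rest i) + card (bad i)" "finite (bad i)"
proof -
  let ?G = "\<rho> i ` D i - {0}"
  have fG: "finite ?G" using finite_D by simp
  have "bad i \<subseteq> ?G" unfolding bad_def by blast
  then show fb: "finite (bad i)" using fG by (rule finite_subset)
  have restQ: "rest i \<subseteq> Q" using off_Q by (auto simp: rest_def)
  have cG: "card ?G \<le> 2 * card (rest i)"
  proof (rule card_lifted_parts[OF restQ i(1) _ fG])
    show "i \<notin> rest i" by (simp add: rest_def)
    fix g assume g: "g \<in> ?G"
    then obtain d where d: "d \<in> D i" "g = \<rho> i d" "\<rho> i d \<noteq> 0" by blast
    obtain u v where uv: "u \<in> W" "v \<in> W" "pr i u = d" "pr i v = d" "crd i v = crd i u + 1"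
      by (rule D_off_lifts[OF i d(1,3)])
    have "\<rho> i u = g" "\<rho> i v = g" using crd_rho_pr[OF i(1), of u] crd_rho_pr[OF i(1), of v] uv d(2) by auto
    then show "g \<noteq> 0 \<and> (\<exists>u v. u \<in> W \<and> v \<in> W \<and> \<rho> i u = g \<and> \<rho> i v = g \<and> crd i v = crd i u + 1)"
      using uv g by blast
  qed
  have e: "card {d \<in> D i. \<rho> i d = h} \<le> 1 + (if h \<in> bad i then 1 else 0)" if h: "h \<in> ?G" for h
  proof (cases "h \<in> bad i")
    case False
    have fin: "finite {d \<in> D i. \<rho> i d = h}" using finite_D by simp
    have one: "d = e" if "d \<in> {d \<in> D i. \<rho> i d = h}" "e \<in> {d \<in> D i. \<rho> i d = h}" for d e
      using False h that unfolding bad_def by blast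
    have "card {d \<in> D i. \<rho> i d = h} \<le> Suc 0" unfolding card_le_Suc0_iff_eq[OF fin] using one by blast
    then show ?thesis by simp
  next
    case True
    have "card {d \<in> D i. \<rho> i d = h} \<le> 2"
    proof (rule ccontr)
      assume "\<not> ?thesis"
      from three_elements[OF this] obtain a b c where
        m: "a \<in> {d \<in> D i. \<rho> i d = h}" "b \<in> {d \<in> D i. \<rho> i d = h}" "c \<in> {d \<in> D i. \<rho> i d = h}"
        and abc: "a \<noteq> b" "a \<noteq> c" "b \<noteq> c" .
      have m': "a \<in> D i" "b \<in> D i" "c \<in> D i" "\<rho> i a = \<rho> i b" "\<rho> i a = \<rho> i c" "\<rho> i b = \<rho> i c" "\<rho> i a \<noteq> 0" "\<rho> i b \<noteq> 0"
        using m h by auto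
      show False
        using bad_lifts(2)[OF i m'(1,2) abc(1) m'(4,7) y] bad_lifts(2)[OF i m'(1,3) abc(2) m'(5,7) y]
          bad_lifts(2)[OF i m'(2,3) abc(3) m'(6,8) y] by linarith
    qed
    then show ?thesis using True by simp
  qed
  have "{d \<in> D i. \<rho> i d \<noteq> 0} = (\<Union>h\<in>?G. {d \<in> D i. \<rho> i d = h})" by auto
  then have "card {d \<in> D i. \<rho> i d \<noteq> 0} = card (\<Union>h\<in>?G. {d \<in> D i. \<rho> i d = h})" by (rule arg_cong)
  also have "\<dots> \<le> (\<Sum>h\<in>?G. card {d \<in> D i. \<rho> i d = h})" by (rule card_UN_le[OF fG])
  also have "\<dots> \<le> (\<Sum>h\<in>?G. 1 + (if h \<in> bad i then 1 else 0))" by (rule sum_mono) (rule e)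
  also have "\<dots> = card ?G + (\<Sum>h\<in>?G. if h \<in> bad i then 1 else 0)" by (simp only: sum.distrib) simp
  also have "(\<Sum>h\<in>?G. if h \<in> bad i then 1 else 0) = card {h \<in> ?G. h \<in> bad i}"
    using fG by (simp add: sum.If_cases Int_def)
  also have "\<dots> \<le> card (bad i)" using fb by (intro card_mono) auto
  finally show "card {d \<in> D i. \<rho> i d \<noteq> 0} \<le> 2 * card (rest i) + card (bad i)" using cG by linarith
qed

lemma card_W_off:
  assumes i: "i \<in> I" "i \<noteq> j"
  shows "card W \<le> card (pr i ` W - {0}) + 2 * card (over i) + card {d \<in> D i. \<rho> i d \<noteq> 0}"
proof -
  let ?X = "{d \<in> pr i ` W. \<rho> i d \<noteq> 0}" and ?Y = "{d \<in> pr i ` W - {0}. \<rho> i d = 0}"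
  let ?Z = "{v \<in> W. \<rho> i v = 0 \<and> crd i v = 0}"
  have fX: "finite ?X" and fY: "finite ?Y" using fin_W by simp_all
  have fo: "finite (over i)" unfolding over_def using fin_W by simp
  have p0: "\<rho> i 0 = 0" by (rule proj_zero) (auto simp: rest_def)
  have "pr i ` W - {0} = ?X \<union> ?Y" using p0 by auto
  moreover have "card (?X \<union> ?Y) = card ?X + card ?Y" using fX fY by (intro card_Un_disjoint) auto
  ultimately have XY: "card (pr i ` W - {0}) = card ?X + card ?Y" by (rule ssubst[where P="\<lambda>s. card s = _"])
  have "W \<subseteq> ?Z \<union> over i \<union> uminus ` over i \<union> (\<Union>d\<in>?X. {v \<in> W. pr i v = d})"
  proof
    fix v assume v: "v \<in> W"
    show "v \<in> ?Z \<union> over i \<union> uminus ` over i \<union> (\<Union>d\<in>?X. {v \<in> W. pr i v = d})"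
    proof (cases "\<rho> i v = 0")
      case False
      then have "pr i v \<in> ?X" using v crd_rho_pr[OF i(1), of v] by simp
      then show ?thesis using v by blast
    next
      case True
      have m: "\<rho> i (- v) = 0" using True proj_minus[of "rest i" v] by (auto simp: rest_def)
      consider "crd i v = 0" | "crd i v = 1" | "crd i v = -1" using crd_off_cases[OF v i] by blast
      then show ?thesis
      proof cases
        case 1
        then show ?thesis using True v by blast
      next
        case 2
        then show ?thesis using True v by (simp add: over_def)
      next
        case 3
        then have "- v \<in> over i" using m W_minus[OF v] i(1) by (simp add: over_def)
        then have "v \<in> uminus ` over i" by (metis add.inverse_inverse imageI)
        then show ?thesis by blast
      qed
    qed
  qed
  then have "card W \<le> card (?Z \<union> over i \<union> uminus ` over i \<union> (\<Union>d\<in>?X. {v \<in> W. pr i v = d}))"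
    by (rule card_mono[rotated]) (use fin_W fo fX in auto)
  also have "\<dots> \<le> card ?Z + card (over i) + card (uminus ` over i) + card (\<Union>d\<in>?X. {v \<in> W. pr i v = d})"
    by (meson add_le_mono card_Un_le le_trans order_refl)
  finally have 1: "card W \<le> card ?Z + card (over i) + card (uminus ` over i) + card (\<Union>d\<in>?X. {v \<in> W. pr i v = d})" .
  have 2: "card (uminus ` over i) \<le> card (over i)" by (rule card_image_le[OF fo])
  have 3: "card ?Z \<le> card ?Y"
  proof (rule card_mono[OF fY])
    show "?Z \<subseteq> ?Y"
    proof
      fix v assume "v \<in> ?Z"
      then have v: "v \<in> W" "\<rho> i v = 0" "crd i v = 0" by auto
      have "pr i v = v"
      proof (rule eqI)
        show "pr i v \<in> V" by (rule proj_in_V) auto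
        show "v \<in> V" by (rule W_V[OF v(1)])
        fix k assume "k \<in> I"
        then show "crd k (pr i v) = crd k v" using v(3) i(1) by (cases "k = i") auto
      qed
      moreover have "v \<noteq> 0" using v(1) zero_W by auto
      ultimately show "v \<in> ?Y" using v(1,2) by (metis (mono_tags, lifting) DiffI imageI mem_Collect_eq singletonD)
    qed
  qed
  have "card (\<Union>d\<in>?X. {v \<in> W. pr i v = d}) \<le> (\<Sum>d\<in>?X. card {v \<in> W. pr i v = d})"
    by (rule card_UN_le[OF fX])
  also have "\<dots> \<le> (\<Sum>d\<in>?X. 1 + (if d \<in> D i then 1 else 0))"
  proof (rule sum_mono)
    fix d assume d: "d \<in> ?X"
    have fin: "finite {v \<in> W. pr i v = d}" using fin_W by simp
    show "card {v \<in> W. pr i v = d} \<le> 1 + (if d \<in> D i then 1 else 0)"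
    proof (cases "d \<in> D i")
      case False
      have one: "u = v" if "u \<in> {v \<in> W. pr i v = d}" "v \<in> {v \<in> W. pr i v = d}" for u v
      proof (rule ccontr)
        assume "u \<noteq> v"
        moreover have "d \<noteq> 0" using d p0 by auto
        ultimately have "d \<in> D i" using that unfolding D_def by blast
        then show False using False by blast
      qed
      have "card {v \<in> W. pr i v = d} \<le> Suc 0" unfolding card_le_Suc0_iff_eq[OF fin] using one by blast
      then show ?thesis by simp
    next
      case True
      have "card {v \<in> W. pr i v = d} \<le> 2"
      proof (rule ccontr)
        assume "\<not> ?thesis"
        from three_elements[OF this] obtain a b c where
          m: "a \<in> {v \<in> W. pr i v = d}" "b \<in> {v \<in> W. pr i v = d}" "c \<in> {v \<in> W. pr i v = d}"
          and abc: "a \<noteq> b" "a \<noteq> c" "b \<noteq> c" .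
        have m': "a \<in> W" "b \<in> W" "c \<in> W" "pr i a = pr i b" "pr i a = pr i c" "pr i b = pr i c" using m by auto
        have r: "\<rho> i a \<noteq> 0" "\<rho> i b \<noteq> 0"
          using m d crd_rho_pr[OF i(1), of a] crd_rho_pr[OF i(1), of b] by auto
        show False
          using fibre_off[OF i m'(1,2) abc(1) m'(4) r(1)] fibre_off[OF i m'(1,3) abc(2) m'(5) r(1)]
            fibre_off[OF i m'(2,3) abc(3) m'(6) r(2)] by linarith
      qed
      then show ?thesis using True by simp
    qed
  qed
  also have "\<dots> = card ?X + (\<Sum>d\<in>?X. if d \<in> D i then 1 else 0)" by (simp only: sum.distrib) simp
  also have "(\<Sum>d\<in>?X. if d \<in> D i then 1 else 0) = card {d \<in> ?X. d \<in> D i}"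
    using fX by (simp add: sum.If_cases Int_def)
  also have "\<dots> \<le> card {d \<in> D i. \<rho> i d \<noteq> 0}" using finite_D by (intro card_mono) auto
  finally show ?thesis using 1 2 3 XY by linarith
qed

lemma onerow_rebase:
  assumes i: "i \<in> I" "i \<noteq> j" and v: "v \<in> W" "crd i v \<noteq> 0"
  shows "onerow I (\<lambda>x. \<omega> x / crd i v) (B(i := v)) W j"
proof -
  have w: "\<omega> (B(i := v)) = crd i v" by (simp add: crd_def)
  have c: "crd i v = 1 \<or> crd i v = -1" using crd_off_cases[OF v(1) i] v(2) by blast
  have CW: "(B(i := v)) k \<in> W" if "k \<in> I" for k using v(1) B_W[OF that] by simp
  have C1: "\<bar>\<omega> (B(i := v))\<bar> = 1" using w c by auto
  note bm = bimod_rebase[OF CW C1]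
  have "Kset (B(i := v)) \<subseteq> {j}"
  proof
    fix k assume "k \<in> Kset (B(i := v))"
    then obtain u where k: "k \<in> I" "u \<in> W" "\<omega> (B(i := v, k := u)) \<notin> \<int>" unfolding Kset_def by blast
    show "k \<in> {j}"
    proof (rule ccontr)
      assume "k \<notin> {j}"
      then have kj: "k \<noteq> j" by simp
      have "\<omega> (B(i := v, k := u)) \<in> \<int>"
      proof (cases "k = i")
        case True
        then have "\<omega> (B(i := v, k := u)) = crd i u" by (simp add: crd_def)
        then show ?thesis using crd_off[OF k(2) i] by simp
      next
        case False
        have "\<omega> (B(i := v, k := u)) = crd i v * crd k u - crd k v * crd i u"
          using i(1) k(1) False W_V[OF v(1)] W_V[OF k(2)] by (intro form2) auto
        then show ?thesis using crd_off[OF v(1)] crd_off[OF k(2)] i k(1) kj by simp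
      qed
      then show False using k(3) by simp
    qed
  qed
  then show ?thesis
    unfolding onerow_def onerow_axioms_def using bm Kset_rebase[OF CW C1, of "B(i := v)"] jI w by simp
qed

end


context onerow begin

lemma card_arith:
  assumes i: "i \<in> I" "i \<noteq> j"
  obtains r where "card I = r + 2" "card (I - {i}) = r + 1" "card (rest i) = r"
proof -
  have "card (I - {i}) = card I - 1" using i fin_I by simp
  moreover have "card (rest i) = card I - 2"
  proof -
    have "rest i = I - {i} - {j}" by (auto simp: rest_def)
    then show ?thesis using i jI fin_I by simp
  qed
  moreover have "card {i, j} \<le> card I" using i jI fin_I by (intro card_mono) auto
  then have "2 \<le> card I" using i(2) by simp
  ultimately show ?thesis using that[of "card I - 2"] by simp
qed

lemma card_contracted:
  assumes IH: "\<forall>J \<omega>' (B' :: nat \<Rightarrow> 'v) W'. bimod J \<omega>' B' W' \<and> card J < card I \<longrightarrow> card W' \<le> card J ^ 2 + 3 * card J"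
    and i: "i \<in> I" "i \<noteq> j" and y: "y \<in> over i" "crd j y \<noteq> 0"
    and p: "2 * card (over i) + card (bad i) \<le> 6"
  shows "card W \<le> card I ^ 2 + 3 * card I"
proof -
  obtain r where r: "card I = r + 2" "card (I - {i}) = r + 1" "card (rest i) = r"
    by (rule card_arith[OF i])
  have "card (pr i ` W - {0}) \<le> card (I - {i}) ^ 2 + 3 * card (I - {i})"
    by (rule IH[rule_format, OF conjI[OF bimod_restr]]) (use r in auto)
  then have "card (pr i ` W - {0}) \<le> (r + 1) ^ 2 + 3 * (r + 1)" using r(2) by simp
  then have "card W \<le> (r + 1) ^ 2 + 3 * (r + 1) + 6 + 2 * r"
    using card_W_off[OF i] card_D_off(1)[OF i y] p r by linarith
  then show ?thesis using r(1) by (simp add: power2_eq_square)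
qed

lemma over_card_3:
  assumes i: "i \<in> I" "i \<noteq> j" and nn: "\<And>y. y \<in> over i \<Longrightarrow> 0 \<le> crd j y"
  shows "card (over i) \<le> 3"
    and "(\<And>y. y \<in> over i \<Longrightarrow> crd j y \<le> 1/2) \<Longrightarrow> card (over i) \<le> 2"
proof -
  have inj: "inj_on (crd j) (over i)"
  proof (rule inj_onI)
    fix u v assume uv: "u \<in> over i" "v \<in> over i" "crd j u = crd j v"
    have u: "u \<in> W" "crd i u = 1" "\<rho> i u = 0" and v: "v \<in> W" "crd i v = 1" "\<rho> i v = 0"
      using uv unfolding over_def by auto
    show "u = v"
    proof (rule eqI)
      show "u \<in> V" "v \<in> V" using u v W_V by auto
      fix k assume "k \<in> I"
      then consider "k = i" | "k = j" | "k \<in> rest i" by (auto simp: rest_def)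
      then show "crd k u = crd k v"
        by cases (use u v uv(3) rho_eq_0_iff[of i u] rho_eq_0_iff[of i v] in auto)
    qed
  qed
  have c: "crd j y = 0 \<or> crd j y = 1/2 \<or> crd j y = 1" if y: "y \<in> over i" for y
  proof -
    have "y \<in> W" using y unfolding over_def by blast
    then show ?thesis using crd_cases[of y j] jI nn[OF y] by auto
  qed
  have "crd j ` over i \<subseteq> {0, 1/2, 1}" using c by blast
  then have "card (over i) \<le> card {0, 1/2, 1::real}" using inj by (intro card_inj_on_le) auto
  also have "\<dots> \<le> 3" by (simp add: card_insert_if)
  finally show "card (over i) \<le> 3" .
  assume h: "\<And>y. y \<in> over i \<Longrightarrow> crd j y \<le> 1/2"
  have "crd j ` over i \<subseteq> {0, 1/2}" using c h by fastforce
  then have "card (over i) \<le> card {0, 1/2::real}" using inj by (intro card_inj_on_le) auto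
  also have "\<dots> \<le> 2" by (simp add: card_insert_if)
  finally show "card (over i) \<le> 2" .
qed

lemma onerow_extreme:
  assumes IH: "\<forall>J \<omega>' (B' :: nat \<Rightarrow> 'v) W'. bimod J \<omega>' B' W' \<and> card J < card I \<longrightarrow> card W' \<le> card J ^ 2 + 3 * card J"
    and i: "i \<in> I" "i \<noteq> j" and y: "y \<in> over i" "crd j y \<noteq> 0"
    and nn: "\<And>y. y \<in> over i \<Longrightarrow> 0 \<le> crd j y"
  shows "card W \<le> card I ^ 2 + 3 * card I"
proof (cases "bad i = {}")
  case True
  then have "2 * card (over i) + card (bad i) \<le> 6" using over_card_3(1)[OF i nn] by simp
  then show ?thesis by (rule card_contracted[OF IH i y])
next
  case False
  then obtain h where "h \<in> bad i" by blast
  then obtain d e where de: "d \<in> D i" "e \<in> D i" "d \<noteq> e" "\<rho> i d = h" "\<rho> i e = h" "h \<noteq> 0"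
    unfolding bad_def by blast
  have de': "\<rho> i d = \<rho> i e" "\<rho> i d \<noteq> 0" using de by simp_all
  have half: "crd j z = 1/2" if z: "z \<in> over i" "crd j z \<noteq> 0" for z
    using bad_lifts(1)[OF i de(1-3) de' z] nn[OF z(1)] by simp
  have z12: "crd j z \<le> 1/2" if z: "z \<in> over i" for z using half[OF z] by (cases "crd j z = 0") auto
  have p2: "card (over i) \<le> 2" by (intro over_card_3(2)[OF i nn] z12)
  have yW: "y \<in> W" "crd i y = 1" "\<rho> i y = 0" using y(1) unfolding over_def by auto
  have yr: "crd k y = 0" if "k \<in> rest i" for k using yW(3) that unfolding rho_eq_0_iff by blast
  have ye: "y = B i + (1/2) *\<^sub>R B j"
  proof (rule eq_add_B[OF _ _ jI])
    show "B i \<in> V" "y \<in> V" using i B_in_V W_V yW by auto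
    show "crd j y = crd j (B i) + 1/2" using half[OF y] i jI by simp
    fix k assume "k \<in> I" "k \<noteq> j"
    then show "crd k y = crd k (B i)" using yW(2) yr[of k] i by (cases "k = i") (auto simp: rest_def)
  qed
  interpret N: onerow I "\<lambda>x. \<omega> x / crd i y" "B(i := y)" W j
    using onerow_rebase[OF i yW(1)] yW(2) by simp
  have Nval: "N.crd k v = crd k v - crd k y * crd i v" if "k \<in> I" "k \<noteq> i" "v \<in> V" for k v
  proof -
    have "\<omega> (B(i := y, k := v)) = crd i y * crd k v - crd k y * crd i v"
      using i that W_V[OF yW(1)] by (intro form2) auto
    then show ?thesis unfolding N.crd_def using yW(2) by simp
  qed
  have Ni: "N.crd i v = crd i v" for v unfolding N.crd_def fun_upd_upd by (simp only: yW(2) div_by_1) (simp only: crd_def)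
  have Nr: "N.crd k v = crd k v" if "k \<in> rest i" "v \<in> V" for k v
    using Nval[of k v] that yr[OF that(1)] by (simp add: rest_def)
  have Nrho: "N.\<rho> i v = \<rho> i v" if v: "v \<in> V" for v
    unfolding N.proj_def proj_def
  proof (rule sum.cong[OF refl])
    fix k assume k: "k \<in> rest i"
    then have "k \<noteq> i" by (simp add: rest_def)
    then have "(B(i := y)) k = B k" by simp
    then show "N.crd k v *\<^sub>R (B(i := y)) k = crd k v *\<^sub>R B k" by (simp only: Nr[OF k v])
  qed
  have Nover: "N.over i = over i"
  proof (rule Set.set_eqI)
    fix z
    show "z \<in> N.over i \<longleftrightarrow> z \<in> over i"
    proof (cases "z \<in> W")
      case True
      show ?thesis unfolding N.over_def over_def mem_Collect_eq Ni Nrho[OF W_V[OF True]] by (rule refl)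
    next
      case False
      then show ?thesis unfolding N.over_def over_def by blast
    qed
  qed
  have yN: "B i \<in> N.over i" "N.crd j (B i) \<noteq> 0"
  proof -
    have "\<rho> i (B i) = 0" unfolding rho_eq_0_iff using i by (auto simp: rest_def)
    then show "B i \<in> N.over i" unfolding Nover over_def using B_W[OF i(1)] i by simp
    have "N.crd j (B i) = - (1/2)" using Nval[OF jI i(2)[symmetric] B_in_V[OF i(1)]] i jI half[OF y] by simp
    then show "N.crd j (B i) \<noteq> 0" by simp
  qed
  show ?thesis
  proof (cases "N.bad i = {}")
    case True
    then have "2 * card (N.over i) + card (N.bad i) \<le> 6" using p2 Nover by simp
    then show ?thesis by (rule N.card_contracted[OF IH i yN])
  next
    case False
    then obtain h' where "h' \<in> N.bad i" by blast
    then obtain d' e' where de': "d' \<in> N.D i" "e' \<in> N.D i" "d' \<noteq> e'" "N.\<rho> i d' = h'" "N.\<rho> i e' = h'" "h' \<noteq> 0"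
      unfolding N.bad_def by blast
    have de2: "N.\<rho> i d' = N.\<rho> i e'" "N.\<rho> i d' \<noteq> 0" using de' by simp_all
    obtain v where v: "v \<in> W" "N.\<rho> i v = h'" "v + (1/2) *\<^sub>R B j + y \<in> W"
      using N.bad_lifts(3)[OF i de'(1-3) de2 yN] de'(4) i by auto
    have vr: "\<rho> i v = h'" using Nrho[OF W_V[OF v(1)]] v(2) by simp
    have v2: "v + (1/2) *\<^sub>R B j + y = v + (B i + B j)"
      unfolding ye by (simp add: algebra_simps flip: scaleR_add_left)
    have "bad i \<subseteq> {h', - h'}"
    proof
      fix g assume "g \<in> bad i"
      then obtain a b where ab: "a \<in> D i" "b \<in> D i" "a \<noteq> b" "\<rho> i a = g" "\<rho> i b = g" "g \<noteq> 0"
        unfolding bad_def by blast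
      have ab2: "\<rho> i a = \<rho> i b" "\<rho> i a \<noteq> 0" using ab by simp_all
      obtain u where u: "u \<in> W" "\<rho> i u = g" "u + (1/2) *\<^sub>R B j \<in> W" "u + B i \<in> W"
        using bad_lifts(3)[OF i ab(1-3) ab2 y] ab(4) by blast
      show "g \<in> {h', - h'}"
      proof (rule ccontr)
        assume no: "g \<notin> {h', - h'}"
        have gu: "\<rho> i (u + (1/2) *\<^sub>R B j) = g"
        proof -
          have "\<rho> i (u + (1/2) *\<^sub>R B j) = \<rho> i u"
            unfolding rho_eq_iff using jI by (auto simp: rest_def)
          then show ?thesis using u(2) by simp
        qed
        let ?p = "B i - (1/2) *\<^sub>R B j" and ?r = "B i + B j"
        have "\<bar>crd i ?p * crd j ?r - crd j ?p * crd i ?r\<bar> \<le> 1"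
        proof (rule diff_minor[of "rest i" i j "u + (1/2) *\<^sub>R B j" "u + B i" v "v + (B i + B j)"])
          show "rest i \<subseteq> Q" using off_Q by (auto simp: rest_def)
          show "i \<in> I - rest i" "j \<in> I - rest i" using i jI by (auto simp: rest_def)
          show "?p \<in> V" "?r \<in> V" using i jI B_in_V by (auto intro: span_add span_diff span_scale)
          show "crd a ?p = 0 \<and> crd a ?r = 0" if "a \<in> rest i" for a using that i jI by (auto simp: rest_def)
          show "v + (B i + B j) \<in> W" using v(3) unfolding v2 .
          show "\<rho> i (u + (1/2) *\<^sub>R B j) \<noteq> 0" "\<rho> i v \<noteq> 0" unfolding gu vr by fact+
          show "\<rho> i (u + (1/2) *\<^sub>R B j) \<noteq> \<rho> i v" "\<rho> i (u + (1/2) *\<^sub>R B j) \<noteq> - \<rho> i v"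
            unfolding gu vr using no by auto
        qed (use i u v in auto)
        then show False using i jI by simp
      qed
    qed
    then have "card (bad i) \<le> card {h', - h'}" by (intro card_mono) auto
    also have "\<dots> \<le> 2" by (simp add: card_insert_if)
    finally have "2 * card (over i) + card (bad i) \<le> 6" using p2 by simp
    then show ?thesis by (rule card_contracted[OF IH i y])
  qed
qed

lemma card_onerow:
  assumes IH: "\<forall>J \<omega>' (B' :: nat \<Rightarrow> 'v) W'. bimod J \<omega>' B' W' \<and> card J < card I \<longrightarrow> card W' \<le> card J ^ 2 + 3 * card J"
  shows "card W \<le> card I ^ 2 + 3 * card I"
proof (cases "\<exists>u\<in>W. \<exists>v\<in>W. pr j u = pr j v \<and> pr j u \<noteq> 0 \<and> u \<noteq> v")
  case False
  then show ?thesis by (intro card_W_simple) blast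
next
  case True
  then obtain u v where uv: "u \<in> W" "v \<in> W" "pr j u = pr j v" "pr j u \<noteq> 0" "u \<noteq> v" by blast
  define F where "F = {w \<in> W. pr j w = pr j u}"
  have "finite F" "F \<noteq> {}" using uv fin_W by (auto simp: F_def)
  then have fin: "finite (crd j ` F)" "crd j ` F \<noteq> {}" by simp_all
  obtain x where x0: "x \<in> F" "Min (crd j ` F) = crd j x" using Min_in[OF fin] by (rule imageE) simp
  have x: "x \<in> F" "crd j x \<le> crd j w" if "w \<in> F" for w
    using x0 Min_le[OF fin(1), of "crd j w"] that by auto
  have xW: "x \<in> W" "pr j x = pr j u" using x0(1) by (auto simp: F_def)
  have "u \<in> F" "v \<in> F" using uv by (auto simp: F_def)
  then obtain w where w: "w \<in> F" "w \<noteq> x" using uv(5) by (cases "u = x") auto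
  have wW: "w \<in> W" "pr j w = pr j u" using w(1) by (auto simp: F_def)
  have "pr j x \<noteq> 0" using xW uv by simp
  then have "\<not> (\<forall>k\<in>I - {j}. crd k x = 0)" using proj_eq_0_iff[of "I - {j}" x] by auto
  then obtain i where i: "i \<in> I" "i \<noteq> j" "crd i x \<noteq> 0" by blast
  interpret M: onerow I "\<lambda>y. \<omega> y / crd i x" "B(i := x)" W j
    by (rule onerow_rebase[OF i(1,2) xW(1) i(3)])
  have MB: "(B(i := x)) i = x" "(B(i := x)) j = B j" using i by auto
  have MBW: "M.crd i x = 1" "M.crd j x = 0" "M.crd i (B j) = 0" "M.crd j (B j) = 1"
    using M.crd_B[OF i(1,1)] M.crd_B[OF jI i(1)] M.crd_B[OF i(1) jI] M.crd_B[OF jI jI] MB i by auto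
  show ?thesis
  proof (rule M.onerow_extreme[OF IH i(1,2)])
    have e: "w = x + (crd j w - crd j x) *\<^sub>R B j"
    proof (rule eq_add_B[OF _ _ jI])
      show "x \<in> V" "w \<in> V" using xW wW W_V by auto
      fix k assume "k \<in> I" "k \<noteq> j"
      then show "crd k w = crd k x" using pr_eq_iff[of j w x] xW(2) wW(2) by auto
    qed simp
    define t where "t = crd j w - crd j x"
    have wt: "w = x + t *\<^sub>R B j" using e by (simp add: t_def)
    have t0: "t \<noteq> 0" using wt w(2) by auto
    have "M.crd i w = 1" unfolding wt using i(1) MBW by simp
    moreover have "M.\<rho> i w = 0"
      unfolding M.rho_eq_0_iff
    proof
      fix k assume "k \<in> M.rest i"
      then have k: "k \<in> I" "k \<noteq> i" "k \<noteq> j" by (auto simp: M.rest_def)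
      have "M.crd k x = 0" "M.crd k (B j) = 0"
        using M.crd_B[OF k(1) i(1)] M.crd_B[OF k(1) jI] MB k by auto
      then show "M.crd k w = 0" unfolding wt using k(1) by simp
    qed
    ultimately show "w \<in> M.over i" unfolding M.over_def using wW(1) by simp
    show "M.crd j w \<noteq> 0" unfolding wt using jI MBW t0 by simp
  next
    fix z assume "z \<in> M.over i"
    then have z: "z \<in> W" "M.crd i z = 1" "M.\<rho> i z = 0" unfolding M.over_def by auto
    have zr: "M.crd k z = 0" if "k \<in> M.rest i" for k using z(3) that unfolding M.rho_eq_0_iff by blast
    define s where "s = M.crd j z"
    have xV: "x \<in> M.V" using xW M.W_V by blast
    have ze: "z = x + s *\<^sub>R (B(i := x)) j"
    proof (rule M.eq_add_B[OF xV M.W_V[OF z(1)] jI])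
      show "M.crd j z = M.crd j x + s" using MBW by (simp add: s_def)
      fix k assume k: "k \<in> I" "k \<noteq> j"
      show "M.crd k z = M.crd k x"
      proof (cases "k = i")
        case False
        then have "k \<in> M.rest i" using k by (simp add: M.rest_def)
        moreover have "M.crd k x = 0" using M.crd_B[OF k(1) i(1)] MB False by auto
        ultimately show ?thesis using zr by simp
      qed (use z MBW in simp)
    qed
    then have ze: "z = x + s *\<^sub>R B j" using MB by simp
    have "pr j z = pr j x" unfolding pr_eq_iff ze using jI by simp
    then have "z \<in> F" using z(1) xW by (simp add: F_def)
    then have "crd j x \<le> crd j z" by (rule x(2))
    moreover have "crd j z = crd j x + s" unfolding ze using jI by simp
    ultimately show "0 \<le> M.crd j z" by (simp add: s_def)
  qed
qed

end

theorem (in bimod) card_bimodular_step: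
  assumes IH: "\<forall>J \<omega>' (B' :: nat \<Rightarrow> 'v) W'. bimod J \<omega>' B' W' \<and> card J < card I \<longrightarrow> card W' \<le> card J ^ 2 + 3 * card J"
    and min: "\<And>C. (\<And>i. i \<in> I \<Longrightarrow> C i \<in> W) \<Longrightarrow> \<bar>\<omega> C\<bar> = 1 \<Longrightarrow> card K \<le> card (Kset C)"
  shows "card W \<le> card I ^ 2 + 3 * card I"
proof -
  interpret minbimod I \<omega> B W by unfold_locales (rule min)
  consider "card K = 0" | "card K = 1" | "2 \<le> card K" by linarith
  then show ?thesis
  proof cases
    case 1
    then have K0: "K = {}" using finite_K by simp
    have int: "\<omega> x \<in> \<int>" if x: "\<And>k. k \<in> I \<Longrightarrow> x k \<in> W" for x
    proof (rule form_lat)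
      fix k assume k: "k \<in> I"
      have "crd p (x k) \<in> \<int>" if "p \<in> I" for p using crd_Q[OF x[OF k], of p] that K0 by simp
      then show "x k \<in> lat" using W_V[OF x[OF k]] by (simp add: lat_def)
    qed
    have "conf I \<omega> B 1 W"
      unfolding conf_def conf_axioms_def
      using based_form_axioms fin_W W_minus zero_W B_W W_V W_bound int by auto
    then interpret U: conf I \<omega> B 1 W .
    show ?thesis using U.card_unimodular by simp
  next
    case 2
    then obtain j where j: "K = {j}" by (auto simp: card_1_singleton_iff)
    interpret onerow I \<omega> B W j by unfold_locales (use j K_I in auto)
    show ?thesis by (rule card_onerow[OF IH])
  next
    case 3
    have "K \<noteq> {}"
    proof
      assume "K = {}"
      then have "card K = 0" by (simp only: card.empty)
      then show False using 3 by simp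
    qed
    then obtain i where i: "i \<in> K" by blast
    have "K \<noteq> {i}"
    proof
      assume "K = {i}"
      then have "card K = card {i}" by (rule arg_cong)
      then show False using 3 by simp
    qed
    then obtain l where l: "l \<in> K" "l \<noteq> i" using i by blast
    have iI: "i \<in> I" using i K_I by auto
    obtain m where m: "card I = m + 1" "card (I - {i}) = m"
      using iI fin_I card_Suc_Diff1[of I i] by (metis Suc_eq_plus1)
    have c1: "card (pr i ` W - {0}) \<le> card (I - {i}) ^ 2 + 3 * card (I - {i})"
      by (rule IH[rule_format, OF conjI[OF bimod_restr]]) (use m in auto)
    have c2: "card W \<le> card (pr i ` W - {0}) + 2 + card (D i)" by (rule card_contract[OF i l])
    have fine: ?thesis if "card (D i) \<le> 2 * card I"
    proof -
      have "card W \<le> m ^ 2 + 3 * m + 2 + 2 * (m + 1)" using c1 c2 that m by simp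
      then show ?thesis using m(1) by (simp add: power2_eq_square)
    qed
    show ?thesis
    proof (cases "5 \<le> card K")
      case True
      then show ?thesis using card_D_large[OF min True i] by (intro fine) simp
    next
      case False
      then have "card K \<le> 4" by simp
      from card_D_small[OF i l this] consider "card (D i) \<le> 2 * card I"
        | "card K = 4" "card (D i) \<le> 10 + 2 * card Q" "sq_parts i \<noteq> {}" "\<exists>\<kappa>\<in>W. \<gamma> \<kappa> = 0 \<and> crd i \<kappa> \<notin> \<int>" by blast
      then show ?thesis
      proof cases
        case 1
        then show ?thesis by (rule fine)
      next
        case 2
        obtain g where "g \<in> sq_parts i" using 2(3) by blast
        then obtain j u where j: "j \<in> K - {i}" "square i j u" "\<gamma> u \<noteq> 0" unfolding sq_parts_def by blast
        obtain \<kappa> where k: "\<kappa> \<in> W" "\<gamma> \<kappa> = 0" "crd i \<kappa> \<notin> \<int>" using 2(4) by blast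
        have jK: "j \<in> K" "i \<noteq> j" using j(1) by auto
        have le: "card W \<le> card (proj (I - {i} - {j}) ` W - {0}) + 18 + 4 * card Q"
          by (rule card_W_two_contractions[OF i jK 2(1) j(2,3) k 2(2)])
        have "card I = card K + card Q"
          using card_Un_disjoint[OF finite_K finite_Q] K_I by (simp add: Diff_disjoint Un_absorb1)
        then have cI: "card I = card Q + 4" using 2(1) by simp
        have jI: "j \<in> I" using jK K_I by auto
        have cJ: "card (I - {i} - {j}) = card Q + 2" using cI iI jI jK fin_I by simp
        have "card (proj (I - {i} - {j}) ` W - {0}) \<le> card (I - {i} - {j}) ^ 2 + 3 * card (I - {i} - {j})"
        proof (rule IH[rule_format, OF conjI[OF bimod_restr]])
          show "I - {i} - {j} \<subseteq> I" by blast
          show "card (I - {i} - {j}) < card I" using cI cJ by simp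
        qed
        then show ?thesis using le unfolding cI cJ by (simp add: power2_eq_square algebra_simps)
      qed
    qed
  qed
qed

theorem card_bimodular:
  assumes "bimod I \<omega> B W"
  shows "card W \<le> card I ^ 2 + 3 * card I"
  using assms
proof (induction "card I" arbitrary: I \<omega> B W rule: less_induct)
  case less
  interpret bimod I \<omega> B W by fact
  define P where "P C \<longleftrightarrow> (\<forall>i\<in>I. C i \<in> W) \<and> \<bar>\<omega> C\<bar> = 1" for C
  have "P B" using B_W form_B by (simp add: P_def)
  then obtain C where C: "P C" "\<And>C'. P C' \<Longrightarrow> card (Kset C) \<le> card (Kset C')"
    using ex_has_least_nat[of P B "\<lambda>C. card (Kset C)"] by blast
  have CW: "\<And>i. i \<in> I \<Longrightarrow> C i \<in> W" and C1: "\<bar>\<omega> C\<bar> = 1" using C(1) by (auto simp: P_def)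
  interpret X: bimod I "\<lambda>x. \<omega> x / \<omega> C" C W by (rule bimod_rebase[OF CW C1])
  show ?case
  proof (rule X.card_bimodular_step)
    show "\<forall>J \<omega>' (B' :: nat \<Rightarrow> 'a) W'. bimod J \<omega>' B' W' \<and> card J < card I \<longrightarrow> card W' \<le> card J ^ 2 + 3 * card J"
      using less.hyps by blast
    fix C' assume C': "\<And>i. i \<in> I \<Longrightarrow> C' i \<in> W" "\<bar>\<omega> C' / \<omega> C\<bar> = 1"
    then have "P C'" using C1 by (simp add: P_def)
    then show "card X.K \<le> card (X.Kset C')"
      using C(2) Kset_rebase[OF CW C1] by simp
  qed
qed


lemma subgroup_scale_int:
  fixes G :: "'a::real_vector set"
  assumes "0 \<in> G" "\<And>a b. a \<in> G \<Longrightarrow> b \<in> G \<Longrightarrow> a - b \<in> G" "v \<in> G"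
  shows "of_int k *\<^sub>R v \<in> G"
proof -
  have neg: "- a \<in> G" if "a \<in> G" for a using assms(2)[OF assms(1) that] by simp
  have add: "a + b \<in> G" if "a \<in> G" "b \<in> G" for a b using assms(2)[OF that(1) neg[OF that(2)]] by simp
  have nat: "real n *\<^sub>R v \<in> G" for n
  proof (induction n)
    case 0
    then show ?case using assms(1) by simp
  next
    case (Suc n)
    have "real (Suc n) *\<^sub>R v = (real n + 1) *\<^sub>R v" by (simp only: of_nat_Suc add.commute)
    also have "\<dots> = real n *\<^sub>R v + v" by (simp only: scaleR_left_distrib scaleR_one)
    finally show ?case using add[OF Suc assms(3)] by (simp only:)
  qed
  show ?thesis
  proof (cases "0 \<le> k")
    case True
    then have "of_int k = (of_nat (nat k) :: real)" by simp
    then show ?thesis using nat[of "nat k"] by (simp only:)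
  next
    case False
    then have e: "of_int k = - (of_nat (nat (- k)) :: real)" by simp
    have "- (of_nat (nat (- k)) *\<^sub>R v) \<in> G" by (rule neg[OF nat])
    then show ?thesis unfolding e by simp
  qed
qed

theorem card_incongruent_le:
  fixes B :: "nat \<Rightarrow> 'v::real_vector"
  assumes "based_form I \<omega> B" "finite X" "X \<subseteq> G"
    and "0 \<in> G" "\<And>a b. a \<in> G \<Longrightarrow> b \<in> G \<Longrightarrow> a - b \<in> G" "\<And>i. i \<in> I \<Longrightarrow> B i \<in> G" "G \<subseteq> span (B ` I)"
    and "\<And>x. (\<And>i. i \<in> I \<Longrightarrow> x i \<in> G) \<Longrightarrow> real n * \<omega> x \<in> \<int>" "n \<ge> 1"
    and "\<And>x y. x \<in> X \<Longrightarrow> y \<in> X \<Longrightarrow> x \<noteq> y \<Longrightarrow> \<exists>i\<in>I. based_form.crd \<omega> B i (x - y) \<notin> \<int>"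
  shows "card X \<le> n"
  using assms
proof (induction "card I" arbitrary: I \<omega> X G n)
  case 0
  interpret based_form I \<omega> B by fact
  have "I = {}" using 0(1) fin_I by simp
  then have "x = y" if "x \<in> X" "y \<in> X" for x y using 0(11)[OF that] by blast
  then have "card X \<le> Suc 0" unfolding card_le_Suc0_iff_eq[OF 0(3)] by blast
  then show ?case using 0(10) by simp
next
  case (Suc c)
  interpret based_form I \<omega> B by fact
  note G0 = Suc.prems(4) and Gd = Suc.prems(5) and BG = Suc.prems(6) and GV = Suc.prems(7)
    and Gint = Suc.prems(8) and n1 = Suc.prems(9) and inc = Suc.prems(10)
  have "I \<noteq> {}" using Suc.hyps(2) by auto
  then obtain i where i: "i \<in> I" by blast
  define J where "J = I - {i}"
  have JI: "J \<subseteq> I" and fJ: "finite J" and iJ: "i \<notin> J" using fin_I by (auto simp: J_def)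
  have cJ: "c = card J" using Suc.hyps(2) i fin_I by (simp add: J_def)
  have Gs: "of_int k *\<^sub>R v \<in> G" if "v \<in> G" for k v using subgroup_scale_int[OF G0 Gd that] .
  have ci: "real n * crd i v \<in> \<int>" if "v \<in> G" for v
    unfolding crd_def by (rule Gint) (use that BG in auto)
  define P where "P p \<longleftrightarrow> 0 < p \<and> (\<exists>v\<in>G. real n * crd i v = real p)" for p :: nat
  have "P n" unfolding P_def using n1 i BG[OF i] by (intro conjI bexI[of _ "B i"]) auto
  define p where "p = (LEAST p. P p)"
  have Pp: "P p" unfolding p_def using \<open>P n\<close> by (rule LeastI)
  have least: "p \<le> r" if "P r" for r unfolding p_def using that by (rule Least_le)
  obtain u where u: "u \<in> G" "real n * crd i u = real p" and p0: "0 < p" using Pp unfolding P_def by blast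
  have mult: "\<exists>t::int. real n * crd i v = real p * of_int t" if v: "v \<in> G" for v
  proof -
    obtain s :: int where s: "real n * crd i v = of_int s" using ci[OF v] by (auto elim: Ints_cases)
    define w where "w = v - of_int (s div int p) *\<^sub>R u"
    have wG: "w \<in> G" unfolding w_def by (intro Gd Gs v u(1))
    have "real n * crd i w = real n * crd i v - of_int (s div int p) * (real n * crd i u)"
      unfolding w_def using i by (simp add: algebra_simps)
    also have "\<dots> = of_int (s - (s div int p) * int p)" unfolding s u(2) by simp
    also have "s - (s div int p) * int p = s mod int p" by (simp add: minus_div_mult_eq_mod)
    finally have w: "real n * crd i w = of_int (s mod int p)" .
    have "0 \<le> s mod int p" "s mod int p < int p" using p0 by simp_all
    have "s mod int p = 0"
    proof (rule ccontr)
      assume "s mod int p \<noteq> 0"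
      then have "0 < nat (s mod int p)" using \<open>0 \<le> s mod int p\<close> by linarith
      moreover have "real (nat (s mod int p)) = of_int (s mod int p)" using \<open>0 \<le> s mod int p\<close> by simp
      ultimately have "P (nat (s mod int p))" unfolding P_def using wG w by auto
      then have "p \<le> nat (s mod int p)" by (rule least)
      moreover have "nat (s mod int p) < p"
        using \<open>s mod int p < int p\<close> \<open>0 \<le> s mod int p\<close> by (simp add: nat_less_iff)
      ultimately show False by simp
    qed
    then have "s = int p * (s div int p)" using mult_div_mod_eq[of "int p" s] by linarith
    then have "real_of_int s = real_of_int (int p * (s div int p))" by (rule arg_cong)
    then have "real n * crd i v = real p * of_int (s div int p)" unfolding s of_int_mult of_int_of_nat_eq .
    then show ?thesis by blast
  qed
  obtain k' :: int where k': "real n * crd i (B i) = real p * of_int k'" using mult[OF BG[OF i]] by blast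
  have "real n = real p * of_int k'" using k' i by simp
  then have "of_int (int n) = (of_int (int p * k') :: real)" by simp
  then have nk': "int n = int p * k'" by (simp only: of_int_eq_iff)
  have k'0: "0 < k'"
  proof (rule ccontr)
    assume "\<not> 0 < k'"
    then have "int p * k' \<le> 0" by (simp add: mult_nonneg_nonpos)
    then show False using nk' n1 by linarith
  qed
  define k where "k = nat k'"
  have k0: "0 < k" and nk: "n = p * k"
  proof -
    show "0 < k" using k'0 by (simp add: k_def)
    have "int n = int (p * k)" using nk' k'0 by (simp add: k_def)
    then show "n = p * k" by (simp only: of_nat_eq_iff)
  qed
  define G' where "G' = {v \<in> G. crd i v = 0}"
  interpret R: based_form J "restr J" B by (rule based_form_restr[OF JI])
  have Rc: "R.crd l v = crd l v" if "l \<in> J" for l v by (rule crd_restr[OF JI that])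
  have small: "card Y \<le> p" if Y: "finite Y" "Y \<subseteq> G'"
    and inc': "\<And>x y. x \<in> Y \<Longrightarrow> y \<in> Y \<Longrightarrow> x \<noteq> y \<Longrightarrow> \<exists>l\<in>J. crd l (x - y) \<notin> \<int>" for Y
  proof (rule Suc.hyps(1)[OF cJ R.based_form_axioms Y])
    show "0 \<in> G'" using G0 i by (simp add: G'_def)
    show "a - b \<in> G'" if "a \<in> G'" "b \<in> G'" for a b using that Gd i by (simp add: G'_def)
    show "B l \<in> G'" if "l \<in> J" for l using that BG JI i iJ by (auto simp: G'_def)
    have sp: "G' \<subseteq> span (B ` J)"
    proof
      fix v assume v: "v \<in> G'"
      then have vV: "v \<in> V" "crd i v = 0" using GV by (auto simp: G'_def)
      have "v = proj J v"
      proof (rule eqI[OF vV(1) proj_in_V[OF JI]])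
        fix l assume "l \<in> I"
        then show "crd l v = crd l (proj J v)" using vV(2) JI by (cases "l = i") (auto simp: J_def)
      qed
      then show "v \<in> span (B ` J)" using proj_in_span by metis
    qed
    then show "G' \<subseteq> span (B ` J)" .
    show "1 \<le> p" using p0 by simp
    show "\<exists>l\<in>J. R.crd l (x - y) \<notin> \<int>" if "x \<in> Y" "y \<in> Y" "x \<noteq> y" for x y
      using inc'[OF that] Rc by auto
    fix x assume x: "\<And>l. l \<in> J \<Longrightarrow> x l \<in> G'"
    have "real n * \<omega> (x(i := u)) \<in> \<int>"
    proof (rule Gint)
      fix l assume "l \<in> I"
      then show "(x(i := u)) l \<in> G" using x u by (cases "l = i") (auto simp: J_def G'_def)
    qed
    moreover have "\<omega> (x(i := u)) = crd i u * restr J x"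
    proof -
      have xi: "x(i := u) = x(i := (u - crd i u *\<^sub>R B i) + crd i u *\<^sub>R B i)" by simp
      have "\<omega> (x(i := u)) = \<omega> (x(i := u - crd i u *\<^sub>R B i)) + crd i u * \<omega> (x(i := B i))"
        by (subst xi) (simp only: form_add[OF i] form_scale[OF i])
      moreover have "\<omega> (x(i := u - crd i u *\<^sub>R B i)) = 0"
      proof (rule form_dependent)
        show "finite (B ` J)" using fJ by simp
        have "card (B ` J) \<le> card J" by (rule card_image_le[OF fJ])
        also have "\<dots> < card I" using cJ Suc.hyps(2) by simp
        finally show "card (B ` J) < card I" .
        fix l assume l: "l \<in> I"
        show "(x(i := u - crd i u *\<^sub>R B i)) l \<in> span (B ` J)"
        proof (cases "l = i")
          case True
          have uV: "u \<in> V" using u GV by blast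
          have wV: "u - crd i u *\<^sub>R B i \<in> V" using uV B_in_V[OF i] by (intro span_diff span_scale)
          have "u - crd i u *\<^sub>R B i = proj J (u - crd i u *\<^sub>R B i)"
          proof (rule eqI[OF wV proj_in_V[OF JI]])
            fix l assume "l \<in> I"
            then show "crd l (u - crd i u *\<^sub>R B i) = crd l (proj J (u - crd i u *\<^sub>R B i))"
              using JI i by (cases "l = i") (auto simp: J_def)
          qed
          then show ?thesis using True proj_in_span by (metis fun_upd_same)
        next
          case False
          then show ?thesis using x[of l] l sp by (auto simp: J_def)
        qed
      qed
      moreover have "\<omega> (x(i := B i)) = restr J x"
        unfolding restr_def by (rule form_cong) (auto simp: override_on_def J_def)
      ultimately show ?thesis by simp
    qed
    ultimately have "(real n * crd i u) * restr J x \<in> \<int>" by (simp add: mult.assoc)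
    then show "real p * restr J x \<in> \<int>" unfolding u(2) .
  qed
  define t where "t v = (SOME t::int. real n * crd i v = real p * of_int t)" for v
  have t: "real n * crd i v = real p * of_int (t v)" if "v \<in> G" for v
    unfolding t_def using mult[OF that] by (rule someI_ex)
  define a where "a v = t v mod int k" for v
  define r where "r v = v - of_int (a v) *\<^sub>R u - of_int (t v div int k) *\<^sub>R B i" for v
  have arith: "x * of_int y - of_int z * x - w * of_int d = x * of_int (y - z - int k * d)"
    if "w = x * real k" for x w :: real and y z d :: int
    unfolding that by (simp add: algebra_simps)
  have rG: "r v \<in> G'" if v: "v \<in> G" for v
  proof -
    have "r v \<in> G" unfolding r_def by (intro Gd Gs v u(1) BG i)
    moreover have "real n * crd i (r v) = 0"
    proof -
      have "real n * crd i (r v) = real n * crd i v - of_int (a v) * (real n * crd i u) - real n * of_int (t v div int k)"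
        unfolding r_def using i by (simp add: algebra_simps)
      also have "\<dots> = real p * of_int (t v - a v - int k * (t v div int k))"
        unfolding t[OF v] u(2) by (rule arith, unfold nk of_nat_mult, rule refl)
      also have "t v - a v - int k * (t v div int k) = 0"
        unfolding a_def minus_mod_eq_mult_div by (rule diff_self)
      finally show ?thesis by (simp only: of_int_0 mult_zero_right)
    qed
    ultimately show ?thesis using n1 by (simp add: G'_def)
  qed
  have cls: "card {v \<in> X. a v = b} \<le> p" for b
  proof -
    let ?Y = "{v \<in> X. a v = b}"
    have fY: "finite ?Y" using Suc.prems(2) by simp
    have diff: "\<exists>l\<in>J. crd l (r v - r w) \<notin> \<int>" if v: "v \<in> ?Y" and w: "w \<in> ?Y" and ne: "v \<noteq> w" for v w
    proof (rule ccontr)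
      assume no: "\<not> ?thesis"
      have vX: "v \<in> X" and wX: "w \<in> X" and ab: "a v = a w" using v w by auto
      have vG: "v \<in> G" "w \<in> G" using vX wX Suc.prems(3) by auto
      obtain l where l: "l \<in> I" "crd l (v - w) \<notin> \<int>" using inc[OF vX wX ne] by blast
      have e: "v - w = (r v - r w) + of_int (t v div int k - t w div int k) *\<^sub>R B i"
        unfolding r_def ab by (simp add: algebra_simps)
      have "crd l (r v - r w) \<in> \<int>"
      proof (cases "l = i")
        case True
        have "crd i (r v) = 0" "crd i (r w) = 0" using rG vG by (auto simp: G'_def)
        then show ?thesis using True i by simp
      next
        case False
        then show ?thesis using no l(1) by (auto simp: J_def)
      qed
      moreover have "of_int (t v div int k - t w div int k) * crd l (B i) \<in> \<int>" using l(1) i by simp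
      ultimately have "crd l (v - w) \<in> \<int>" unfolding e using l(1) by (simp del: crd_diff of_int_diff)
      then show False using l(2) by simp
    qed
    have "inj_on r ?Y"
    proof (rule inj_onI, rule ccontr)
      fix v w assume vw: "v \<in> ?Y" "w \<in> ?Y" "r v = r w" "v \<noteq> w"
      obtain l where l: "l \<in> J" "crd l (r v - r w) \<notin> \<int>" using diff[OF vw(1,2,4)] by blast
      have "l \<in> I" using l(1) JI by blast
      then have "crd l (r v - r w) = 0" unfolding vw(3) by simp
      then show False using l(2) by simp
    qed
    then have "card ?Y = card (r ` ?Y)" by (rule card_image[symmetric])
    also have "\<dots> \<le> p"
    proof (rule small)
      show "finite (r ` ?Y)" using fY by simp
      show "r ` ?Y \<subseteq> G'"
      proof (rule image_subsetI)
        fix v assume "v \<in> ?Y"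
        then have "v \<in> G" using Suc.prems(3) by auto
        then show "r v \<in> G'" by (rule rG)
      qed
      fix x y assume xy: "x \<in> r ` ?Y" "y \<in> r ` ?Y" "x \<noteq> y"
      obtain v where v: "v \<in> ?Y" "x = r v" using xy(1) by (rule imageE)
      obtain w where w: "w \<in> ?Y" "y = r w" using xy(2) by (rule imageE)
      have "v \<noteq> w" using xy(3) unfolding v(2) w(2) by (rule contrapos_nn) (rule arg_cong)
      from diff[OF v(1) w(1) this] show "\<exists>l\<in>J. crd l (x - y) \<notin> \<int>" unfolding v(2) w(2) .
    qed
    finally show ?thesis .
  qed
  have sub: "a ` X \<subseteq> {0..<int k}" unfolding a_def using k0 by auto
  have "card X \<le> p * card (a ` X)" using Suc.prems(2) by (rule card_le_fibres) (rule cls)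
  also have "card (a ` X) \<le> card {0..<int k}" using sub by (intro card_mono) auto
  then have "p * card (a ` X) \<le> p * k" by simp
  finally show ?case unfolding nk .
qed

text \<open>The additive closure of the vectors of a configuration.\<close>

inductive_set closure_add :: "'a::ab_group_add set \<Rightarrow> 'a set" for S where
  zero: "0 \<in> closure_add S"
| step: "a \<in> closure_add S \<Longrightarrow> s \<in> S \<Longrightarrow> a + s \<in> closure_add S"

lemma closure_add_base: "s \<in> S \<Longrightarrow> s \<in> closure_add S"
  using closure_add.step[OF closure_add.zero] by simp

lemma closure_add_diff:
  assumes S: "\<And>s. s \<in> S \<Longrightarrow> - s \<in> S" and b: "b \<in> closure_add S" and a: "a \<in> closure_add S"
  shows "a - b \<in> closure_add S"
  using b
proof (induction rule: closure_add.induct)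
  case zero
  then show ?case using a by simp
next
  case (step b s)
  have "(a - b) + - s \<in> closure_add S" by (rule closure_add.step[OF step.IH S[OF step.hyps(2)]])
  then show ?case by (simp add: algebra_simps)
qed

context conf begin

lemma form_closure_int:
  assumes "\<And>i. i \<in> I \<Longrightarrow> x i \<in> closure_add W"
  shows "real q * \<omega> x \<in> \<int>"
proof -
  have "real q * \<omega> x \<in> \<int>" if "finite K" "K \<subseteq> I" "\<And>i. i \<in> K \<Longrightarrow> x i \<in> closure_add W"
      "\<And>i. i \<in> I - K \<Longrightarrow> x i \<in> W" for K x
    using that
  proof (induction K arbitrary: x rule: finite_induct)
    case empty
    then show ?case by (intro W_int) auto
  next
    case (insert k K)
    have k: "k \<in> I" "x k \<in> closure_add W" using insert.prems by auto
    have "real q * \<omega> (x(k := v)) \<in> \<int>" if "v \<in> closure_add W" for v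
      using that
    proof (induction rule: closure_add.induct)
      case zero
      have "real q * \<omega> (x(k := 0)) \<in> \<int>" unfolding form_zero[OF k(1)] by simp
      then show ?case .
    next
      case (step a s)
      have "real q * \<omega> (x(k := s)) \<in> \<int>"
        by (rule insert.IH) (use insert.prems insert.hyps step.hyps(2) in auto)
      then have "real q * \<omega> (x(k := a)) + real q * \<omega> (x(k := s)) \<in> \<int>" by (rule Ints_add[OF step.IH])
      moreover have "\<omega> (x(k := a + s)) = \<omega> (x(k := a)) + \<omega> (x(k := s))" by (rule form_add[OF k(1)])
      ultimately have "real q * \<omega> (x(k := a + s)) \<in> \<int>" by (simp only: distrib_left)
      then show ?case .
    qed
    from this[OF k(2)] show ?case by simp
  qed
  from this[of I x] show ?thesis using assms fin_I by blast
qed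

lemma card_incongruent:
  assumes X: "X \<subseteq> W" "\<And>x y. x \<in> X \<Longrightarrow> y \<in> X \<Longrightarrow> x \<noteq> y \<Longrightarrow> x - y \<notin> lat"
  shows "card X \<le> q"
proof (rule card_incongruent_le[OF based_form_axioms, of X "closure_add W"])
  show "finite X" using X(1) fin_W finite_subset by blast
  show "X \<subseteq> closure_add W" using X(1) closure_add_base by blast
  show "0 \<in> closure_add W" by (rule closure_add.zero)
  show "a - b \<in> closure_add W" if "a \<in> closure_add W" "b \<in> closure_add W" for a b
    using closure_add_diff[OF W_minus that(2,1)] .
  show "B i \<in> closure_add W" if "i \<in> I" for i by (rule closure_add_base[OF B_W[OF that]])
  show "closure_add W \<subseteq> V"
  proof
    fix v assume "v \<in> closure_add W"
    then show "v \<in> V" by (induction rule: closure_add.induct) (auto intro: span_zero span_add W_V)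
  qed
  show "real q * \<omega> x \<in> \<int>" if "\<And>i. i \<in> I \<Longrightarrow> x i \<in> closure_add W" for x by (rule form_closure_int[OF that])
  show "q \<ge> 1" by (rule q_pos)
  show "\<exists>i\<in>I. crd i (x - y) \<notin> \<int>" if xy: "x \<in> X" "y \<in> X" "x \<noteq> y" for x y
  proof -
    have "x - y \<in> V" using X(1) xy W_V by (intro span_diff) auto
    then show ?thesis using X(2)[OF xy] unfolding lat_def by blast
  qed
qed

end


text \<open>Farkas' lemma by Fourier--Motzkin elimination.\<close>

inductive_set cone :: "((nat \<Rightarrow> real) \<times> real) set \<Rightarrow> ((nat \<Rightarrow> real) \<times> real) set" for S where
  base: "p \<in> S \<Longrightarrow> p \<in> cone S"
| comb: "p \<in> cone S \<Longrightarrow> r \<in> cone S \<Longrightarrow> 0 \<le> c \<Longrightarrow> 0 \<le> d \<Longrightarrow>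
    (\<lambda>j. c * fst p j + d * fst r j, c * snd p + d * snd r) \<in> cone S"

lemma cone_subset:
  assumes "p \<in> cone T" "T \<subseteq> cone S"
  shows "p \<in> cone S"
  using assms(1)
proof (induction rule: cone.induct)
  case (base p)
  then show ?case using assms(2) by blast
next
  case (comb p r c d)
  show ?case by (rule cone.comb[OF comb.IH comb.hyps(3,4)])
qed

lemma cone_vanish:
  assumes "p \<in> cone T" "\<And>t. t \<in> T \<Longrightarrow> fst t j = 0"
  shows "fst p j = 0"
  using assms(1) by (induction rule: cone.induct) (use assms(2) in auto)

lemma farkas:
  assumes "finite J" "finite S"
    and "\<not> (\<exists>w. \<forall>(a, b)\<in>S. b \<le> (\<Sum>j\<in>J. a j * w j))"
  shows "\<exists>(a, b)\<in>cone S. (\<forall>j\<in>J. a j = 0) \<and> 0 < b"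
  using assms
proof (induction J arbitrary: S rule: finite_induct)
  case empty
  then obtain a b where "(a, b) \<in> S" "0 < b" by (auto simp: not_le)
  then have "(a, b) \<in> cone S" "0 < b" by (auto intro: cone.base)
  then show ?case by auto
next
  case (insert k J)
  define L where "L = {p \<in> S. 0 < fst p k}"
  define U where "U = {p \<in> S. fst p k < 0}"
  define Z where "Z = {p \<in> S. fst p k = 0}"
  define mix where "mix p r = ((\<lambda>j. (- fst r k) * fst p j + fst p k * fst r j), (- fst r k) * snd p + fst p k * snd r)"
    for p r :: "(nat \<Rightarrow> real) \<times> real"
  define T where "T = Z \<union> (\<lambda>(p, r). mix p r) ` (L \<times> U)"
  have fin: "finite L" "finite U" "finite T" using insert.prems(1) by (auto simp: L_def U_def Z_def T_def)
  have Tc: "T \<subseteq> cone S"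
  proof
    fix t assume "t \<in> T"
    then consider "t \<in> Z" | p r where "p \<in> L" "r \<in> U" "t = mix p r" by (auto simp: T_def)
    then show "t \<in> cone S"
    proof cases
      case 1
      then show ?thesis by (auto simp: Z_def intro: cone.base)
    next
      case 2
      then have pr: "p \<in> S" "r \<in> S" "0 \<le> - fst r k" "0 \<le> fst p k" by (auto simp: L_def U_def)
      show ?thesis unfolding 2(3) mix_def
        by (rule cone.comb[OF cone.base[OF pr(1)] cone.base[OF pr(2)] pr(3,4)])
    qed
  qed
  have Tk: "fst t k = 0" if "t \<in> T" for t
    using that by (auto simp: T_def Z_def mix_def)
  have infeas: "\<not> (\<exists>w. \<forall>(a, b)\<in>T. b \<le> (\<Sum>j\<in>J. a j * w j))"
  proof
    assume "\<exists>w. \<forall>(a, b)\<in>T. b \<le> (\<Sum>j\<in>J. a j * w j)"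
    then obtain w where w: "\<And>t. t \<in> T \<Longrightarrow> snd t \<le> (\<Sum>j\<in>J. fst t j * w j)" by fastforce
    define v where "v p = (snd p - (\<Sum>j\<in>J. fst p j * w j)) / fst p k" for p :: "(nat \<Rightarrow> real) \<times> real"
    have LU: "v p \<le> v r" if p: "p \<in> L" and r: "r \<in> U" for p r
    proof -
      have pk: "0 < fst p k" and rk: "fst r k < 0" using p r by (auto simp: L_def U_def)
      have "mix p r \<in> T" using p r by (auto simp: T_def)
      from w[OF this] have "(- fst r k) * snd p + fst p k * snd r
        \<le> (\<Sum>j\<in>J. ((- fst r k) * fst p j + fst p k * fst r j) * w j)" by (simp add: mix_def)
      also have "\<dots> = (- fst r k) * (\<Sum>j\<in>J. fst p j * w j) + fst p k * (\<Sum>j\<in>J. fst r j * w j)"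
        by (simp add: sum_distrib_left sum.distrib[symmetric] algebra_simps)
      finally have "(- fst r k) * (snd p - (\<Sum>j\<in>J. fst p j * w j)) \<le> fst p k * - (snd r - (\<Sum>j\<in>J. fst r j * w j))"
        by (simp add: algebra_simps)
      moreover have "snd p - (\<Sum>j\<in>J. fst p j * w j) = v p * fst p k" using pk by (simp add: v_def)
      moreover have "snd r - (\<Sum>j\<in>J. fst r j * w j) = v r * fst r k" using rk by (simp add: v_def)
      ultimately have "(- fst r k * fst p k) * v p \<le> (- fst r k * fst p k) * v r" by (simp add: algebra_simps)
      moreover have "0 < - fst r k * fst p k" using pk rk by (simp add: mult_neg_pos)
      ultimately show ?thesis using mult_le_cancel_left_pos by blast
    qed
    have "\<exists>z. (\<forall>p\<in>L. v p \<le> z) \<and> (\<forall>r\<in>U. z \<le> v r)"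
    proof (cases "L = {}")
      case True
      then show ?thesis
      proof (cases "U = {}")
        case False
        then have "\<forall>r\<in>U. Min (v ` U) \<le> v r" using fin by simp
        then show ?thesis using True by blast
      qed auto
    next
      case False
      have "\<forall>p\<in>L. v p \<le> Max (v ` L)" using fin by simp
      moreover have "\<forall>r\<in>U. Max (v ` L) \<le> v r" using fin False LU by simp
      ultimately show ?thesis by blast
    qed
    then obtain z where z: "\<And>p. p \<in> L \<Longrightarrow> v p \<le> z" "\<And>r. r \<in> U \<Longrightarrow> z \<le> v r" by blast
    have "\<forall>(a, b)\<in>S. b \<le> (\<Sum>j\<in>insert k J. a j * (w(k := z)) j)"
    proof (rule ballI, clarify)
      fix a b assume ab: "(a, b) \<in> S"
      have "(\<Sum>j\<in>J. a j * (w(k := z)) j) = (\<Sum>j\<in>J. a j * w j)"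
        using insert.hyps by (intro sum.cong) auto
      then have e: "(\<Sum>j\<in>insert k J. a j * (w(k := z)) j) = a k * z + (\<Sum>j\<in>J. a j * w j)"
        using insert.hyps by simp
      consider "0 < a k" | "a k < 0" | "a k = 0" by linarith
      then show "b \<le> (\<Sum>j\<in>insert k J. a j * (w(k := z)) j)"
        unfolding e
      proof cases
        case 1
        then have "v (a, b) \<le> z" using z(1)[of "(a, b)"] ab by (simp add: L_def)
        then show "b \<le> a k * z + (\<Sum>j\<in>J. a j * w j)" using 1 by (simp add: v_def field_simps)
      next
        case 2
        then have "z \<le> v (a, b)" using z(2)[of "(a, b)"] ab by (simp add: U_def)
        then show "b \<le> a k * z + (\<Sum>j\<in>J. a j * w j)" using 2 by (simp add: v_def field_simps)
      next
        case 3
        then have "(a, b) \<in> T" using ab by (simp add: T_def Z_def)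
        then show "b \<le> a k * z + (\<Sum>j\<in>J. a j * w j)" using w[of "(a, b)"] 3 by simp
      qed
    qed
    then show False using insert.prems(2) by blast
  qed
  obtain a b where ab: "(a, b) \<in> cone T" "\<forall>j\<in>J. a j = 0" "0 < b" using insert.IH[OF fin(3) infeas] by blast
  have "a k = 0" using cone_vanish[OF ab(1), of k] Tk by simp
  then have "\<forall>j\<in>insert k J. a j = 0" using ab(2) by simp
  moreover have "(a, b) \<in> cone S" by (rule cone_subset[OF ab(1) Tc])
  ultimately show ?case using ab(3) by blast
qed

text \<open>Reduction of a nonnegative combination to an independent one, not decreasing a linear objective.\<close>

lemma independent_combination:
  fixes Z :: "'v::real_vector set" and \<psi> :: "'v \<Rightarrow> real"
  assumes "finite Z" and pos: "\<And>z. z \<in> Z \<Longrightarrow> 0 < \<psi> z" "linear \<psi>"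
    and y: "\<And>z. z \<in> Z \<Longrightarrow> 0 \<le> y z" "f = (\<Sum>z\<in>Z. y z *\<^sub>R z)" "t < (\<Sum>z\<in>Z. c z * y z)"
  shows "\<exists>Y u. Y \<subseteq> Z \<and> independent Y \<and> f = (\<Sum>z\<in>Y. u z *\<^sub>R z) \<and> t < (\<Sum>z\<in>Y. c z * u z)"
  using assms
proof (induction "card Z" arbitrary: Z y rule: less_induct)
  case less
  show ?case
  proof (cases "independent Z")
    case True
    then show ?thesis using less.prems by blast
  next
    case False
    then obtain u where u: "\<exists>z\<in>Z. u z \<noteq> 0" "(\<Sum>z\<in>Z. u z *\<^sub>R z) = 0"
      using dependent_finite[OF less.prems(1)] by auto
    obtain w where w: "\<exists>z\<in>Z. w z \<noteq> 0" "(\<Sum>z\<in>Z. w z *\<^sub>R z) = 0" "0 \<le> (\<Sum>z\<in>Z. c z * w z)"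
    proof (cases "0 \<le> (\<Sum>z\<in>Z. c z * u z)")
      case True
      then show ?thesis using that[of u] u by blast
    next
      case False
      have "(\<Sum>z\<in>Z. - u z *\<^sub>R z) = 0" using u(2) by (simp add: sum_negf)
      moreover have "0 \<le> (\<Sum>z\<in>Z. c z * - u z)" using False by (simp add: sum_negf)
      ultimately show ?thesis using that[of "\<lambda>z. - u z"] u(1) by auto
    qed
    define N where "N = {z \<in> Z. w z < 0}"
    have fN: "finite N" using less.prems(1) by (simp add: N_def)
    have "N \<noteq> {}"
    proof
      assume "N = {}"
      then have nn: "0 \<le> w z" if "z \<in> Z" for z using that by (auto simp: N_def not_less)
      have "0 = \<psi> (\<Sum>z\<in>Z. w z *\<^sub>R z)" using w(2) linear_0[OF less.prems(3)] by simp
      also have "\<dots> = (\<Sum>z\<in>Z. w z * \<psi> z)"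
        by (simp add: linear_sum[OF less.prems(3)] linear_scale[OF less.prems(3)])
      finally have "(\<Sum>z\<in>Z. w z * \<psi> z) = 0" by simp
      then have "\<forall>z\<in>Z. w z * \<psi> z = 0"
        using less.prems(1) nn less_imp_le[OF less.prems(2)] by (subst (asm) sum_nonneg_eq_0_iff) auto
      then show False using w(1) less.prems(2) by fastforce
    qed
    define \<tau> where "\<tau> = Min ((\<lambda>z. y z / - w z) ` N)"
    have "\<tau> \<in> (\<lambda>z. y z / - w z) ` N"
      unfolding \<tau>_def using fN \<open>N \<noteq> {}\<close> by (intro Min_in) auto
    then obtain z0 where z0: "z0 \<in> N" "\<tau> = y z0 / - w z0" by blast
    have z0Z: "z0 \<in> Z" and wz0: "w z0 < 0" using z0 by (auto simp: N_def)
    have \<tau>0: "0 \<le> \<tau>" unfolding z0(2) using less.prems(4)[OF z0Z] wz0 by (intro divide_nonneg_pos) auto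
    define y' where "y' z = y z + \<tau> * w z" for z
    have y'0: "y' z0 = 0" using z0(2) wz0 by (simp add: y'_def)
    have y'nn: "0 \<le> y' z" if z: "z \<in> Z" for z
    proof (cases "w z < 0")
      case True
      then have "\<tau> \<le> y z / - w z" using fN z by (auto simp: \<tau>_def N_def intro: Min_le)
      then have "\<tau> * - w z \<le> y z" using True by (simp add: field_simps)
      then show ?thesis by (simp add: y'_def)
    next
      case False
      then show ?thesis using \<tau>0 less.prems(4)[OF z] by (simp add: y'_def)
    qed
    have "(\<Sum>z\<in>Z. y' z *\<^sub>R z) = (\<Sum>z\<in>Z. y z *\<^sub>R z) + \<tau> *\<^sub>R (\<Sum>z\<in>Z. w z *\<^sub>R z)"
      by (simp add: y'_def scaleR_add_left sum.distrib scaleR_sum_right)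
    then have f1: "f = (\<Sum>z\<in>Z. y' z *\<^sub>R z)" using less.prems(5) w(2) by simp
    have "(\<Sum>z\<in>Z. c z * y' z) = (\<Sum>z\<in>Z. c z * y z) + \<tau> * (\<Sum>z\<in>Z. c z * w z)"
      by (simp add: y'_def distrib_left sum.distrib sum_distrib_left mult.left_commute)
    moreover have "0 \<le> \<tau> * (\<Sum>z\<in>Z. c z * w z)" using \<tau>0 w(3) by simp
    ultimately have t1: "t < (\<Sum>z\<in>Z. c z * y' z)" using less.prems(6) by linarith
    let ?Z = "Z - {z0}"
    have f2: "f = (\<Sum>z\<in>?Z. y' z *\<^sub>R z)" using f1 y'0 sum.remove[OF less.prems(1) z0Z, of "\<lambda>z. y' z *\<^sub>R z"] by simp
    have t2: "t < (\<Sum>z\<in>?Z. c z * y' z)" using t1 y'0 sum.remove[OF less.prems(1) z0Z, of "\<lambda>z. c z * y' z"] by simp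
    have "card ?Z < card Z" using less.prems(1) z0Z by (rule card_Diff1_less)
    from less.hyps[OF this _ _ less.prems(3) _ f2 t2] less.prems(1,2) y'nn
    obtain Y u where "Y \<subseteq> ?Z" "independent Y" "f = (\<Sum>z\<in>Y. u z *\<^sub>R z)" "t < (\<Sum>z\<in>Y. c z * u z)" by auto
    then show ?thesis by blast
  qed
qed

context based_form begin

text \<open>Reflecting several basis vectors at a common vector.\<close>

lemma form_reflect:
  assumes S: "S \<subseteq> I" and f: "\<And>l. l \<in> I \<Longrightarrow> \<omega> (x(l := f)) = a l * \<omega> x"
  shows "\<omega> (\<lambda>j. if j \<in> S then f - x j else x j) = (-1) ^ card S * (1 - (\<Sum>l\<in>S. a l)) * \<omega> x"
proof -
  define E where "E S = (\<lambda>j. if j \<in> S then f - x j else x j)" for S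
  have "finite S" using S fin_I finite_subset by blast
  then have "\<omega> (E S) = (-1) ^ card S * (1 - (\<Sum>l\<in>S. a l)) * \<omega> x \<and>
    (\<forall>l\<in>I - S. \<omega> ((E S)(l := f)) = (-1) ^ card S * a l * \<omega> x)"
    using S
  proof (induction S rule: finite_induct)
    case empty
    have e: "E {} = x" by (simp add: E_def)
    have 1: "\<omega> ((E {})(l := f)) = (-1) ^ card ({}::nat set) * a l * \<omega> x" if "l \<in> I - {}" for l
      unfolding e card.empty power_0 mult_1_left using that by (intro f) simp
    have 2: "\<omega> (E {}) = (-1) ^ card ({}::nat set) * (1 - (\<Sum>l\<in>{}. a l)) * \<omega> x" unfolding e by simp
    show ?case using 1 2 by blast
  next
    case (insert k S)
    have k: "k \<in> I" using insert.prems by blast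
    have SI: "S \<subseteq> I" using insert.prems by blast
    have IH1: "\<omega> (E S) = (-1) ^ card S * (1 - (\<Sum>l\<in>S. a l)) * \<omega> x" using insert.IH[OF SI] by blast
    have IH2: "\<omega> ((E S)(l := f)) = (-1) ^ card S * a l * \<omega> x" if "l \<in> I - S" for l
      using insert.IH[OF SI] that by blast
    have Ek: "E (insert k S) = (E S)(k := f - x k)" by (auto simp: E_def fun_eq_iff)
    have Ekk: "(E S)(k := x k) = E S" using insert.hyps by (auto simp: E_def fun_eq_iff)
    have kS: "k \<in> I - S" using k insert.hyps by blast
    have "\<omega> (E (insert k S)) = \<omega> ((E S)(k := f)) - \<omega> ((E S)(k := x k))"
      unfolding Ek by (rule form_diff[OF k])
    also have "\<dots> = (-1) ^ card S * a k * \<omega> x - (-1) ^ card S * (1 - (\<Sum>l\<in>S. a l)) * \<omega> x"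
      unfolding Ekk IH1 IH2[OF kS] by (rule refl)
    also have "\<dots> = (-1) ^ card (insert k S) * (1 - (\<Sum>l\<in>insert k S. a l)) * \<omega> x"
      using insert.hyps by (simp add: algebra_simps)
    finally have 1: "\<omega> (E (insert k S)) = (-1) ^ card (insert k S) * (1 - (\<Sum>l\<in>insert k S. a l)) * \<omega> x" .
    have 2: "\<omega> ((E (insert k S))(l := f)) = (-1) ^ card (insert k S) * a l * \<omega> x" if l: "l \<in> I - insert k S" for l
    proof -
      have lI: "l \<in> I" and lk: "l \<noteq> k" and lS: "l \<in> I - S" using l by auto
      have tw: "(E (insert k S))(l := f) = ((E S)(l := f))(k := f - x k)"
        unfolding Ek using lk by (simp add: fun_upd_twist)
      have twk: "((E S)(l := f))(k := x k) = (E S)(l := f)" using Ekk lk by (metis fun_upd_twist)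
      have "\<omega> (((E S)(l := f))(k := f)) = 0" using lI k lk by (intro form_eq[of k l]) auto
      then have "\<omega> ((E (insert k S))(l := f)) = - \<omega> ((E S)(l := f))"
        unfolding tw form_diff[OF k] twk by simp
      then show ?thesis unfolding IH2[OF lS] using insert.hyps by simp
    qed
    show ?case using 1 2 by blast
  qed
  then show ?thesis unfolding E_def by blast
qed

end

context conf begin

text \<open>Weights for the vectors lying below the centre.\<close>

lemma weights:
  fixes \<phi> :: "nat \<Rightarrow> real" and \<P> :: "nat set set"
  assumes P: "\<And>P. P \<in> \<P> \<Longrightarrow> P \<subseteq> I \<and> P \<noteq> {} \<and> (\<Sum>i\<in>I. \<phi> i *\<^sub>R B i) - (\<Sum>i\<in>P. B i) \<in> W"
  shows "\<exists>w. (\<forall>i\<in>I. 0 \<le> w i) \<and> (\<forall>P\<in>\<P>. 1 \<le> sum w P) \<and> (\<Sum>i\<in>I. \<phi> i * w i) \<le> 2"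
proof (rule ccontr)
  assume no: "\<not> ?thesis"
  define f where "f = (\<Sum>i\<in>I. \<phi> i *\<^sub>R B i)"
  define zz where "zz P = (\<Sum>i\<in>P. B i)" for P
  have fP: "finite \<P>" using P fin_I by (meson PowI finite_Pow_iff finite_subset subsetI)
  have Pf: "finite P" if "P \<in> \<P>" for P using P[OF that] fin_I finite_subset by blast
  define S :: "((nat \<Rightarrow> real) \<times> real) set" where "S = (\<lambda>P. (\<lambda>j. if j \<in> P then 1 else 0, 1)) ` \<P> \<union> (\<lambda>i. (\<lambda>j. if j = i then 1 else 0, 0)) ` I
    \<union> {(\<lambda>j. - \<phi> j, -2)}"
  have fS: "finite S" using fP fin_I by (simp add: S_def)
  have infeas: "\<not> (\<exists>w. \<forall>(a, b)\<in>S. b \<le> (\<Sum>j\<in>I. a j * w j))"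
  proof
    assume "\<exists>w. \<forall>(a, b)\<in>S. b \<le> (\<Sum>j\<in>I. a j * w j)"
    then obtain w where w: "\<And>a b. (a, b) \<in> S \<Longrightarrow> b \<le> (\<Sum>j\<in>I. a j * w j)" by blast
    have "0 \<le> w i" if "i \<in> I" for i
    proof -
      have "0 \<le> (\<Sum>j\<in>I. (if j = i then 1 else 0) * w j)" using that by (intro w) (auto simp: S_def)
      also have "\<dots> = (\<Sum>j\<in>I. if j = i then w j else 0)" by (intro sum.cong) auto
      also have "\<dots> = w i" using that fin_I by simp
      finally show ?thesis .
    qed
    moreover have "1 \<le> sum w P" if "P \<in> \<P>" for P
    proof -
      have "1 \<le> (\<Sum>j\<in>I. (if j \<in> P then 1 else 0) * w j)" using that by (intro w) (auto simp: S_def)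
      also have "\<dots> = (\<Sum>j\<in>I. if j \<in> P then w j else 0)" by (intro sum.cong) auto
      also have "\<dots> = sum w P" using P[OF that] fin_I by (simp add: sum.If_cases Int_absorb1)
      finally show ?thesis .
    qed
    moreover have "-2 \<le> (\<Sum>j\<in>I. - \<phi> j * w j)" by (intro w) (simp add: S_def)
    then have "(\<Sum>i\<in>I. \<phi> i * w i) \<le> 2" by (simp add: sum_negf)
    ultimately show False using no by blast
  qed
  obtain a b where ab: "(a, b) \<in> cone S" "\<forall>j\<in>I. a j = 0" "0 < b"
    using farkas[OF fin_I fS infeas] by blast
  define rep where "rep p \<longleftrightarrow> (\<exists>y s t. (\<forall>P\<in>\<P>. 0 \<le> y P) \<and> (\<forall>i\<in>I. 0 \<le> s i) \<and> 0 \<le> t \<and>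
    (\<forall>i\<in>I. fst p i = (\<Sum>P\<in>\<P>. if i \<in> P then y P else 0) + s i - t * \<phi> i) \<and> snd p = sum y \<P> - 2 * t)"
    for p :: "(nat \<Rightarrow> real) \<times> real"
  have "rep (a, b)"
    using ab(1)
  proof (induction rule: cone.induct)
    case (base p)
    then consider "p \<in> (\<lambda>P. (\<lambda>j. if j \<in> P then 1 else 0, 1)) ` \<P>"
      | "p \<in> (\<lambda>i. (\<lambda>j. if j = i then 1 else 0, 0)) ` I" | "p = (\<lambda>j. - \<phi> j, -2)"
      unfolding S_def by (elim UnE singletonE)
    then show ?case
    proof cases
      case 1
      then obtain P where P1: "p = (\<lambda>j. if j \<in> P then 1 else 0, 1)" "P \<in> \<P>" by (rule imageE)
      have d1: "(\<Sum>R\<in>\<P>. if i \<in> R then if R = P then 1 else 0 else 0) = (if i \<in> P then 1 else (0::real))" for i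
      proof -
        have "(\<Sum>R\<in>\<P>. if i \<in> R then if R = P then 1 else 0 else 0) = (\<Sum>R\<in>\<P>. if R = P then if i \<in> P then 1 else 0 else (0::real))"
          by (rule sum.cong) auto
        also have "\<dots> = (if i \<in> P then 1 else 0)" using sum.delta[OF fP, of P "\<lambda>_. if i \<in> P then 1 else (0::real)"] P1(2) by (simp only: if_True)
        finally show ?thesis .
      qed
      have d2: "(\<Sum>R\<in>\<P>. if R = P then 1 else 0) = (1::real)"
        using sum.delta[OF fP, of P "\<lambda>_. 1::real"] P1(2) by (simp only: if_True)
      show ?thesis unfolding rep_def P1(1) fst_conv snd_conv
        by (rule exI[of _ "\<lambda>R. if R = P then 1 else 0"], rule exI[of _ "\<lambda>_. 0"], rule exI[of _ 0],
            simp only: d1 d2, simp)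
    next
      case 2
      then obtain i where i1: "p = (\<lambda>j. if j = i then 1 else 0, 0)" "i \<in> I" by (rule imageE)
      show ?thesis unfolding rep_def i1(1) fst_conv snd_conv
        by (rule exI[of _ "\<lambda>R. 0"], rule exI[of _ "\<lambda>j. if j = i then 1 else 0"], rule exI[of _ 0],
            simp only: if_cancel sum.neutral_const, simp)
    next
      case 3
      show ?thesis unfolding rep_def 3 fst_conv snd_conv
        by (rule exI[of _ "\<lambda>R. 0"], rule exI[of _ "\<lambda>j. 0"], rule exI[of _ 1],
            simp only: if_cancel sum.neutral_const, simp)
    qed
  next
    case (comb p r c d)
    obtain y s t where 1: "\<forall>P\<in>\<P>. 0 \<le> y P" "\<forall>i\<in>I. 0 \<le> s i" "0 \<le> t"
      "\<forall>i\<in>I. fst p i = (\<Sum>P\<in>\<P>. if i \<in> P then y P else 0) + s i - t * \<phi> i" "snd p = sum y \<P> - 2 * t"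
      using comb.IH(1) unfolding rep_def by blast
    obtain y' s' t' where 2: "\<forall>P\<in>\<P>. 0 \<le> y' P" "\<forall>i\<in>I. 0 \<le> s' i" "0 \<le> t'"
      "\<forall>i\<in>I. fst r i = (\<Sum>P\<in>\<P>. if i \<in> P then y' P else 0) + s' i - t' * \<phi> i" "snd r = sum y' \<P> - 2 * t'"
      using comb.IH(2) unfolding rep_def by blast
    have e: "(\<Sum>P\<in>\<P>. if i \<in> P then c * y P + d * y' P else 0)
        = c * (\<Sum>P\<in>\<P>. if i \<in> P then y P else 0) + d * (\<Sum>P\<in>\<P>. if i \<in> P then y' P else 0)" for i
      unfolding sum_distrib_left sum.distrib[symmetric] by (rule sum.cong) auto
    have e2: "(\<Sum>P\<in>\<P>. c * y P + d * y' P) = c * sum y \<P> + d * sum y' \<P>"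
      by (simp only: sum_distrib_left sum.distrib)
    show ?case unfolding rep_def
    proof (intro exI conjI)
      show "\<forall>P\<in>\<P>. 0 \<le> c * y P + d * y' P" using 1(1) 2(1) comb.hyps(3,4) by simp
      show "\<forall>i\<in>I. 0 \<le> c * s i + d * s' i" using 1(2) 2(2) comb.hyps(3,4) by simp
      show "0 \<le> c * t + d * t'" using 1(3) 2(3) comb.hyps(3,4) by simp
      show "\<forall>i\<in>I. fst (\<lambda>j. c * fst p j + d * fst r j, c * snd p + d * snd r) i =
         (\<Sum>P\<in>\<P>. if i \<in> P then c * y P + d * y' P else 0) + (c * s i + d * s' i) - (c * t + d * t') * \<phi> i"
      proof
        fix i assume i: "i \<in> I"
        show "fst (\<lambda>j. c * fst p j + d * fst r j, c * snd p + d * snd r) i =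
         (\<Sum>P\<in>\<P>. if i \<in> P then c * y P + d * y' P else 0) + (c * s i + d * s' i) - (c * t + d * t') * \<phi> i"
          unfolding e fst_conv bspec[OF 1(4) i] bspec[OF 2(4) i] by (simp add: algebra_simps)
      qed
      show "snd (\<lambda>j. c * fst p j + d * fst r j, c * snd p + d * snd r) =
         (\<Sum>P\<in>\<P>. c * y P + d * y' P) - 2 * (c * t + d * t')"
        unfolding e2 snd_conv 1(5) 2(5) by (simp add: algebra_simps)
    qed
  qed
  then obtain y s t where y0: "\<forall>P\<in>\<P>. 0 \<le> y P" "\<forall>i\<in>I. 0 \<le> s i" "0 \<le> t"
    "\<forall>i\<in>I. a i = (\<Sum>P\<in>\<P>. if i \<in> P then y P else 0) + s i - t * \<phi> i" "b = sum y \<P> - 2 * t"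
    unfolding rep_def fst_conv snd_conv by (elim exE conjE)
  have y4: "\<forall>i\<in>I. 0 = (\<Sum>P\<in>\<P>. if i \<in> P then y P else 0) + s i - t * \<phi> i"
  proof
    fix i assume i: "i \<in> I"
    show "0 = (\<Sum>P\<in>\<P>. if i \<in> P then y P else 0) + s i - t * \<phi> i"
      by (rule trans[OF sym[OF bspec[OF ab(2) i]] bspec[OF y0(4) i]])
  qed
  note y = y0(1) y0(2) y0(3) y4 y0(5)
  have t0: "0 < t"
  proof (rule ccontr)
    assume "\<not> 0 < t"
    then have t: "t = 0" using y(3) by simp
    have "y P = 0" if P': "P \<in> \<P>" for P
    proof -
      obtain i where i: "i \<in> P" "i \<in> I" using P[OF P'] by blast
      have nn: "0 \<le> (\<Sum>P\<in>\<P>. if i \<in> P then y P else 0)" using y(1) by (intro sum_nonneg) auto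
      have "(\<Sum>P\<in>\<P>. if i \<in> P then y P else 0) = 0" using nn y(2,4) i(2) t by fastforce
      then have "(if i \<in> P then y P else 0) = 0"
        using fP y(1) P' by (subst (asm) sum_nonneg_eq_0_iff) auto
      then show ?thesis using i by simp
    qed
    then show False using y(5) t ab(3) by simp
  qed
  text \<open>The two kinds of vectors and the objective.\<close>
  define Z where "Z = zz ` \<P> \<union> B ` I"
  define c where "c z = (if z \<in> zz ` \<P> then 1 else (0::real))" for z
  define \<psi> where "\<psi> v = (\<Sum>i\<in>I. crd i v)" for v
  have fZ: "finite Z" using fP fin_I by (simp add: Z_def)
  have lin: "linear \<psi>"
    by (rule linearI) (simp_all add: \<psi>_def sum.distrib sum_distrib_left)
  have cz: "crd i (zz P) = (if i \<in> P then 1 else 0)" if "i \<in> I" "P \<in> \<P>" for i P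
  proof -
    have PI: "P \<subseteq> I" using P[OF that(2)] by blast
    have "crd i (zz P) = (\<Sum>j\<in>P. if i = j then 1 else 0)"
      unfolding zz_def using that(1) PI by simp (intro sum.cong, auto)
    then show ?thesis using Pf[OF that(2)] by simp
  qed
  have inj: "inj_on zz \<P>"
  proof (rule inj_onI)
    fix P R assume PR: "P \<in> \<P>" "R \<in> \<P>" "zz P = zz R"
    have "i \<in> P \<longleftrightarrow> i \<in> R" if "i \<in> I" for i
      using cz[OF that PR(1)] cz[OF that PR(2)] PR(3) by (simp split: if_splits)
    then show "P = R" using P[OF PR(1)] P[OF PR(2)] by blast
  qed
  have pos: "0 < \<psi> z" if zZ: "z \<in> Z" for z
  proof -
    consider P where "P \<in> \<P>" "z = zz P" | i where "i \<in> I" "z = B i" using zZ by (auto simp: Z_def)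
    then show ?thesis
    proof cases
      case 1
      have PI: "P \<subseteq> I" "P \<noteq> {}" using P[OF 1(1)] by auto
      have "\<psi> z = (\<Sum>i\<in>I. if i \<in> P then 1 else 0)" unfolding \<psi>_def 1(2) using cz 1(1) by (intro sum.cong) auto
      also have "\<dots> = real (card P)" using PI fin_I by (simp add: sum.If_cases Int_absorb1)
      finally show ?thesis using PI Pf[OF 1(1)] by (simp add: card_gt_0_iff)
    next
      case 2
      have "\<psi> z = (\<Sum>j\<in>I. if j = i then 1 else 0)" unfolding \<psi>_def 2(2) using 2(1) by (intro sum.cong) auto
      then show ?thesis using 2(1) fin_I by simp
    qed
  qed
  define y1 where "y1 z = (\<Sum>P\<in>\<P>. if zz P = z then y P / t else 0)" for z
  define y2 where "y2 z = (\<Sum>i\<in>I. if B i = z then s i / t else 0)" for z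
  have swap1: "(\<Sum>z\<in>Z. y1 z *\<^sub>R z) = (\<Sum>P\<in>\<P>. (y P / t) *\<^sub>R zz P)"
  proof -
    have "(\<Sum>z\<in>Z. y1 z *\<^sub>R z) = (\<Sum>P\<in>\<P>. \<Sum>z\<in>Z. (if zz P = z then y P / t else 0) *\<^sub>R z)"
      unfolding y1_def scaleR_sum_left by (rule sum.swap)
    also have "\<dots> = (\<Sum>P\<in>\<P>. (y P / t) *\<^sub>R zz P)"
    proof (rule sum.cong[OF refl])
      fix P assume "P \<in> \<P>"
      then have m: "zz P \<in> Z" by (simp add: Z_def)
      have "(\<Sum>z\<in>Z. (if zz P = z then y P / t else 0) *\<^sub>R z) = (\<Sum>z\<in>Z. if zz P = z then (y P / t) *\<^sub>R z else 0)"
        by (intro sum.cong) auto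
      then show "(\<Sum>z\<in>Z. (if zz P = z then y P / t else 0) *\<^sub>R z) = (y P / t) *\<^sub>R zz P" using fZ m by simp
    qed
    finally show ?thesis .
  qed
  have swap2: "(\<Sum>z\<in>Z. y2 z *\<^sub>R z) = (\<Sum>i\<in>I. (s i / t) *\<^sub>R B i)"
  proof -
    have "(\<Sum>z\<in>Z. y2 z *\<^sub>R z) = (\<Sum>i\<in>I. \<Sum>z\<in>Z. (if B i = z then s i / t else 0) *\<^sub>R z)"
      unfolding y2_def scaleR_sum_left by (rule sum.swap)
    also have "\<dots> = (\<Sum>i\<in>I. (s i / t) *\<^sub>R B i)"
    proof (rule sum.cong[OF refl])
      fix i assume "i \<in> I"
      then have m: "B i \<in> Z" by (simp add: Z_def)
      have "(\<Sum>z\<in>Z. (if B i = z then s i / t else 0) *\<^sub>R z) = (\<Sum>z\<in>Z. if B i = z then (s i / t) *\<^sub>R z else 0)"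
        by (intro sum.cong) auto
      then show "(\<Sum>z\<in>Z. (if B i = z then s i / t else 0) *\<^sub>R z) = (s i / t) *\<^sub>R B i" using fZ m by simp
    qed
    finally show ?thesis .
  qed
  have f_eq: "f = (\<Sum>z\<in>Z. (y1 z + y2 z) *\<^sub>R z)"
  proof -
    have zV: "zz P \<in> V" if "P \<in> \<P>" for P unfolding zz_def using P[OF that] B_in_V by (intro span_sum) auto
    have "f = (\<Sum>P\<in>\<P>. (y P / t) *\<^sub>R zz P) + (\<Sum>i\<in>I. (s i / t) *\<^sub>R B i)"
    proof (rule eqI)
      show "f \<in> V" unfolding f_def using B_in_V by (intro span_sum span_scale)
      show "(\<Sum>P\<in>\<P>. (y P / t) *\<^sub>R zz P) + (\<Sum>i\<in>I. (s i / t) *\<^sub>R B i) \<in> V"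
        using B_in_V zV by (intro span_add span_sum span_scale)
      fix i assume i: "i \<in> I"
      have "crd i f = (\<Sum>j\<in>I. if i = j then \<phi> j else 0)"
        unfolding f_def using i by simp (intro sum.cong, auto)
      then have 1: "crd i f = \<phi> i" using i fin_I by simp
      have "(\<Sum>j\<in>I. s j / t * crd i (B j)) = (\<Sum>j\<in>I. if i = j then s j / t else 0)"
        using i by (intro sum.cong) auto
      then have 2: "(\<Sum>j\<in>I. s j / t * crd i (B j)) = s i / t" using i fin_I by simp
      have 3: "(\<Sum>P\<in>\<P>. y P / t * crd i (zz P)) = (\<Sum>P\<in>\<P>. if i \<in> P then y P else 0) / t"
        unfolding sum_divide_distrib using cz[OF i] by (intro sum.cong) auto
      have "\<phi> i = (\<Sum>P\<in>\<P>. if i \<in> P then y P else 0) / t + s i / t"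
        using bspec[OF y(4) i] t0 by (simp add: field_simps)
      then show "crd i f = crd i ((\<Sum>P\<in>\<P>. (y P / t) *\<^sub>R zz P) + (\<Sum>i\<in>I. (s i / t) *\<^sub>R B i))"
        using i by (simp only: crd_add crd_sum crd_scale 1 2 3)
    qed
    then show ?thesis by (simp only: scaleR_add_left sum.distrib swap1 swap2)
  qed
  have ynn: "0 \<le> y1 z + y2 z" for z
    unfolding y1_def y2_def using y(1,2) t0 by (intro add_nonneg_nonneg sum_nonneg) auto
  have obj: "2 < (\<Sum>z\<in>Z. c z * (y1 z + y2 z))"
  proof -
    have "sum y \<P> / t \<le> (\<Sum>z\<in>Z. c z * (y1 z + y2 z))"
    proof -
      have "(\<Sum>z\<in>zz ` \<P>. y1 z) \<le> (\<Sum>z\<in>zz ` \<P>. c z * (y1 z + y2 z))"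
      proof (rule sum_mono)
        fix z assume "z \<in> zz ` \<P>"
        then have "c z = 1" by (simp add: c_def)
        moreover have "0 \<le> y2 z" unfolding y2_def using y(2) t0 by (intro sum_nonneg) auto
        ultimately show "y1 z \<le> c z * (y1 z + y2 z)" by simp
      qed
      also have "\<dots> \<le> (\<Sum>z\<in>Z. c z * (y1 z + y2 z))"
        by (rule sum_mono2[OF fZ]) (use ynn in \<open>auto simp: Z_def c_def\<close>)
      finally have 1: "(\<Sum>z\<in>zz ` \<P>. y1 z) \<le> (\<Sum>z\<in>Z. c z * (y1 z + y2 z))" .
      have "(\<Sum>z\<in>zz ` \<P>. y1 z) = (\<Sum>P\<in>\<P>. y1 (zz P))" using inj by (simp add: sum.reindex)
      also have "\<dots> = (\<Sum>P\<in>\<P>. y P / t)"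
      proof (rule sum.cong[OF refl])
        fix P assume P': "P \<in> \<P>"
        have "y1 (zz P) = (\<Sum>R\<in>\<P>. if R = P then y R / t else 0)"
          unfolding y1_def using inj P' by (intro sum.cong) (auto simp: inj_on_def)
        then show "y1 (zz P) = y P / t" using fP P' by simp
      qed
      finally show ?thesis using 1 by (simp add: sum_divide_distrib)
    qed
    moreover have "2 < sum y \<P> / t" using y(5) ab(3) t0 by (simp add: field_simps)
    ultimately show ?thesis by linarith
  qed
  obtain Y u where Y: "Y \<subseteq> Z" "independent Y" "f = (\<Sum>z\<in>Y. u z *\<^sub>R z)" "2 < (\<Sum>z\<in>Y. c z * u z)"
    using independent_combination[OF fZ pos lin ynn f_eq obj] by blast
  have fY: "finite Y" using Y(1) fZ finite_subset by blast
  have Zlat: "z \<in> lat" if zZ: "z \<in> Z" for z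
  proof -
    consider P where "P \<in> \<P>" "z = zz P" | i where "i \<in> I" "z = B i" using zZ by (auto simp: Z_def)
    then show ?thesis
    proof cases
      case 1
      have "zz P \<in> V" unfolding zz_def using P[OF 1(1)] B_in_V by (intro span_sum) auto
      then show ?thesis unfolding 1(2) lat_def using cz[OF _ 1(1)] by auto
    next
      case 2
      then show ?thesis using lat_B by simp
    qed
  qed
  have YV: "Y \<subseteq> V" using Y(1) Zlat lat_in_V by blast
  obtain x where x: "\<omega> x \<noteq> 0" "\<forall>j\<in>I. x j \<in> Y \<or> x j = B j" "Y \<subseteq> x ` I"
    using extend_independent[OF fY Y(2) YV] by blast
  interpret X: based_form I "\<lambda>z. \<omega> z / \<omega> x" x using x(1) by (rule rebase)
  define J where "J = {j \<in> I. x j \<in> Y}"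
  have bij: "bij_betw x J Y"
    unfolding bij_betw_def
  proof
    show "inj_on x J" using X.B_inj by (rule inj_on_subset) (auto simp: J_def)
    show "x ` J = Y" using x(3) by (auto simp: J_def)
  qed
  have JI: "J \<subseteq> I" by (auto simp: J_def)
  have fJ: "f = (\<Sum>j\<in>J. u (x j) *\<^sub>R x j)"
    using Y(3) sum.reindex_bij_betw[OF bij, of "\<lambda>z. u z *\<^sub>R z"] by simp
  have cJ: "2 < (\<Sum>j\<in>J. c (x j) * u (x j))"
    using Y(4) sum.reindex_bij_betw[OF bij, of "\<lambda>z. c z * u z"] by simp
  define al where "al l = (if l \<in> J then u (x l) else 0)" for l
  have fl: "\<omega> (x(l := f)) = al l * \<omega> x" if l: "l \<in> I" for l
  proof -
    have "X.crd l f = (\<Sum>j\<in>J. if l = j then u (x j) else 0)"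
      unfolding fJ using l JI by simp (intro sum.cong, auto)
    also have "\<dots> = al l" using finite_subset[OF JI fin_I] by (simp add: al_def)
    finally show ?thesis using x(1) by (simp add: X.crd_def field_simps)
  qed
  define T where "T = {j \<in> J. c (x j) = 1}"
  have TI: "T \<subseteq> I" using JI by (auto simp: T_def)
  have "(\<Sum>j\<in>J. c (x j) * u (x j)) = (\<Sum>j\<in>J. if j \<in> T then u (x j) else 0)"
    by (intro sum.cong) (auto simp: T_def c_def)
  also have "\<dots> = (\<Sum>j\<in>T. u (x j))"
    using finite_subset[OF JI fin_I] by (simp add: sum.If_cases) (rule sum.cong, auto simp: T_def)
  also have "\<dots> = (\<Sum>j\<in>T. al j)" by (intro sum.cong) (auto simp: T_def al_def)
  finally have sT: "2 < (\<Sum>j\<in>T. al j)" using cJ by simp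
  let ?E = "\<lambda>j. if j \<in> T then f - x j else x j"
  have "\<bar>\<omega> ?E\<bar> \<le> 1"
  proof (rule W_bound)
    fix j assume j: "j \<in> I"
    show "?E j \<in> W"
    proof (cases "j \<in> T")
      case True
      then have "x j \<in> zz ` \<P>" by (auto simp: T_def c_def split: if_splits)
      then obtain P' where "P' \<in> \<P>" "x j = zz P'" by blast
      then show ?thesis using True P[of P'] by (simp add: f_def zz_def)
    next
      case False
      have "x j \<in> B ` I"
      proof (cases "x j \<in> Y")
        case True
        then have "x j \<notin> zz ` \<P>" using False j by (auto simp: T_def J_def c_def)
        then show ?thesis using True Y(1) by (auto simp: Z_def)
      next
        case False
        then show ?thesis using x(2) j by auto
      qed
      then show ?thesis using False B_W by auto
    qed
  qed
  moreover have "\<omega> ?E = (-1) ^ card T * (1 - (\<Sum>l\<in>T. al l)) * \<omega> x" by (rule form_reflect[OF TI fl])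
  then have "\<bar>\<omega> ?E\<bar> = \<bar>1 - (\<Sum>l\<in>T. al l)\<bar> * \<bar>\<omega> x\<bar>" by (simp add: abs_mult power_abs)
  moreover have "1 \<le> \<bar>\<omega> x\<bar>"
  proof -
    have "\<omega> x \<in> \<int>"
    proof (rule form_lat)
      fix j assume j: "j \<in> I"
      then show "x j \<in> lat" using x(2) Y(1) Zlat lat_B by (metis subsetD)
    qed
    then obtain k :: int where "\<omega> x = of_int k" by (auto elim: Ints_cases)
    then show ?thesis using x(1) by simp
  qed
  moreover have "1 < \<bar>1 - (\<Sum>l\<in>T. al l)\<bar>" using sT by linarith
  moreover have "False" if "e \<le> 1" "e = p * r" "1 \<le> r" "1 < p" for e p r :: real
  proof -
    have "p \<le> p * r" using that(3,4) by simp
    then show False using that(1,2,4) by linarith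
  qed
  ultimately show False by blast
qed

end


context conf begin

lemma card_half_class:
  assumes f: "f \<in> W" "\<And>i. i \<in> I \<Longrightarrow> 2 * crd i f \<in> \<int>"
  shows "card {v \<in> W. v - f \<in> lat} \<le> card I ^ 2 + 3 * card I"
proof -
  define X where "X = {v \<in> W. v - f \<in> lat}"
  define W' where "W' = X \<union> uminus ` X \<union> (B ` I \<union> uminus ` B ` I)"
  have XW: "X \<subseteq> W" by (auto simp: X_def)
  have W'W: "W' \<subseteq> W" unfolding W'_def using XW W_minus B_W by auto
  have fW': "finite W'" using W'W fin_W finite_subset by blast
  have fV: "f \<in> V" by (rule W_V[OF f(1)])
  have f2: "2 *\<^sub>R f \<in> lat" using f(2) fV by (simp add: lat_def span_scale)
  have m2: "- v - f \<in> lat" if v: "v \<in> X" for v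
  proof -
    have "v - f \<in> lat" using v by (simp add: X_def)
    from lat_diff[OF lat_minus[OF this] f2] have "- (v - f) - 2 *\<^sub>R f \<in> lat" .
    moreover have "- (v - f) - 2 *\<^sub>R f = - v - f" by (simp add: scaleR_2)
    ultimately show ?thesis by (simp only:)
  qed
  have cl: "v \<in> lat \<or> v - f \<in> lat" if "v \<in> W'" for v
    using that m2 lat_B lat_minus unfolding W'_def by (auto simp: X_def)
  have "conf_axioms I \<omega> B 2 W'"
  proof (rule conf_axioms.intro, goal_cases)
    case 1 show ?case by simp
  next
    case 2 show ?case by (rule fW')
  next
    case (3 v)
    then show ?case unfolding W'_def by auto
  next
    case 4 show ?case using W'W zero_W by blast
  next
    case (5 i) then show ?case by (simp add: W'_def)
  next
    case (6 v) then show ?case using W'W W_V by blast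
  next
    case (7 x)
    then have "x i \<in> W" if "i \<in> I" for i using W'W that by blast
    then show ?case by (rule W_bound)
  next
    case (8 x)
    have "2 * \<omega> x \<in> \<int>"
      by (rule form_half_lat[OF fV f(2)]) (use cl 8 in blast)+
    then show ?case by simp
  qed
  then have "bimod I \<omega> B W'" using based_form_axioms by (simp add: bimod_def conf_def)
  then have "card W' \<le> card I ^ 2 + 3 * card I" by (rule card_bimodular)
  moreover have "card X \<le> card W'" using fW' by (intro card_mono) (auto simp: W'_def)
  ultimately show ?thesis by (simp add: X_def)
qed

lemma card_slice:
  assumes U: "U \<subseteq> W" "\<And>v w. v \<in> U \<Longrightarrow> w \<in> U \<Longrightarrow> v - w \<in> lat" and i: "i \<in> I"
    and c: "1/2 < \<bar>c\<bar>" and L: "\<And>v. v \<in> U \<Longrightarrow> crd i v = c"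
  shows "2 * card U \<le> card I ^ 2 + card I"
proof (cases "U = {}")
  case False
  then obtain v0 where v0: "v0 \<in> U" by blast
  have c0: "c \<noteq> 0" using c by auto
  define C where "C = B(i := v0)"
  have wC: "\<omega> C = c" using L[OF v0] by (simp add: C_def crd_def)
  have C0: "\<omega> C \<noteq> 0" using wC c0 by simp
  have CV: "C k \<in> V" if "k \<in> I" for k using U(1) v0 W_V B_in_V[OF that] by (auto simp: C_def)
  interpret X: based_form I "\<lambda>x. \<omega> x / \<omega> C" C using C0 by (rule rebase)
  have sp: "span (C ` I) = V" by (rule rebase_span[OF C0 CV])
  define W' where "W' = U \<union> uminus ` U \<union> (C ` I \<union> uminus ` C ` I)"
  have CW: "C k \<in> W" if "k \<in> I" for k using U(1) v0 B_W[OF that] by (auto simp: C_def)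
  have W'W: "W' \<subseteq> W" unfolding W'_def using U(1) W_minus CW by auto
  have fW': "finite W'" using W'W fin_W finite_subset by blast
  have Ulat: "v \<in> X.lat" if v: "v \<in> U" for v
  proof -
    have dl: "v - v0 \<in> lat" by (rule U(2)[OF v v0])
    have di: "crd i (v - v0) = 0" using i L[OF v] L[OF v0] by simp
    have "X.crd k (v - v0) \<in> \<int>" if k: "k \<in> I" for k
    proof (cases "k = i")
      case True
      have "C(i := v - v0) = B(i := v - v0)" by (simp add: C_def)
      then have "X.crd i (v - v0) = 0" using di by (simp add: X.crd_def crd_def)
      then show ?thesis using True by simp
    next
      case False
      have "\<omega> (C(k := v - v0)) = crd k (v - v0) * \<omega> C"
        by (rule crd_rebase_off[of C "{i}"]) (use C0 lat_in_V[OF dl] di k False in \<open>auto simp: C_def\<close>)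
      then have "X.crd k (v - v0) = crd k (v - v0)" using C0 by (simp add: X.crd_def)
      then show ?thesis using lat_crd[OF dl k] by simp
    qed
    then have "v - v0 \<in> X.lat" using lat_in_V[OF dl] by (simp add: X.lat_def sp)
    moreover have "v0 \<in> X.lat" using X.lat_B[OF i] by (simp add: C_def)
    ultimately show ?thesis using X.lat_add[of "v - v0" v0] by simp
  qed
  have W'lat: "v \<in> X.lat" if "v \<in> W'" for v
    using that Ulat X.lat_B X.lat_minus unfolding W'_def by auto
  have int: "\<omega> x / \<omega> C \<in> \<int>" if "\<And>k. k \<in> I \<Longrightarrow> x k \<in> W'" for x
    by (rule X.form_lat) (use W'lat that in blast)
  have "conf_axioms I (\<lambda>x. \<omega> x / \<omega> C) C 1 W'"
  proof (rule conf_axioms.intro, goal_cases)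
    case 1 show ?case by simp
  next
    case 2 show ?case by (rule fW')
  next
    case (3 v)
    then show ?case unfolding W'_def by auto
  next
    case 4 show ?case using W'W zero_W by blast
  next
    case (5 k) then show ?case by (simp add: W'_def)
  next
    case (6 v) then show ?case using W'W W_V sp by blast
  next
    case (7 x)
    have "\<bar>\<omega> x\<bar> \<le> 1" by (rule W_bound) (use 7 W'W in blast)
    then have lt: "\<bar>\<omega> x / \<omega> C\<bar> < 2" using c wC by (simp add: abs_divide field_simps)
    have in_Z: "\<omega> x / \<omega> C \<in> \<int>" by (rule int) (rule 7)
    show ?case
    proof (cases "\<omega> x / \<omega> C = 0")
      case True
      show ?thesis unfolding True by simp
    next
      case False
      from int_abs_less_2[OF in_Z False lt] show ?thesis
      proof
        assume e: "\<omega> x / \<omega> C = 1"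
        show ?thesis unfolding e by simp
      next
        assume e: "\<omega> x / \<omega> C = -1"
        show ?thesis unfolding e by simp
      qed
    qed
  next
    case (8 x)
    then show ?case using int by simp
  qed
  then interpret H: conf I "\<lambda>x. \<omega> x / \<omega> C" C 1 W'
    using X.based_form_axioms by (simp add: conf_def)
  have fU: "finite U" using U(1) fin_W finite_subset by blast
  have disj: "U \<inter> uminus ` U = {}"
  proof -
    have False if "v \<in> U" "w \<in> U" "v = - w" for v w
      using L[OF that(1)] L[OF that(2)] that(3) i c0 by simp
    then show ?thesis by blast
  qed
  have "card (uminus ` U) = card U" by (rule card_image) simp
  then have "2 * card U = card (U \<union> uminus ` U)" using card_Un_disjoint[OF fU _ disj] fU by simp
  also have "\<dots> \<le> card W'" using fW' by (intro card_mono) (auto simp: W'_def)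
  finally show ?thesis using H.card_unimodular by simp
qed simp

lemma card_fixed_part:
  assumes U: "U \<subseteq> W" "\<And>v w. v \<in> U \<Longrightarrow> w \<in> U \<Longrightarrow> v - w \<in> lat" and F: "F \<subseteq> I" "F \<noteq> {}"
    and L: "\<And>v w i. v \<in> U \<Longrightarrow> w \<in> U \<Longrightarrow> i \<in> F \<Longrightarrow> crd i v = crd i w"
    and h: "\<And>v i. v \<in> U \<Longrightarrow> i \<in> I - F \<Longrightarrow> 2 * crd i v \<in> \<int>"
  shows "card U \<le> card I ^ 2 + card I"
proof (cases "U = {}")
  case False
  then obtain v0 where v0: "v0 \<in> U" by blast
  define J where "J = I - F"
  have JI: "J \<subseteq> I" by (auto simp: J_def)
  interpret R: conf J "restr J" B q "proj J ` W - {0}" by (rule conf_restr[OF JI])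
  have Rc: "R.crd k v = crd k v" if "k \<in> J" for k v by (rule crd_restr[OF JI that])
  have cp: "crd k (proj J v) = crd k v" if "k \<in> J" for k v using that JI by (subst crd_proj) auto
  define f where "f = proj J v0"
  have fV: "f \<in> R.V" unfolding f_def by (rule proj_in_span)
  have f2: "2 * R.crd k f \<in> \<int>" if k: "k \<in> J" for k
    using h[OF v0, of k] k unfolding Rc[OF k] f_def cp[OF k] by (simp add: J_def)
  define X where "X = proj J ` U"
  define W' where "W' = (X \<union> uminus ` X \<union> (B ` J \<union> uminus ` B ` J)) - {0}"
  have fU: "finite U" using U(1) fin_W finite_subset by blast
  have fX: "finite X" using fU by (simp add: X_def)
  have fW': "finite W'" using fX R.fin_I by (simp add: W'_def)
  have W'W: "W' \<subseteq> proj J ` W - {0}"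
  proof -
    have "X \<subseteq> proj J ` W" using U(1) by (auto simp: X_def)
    moreover have "uminus ` X \<subseteq> proj J ` W" using U(1) W_minus proj_minus[OF JI] unfolding X_def by (auto simp flip: proj_minus[OF JI])
    moreover have "B ` J \<subseteq> proj J ` W" using R.B_W by auto
    moreover have "uminus ` B ` J \<subseteq> proj J ` W" using R.B_W R.W_minus by auto
    ultimately show ?thesis unfolding W'_def by blast
  qed
  have Xf: "x - f \<in> R.lat" if x: "x \<in> X" for x
  proof -
    obtain v where v: "v \<in> U" "x = proj J v" using x by (auto simp: X_def)
    have "R.crd k (x - f) \<in> \<int>" if k: "k \<in> J" for k
    proof -
      have kI: "k \<in> I" using k JI by blast
      have "R.crd k (x - f) = crd k (v - v0)"
        unfolding Rc[OF k] v(2) f_def using kI cp[OF k] by simp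
      then show ?thesis using lat_crd[OF U(2)[OF v(1) v0] kI] by simp
    qed
    moreover have "x - f \<in> R.V" using fV v(2) proj_in_span by (simp add: span_diff)
    ultimately show ?thesis by (simp add: R.lat_def)
  qed
  have ff: "2 *\<^sub>R f \<in> R.lat" using f2 fV by (simp add: R.lat_def span_scale)
  have cl: "v \<in> R.lat \<or> v - f \<in> R.lat" if v: "v \<in> W'" for v
  proof -
    consider "v \<in> X" | x where "x \<in> X" "v = - x" | k where "k \<in> J" "v = B k \<or> v = - B k"
      using v unfolding W'_def by blast
    then show ?thesis
    proof cases
      case 1 then show ?thesis using Xf by blast
    next
      case 2
      from R.lat_diff[OF R.lat_minus[OF Xf[OF 2(1)]] ff] have "- (x - f) - 2 *\<^sub>R f \<in> R.lat" .
      moreover have "- (x - f) - 2 *\<^sub>R f = v - f" unfolding 2(2) by (simp add: scaleR_2)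
      ultimately show ?thesis by (simp only:) simp
    next
      case 3 then show ?thesis using R.lat_B R.lat_minus by blast
    qed
  qed
  have "conf_axioms J (restr J) B 2 W'"
  proof (rule conf_axioms.intro, goal_cases)
    case 1 show ?case by simp
  next
    case 2 show ?case by (rule fW')
  next
    case (3 v)
    then show ?case unfolding W'_def by auto
  next
    case 4 show ?case by (simp add: W'_def)
  next
    case (5 k)
    then show ?case using R.B_W[OF 5] unfolding W'_def by auto
  next
    case (6 v) then show ?case using W'W R.W_V by blast
  next
    case (7 x)
    then have "x k \<in> proj J ` W - {0}" if "k \<in> J" for k using W'W that by blast
    then show ?case by (rule R.W_bound)
  next
    case (8 x)
    have "2 * restr J x \<in> \<int>"
      by (rule R.form_half_lat[OF fV f2]) (use cl 8 in blast)+
    then show ?case by simp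
  qed
  then have "bimod J (restr J) B W'" using R.based_form_axioms by (simp add: bimod_def conf_def)
  then have b: "card W' \<le> card J ^ 2 + 3 * card J" by (rule card_bimodular)
  have "inj_on (proj J) U"
  proof (rule inj_onI)
    fix v w assume vw: "v \<in> U" "w \<in> U" "proj J v = proj J w"
    show "v = w"
    proof (rule eqI)
      show "v \<in> V" "w \<in> V" using vw(1,2) U(1) W_V by auto
      fix k assume k: "k \<in> I"
      show "crd k v = crd k w"
      proof (cases "k \<in> F")
        case True then show ?thesis using L[OF vw(1,2)] by blast
      next
        case False then show ?thesis using vw(3) k unfolding proj_eq_iff[OF JI] by (simp add: J_def)
      qed
    qed
  qed
  then have "card U = card X" unfolding X_def by (rule card_image[symmetric])
  also have "\<dots> \<le> card (insert 0 W')" using fW' by (intro card_mono) (auto simp: W'_def)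
  also have "\<dots> \<le> card W' + 1" using fW' by (simp add: card_insert_if)
  finally have u: "card U \<le> card J ^ 2 + 3 * card J + 1" using b by linarith
  have "J \<subset> I" using F by (auto simp: J_def)
  then have "card J < card I" using fin_I by (rule psubset_card_mono[rotated])
  then have "card J + 1 \<le> card I" by simp
  then have "(card J + 1) ^ 2 \<le> card I ^ 2" "card J + 1 \<le> card I" by (simp_all only: power_mono)
  then show ?thesis using u by (simp add: power2_eq_square algebra_simps)
qed simp

lemma card_oriented_class:
  assumes U: "U \<subseteq> W" "\<And>v w. v \<in> U \<Longrightarrow> w \<in> U \<Longrightarrow> v - w \<in> lat" and F: "F \<subseteq> I" "F \<noteq> {}"
    and \<phi>: "\<And>i. i \<in> F \<Longrightarrow> 0 < \<phi> i \<and> \<phi> i < 1/2"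
    and c: "\<And>v i. v \<in> U \<Longrightarrow> i \<in> F \<Longrightarrow> crd i v = \<phi> i \<or> crd i v = \<phi> i - 1"
    and h: "\<And>v i. v \<in> U \<Longrightarrow> i \<in> I - F \<Longrightarrow> 2 * crd i v \<in> \<int>"
  shows "card U \<le> (q + 1) * (card I ^ 2 + card I)"
proof -
  define m where "m = card I ^ 2 + card I"
  define P where "P v = {i \<in> F. crd i v = \<phi> i - 1}" for v
  define U0 where "U0 = {v \<in> U. P v = {}}"
  define U1 where "U1 = {v \<in> U. P v \<noteq> {}}"
  have fF: "finite F" using F(1) fin_I finite_subset by blast
  have fU: "finite U" using U(1) fin_W finite_subset by blast
  have U01: "card U = card U0 + card U1"
  proof -
    have "U = U0 \<union> U1" by (auto simp: U0_def U1_def)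
    moreover have "card (U0 \<union> U1) = card U0 + card U1"
      by (rule card_Un_disjoint) (use fU in \<open>auto simp: U0_def U1_def\<close>)
    ultimately show ?thesis by simp
  qed
  have U0c: "crd i v = \<phi> i" if "v \<in> U0" "i \<in> F" for v i
    using that c[of v i] by (auto simp: U0_def P_def)
  have c0: "card U0 \<le> m" unfolding m_def
  proof (rule card_fixed_part[of U0 F])
    show "U0 \<subseteq> W" using U(1) by (auto simp: U0_def)
    show "v - w \<in> lat" if "v \<in> U0" "w \<in> U0" for v w using that U(2) by (simp add: U0_def)
    show "crd i v = crd i w" if "v \<in> U0" "w \<in> U0" "i \<in> F" for v w i
      using U0c[OF that(1,3)] U0c[OF that(2,3)] by simp
    show "2 * crd i v \<in> \<int>" if "v \<in> U0" "i \<in> I - F" for v i using that h by (simp add: U0_def)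
  qed (use F in auto)
  interpret R: conf F "restr F" B q "proj F ` W - {0}" by (rule conf_restr[OF F(1)])
  have "\<exists>w. (\<forall>i\<in>F. 0 \<le> w i) \<and> (\<forall>S\<in>P ` U1. 1 \<le> sum w S) \<and> (\<Sum>i\<in>F. \<phi> i * w i) \<le> 2"
  proof (rule R.weights)
    fix S assume "S \<in> P ` U1"
    then obtain v where "v \<in> U1" and v3: "S = P v" by (rule imageE)
    then have v: "v \<in> U" "P v \<noteq> {}" "S = P v" unfolding U1_def by simp_all
    have SF: "S \<subseteq> F" unfolding v(3) by (auto simp: P_def)
    have "{i \<in> F. i \<in> S} = S" using SF by blast
    then have "(\<Sum>i\<in>S. B i) = (\<Sum>i\<in>F. if i \<in> S then B i else 0)"
      using sum.inter_filter[OF fF, of B "\<lambda>i. i \<in> S"] by (simp only:)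
    then have "(\<Sum>i\<in>F. \<phi> i *\<^sub>R B i) - (\<Sum>i\<in>S. B i) = (\<Sum>i\<in>F. \<phi> i *\<^sub>R B i - (if i \<in> S then B i else 0))"
      by (simp only: sum_subtractf)
    also have "\<dots> = (\<Sum>i\<in>F. crd i v *\<^sub>R B i)"
    proof (rule sum.cong[OF refl])
      fix i assume i: "i \<in> F"
      show "\<phi> i *\<^sub>R B i - (if i \<in> S then B i else 0) = crd i v *\<^sub>R B i"
      proof (cases "i \<in> S")
        case True
        then have "crd i v = \<phi> i - 1" unfolding v(3) by (simp add: P_def)
        then show ?thesis using True by (simp add: scaleR_diff_left)
      next
        case False
        then have "crd i v = \<phi> i" using c[OF v(1) i] i unfolding v(3) by (auto simp: P_def)
        then show ?thesis using False by simp
      qed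
    qed
    finally have e: "(\<Sum>i\<in>F. \<phi> i *\<^sub>R B i) - (\<Sum>i\<in>S. B i) = proj F v" unfolding proj_def .
    have "proj F v \<noteq> 0"
    proof
      assume z: "proj F v = 0"
      obtain i where i: "i \<in> S" using v(2) unfolding v(3) by blast
      then have "crd i v = 0" using z SF unfolding proj_eq_0_iff[OF F(1)] by blast
      moreover have "crd i v = \<phi> i - 1" using i unfolding v(3) by (simp add: P_def)
      moreover have "\<phi> i < 1/2" using \<phi> i SF by blast
      ultimately show False by linarith
    qed
    moreover have "proj F v \<in> proj F ` W" using v(1) U(1) by blast
    moreover have "S \<noteq> {}" unfolding v(3) by (rule v(2))
    ultimately show "S \<subseteq> F \<and> S \<noteq> {} \<and> (\<Sum>i\<in>F. \<phi> i *\<^sub>R B i) - (\<Sum>i\<in>S. B i) \<in> proj F ` W - {0}"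
      unfolding e using SF by simp
  qed
  then obtain w where w0: "\<forall>i\<in>F. 0 \<le> w i" "\<forall>S\<in>P ` U1. 1 \<le> sum w S" "(\<Sum>i\<in>F. \<phi> i * w i) \<le> 2"
    by (elim exE conjE)
  have w: "0 \<le> w i" if "i \<in> F" for i using w0(1) that by (rule bspec)
  have w1: "1 \<le> sum w (P v)" if "v \<in> U1" for v using w0(2) imageI[OF that] by (rule bspec)
  have c1: "card U1 \<le> q * m"
  proof (cases "U = {}")
    case True
    then show ?thesis by (simp add: U1_def)
  next
    case False
    then obtain v0 where v0: "v0 \<in> U" by blast
    have q\<phi>: "1 \<le> real q * \<phi> i" if i: "i \<in> F" for i
    proof -
      have "real q * crd i v0 \<in> \<int>" using crd_int U(1) v0 F(1) i by blast
      moreover have "real q * \<phi> i = real q * crd i v0 \<or> real q * \<phi> i = real q * crd i v0 + real q"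
      proof -
        have "\<phi> i = crd i v0 \<or> \<phi> i = crd i v0 + 1" using c[OF v0 i] by linarith
        then show ?thesis by (auto simp: distrib_left)
      qed
      ultimately have "real q * \<phi> i \<in> \<int>" by auto
      then obtain k :: int where k: "real q * \<phi> i = of_int k" by (auto elim: Ints_cases)
      have "0 < real q * \<phi> i" using \<phi>[OF i] q_pos by simp
      then show ?thesis unfolding k by simp
    qed
    have "(\<Sum>i\<in>F. w i) \<le> (\<Sum>i\<in>F. real q * (\<phi> i * w i))"
    proof (rule sum_mono)
      fix i assume i: "i \<in> F"
      have "1 * w i \<le> (real q * \<phi> i) * w i" using q\<phi>[OF i] w[OF i] by (rule mult_right_mono)
      then show "w i \<le> real q * (\<phi> i * w i)" by (simp add: mult.assoc)
    qed
    also have "\<dots> = real q * (\<Sum>i\<in>F. \<phi> i * w i)" by (simp add: sum_distrib_left)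
    also have "\<dots> \<le> real q * 2" using w0(3) by (intro mult_left_mono) auto
    finally have sw: "(\<Sum>i\<in>F. w i) \<le> 2 * real q" by simp
    have fU1: "finite U1" using fU by (simp add: U1_def)
    have "real (card U1) = (\<Sum>v\<in>U1. 1)" by simp
    also have "\<dots> \<le> (\<Sum>v\<in>U1. sum w (P v))" by (rule sum_mono) (rule w1)
    also have "\<dots> = (\<Sum>v\<in>U1. \<Sum>i\<in>F. if crd i v = \<phi> i - 1 then w i else 0)"
      unfolding P_def sum.inter_filter[OF fF] by (rule refl)
    also have "\<dots> = (\<Sum>i\<in>F. \<Sum>v\<in>U1. if crd i v = \<phi> i - 1 then w i else 0)" by (rule sum.swap)
    also have "\<dots> = (\<Sum>i\<in>F. w i * real (card {v \<in> U1. crd i v = \<phi> i - 1}))"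
    proof (rule sum.cong[OF refl])
      fix i
      have "(\<Sum>v\<in>U1. if crd i v = \<phi> i - 1 then w i else 0) = sum (\<lambda>_. w i) {v \<in> U1. crd i v = \<phi> i - 1}"
        by (rule sum.inter_filter[OF fU1, symmetric])
      then show "(\<Sum>v\<in>U1. if crd i v = \<phi> i - 1 then w i else 0) = w i * real (card {v \<in> U1. crd i v = \<phi> i - 1})"
        by (simp only: sum_constant mult.commute)
    qed
    also have "\<dots> \<le> (\<Sum>i\<in>F. w i * (real m / 2))"
    proof (rule sum_mono)
      fix i assume i: "i \<in> F"
      have "2 * card {v \<in> U1. crd i v = \<phi> i - 1} \<le> m" unfolding m_def
      proof (rule card_slice[of _ i "\<phi> i - 1"])
        show "{v \<in> U1. crd i v = \<phi> i - 1} \<subseteq> W" using U(1) by (auto simp: U1_def)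
        show "i \<in> I" using i F(1) by blast
        show "1/2 < \<bar>\<phi> i - 1\<bar>" using \<phi>[OF i] by auto
        show "v - w \<in> lat" if "v \<in> {v \<in> U1. crd i v = \<phi> i - 1}" "w \<in> {v \<in> U1. crd i v = \<phi> i - 1}" for v w
          using that U(2) by (simp add: U1_def)
      qed simp
      then have "real (card {v \<in> U1. crd i v = \<phi> i - 1}) \<le> real m / 2" by linarith
      then show "w i * real (card {v \<in> U1. crd i v = \<phi> i - 1}) \<le> w i * (real m / 2)"
        using w[OF i] by (rule mult_left_mono)
    qed
    also have "\<dots> = (\<Sum>i\<in>F. w i) * (real m / 2)" by (rule sum_distrib_right[symmetric])
    also have "\<dots> \<le> 2 * real q * (real m / 2)" using sw by (rule mult_right_mono) simp
    finally have "real (card U1) \<le> real (q * m)" by simp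
    then show ?thesis by (simp only: of_nat_le_iff)
  qed
  show ?thesis using U01 c0 c1 unfolding m_def[symmetric] by simp
qed

lemma form_signs:
  assumes s: "\<And>i. i \<in> I \<Longrightarrow> s i = 1 \<or> s i = -1"
  shows "\<bar>\<omega> (\<lambda>i. s i *\<^sub>R B i)\<bar> = 1"
proof -
  have "\<bar>\<omega> (\<lambda>i. if i \<in> K then s i *\<^sub>R B i else B i)\<bar> = 1" if "finite K" "K \<subseteq> I" for K
    using that
  proof (induction K rule: finite_induct)
    case empty
    then show ?case using form_B by simp
  next
    case (insert k K)
    let ?z = "\<lambda>i. if i \<in> K then s i *\<^sub>R B i else B i"
    have k: "k \<in> I" using insert.prems by blast
    have "(\<lambda>i. if i \<in> insert k K then s i *\<^sub>R B i else B i) = ?z(k := s k *\<^sub>R B k)" by auto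
    moreover have "?z(k := B k) = ?z" using insert.hyps by auto
    moreover have "\<omega> (?z(k := s k *\<^sub>R B k)) = s k * \<omega> (?z(k := B k))" by (rule form_scale[OF k])
    ultimately have "\<omega> (\<lambda>i. if i \<in> insert k K then s i *\<^sub>R B i else B i) = s k * \<omega> ?z" by metis
    moreover have "\<bar>\<omega> ?z\<bar> = 1" using insert by blast
    ultimately show ?case using s[OF k] by (auto simp: abs_mult)
  qed
  from this[of I] have "\<bar>\<omega> (\<lambda>i. if i \<in> I then s i *\<^sub>R B i else B i)\<bar> = 1" using fin_I by blast
  moreover have "\<omega> (\<lambda>i. if i \<in> I then s i *\<^sub>R B i else B i) = \<omega> (\<lambda>i. s i *\<^sub>R B i)" by (rule form_cong) auto
  ultimately show ?thesis by simp
qed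

end


lemma frac_sign:
  fixes x :: real
  assumes "2 * x \<notin> \<int>"
  shows "\<exists>s. (s = 1 \<or> s = -1) \<and> 0 < frac (s * x) \<and> frac (s * x) < 1/2"
proof -
  have xn: "x \<notin> \<int>" using assms Ints_mult[of 2 x] by auto
  have half: "frac x \<noteq> 1/2"
  proof
    assume "frac x = 1/2"
    then have "2 * x = 2 * of_int \<lfloor>x\<rfloor> + 1" by (simp add: frac_def)
    then show False using assms by simp
  qed
  have pos: "0 < frac x" using xn frac_gt_0_iff by blast
  show ?thesis
  proof (cases "frac x < 1/2")
    case True
    then show ?thesis using pos by (intro exI[of _ 1]) simp
  next
    case False
    have "frac (- x) = 1 - frac x" using xn by (simp add: frac_neg)
    then show ?thesis using False half frac_lt_1[of x] by (intro exI[of _ "-1"]) auto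
  qed
qed

lemma congruent_frac_cases:
  fixes x y :: real
  assumes "x - y \<in> \<int>" "\<bar>x\<bar> \<le> 1" "0 < frac y" "frac y < 1/2"
  shows "x = frac y \<or> x = frac y - 1"
proof -
  have "frac x = frac y"
  proof -
    obtain k :: int where "x - y = of_int k" using assms(1) by (auto elim: Ints_cases)
    then have "x = y + of_int k" by simp
    then show ?thesis by (simp add: frac_def)
  qed
  then have x: "x = of_int \<lfloor>x\<rfloor> + frac y" by (simp add: frac_def)
  then have "\<lfloor>x\<rfloor> < 1" "-2 < \<lfloor>x\<rfloor>" using assms(2-4) by linarith+
  then have "\<lfloor>x\<rfloor> = 0 \<or> \<lfloor>x\<rfloor> = -1" by linarith
  then show ?thesis using x by auto
qed

context conf begin

lemma card_class:
  assumes q: "3 \<le> q" and v0: "v0 \<in> W"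
  shows "card {v \<in> W. v - v0 \<in> lat} \<le> (q + 1) * (card I ^ 2 + card I)"
proof -
  define F where "F = {i \<in> I. 2 * crd i v0 \<notin> \<int>}"
  show ?thesis
  proof (cases "F = {}")
    case True
    then have "2 * crd i v0 \<in> \<int>" if "i \<in> I" for i using that unfolding F_def by blast
    then have "card {v \<in> W. v - v0 \<in> lat} \<le> card I ^ 2 + 3 * card I" by (rule card_half_class[OF v0])
    also have "\<dots> \<le> 4 * (card I ^ 2 + card I)" by simp
    also have "\<dots> \<le> (q + 1) * (card I ^ 2 + card I)" using q by (intro mult_right_mono) auto
    finally show ?thesis .
  next
    case False
    have "\<forall>i. \<exists>s. (s = 1 \<or> s = -1) \<and> (i \<in> F \<longrightarrow> 0 < frac (s * crd i v0) \<and> frac (s * crd i v0) < 1/2)"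
    proof
      fix i
      show "\<exists>s. (s = 1 \<or> s = -1) \<and> (i \<in> F \<longrightarrow> 0 < frac (s * crd i v0) \<and> frac (s * crd i v0) < 1/2)"
      proof (cases "i \<in> F")
        case True
        then have "2 * crd i v0 \<notin> \<int>" by (simp add: F_def)
        then show ?thesis using frac_sign by blast
      next
        case False
        then show ?thesis by blast
      qed
    qed
    then obtain s where s: "\<And>i. s i = 1 \<or> s i = -1"
      "\<And>i. i \<in> F \<Longrightarrow> 0 < frac (s i * crd i v0) \<and> frac (s i * crd i v0) < 1/2" by metis
    define C where "C i = s i *\<^sub>R B i" for i
    have CW: "C i \<in> W" if "i \<in> I" for i using s(1)[of i] B_W[OF that] W_minus by (auto simp: C_def)
    have wC: "\<bar>\<omega> C\<bar> = 1" unfolding C_def by (rule form_signs) (rule s(1))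
    then have C0: "\<omega> C \<noteq> 0" by auto
    interpret X: conf I "\<lambda>x. \<omega> x / \<omega> C" C q W by (rule conf_rebase[OF CW wC])
    have sp: "X.V = V" by (rule rebase_span[OF C0]) (use CW W_V in blast)
    have ss: "s i * s i = 1" for i using s(1)[of i] by auto
    have Xc: "X.crd i v = s i * crd i v" if i: "i \<in> I" and v: "v \<in> V" for i v
    proof -
      have "v = (\<Sum>k\<in>I. crd k v *\<^sub>R B k)" by (rule expand[OF v])
      also have "\<dots> = (\<Sum>k\<in>I. (s k * crd k v) *\<^sub>R C k)"
      proof (rule sum.cong[OF refl])
        fix k
        have "(s k * crd k v) *\<^sub>R C k = ((s k * s k) * crd k v) *\<^sub>R B k" by (simp add: C_def mult_ac)
        then show "crd k v *\<^sub>R B k = (s k * crd k v) *\<^sub>R C k" by (simp add: ss)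
      qed
      finally have "X.crd i v = X.crd i (\<Sum>k\<in>I. (s k * crd k v) *\<^sub>R C k)" by (rule arg_cong)
      also have "\<dots> = (\<Sum>k\<in>I. if i = k then s k * crd k v else 0)"
        using i by simp (intro sum.cong, auto)
      also have "\<dots> = s i * crd i v" using i fin_I by simp
      finally show ?thesis .
    qed
    have latX: "v \<in> X.lat" if v: "v \<in> lat" for v
    proof -
      have "X.crd i v \<in> \<int>" if i: "i \<in> I" for i
        unfolding Xc[OF i lat_in_V[OF v]] using lat_crd[OF v i] s(1)[of i] by auto
      then show ?thesis using lat_in_V[OF v] by (simp add: X.lat_def sp)
    qed
    let ?U = "{v \<in> W. v - v0 \<in> lat}"
    show ?thesis
    proof (rule X.card_oriented_class[of ?U F "\<lambda>i. frac (s i * crd i v0)"])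
      show "?U \<subseteq> W" by blast
      show "v - w \<in> X.lat" if "v \<in> ?U" "w \<in> ?U" for v w
      proof -
        have "(v - v0) - (w - v0) \<in> lat" by (rule lat_diff) (use that in blast)+
        then show ?thesis using latX by simp
      qed
      show "F \<subseteq> I" by (auto simp: F_def)
      show "F \<noteq> {}" by fact
      show "0 < frac (s i * crd i v0) \<and> frac (s i * crd i v0) < 1/2" if "i \<in> F" for i by (rule s(2)[OF that])
      show "X.crd i v = frac (s i * crd i v0) \<or> X.crd i v = frac (s i * crd i v0) - 1" if v: "v \<in> ?U" and i: "i \<in> F" for v i
      proof (rule congruent_frac_cases)
        have iI: "i \<in> I" using i by (simp add: F_def)
        have vW: "v \<in> W" "v - v0 \<in> lat" using v by auto
        have "X.crd i (v - v0) \<in> \<int>" by (rule X.lat_crd[OF latX[OF vW(2)] iI])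
        then show "X.crd i v - s i * crd i v0 \<in> \<int>" using iI Xc[OF iI W_V[OF v0]] by simp
        show "\<bar>X.crd i v\<bar> \<le> 1" by (rule X.crd_bound[OF vW(1) iI])
        show "0 < frac (s i * crd i v0)" "frac (s i * crd i v0) < 1/2" using s(2)[OF i] by blast+
      qed
      show "2 * X.crd i v \<in> \<int>" if v: "v \<in> ?U" and i: "i \<in> I - F" for v i
      proof -
        have iI: "i \<in> I" and vW: "v \<in> W" "v - v0 \<in> lat" using v i by auto
        have "2 * crd i v0 \<in> \<int>" using i by (auto simp: F_def)
        moreover have "crd i (v - v0) \<in> \<int>" by (rule lat_crd[OF vW(2) iI])
        then have "2 * (crd i v - crd i v0) \<in> \<int>" using iI by (intro Ints_mult) auto
        ultimately have "2 * (crd i v - crd i v0) + 2 * crd i v0 \<in> \<int>" by (intro Ints_add)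
        then have z: "2 * crd i v \<in> \<int>" by simp
        show ?thesis unfolding Xc[OF iI W_V[OF vW(1)]] using s(1)[of i]
        proof
          assume e: "s i = 1"
          show "2 * (s i * crd i v) \<in> \<int>" unfolding e using z by simp
        next
          assume e: "s i = -1"
          have "- (2 * crd i v) \<in> \<int>" using z by (simp only: minus_in_Ints_iff)
          then show "2 * (s i * crd i v) \<in> \<int>" unfolding e by simp
        qed
      qed
    qed
  qed
qed

theorem card_conf:
  assumes q: "3 \<le> q"
  shows "card W \<le> (card I ^ 2 + card I) * q ^ 2"
proof (cases "I = {}")
  case True
  have "W \<subseteq> {}"
  proof
    fix v assume v: "v \<in> W"
    then have "v = 0" using W_V[OF v] True by simp
    then show "v \<in> {}" using v zero_W by simp
  qed
  then show ?thesis by simp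
next
  case False
  then obtain i where i: "i \<in> I" by blast
  define m where "m = card I ^ 2 + card I"
  define cl where "cl v = {w \<in> W. w - v \<in> lat}" for v
  have clm: "v \<in> cl v" if "v \<in> W" for v using that by (simp add: cl_def lat_zero)
  obtain X where X: "X \<subseteq> W" "inj_on cl X" "cl ` W = cl ` X"
    using subset_image_inj[of "cl ` W" cl W] by auto
  have fX: "finite X" using X(1) fin_W finite_subset by blast
  have cX: "card (cl ` W) \<le> q"
  proof -
    have "card X \<le> q"
    proof (rule card_incongruent[OF X(1)])
      fix x y assume xy: "x \<in> X" "y \<in> X" "x \<noteq> y"
      show "x - y \<notin> lat"
      proof
        assume l: "x - y \<in> lat"
        have "w - x \<in> lat \<longleftrightarrow> w - y \<in> lat" for w
          using lat_add[of "w - x" "x - y"] lat_diff[of "w - y" "x - y"] l by auto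
        then have "cl x = cl y" by (simp add: cl_def)
        then show False using X(2) xy by (auto dest: inj_onD)
      qed
    qed
    then show ?thesis using card_image_le[OF fX, of cl] X(3) by simp
  qed
  have base: "card (cl (B i)) \<le> m"
  proof -
    have sub: "cl (B i) = W \<inter> lat"
      using lat_add[of _ "B i"] lat_diff[of _ "B i"] lat_B[OF i] by (force simp: cl_def)
    have "conf_axioms I \<omega> B 1 (W \<inter> lat)"
    proof (rule conf_axioms.intro, goal_cases)
      case (7 x)
      then show ?case by (intro W_bound) auto
    next
      case (8 x)
      then have "\<omega> x \<in> \<int>" by (intro form_lat) auto
      then show ?case by simp
    qed (use fin_W W_minus lat_minus zero_W B_W lat_B W_V in auto)
    then interpret H: conf I \<omega> B 1 "W \<inter> lat" using based_form_axioms by (simp add: conf_def)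
    show ?thesis unfolding sub m_def by (rule H.card_unimodular) simp
  qed
  have fcl: "finite (cl ` W)" using fin_W by simp
  have mem: "cl (B i) \<in> cl ` W" using B_W[OF i] by simp
  have "W \<subseteq> (\<Union>c\<in>cl ` W. c)" using clm by blast
  then have "card W \<le> card (\<Union>c\<in>cl ` W. c)" by (rule card_mono[rotated]) (use fin_W in \<open>auto simp: cl_def\<close>)
  also have "\<dots> \<le> (\<Sum>c\<in>cl ` W. card c)" by (rule card_UN_le[OF fcl])
  also have "\<dots> = card (cl (B i)) + (\<Sum>c\<in>cl ` W - {cl (B i)}. card c)" by (rule sum.remove[OF fcl mem])
  also have "(\<Sum>c\<in>cl ` W - {cl (B i)}. card c) \<le> (\<Sum>c\<in>cl ` W - {cl (B i)}. (q + 1) * m)"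
  proof (rule sum_mono)
    fix c assume "c \<in> cl ` W - {cl (B i)}"
    then obtain v where "v \<in> W" "c = cl v" by blast
    then show "card c \<le> (q + 1) * m" using card_class[OF q, of v] by (simp add: cl_def m_def)
  qed
  also have "\<dots> = (card (cl ` W) - 1) * ((q + 1) * m)" using fcl mem by simp
  also have "\<dots> \<le> (q - 1) * ((q + 1) * m)" using cX by (intro mult_right_mono) auto
  finally have "card W \<le> m + (q - 1) * ((q + 1) * m)" using base by linarith
  moreover obtain p where "q = Suc p" using q by (cases q) auto
  then have "m + (q - 1) * ((q + 1) * m) = m * q ^ 2" by (simp add: power2_eq_square algebra_simps)
  ultimately show ?thesis by (simp add: m_def)
qed

end


instantiation "fun" :: (type, real_vector) real_vector
begin

definition scaleR_fun :: "real \<Rightarrow> ('a \<Rightarrow> 'b) \<Rightarrow> 'a \<Rightarrow> 'b" where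
  "scaleR_fun c f = (\<lambda>x. c *\<^sub>R f x)"

instance
  by standard (simp_all add: scaleR_fun_def fun_eq_iff scaleR_add_right scaleR_add_left)

end

definition det_form :: "nat \<Rightarrow> (nat \<Rightarrow> nat \<Rightarrow> real) \<Rightarrow> real" where
  "det_form m x = det (mat m m (\<lambda>(i, j). x i j))"

lemma det_form_sum:
  "det_form m x = (\<Sum>p | p permutes {0..<m}. signof p * (\<Prod>i = 0..<m. x i (p i)))"
proof -
  have "det_form m x = (\<Sum>p | p permutes {0..<m}. signof p * (\<Prod>i = 0..<m. mat m m (\<lambda>(i, j). x i j) $$ (i, p i)))"
    unfolding det_form_def by (rule det_def') simp
  also have "\<dots> = (\<Sum>p | p permutes {0..<m}. signof p * (\<Prod>i = 0..<m. x i (p i)))"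
  proof (rule sum.cong[OF refl])
    fix p assume "p \<in> {p. p permutes {0..<m}}"
    then have p: "p permutes {0..<m}" by simp
    have "(\<Prod>i = 0..<m. mat m m (\<lambda>(i, j). x i j) $$ (i, p i)) = (\<Prod>i = 0..<m. x i (p i))"
    proof (rule prod.cong[OF refl])
      fix i assume i: "i \<in> {0..<m}"
      then have "p i \<in> {0..<m}" using permutes_in_image[OF p] by blast
      then show "mat m m (\<lambda>(i, j). x i j) $$ (i, p i) = x i (p i)" using i by simp
    qed
    then show "signof p * (\<Prod>i = 0..<m. mat m m (\<lambda>(i, j). x i j) $$ (i, p i)) = signof p * (\<Prod>i = 0..<m. x i (p i))"
      by simp
  qed
  finally show ?thesis .
qed

lemma alternating_form_det: "alternating_form {..<m} (det_form m)"
proof (rule alternating_form.intro, goal_cases)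
  case 1
  show ?case by simp
next
  case (2 x y)
  have "mat m m (\<lambda>(i, j). x i j) = mat m m (\<lambda>(i, j). y i j)"
    by (rule eq_matI) (use 2 in auto)
  then show ?case by (simp add: det_form_def)
next
  case (3 x k)
  define c where "c p = signof p * (\<Prod>i\<in>{0..<m} - {k}. x i (p i))" for p
  have e: "det_form m (x(k := v)) = (\<Sum>p | p permutes {0..<m}. c p * v (p k))" for v
    unfolding det_form_sum
  proof (rule sum.cong[OF refl])
    fix p
    have "(\<Prod>i = 0..<m. (x(k := v)) i (p i)) = (x(k := v)) k (p k) * (\<Prod>i\<in>{0..<m} - {k}. (x(k := v)) i (p i))"
      using 3 by (intro prod.remove) auto
    also have "(\<Prod>i\<in>{0..<m} - {k}. (x(k := v)) i (p i)) = (\<Prod>i\<in>{0..<m} - {k}. x i (p i))"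
      by (rule prod.cong) auto
    finally show "signof p * (\<Prod>i = 0..<m. (x(k := v)) i (p i)) = c p * v (p k)" by (simp add: c_def)
  qed
  show ?case unfolding e
    by (rule linearI) (simp_all add: scaleR_fun_def algebra_simps sum.distrib sum_distrib_left)
next
  case (4 x i j)
  show ?case unfolding det_form_def
    by (rule det_identical_rows[of _ m i j]) (use 4 in \<open>auto intro!: eq_vecI\<close>)
qed

definition unit_fun :: "nat \<Rightarrow> nat \<Rightarrow> real" where "unit_fun i = (\<lambda>k. if k = i then 1 else 0)"

lemma based_form_det: "based_form {..<m} (det_form m) unit_fun"
proof -
  have "mat m m (\<lambda>(i, j). unit_fun i j) = 1\<^sub>m m" by (rule eq_matI) (auto simp: unit_fun_def)
  then have "det_form m unit_fun = 1" by (simp add: det_form_def)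
  then show ?thesis using alternating_form_det by (simp add: based_form_def based_form_axioms_def)
qed

lemma in_span_unit_fun:
  assumes "\<And>k. m \<le> k \<Longrightarrow> v k = 0"
  shows "v \<in> span (unit_fun ` {..<m})"
proof -
  have "\<forall>w. (\<forall>k. m \<le> k \<longrightarrow> w k = 0) \<longrightarrow> w \<in> span (unit_fun ` {..<m})"
  proof (induction m)
    case 0
    show ?case
    proof (intro allI impI)
      fix w :: "nat \<Rightarrow> real" assume "\<forall>k. 0 \<le> k \<longrightarrow> w k = 0"
      then have "w = 0" by (intro ext) (simp only: zero_fun_apply le0)
      then show "w \<in> span (unit_fun ` {..<0})" by (simp only: span_zero)
    qed
  next
    case (Suc m)
    show ?case
    proof (intro allI impI)
      fix w :: "nat \<Rightarrow> real" assume w: "\<forall>k. Suc m \<le> k \<longrightarrow> w k = 0"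
      have "\<forall>k. m \<le> k \<longrightarrow> (w(m := 0)) k = 0" using w by simp
      then have "w(m := 0) \<in> span (unit_fun ` {..<m})" using Suc.IH by blast
      moreover have "span (unit_fun ` {..<m}) \<subseteq> span (unit_fun ` {..<Suc m})"
        by (intro span_mono image_mono) simp
      ultimately have "w(m := 0) \<in> span (unit_fun ` {..<Suc m})" by (rule rev_subsetD)
      moreover have "unit_fun m \<in> span (unit_fun ` {..<Suc m})" by (intro span_base imageI) simp
      then have "w m *\<^sub>R unit_fun m \<in> span (unit_fun ` {..<Suc m})" by (rule span_scale)
      ultimately have "w(m := 0) + w m *\<^sub>R unit_fun m \<in> span (unit_fun ` {..<Suc m})" by (rule span_add)
      moreover have "w(m := 0) + w m *\<^sub>R unit_fun m = w"
        by (rule ext) (simp add: scaleR_fun_def unit_fun_def)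
      ultimately show "w \<in> span (unit_fun ` {..<Suc m})" by (simp only:)
    qed
  qed
  then show ?thesis using assms by blast
qed

definition vec_fun :: "int vec \<Rightarrow> nat \<Rightarrow> real" where
  "vec_fun a = (\<lambda>i. if i < dim_vec a then real_of_int (a $ i) else 0)"

lemma finite_minors:
  fixes A :: "int mat"
  shows "finite {\<bar>det B\<bar> | B. (\<exists>I J. B = submatrix A I J) \<and> B \<in> carrier_mat (dim_row A) (dim_row A)}"
proof -
  define S where "S = (\<lambda>(I', J'). \<bar>det (mat (card I') (card J') (\<lambda>(i, j). A $$ (pick I' i, pick J' j)))\<bar>)
    ` (Pow {..<dim_row A} \<times> Pow {..<dim_col A})"
  have "\<bar>det (submatrix A I J)\<bar> \<in> S" for I J
  proof -
    let ?I = "{i. i < dim_row A \<and> i \<in> I}" and ?J = "{j. j < dim_col A \<and> j \<in> J}"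
    have e: "submatrix A I J = mat (card ?I) (card ?J) (\<lambda>(i, j). A $$ (pick ?I i, pick ?J j))"
    proof (rule eq_matI)
      fix i j
      assume "i < dim_row (mat (card ?I) (card ?J) (\<lambda>(i, j). A $$ (pick ?I i, pick ?J j)))"
        "j < dim_col (mat (card ?I) (card ?J) (\<lambda>(i, j). A $$ (pick ?I i, pick ?J j)))"
      then have ij: "i < card ?I" "j < card ?J" by (simp_all only: dim_row_mat dim_col_mat)
      show "submatrix A I J $$ (i, j) = mat (card ?I) (card ?J) (\<lambda>(i, j). A $$ (pick ?I i, pick ?J j)) $$ (i, j)"
        unfolding submatrix_index[OF ij] index_mat(1)[OF ij] split pick_reduce_set[OF ij(1)] pick_reduce_set[OF ij(2)] ..
    qed (simp_all only: dim_submatrix dim_row_mat dim_col_mat)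
    have m: "(?I, ?J) \<in> Pow {..<dim_row A} \<times> Pow {..<dim_col A}"
      by (intro SigmaI PowI subsetI) (simp_all only: mem_Collect_eq lessThan_iff)
    show ?thesis unfolding S_def by (rule image_eqI[OF _ m]) (simp only: e split)
  qed
  then have "{\<bar>det B\<bar> | B. (\<exists>I J. B = submatrix A I J) \<and> B \<in> carrier_mat (dim_row A) (dim_row A)} \<subseteq> S" by blast
  moreover have "finite S" unfolding S_def by simp
  ultimately show ?thesis by (rule finite_subset)
qed

lemma minor_le_max_minor:
  fixes A :: "int mat"
  assumes f: "\<And>i. i < dim_row A \<Longrightarrow> f i < dim_col A"
    and nz: "det_form (dim_row A) (\<lambda>i. vec_fun (col A (f i))) \<noteq> 0"
  shows "\<bar>det_form (dim_row A) (\<lambda>i. vec_fun (col A (f i)))\<bar> \<le> real_of_int (max_minor A)"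
proof -
  define m where "m = dim_row A"
  interpret alternating_form "{..<m}" "det_form m" by (rule alternating_form_det)
  have inj: "inj_on f {..<m}"
  proof (rule inj_onI, rule ccontr)
    fix i j assume "i \<in> {..<m}" "j \<in> {..<m}" "f i = f j" "i \<noteq> j"
    then have "det_form m (\<lambda>i. vec_fun (col A (f i))) = 0" by (intro form_eq[of i j]) auto
    then show False using nz by (simp add: m_def)
  qed
  define J where "J = f ` {..<m}"
  have Jn: "J \<subseteq> {..<dim_col A}" using f by (auto simp: J_def m_def)
  have fJ: "finite J" by (simp add: J_def)
  have cJ: "card J = m" using inj by (simp add: J_def card_image)
  have Jset: "{j. j < dim_col A \<and> j \<in> J} = J" using Jn by auto
  define p where "p i = (if i < m then card {a \<in> J. a < f i} else i)" for i
  have pk: "pick J (p i) = f i" if "i < m" for i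
    using pick_card_in_set[of "f i" J] that by (simp add: p_def J_def)
  have pm: "p i < m" if i: "i < m" for i
  proof -
    have "{a \<in> J. a < f i} \<subset> J" using i by (auto simp: J_def)
    then have "card {a \<in> J. a < f i} < card J" using fJ by (rule psubset_card_mono[rotated])
    then show ?thesis using i cJ by (simp add: p_def)
  qed
  have inj_p: "inj_on p {0..<m}"
  proof (rule inj_onI)
    fix i j assume ij: "i \<in> {0..<m}" "j \<in> {0..<m}" "p i = p j"
    then have "f i = f j" using pk[of i] pk[of j] by simp
    then show "i = j" using inj ij by (auto dest: inj_onD)
  qed
  have "p ` {0..<m} = {0..<m}" by (rule endo_inj_surj[OF _ _ inj_p]) (use pm in auto)
  then have "bij_betw p {0..<m} {0..<m}" using inj_p by (simp add: bij_betw_def)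
  then have perm: "p permutes {0..<m}" by (rule bij_imp_permutes) (simp add: p_def)
  define S where "S = submatrix A UNIV J"
  have rows: "card {i. i < dim_row A \<and> i \<in> UNIV} = m" by (simp add: m_def)
  have cols: "card {j. j < dim_col A \<and> j \<in> J} = m" unfolding Jset by (rule cJ)
  have Sc: "S \<in> carrier_mat m m" unfolding S_def by (rule carrier_matI) (simp_all only: dim_submatrix rows cols)
  define T where "T = transpose_mat (map_mat real_of_int S)"
  have Tc: "T \<in> carrier_mat m m" using Sc by (simp add: T_def)
  have T: "T $$ (i, j) = real_of_int (A $$ (j, pick J i))" if "i < m" "j < m" for i j
    using that Sc submatrix_index[of j A UNIV i J] unfolding T_def S_def rows cols by (simp add: pick_UNIV)
  have "mat m m (\<lambda>(i, j). vec_fun (col A (f i)) j) = mat m m (\<lambda>(i, j). T $$ (p i, j))"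
    by (rule eq_matI) (use T pm pk f in \<open>auto simp: vec_fun_def m_def\<close>)
  then have "det_form m (\<lambda>i. vec_fun (col A (f i))) = signof p * det T"
    unfolding det_form_def using det_permute_rows[OF Tc perm] by simp
  moreover have "det T = real_of_int (det S)"
    unfolding T_def using Sc by (subst det_transpose[of _ m]) (simp_all add: of_int_hom.hom_det)
  moreover have "\<bar>signof p :: real\<bar> = 1" by (simp add: sign_def)
  ultimately have "\<bar>det_form m (\<lambda>i. vec_fun (col A (f i)))\<bar> = real_of_int \<bar>det S\<bar>" by (simp add: abs_mult)
  moreover have "\<bar>det S\<bar> \<le> max_minor A"
    unfolding max_minor_def
    by (rule Max_ge[OF finite_minors]) (use Sc in \<open>auto simp: S_def m_def\<close>)
  ultimately show ?thesis by (simp add: m_def)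
qed

lemma det_form_int:
  assumes "\<And>i. i < m \<Longrightarrow> dim_vec (g i) = m"
  shows "det_form m (\<lambda>i. vec_fun (g i)) \<in> \<int>"
proof -
  have "mat m m (\<lambda>(i, j). vec_fun (g i) j) = map_mat real_of_int (mat m m (\<lambda>(i, j). g i $ j))"
    by (rule eq_matI) (use assms in \<open>auto simp: vec_fun_def\<close>)
  then have "det_form m (\<lambda>i. vec_fun (g i)) = real_of_int (det (mat m m (\<lambda>(i, j). g i $ j)))"
    unfolding det_form_def by (simp add: of_int_hom.hom_det)
  then show ?thesis by simp
qed

lemma nonzero_minor:
  fixes A :: "int mat"
  assumes "full_row_rank A"
  shows "\<exists>f. (\<forall>i < dim_row A. f i < dim_col A) \<and> det_form (dim_row A) (\<lambda>i. vec_fun (col A (f i))) \<noteq> 0"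
proof -
  define m where "m = dim_row A"
  define R where "R = map_mat real_of_int A"
  have Rc: "R \<in> carrier_mat m (dim_col A)" by (simp add: R_def m_def)
  interpret vec_space "TYPE(real)" m .
  have rank: "rank R = m" using assms by (simp add: full_row_rank_def R_def m_def)
  define P where "P T \<longleftrightarrow> T \<subseteq> set (cols R) \<and> lin_indpt T" for T
  have "P {}" unfolding P_def lin_dep_def by auto
  then obtain S where S: "finite S" "maximal S P"
    using maximal_exists_superset[of "set (cols R)" P "{}"] by (auto simp: P_def)
  have PS: "S \<subseteq> set (cols R)" "lin_indpt S" using S(2) unfolding maximal_def P_def by auto
  have "card S = m" using rank_card_indpt[OF Rc, of S] S(2) rank by (simp add: P_def[abs_def])
  obtain xs where xs: "set xs = S" "distinct xs" using finite_distinct_list[OF S(1)] by blast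
  have len: "length xs = m" using distinct_card[OF xs(2)] xs(1) \<open>card S = m\<close> by simp
  have xc: "set xs \<subseteq> carrier_vec m" using PS(1) xs(1) cols_dim Rc by blast
  define M where "M = mat_of_cols m xs"
  have Mc: "M \<in> carrier_mat m m" unfolding M_def using len by (metis mat_of_cols_carrier(1))
  have cM: "cols M = xs" unfolding M_def using xc by (rule cols_mat_of_cols)
  have "rank M = m" by (rule lin_indpt_full_rank[OF Mc]) (use cM xs PS in simp_all)
  then have dM: "det M \<noteq> 0" using det_rank_iff[OF Mc] by simp
  have "\<exists>k < dim_col A. xs ! i = col R k" if "i < m" for i
  proof -
    have "xs ! i \<in> set (cols R)" using nth_mem[of i xs] that len xs(1) PS(1) by auto
    then show ?thesis using Rc by (auto simp: cols_def)
  qed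
  then obtain f where f: "\<And>i. i < m \<Longrightarrow> f i < dim_col A \<and> xs ! i = col R (f i)" by metis
  have "mat m m (\<lambda>(i, j). vec_fun (col A (f i)) j) = transpose_mat M"
  proof (rule eq_matI)
    fix i j assume "i < dim_row (transpose_mat M)" "j < dim_col (transpose_mat M)"
    then have ij: "i < m" "j < m" using Mc by auto
    have "transpose_mat M $$ (i, j) = xs ! i $ j"
      using ij Mc len by (simp add: M_def mat_of_cols_index)
    also have "\<dots> = real_of_int (A $$ (j, f i))" using f[OF ij(1)] ij by (simp add: R_def m_def)
    finally show "mat m m (\<lambda>(i, j). vec_fun (col A (f i)) j) $$ (i, j) = transpose_mat M $$ (i, j)"
      using ij f[OF ij(1)] by (simp add: vec_fun_def m_def)
  qed (use Mc in auto)
  then have "det_form m (\<lambda>i. vec_fun (col A (f i))) = det M"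
    unfolding det_form_def using det_transpose[OF Mc] by simp
  then show ?thesis using dM f unfolding m_def by (intro exI[of _ f]) auto
qed

definition column_bound :: "nat \<Rightarrow> nat \<Rightarrow> nat" where
  "column_bound q m = (if q = 1 then m ^ 2 + m else if q = 2 then m ^ 2 + 3 * m else (m ^ 2 + m) * q ^ 2)"

lemma conf_card_le:
  assumes "conf I \<omega> B q W"
  shows "card W \<le> column_bound q (card I)"
proof -
  interpret conf I \<omega> B q W by fact
  consider "q = 1" | "q = 2" | "3 \<le> q" using q_pos by linarith
  then show ?thesis
  proof cases
    case 1
    then show ?thesis using card_unimodular by (simp add: column_bound_def)
  next
    case 2
    then have "bimod I \<omega> B W" using assms by (simp add: bimod_def)
    then show ?thesis using card_bimodular 2 by (simp add: column_bound_def)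
  next
    case 3
    then show ?thesis using card_conf by (simp add: column_bound_def)
  qed
qed

lemma differing_columns_le:
  fixes A :: "int mat"
  assumes rank: "full_row_rank A" and X: "X \<subseteq># mset (cols A)" "has_differing_columns X"
  shows "\<exists>q. 1 \<le> q \<and> int q \<le> max_minor A \<and> 2 * size X \<le> column_bound q (dim_row A)"
proof -
  define m where "m = dim_row A"
  let ?I = "{..<m}" and ?\<omega> = "det_form m"
  interpret E: based_form ?I ?\<omega> unit_fun by (rule based_form_det)
  define G where "G = (\<lambda>k. vec_fun (col A k)) ` {..<dim_col A}"
  define W where "W = (G - {0}) \<union> uminus ` (G - {0})"
  have fG: "finite G" by (simp add: G_def)
  have fW: "finite W" using fG by (simp add: W_def)
  have Gval: "?\<omega> x \<in> \<int> \<and> (?\<omega> x \<noteq> 0 \<longrightarrow> \<bar>?\<omega> x\<bar> \<le> real_of_int (max_minor A))"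
    if x: "\<And>i. i < m \<Longrightarrow> x i \<in> G" for x
  proof -
    have "\<forall>i. \<exists>k. i < m \<longrightarrow> k < dim_col A \<and> x i = vec_fun (col A k)" using x by (auto simp: G_def)
    then obtain f where f: "\<And>i. i < m \<Longrightarrow> f i < dim_col A \<and> x i = vec_fun (col A (f i))" by metis
    have e: "?\<omega> x = ?\<omega> (\<lambda>i. vec_fun (col A (f i)))" by (rule E.form_cong) (use f in auto)
    show ?thesis unfolding e
      using det_form_int[of m "\<lambda>i. col A (f i)"] minor_le_max_minor[of A f] f by (auto simp: m_def)
  qed
  have Wval0: "?\<omega> x \<in> \<int> \<and> (?\<omega> x \<noteq> 0 \<longrightarrow> \<bar>?\<omega> x\<bar> \<le> real_of_int (max_minor A))"
    if "finite K" "\<And>i. i < m \<Longrightarrow> i \<in> K \<Longrightarrow> x i \<in> W" "\<And>i. i < m \<Longrightarrow> i \<notin> K \<Longrightarrow> x i \<in> G" for K x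
    using that
  proof (induction K arbitrary: x rule: finite_induct)
    case empty
    then show ?case by (intro Gval) auto
  next
    case (insert k K)
    show ?case
    proof (cases "k < m")
      case False
      have "x i \<in> W" if "i < m" "i \<in> K" for i using insert.prems(1)[OF that(1)] that(2) by simp
      moreover have "x i \<in> G" if "i < m" "i \<notin> K" for i
        using insert.prems(2)[OF that(1)] that False by auto
      ultimately show ?thesis by (rule insert.IH)
    next
      case True
      then have "x k \<in> W" using insert.prems(1) by simp
      then obtain g where g: "g \<in> G" "x k = g \<or> x k = - g" by (auto simp: W_def)
      have IH: "?\<omega> (x(k := g)) \<in> \<int> \<and> (?\<omega> (x(k := g)) \<noteq> 0 \<longrightarrow> \<bar>?\<omega> (x(k := g))\<bar> \<le> real_of_int (max_minor A))"
        by (rule insert.IH) (use insert.prems insert.hyps g in auto)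
      have "x = x(k := x k)" by simp
      then have "?\<omega> x = ?\<omega> (x(k := g)) \<or> ?\<omega> x = - ?\<omega> (x(k := g))"
        using g(2) E.form_minus[of k x g] True by (metis lessThan_iff)
      then show ?thesis using IH by auto
    qed
  qed
  have Wval: "?\<omega> x \<in> \<int>" "?\<omega> x \<noteq> 0 \<Longrightarrow> \<bar>?\<omega> x\<bar> \<le> real_of_int (max_minor A)"
    if "\<And>i. i < m \<Longrightarrow> x i \<in> W" for x
    using Wval0[of "{..<m}" x] that by auto
  obtain f where f: "\<forall>i < m. f i < dim_col A" "?\<omega> (\<lambda>i. vec_fun (col A (f i))) \<noteq> 0"
    using nonzero_minor[OF rank] unfolding m_def by blast
  define y where "y i = vec_fun (col A (f i))" for i
  have yW: "y i \<in> W" if i: "i < m" for i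
  proof -
    have "y i \<noteq> 0"
    proof
      assume "y i = 0"
      then have "?\<omega> (y(i := 0)) = ?\<omega> y" by (metis fun_upd_triv)
      then show False using E.form_zero[of i y] i f(2) by (simp add: y_def[abs_def])
    qed
    then show ?thesis using f(1) i by (auto simp: W_def G_def y_def)
  qed
  define Ns where "Ns = {N::nat. \<exists>x. (\<forall>i < m. x i \<in> W) \<and> 1 \<le> N \<and> \<bar>?\<omega> x\<bar> = real N}"
  have nat_val: "\<exists>N::nat. 1 \<le> N \<and> \<bar>?\<omega> x\<bar> = real N" if x: "\<And>i. i < m \<Longrightarrow> x i \<in> W" and nz: "?\<omega> x \<noteq> 0" for x
  proof -
    obtain k :: int where k: "?\<omega> x = of_int k" using Wval(1)[of x] x by (auto elim: Ints_cases)
    then have "\<bar>?\<omega> x\<bar> = real (nat \<bar>k\<bar>)" "1 \<le> nat \<bar>k\<bar>" using nz by auto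
    then show ?thesis by blast
  qed
  have Nle: "int N \<le> max_minor A" if "N \<in> Ns" for N
  proof -
    obtain x where x: "\<forall>i < m. x i \<in> W" "1 \<le> N" "\<bar>?\<omega> x\<bar> = real N" using \<open>N \<in> Ns\<close> unfolding Ns_def by blast
    then have "?\<omega> x \<noteq> 0" by auto
    then have "\<bar>?\<omega> x\<bar> \<le> real_of_int (max_minor A)" using Wval(2) x(1) by blast
    then have "real_of_int (int N) \<le> real_of_int (max_minor A)" using x(3) by simp
    then show ?thesis by (simp only: of_int_le_iff)
  qed
  have "Ns \<subseteq> {..nat (max_minor A)}"
  proof
    fix N assume "N \<in> Ns"
    then show "N \<in> {..nat (max_minor A)}" using Nle[of N] by simp
  qed
  then have fN: "finite Ns" by (rule finite_subset) simp
  have "?\<omega> y \<noteq> 0" using f(2) by (simp add: y_def[abs_def])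
  then have "Ns \<noteq> {}" using nat_val[of y] yW unfolding Ns_def by blast
  define q where "q = Max Ns"
  have "q \<in> Ns" unfolding q_def using fN \<open>Ns \<noteq> {}\<close> by (rule Max_in)
  then obtain B where B: "\<forall>i < m. B i \<in> W" "1 \<le> q" "\<bar>?\<omega> B\<bar> = real q" unfolding Ns_def by blast
  have B0: "?\<omega> B \<noteq> 0" using B by auto
  have WV: "v \<in> E.V" if "v \<in> W" for v
  proof (rule in_span_unit_fun)
    fix k assume "m \<le> k"
    then show "v k = 0" using that by (auto simp: W_def G_def vec_fun_def m_def)
  qed
  interpret X: based_form ?I "\<lambda>x. ?\<omega> x / ?\<omega> B" B using B0 by (rule E.rebase)
  have sp: "span (B ` ?I) = E.V" by (rule E.rebase_span[OF B0]) (use B(1) WV in auto)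
  have sgn: "?\<omega> B = real q \<or> ?\<omega> B = - real q" using B(3) by linarith
  have "conf_axioms ?I (\<lambda>x. ?\<omega> x / ?\<omega> B) B q W"
  proof (rule conf_axioms.intro, goal_cases)
    case 1 show ?case by (rule B(2))
  next
    case 2 show ?case by (rule fW)
  next
    case (3 v)
    then show ?case by (auto simp: W_def)
  next
    case 4 show ?case by (auto simp: W_def)
  next
    case (5 i) then show ?case using B(1) by simp
  next
    case (6 v) then show ?case using WV sp by simp
  next
    case (7 x)
    have "\<bar>?\<omega> x\<bar> \<le> real q"
    proof (cases "?\<omega> x = 0")
      case False
      obtain N :: nat where N: "1 \<le> N" "\<bar>?\<omega> x\<bar> = real N" using nat_val[of x] 7 False by auto
      then have "N \<in> Ns" using 7 unfolding Ns_def by auto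
      then show ?thesis using N(2) Max_ge[OF fN] by (simp add: q_def)
    qed simp
    then show ?case using B(2,3) by (simp add: abs_divide)
  next
    case (8 x)
    have "?\<omega> x \<in> \<int>" by (rule Wval(1)) (use 8 in auto)
    moreover have "real q * (?\<omega> x / ?\<omega> B) = ?\<omega> x \<or> real q * (?\<omega> x / ?\<omega> B) = - ?\<omega> x"
      using sgn B(2) by auto
    ultimately show ?case by auto
  qed
  then have "conf ?I (\<lambda>x. ?\<omega> x / ?\<omega> B) B q W" using X.based_form_axioms by (simp add: conf_def)
  from conf_card_le[OF this] have cW: "card W \<le> column_bound q m" by simp
  have diff: "differ a b" if "{#a, b#} \<subseteq># X" for a b using X(2) that unfolding has_differing_columns_def by blast
  have cnt: "count X a \<le> 1" for a
  proof (rule ccontr)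
    assume "\<not> count X a \<le> 1"
    then have "{#a, a#} \<subseteq># X" by (auto simp: subseteq_mset_def)
    from diff[OF this] show False by (simp add: differ_def)
  qed
  define S where "S = set_mset X"
  have "X = mset_set S"
  proof (rule multiset_eqI)
    fix a
    show "count X a = count (mset_set S) a"
    proof (cases "a \<in># X")
      case True
      then have "count X a = 1" using cnt[of a] count_greater_zero_iff[of X a] by linarith
      then show ?thesis using True by (simp add: S_def)
    next
      case False
      then show ?thesis by (simp add: S_def not_in_iff)
    qed
  qed
  then have size: "size X = card S" by (metis size_mset_set)
  have Scols: "S \<subseteq> set (cols A)" unfolding S_def using set_mset_mono[OF X(1)] by simp
  have dimS: "dim_vec a = m" if "a \<in> S" for a
  proof -
    have "a \<in> set (cols A)" using that Scols by blast
    then have "a \<in> carrier_vec (dim_row A)" using cols_dim[of A] by blast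
    then show ?thesis by (simp add: m_def carrier_vecD)
  qed
  have eqv: "a = b" if ab: "a \<in> S" "dim_vec b = m" "vec_fun a = vec_fun b" for a b
  proof (rule eq_vecI)
    show "dim_vec a = dim_vec b" using dimS ab by simp
    fix i assume "i < dim_vec b"
    then have "vec_fun a i = real_of_int (a $ i)" "vec_fun b i = real_of_int (b $ i)"
      using dimS[OF ab(1)] ab(2) by (simp_all add: vec_fun_def)
    then show "a $ i = b $ i" using ab(3) by simp
  qed
  have vm: "vec_fun (- a) = - vec_fun a" for a by (auto simp: vec_fun_def fun_eq_iff)
  have nz: "a \<noteq> 0\<^sub>v m" if "a \<in> S" for a
    using X(2) that dimS[OF that] unfolding has_differing_columns_def S_def by metis
  have SG: "vec_fun ` S \<subseteq> G - {0}"
  proof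
    fix v assume "v \<in> vec_fun ` S"
    then obtain a where a: "a \<in> S" "v = vec_fun a" by blast
    have "v \<in> G" using a Scols by (auto simp: G_def cols_def)
    moreover have "v \<noteq> 0"
    proof
      assume "v = 0"
      then have "vec_fun a = vec_fun (0\<^sub>v m)" using a(2) by (auto simp: vec_fun_def fun_eq_iff)
      then have "a = 0\<^sub>v m" by (intro eqv[OF a(1)]) simp_all
      then show False using nz[OF a(1)] by simp
    qed
    ultimately show "v \<in> G - {0}" by simp
  qed
  have disj: "vec_fun ` S \<inter> uminus ` vec_fun ` S = {}"
  proof -
    have False if ab: "a \<in> S" "b \<in> S" "vec_fun a = - vec_fun b" for a b
    proof -
      have e: "a = - b" by (rule eqv[OF ab(1)]) (use ab vm dimS in simp_all)
      show False
      proof (cases "a = b")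
        case True
        then have "a $ i = 0" if "i < m" for i
          using arg_cong[OF e, of "\<lambda>v. v $ i"] that dimS[OF ab(2)] by simp
        then have "a = 0\<^sub>v m" using dimS[OF ab(1)] by (intro eq_vecI) auto
        then show False using nz[OF ab(1)] by simp
      next
        case False
        have "count {#a, b#} c \<le> count X c" for c
        proof -
          have "a \<in># X" "b \<in># X" using ab by (simp_all add: S_def)
          then have "0 < count X a" "0 < count X b" by simp_all
          then show ?thesis using False by auto
        qed
        then have "{#a, b#} \<subseteq># X" by (rule mset_subset_eqI)
        from diff[OF this] show False using e by (simp add: differ_def)
      qed
    qed
    then show ?thesis by blast
  qed
  have fS: "finite S" by (simp add: S_def)
  have "inj_on vec_fun S" by (rule inj_onI) (use eqv dimS in blast)
  then have c1: "card (vec_fun ` S) = card S" by (rule card_image)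
  have c2: "card (uminus ` vec_fun ` S) = card (vec_fun ` S)" by (rule card_image) simp
  have "2 * card S = card (vec_fun ` S \<union> uminus ` vec_fun ` S)"
    using card_Un_disjoint[OF _ _ disj] fS c1 c2 by simp
  also have "\<dots> \<le> card W" by (rule card_mono[OF fW]) (use SG in \<open>auto simp: W_def\<close>)
  finally have "2 * size X \<le> column_bound q m" using cW size by simp
  then show ?thesis using B(2) Nle[OF \<open>q \<in> Ns\<close>] by (auto simp: m_def)
qed

lemma column_bound_le:
  assumes "1 \<le> q" "q \<le> \<Delta>" "2 * k \<le> column_bound q m"
  shows "real k \<le> (if \<Delta> \<le> 2 then 1 / 2 * (real m ^ 2 + real m) + real m * (real \<Delta> - 1)
       else 1 / 2 * (real m ^ 2 + real m) * real \<Delta> ^ 2)"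
proof -
  have r: "2 * real k \<le> real (column_bound q m)" using assms(3) by linarith
  show ?thesis
  proof (cases "\<Delta> \<le> 2")
    case True
    then have c: "q = 1 \<and> \<Delta> = 1 \<or> q = 1 \<and> \<Delta> = 2 \<or> q = 2 \<and> \<Delta> = 2" using assms by linarith
    have aux: "2 * k' \<le> T + s \<Longrightarrow> 0 \<le> s \<Longrightarrow> k' \<le> (T + s) / 2 + s" "2 * k' \<le> T + 3 * s \<Longrightarrow> k' \<le> (T + s) / 2 + s"
      for k' T s :: real by (simp_all add: field_simps)
    show ?thesis using c r aux(1)[of "real k" "real m ^ 2" "real m"] aux(2)[of "real k" "real m ^ 2" "real m"]
      by (elim disjE conjE) (simp_all add: column_bound_def)
  next
    case False
    have "column_bound q m \<le> (m ^ 2 + m) * \<Delta> ^ 2"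
    proof -
      have d9: "9 \<le> \<Delta> ^ 2" using False power_mono[of 3 \<Delta> 2] by simp
      have n9: "(m ^ 2 + m) * 9 \<le> (m ^ 2 + m) * \<Delta> ^ 2" using d9 by (rule mult_le_mono2)
      have "(m ^ 2 + m) * q ^ 2 \<le> (m ^ 2 + m) * \<Delta> ^ 2" using assms(2) by (intro mult_le_mono2 power_mono) auto
      then show ?thesis using n9 by (auto simp: column_bound_def)
    qed
    then have "real (column_bound q m) \<le> real ((m ^ 2 + m) * \<Delta> ^ 2)" by (simp only: of_nat_le_iff)
    then show ?thesis using r False by simp
  qed
qed

theorem theorem2:
  fixes \<Delta> m :: nat
  assumes "\<Delta> \<ge> 1" and "m \<ge> 1"
  shows "finite (differing_column_counts \<Delta> m) \<and>
    real (max_differing_columns \<Delta> m) \<le>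
      (if \<Delta> \<le> 2 then 1 / 2 * (real m ^ 2 + real m) + real m * (real \<Delta> - 1)
       else 1 / 2 * (real m ^ 2 + real m) * real \<Delta> ^ 2)"
proof -
  let ?b = "if \<Delta> \<le> 2 then 1 / 2 * (real m ^ 2 + real m) + real m * (real \<Delta> - 1)
       else 1 / 2 * (real m ^ 2 + real m) * real \<Delta> ^ 2"
  have le: "real k \<le> ?b" if k: "k \<in> differing_column_counts \<Delta> m" for k
  proof -
    obtain A :: "int mat" where A: "k = num_differing_columns A" "dim_row A = m" "delta_modular \<Delta> A"
      using k unfolding differing_column_counts_def by blast
    have rank: "full_row_rank A" and mm: "max_minor A \<le> int \<Delta>" using A(3) by (auto simp: delta_modular_def)
    let ?S = "{size X | X. X \<subseteq># mset (cols A) \<and> has_differing_columns X}"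
    have "?S \<subseteq> {..size (mset (cols A))}" by (auto dest: size_mset_mono)
    then have fin: "finite ?S" by (rule finite_subset) simp
    have "{#} \<subseteq># mset (cols A) \<and> has_differing_columns {#}" by (simp add: has_differing_columns_def)
    then have "?S \<noteq> {}" by blast
    with fin have "Max ?S \<in> ?S" by (rule Max_in)
    then obtain X where X: "Max ?S = size X" "X \<subseteq># mset (cols A)" "has_differing_columns X" by blast
    obtain q where q: "1 \<le> q" "int q \<le> max_minor A" "2 * size X \<le> column_bound q (dim_row A)"
      using differing_columns_le[OF rank X(2,3)] by blast
    have "q \<le> \<Delta>" using q(2) mm by linarith
    moreover have "k = size X" using A(1) X(1) by (simp add: num_differing_columns_def)
    ultimately show ?thesis using column_bound_le[OF q(1), of \<Delta> k m] q(3) A(2) by simp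
  qed
  have "differing_column_counts \<Delta> m \<subseteq> {..nat \<lfloor>?b\<rfloor>}"
  proof
    fix k assume "k \<in> differing_column_counts \<Delta> m"
    then show "k \<in> {..nat \<lfloor>?b\<rfloor>}" by (simp only: atMost_iff) (rule le_nat_floor[OF le])
  qed
  then have fin: "finite (differing_column_counts \<Delta> m)" by (rule finite_subset) simp
  then have "max_differing_columns \<Delta> m \<in> differing_column_counts \<Delta> m"
    unfolding max_differing_columns_def using differing_column_counts_nonempty[OF assms(1)] by (rule Max_in)
  then show ?thesis using fin le by blast
qed

end
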